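(* Let $D=[D_0,D_1]$ be a non-trivial barcode with finitely many intervals, and let $\mathrm{PH}^{-1}(D)\subseteq \mathcal{C}^0(\mathbb{S}^1,\mathbb{R})$ be the fiber over $D$ of the persistence map $\mathrm{PH}:\mathcal{C}^0(\mathbb{S}^1,\mathbb{R})\to\mathrm{Bar}^2$. Then $\mathrm{PH}^{-1}(D)$ has finitely many path connected components. Moreover, in each such component $\Omega(D)$ there exists a function $f_{\Omega(D)}:\mathbb{S}^1\to\mathbb{R}$ such that $$\Omega(D)=\mathcal{O}_{\mathrm{Id}}(f_{\Omega(D)}),$$ and then $\Omega(D)$ is homeomorphic to the quotient $\mathrm{End}_{\le}(\mathbb{S}^1)/\mathcal{S}_{\mathrm{Id}}(f_{\Omega(D)})$, and in particular is homotopy equivalent to $\mathbb{S}^1$.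
   Context: $\mathcal{C}^0(\mathbb{S}^1,\mathbb{R})$ and $\mathcal{C}^0(\mathbb{S}^1,\mathbb{S}^1)$ carry the compact-open topology. $\mathrm{Aut}_{\le}(\mathbb{S}^1)$ is the space of orientation-preserving homeomorphisms of the circle, and $\mathrm{End}_{\le}(\mathbb{S}^1)=\overline{\mathrm{Aut}_{\le}(\mathbb{S}^1)}$ is its closure in $\mathcal{C}^0(\mathbb{S}^1,\mathbb{S}^1)$. For $f\in\mathcal{C}^0(\mathbb{S}^1,\mathbb{R})$, consider the pre-composition map $\phi\in\mathrm{End}_{\le}(\mathbb{S}^1)\mapsto f\circ\phi$. The orbit is $\mathcal{O}_{\mathrm{Id}}(f)=\{f\circ\phi\mid\phi\in\mathrm{End}_{\le}(\mathbb{S}^1)\}$ and the stabiliser is $\mathcal{S}_{\mathrm{Id}}(f)=\{\phi\in\mathrm{End}_{\le}(\mathbb{S}^1)\mid f\circ\phi=f\}$. The quotient $\mathrm{End}_{\le}(\mathbb{S}^1)/\mathcal{S}_{\mathrm{Id}}(f)$ is the quotient space for the equivalence relation generated by $\phi\sim s\circ\phi$ for $s\in\mathcal{S}_{\mathrm{Id}}(f)$, $\phi\in\mathrm{End}_{\le}(\mathbb{S}^1)$. Persistence map: fix a coefficient field. For $f\in\mathcal{C}^0(\mathbb{S}^1,\mathbb{R})$ and $k\in\{0,1\}$, the vector spaces $H_k(f^{-1}((-\infty,x]))$, $x\in\mathbb{R}$, with maps induced by inclusions form a functor on $(\mathbb{R},\le)$. The degree $k$ barcode $\mathrm{PH}_k(f)$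 is the multi-set $D_k$ of pairs $(b,d)$, $b<d\le+\infty$, such that this functor is isomorphic to $\bigoplus_{(b,d)\in D_k}\mathbb{I}_{[b,d)}$, where $\mathbb{I}_{[b,d)}$ is one-dimensional on $[b,d)$ with identity maps there, and zero elsewhere. $\mathrm{PH}(f)=[\mathrm{PH}_0(f),\mathrm{PH}_1(f)]\in\mathrm{Bar}^2$, and $\mathrm{PH}^{-1}(D)$ is the set of $f$ with $\mathrm{PH}(f)=D$. The barcode of a constant function, which consists only of two infinite bars $(c,+\infty)$, one in each of the degrees $0$ and $1$ and with the same $c\in\mathbb{R}$, is called trivial; $D$ is assumed not to be of this form. *)

theory Defs
  imports "HOL-Homology.Homology" "HOL-Algebra.Module" "HOL-Library.Multiset" "HOL-Library.Extended_Real"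
begin

section \<open>Function spaces and quotient spaces\<close>

text \<open>
  Continuous maps \<open>X \<rightarrow> Y\<close> are represented by functions that are \<^const>\<open>extensional\<close> on
  \<open>topspace X\<close>, so that equality of maps is equality of HOL functions. Taking \<open>K = {}\<close> shows that
  the whole set of continuous maps is one of the generating sets.
\<close>

definition cmaps :: "'a topology \<Rightarrow> 'b topology \<Rightarrow> ('a \<Rightarrow> 'b) set" where
  "cmaps X Y = {f \<in> extensional (topspace X). continuous_map X Y f}"

definition compact_open_topology :: "'a topology \<Rightarrow> 'b topology \<Rightarrow> ('a \<Rightarrow> 'b) topology" where
  "compact_open_topology X Y =
     topology_generated_by {{f \<in> cmaps X Y. f ` K \<subseteq> U} | K U. compactin X K \<and> openin Y U}"

lemma topspace_compact_open_topology [simp]: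
  "topspace (compact_open_topology X Y) = cmaps X Y"
proof -
  have "cmaps X Y = {f \<in> cmaps X Y. f ` {} \<subseteq> {}}" by simp
  then have "cmaps X Y \<in> {{f \<in> cmaps X Y. f ` K \<subseteq> U} | K U. compactin X K \<and> openin Y U}"
    using compactin_empty openin_empty by blast
  then show ?thesis
    unfolding compact_open_topology_def topology_generated_by_topspace by blast
qed

text \<open>For an equivalence relation \<open>r\<close> on \<open>topspace X\<close>; the points are the classes.\<close>

definition quotient_space :: "'a topology \<Rightarrow> ('a \<times> 'a) set \<Rightarrow> 'a set topology" where
  "quotient_space X r = topology (\<lambda>\<U>. \<U> \<subseteq> topspace X // r \<and> openin X {x \<in> topspace X. r `` {x} \<in> \<U>})"

lemma openin_quotient_space:
  "openin (quotient_space X r) \<U> \<longleftrightarrow>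
     \<U> \<subseteq> topspace X // r \<and> openin X {x \<in> topspace X. r `` {x} \<in> \<U>}"
proof -
  have "istopology (\<lambda>\<U>. \<U> \<subseteq> topspace X // r \<and> openin X {x \<in> topspace X. r `` {x} \<in> \<U>})"
    unfolding istopology_def
  proof (intro conjI allI impI)
    fix S T
    assume "S \<subseteq> topspace X // r \<and> openin X {x \<in> topspace X. r `` {x} \<in> S}"
      and "T \<subseteq> topspace X // r \<and> openin X {x \<in> topspace X. r `` {x} \<in> T}"
    moreover have "{x \<in> topspace X. r `` {x} \<in> S \<inter> T} =
        {x \<in> topspace X. r `` {x} \<in> S} \<inter> {x \<in> topspace X. r `` {x} \<in> T}" by blast
    ultimately show "S \<inter> T \<subseteq> topspace X // r" "openin X {x \<in> topspace X. r `` {x} \<in> S \<inter> T}"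
      by auto
  next
    fix \<K>
    assume *: "\<forall>K\<in>\<K>. K \<subseteq> topspace X // r \<and> openin X {x \<in> topspace X. r `` {x} \<in> K}"
    then show "\<Union>\<K> \<subseteq> topspace X // r" by blast
    have "{x \<in> topspace X. r `` {x} \<in> \<Union>\<K>} = (\<Union>K\<in>\<K>. {x \<in> topspace X. r `` {x} \<in> K})" by blast
    with * show "openin X {x \<in> topspace X. r `` {x} \<in> \<Union>\<K>}" by auto
  qed
  then show ?thesis
    unfolding quotient_space_def by (simp add: topology_inverse')
qed


section \<open>The circle, its orientation-preserving homeomorphisms, orbits and stabilisers\<close>

abbreviation circle :: "complex topology" where
  "circle \<equiv> top_of_set (sphere 0 1)"

abbreviation circle_functions :: "(complex \<Rightarrow> real) topology" where
  "circle_functions \<equiv> compact_open_topology circle euclideanreal"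

text \<open>A circle homeomorphism preserves the orientation iff it has an increasing lift to the real
  line along the covering \<^const>\<open>cis\<close>.\<close>

definition circle_Aut :: "(complex \<Rightarrow> complex) set" where
  "circle_Aut = {\<phi> \<in> extensional (sphere 0 1). homeomorphic_map circle circle \<phi> \<and>
     (\<exists>F :: real \<Rightarrow> real. continuous_on UNIV F \<and> strict_mono F \<and> (\<forall>t. \<phi> (cis t) = cis (F t)))}"

definition circle_End :: "(complex \<Rightarrow> complex) set" where
  "circle_End = compact_open_topology circle circle closure_of circle_Aut"

abbreviation circle_End_space :: "(complex \<Rightarrow> complex) topology" where
  "circle_End_space \<equiv> subtopology (compact_open_topology circle circle) circle_End"

definition orbit_Id :: "(complex \<Rightarrow> real) \<Rightarrow> (complex \<Rightarrow> real) set" where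
  "orbit_Id f = {compose (sphere 0 1) f \<phi> | \<phi>. \<phi> \<in> circle_End}"

definition stabiliser_Id :: "(complex \<Rightarrow> real) \<Rightarrow> (complex \<Rightarrow> complex) set" where
  "stabiliser_Id f = {\<phi> \<in> circle_End. compose (sphere 0 1) f \<phi> = f}"

text \<open>The equivalence relation on \<^const>\<open>circle_End\<close> generated by \<open>\<phi> \<sim> s \<circ> \<phi>\<close> with \<open>s\<close> in the
  stabiliser.\<close>

definition stabiliser_rel :: "(complex \<Rightarrow> real) \<Rightarrow> ((complex \<Rightarrow> complex) \<times> (complex \<Rightarrow> complex)) set" where
  "stabiliser_rel f = {(\<phi>, \<psi>). \<phi> \<in> circle_End \<and> \<psi> \<in> circle_End \<and>
     equivclp (\<lambda>\<alpha> \<beta>. \<alpha> \<in> circle_End \<and> (\<exists>s \<in> stabiliser_Id f. \<beta> = compose (sphere 0 1) s \<alpha>)) \<phi> \<psi>}"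

definition End_mod_stabiliser :: "(complex \<Rightarrow> real) \<Rightarrow> (complex \<Rightarrow> complex) set topology" where
  "End_mod_stabiliser f = quotient_space circle_End_space (stabiliser_rel f)"


section \<open>Singular homology with coefficients in a field\<close>

text \<open>
  \<open>HOL-Homology\<close> only has integral coefficients. Its notions of singular simplex and face are reused
  here; chains are finitely supported functions into the field.
\<close>

type_synonym ('k, 'a) kchain = "((nat \<Rightarrow> real) \<Rightarrow> 'a) \<Rightarrow>\<^sub>0 'k"

definition kchains :: "nat \<Rightarrow> 'a topology \<Rightarrow> ('k::field, 'a) kchain set" where
  "kchains p X = {c. Poly_Mapping.keys c \<subseteq> singular_simplex_set p X}"

definition kboundary :: "nat \<Rightarrow> ('k::field, 'a) kchain \<Rightarrow> ('k, 'a) kchain" where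
  "kboundary p c = (if p = 0 then 0 else
     \<Sum>\<sigma>\<in>Poly_Mapping.keys c. \<Sum>k\<le>p.
       Poly_Mapping.single (singular_face p k \<sigma>) ((-1) ^ k * Poly_Mapping.lookup c \<sigma>))"

definition kcycles :: "nat \<Rightarrow> 'a topology \<Rightarrow> ('k::field, 'a) kchain set" where
  "kcycles p X = {c \<in> kchains p X. kboundary p c = 0}"

definition kboundaries :: "nat \<Rightarrow> 'a topology \<Rightarrow> ('k::field, 'a) kchain set" where
  "kboundaries p X = kboundary (Suc p) ` kchains (Suc p) X"

text \<open>
  Vector spaces are records of the \<open>HOL-Algebra\<close> type \<^typ>\<open>('k, 'v) module\<close>, whose multiplicative
  fields play no role. The vectors of \<open>khomology p X\<close> are the cosets of the boundaries in the cycles;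
  adding the boundaries in \<^const>\<open>smult\<close> makes the result a coset also for the scalar \<open>0\<close>.
\<close>

definition khomology :: "nat \<Rightarrow> 'a topology \<Rightarrow> ('k::field, ('k, 'a) kchain set) module" where
  "khomology p X =
     \<lparr> carrier = {{z + b | b. b \<in> kboundaries p X} | z. z \<in> kcycles p X},
       monoid.mult = undefined, one = undefined,
       zero = kboundaries p X,
       add = (\<lambda>A B. {a + b | a b. a \<in> A \<and> b \<in> B}),
       smult = (\<lambda>r A. {Poly_Mapping.map ((*) r) a + b | a b. a \<in> A \<and> b \<in> kboundaries p X}) \<rparr>"


section \<open>Persistence modules and barcodes\<close>

text \<open>Functors from \<open>(\<real>, \<le>)\<close> to vector spaces; \<open>pmap M x y\<close> is only meaningful for \<open>x \<le> y\<close>.\<close>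

record ('k, 'v) pers_module =
  pspace :: "real \<Rightarrow> ('k, 'v) module"
  pmap :: "real \<Rightarrow> real \<Rightarrow> 'v \<Rightarrow> 'v"

definition linear_iso :: "('k, 'v) module \<Rightarrow> ('k, 'w) module \<Rightarrow> ('v \<Rightarrow> 'w) set" where
  "linear_iso V W = {h \<in> iso (add_monoid V) (add_monoid W).
     \<forall>r. \<forall>v \<in> carrier V. h (r \<odot>\<^bsub>V\<^esub> v) = r \<odot>\<^bsub>W\<^esub> h v}"

definition pers_isomorphic :: "('k, 'v) pers_module \<Rightarrow> ('k, 'w) pers_module \<Rightarrow> bool" where
  "pers_isomorphic M N \<longleftrightarrow> (\<exists>\<theta>.
     (\<forall>x. \<theta> x \<in> linear_iso (pspace M x) (pspace N x)) \<and>
     (\<forall>x y. x \<le> y \<longrightarrow> (\<forall>v \<in> carrier (pspace M x). \<theta> y (pmap M x y v) = pmap N x y (\<theta> x v))))"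

text \<open>The map induced by the inclusion of sublevel sets sends the class of a cycle in the smaller set
  to its class in the larger one.\<close>

definition sublevel :: "(complex \<Rightarrow> real) \<Rightarrow> real \<Rightarrow> complex topology" where
  "sublevel f x = subtopology circle {z. f z \<le> x}"

definition sublevel_homology ::
    "nat \<Rightarrow> (complex \<Rightarrow> real) \<Rightarrow> ('k::field, ('k, complex) kchain set) pers_module" where
  "sublevel_homology k f =
     \<lparr> pspace = (\<lambda>x. khomology k (sublevel f x)),
       pmap = (\<lambda>x y A. {a + b | a b. a \<in> A \<and> b \<in> kboundaries k (sublevel f y)}) \<rparr>"

text \<open>A bar \<open>(b, d)\<close> stands for the half-open interval \<open>[b, d)\<close>.\<close>

definition in_bar :: "real \<times> ereal \<Rightarrow> real \<Rightarrow> bool" where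
  "in_bar I x \<longleftrightarrow> fst I \<le> x \<and> ereal x < snd I"

definition interval_module :: "real \<times> ereal \<Rightarrow> ('k::field, 'k) pers_module" where
  "interval_module I =
     \<lparr> pspace = (\<lambda>x. \<lparr> carrier = (if in_bar I x then UNIV else {0}),
                       monoid.mult = undefined, one = undefined,
                       zero = 0, add = (+), smult = (*) \<rparr>),
       pmap = (\<lambda>x y v. if in_bar I x \<and> in_bar I y then v else 0) \<rparr>"

definition pers_sum :: "'i set \<Rightarrow> ('i \<Rightarrow> ('k, 'v) pers_module) \<Rightarrow> ('k, 'i \<Rightarrow> 'v) pers_module" where
  "pers_sum J M =
     \<lparr> pspace = (\<lambda>x. \<lparr> carrier = {v \<in> (\<Pi>\<^sub>E j\<in>J. carrier (pspace (M j) x)).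
                                    finite {j \<in> J. v j \<noteq> \<zero>\<^bsub>pspace (M j) x\<^esub>}},
                       monoid.mult = undefined, one = undefined,
                       zero = (\<lambda>j\<in>J. \<zero>\<^bsub>pspace (M j) x\<^esub>),
                       add = (\<lambda>v w. \<lambda>j\<in>J. v j \<oplus>\<^bsub>pspace (M j) x\<^esub> w j),
                       smult = (\<lambda>r v. \<lambda>j\<in>J. r \<odot>\<^bsub>pspace (M j) x\<^esub> v j) \<rparr>),
       pmap = (\<lambda>x y v. \<lambda>j\<in>J. pmap (M j) x y (v j)) \<rparr>"

text \<open>Barcodes with finitely many intervals. The type \<^typ>\<open>'a multiset\<close> only has finite multisets.\<close>

definition barcode :: "(real \<times> ereal) multiset \<Rightarrow> bool" where
  "barcode D \<longleftrightarrow> (\<forall>(b, d) \<in># D. ereal b < d)"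

text \<open>Each bar \<open>I\<close> contributes \<open>count D I\<close> summands.\<close>

definition barcode_module :: "(real \<times> ereal) multiset \<Rightarrow>
    ('k::field, (real \<times> ereal) \<times> nat \<Rightarrow> 'k) pers_module" where
  "barcode_module D = pers_sum {(I, j). j < count D I} (\<lambda>(I, j). interval_module I)"

text \<open>\<open>has_PH K k f D\<close>: the degree \<open>k\<close> barcode of \<open>f\<close> over the field \<open>'k\<close> is \<open>D\<close>.\<close>

definition has_PH :: "'k::field itself \<Rightarrow> nat \<Rightarrow> (complex \<Rightarrow> real) \<Rightarrow> (real \<times> ereal) multiset \<Rightarrow> bool" where
  "has_PH K k f D \<longleftrightarrow> barcode D \<and>
     pers_isomorphic
       (sublevel_homology k f :: ('k, ('k, complex) kchain set) pers_module)
       (barcode_module D :: ('k, (real \<times> ereal) \<times> nat \<Rightarrow> 'k) pers_module)"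

definition PH_fiber :: "'k::field itself \<Rightarrow> (real \<times> ereal) multiset \<Rightarrow> (real \<times> ereal) multiset \<Rightarrow>
    (complex \<Rightarrow> real) set" where
  "PH_fiber K D\<^sub>0 D\<^sub>1 = {f \<in> topspace circle_functions. has_PH K 0 f D\<^sub>0 \<and> has_PH K 1 f D\<^sub>1}"

definition trivial_barcode :: "(real \<times> ereal) multiset \<Rightarrow> (real \<times> ereal) multiset \<Rightarrow> bool" where
  "trivial_barcode D\<^sub>0 D\<^sub>1 \<longleftrightarrow> (\<exists>c. D\<^sub>0 = {#(c, \<infinity>)#} \<and> D\<^sub>1 = {#(c, \<infinity>)#})"

end

theory Submission
  imports Defs "HOL-Analysis.Analysis"
begin

text \<open>
  Parametrise the circle by \<open>cis\<close> and lift everything to the real line. A finite barcode bounds the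
  oscillation of \<open>f\<close>: the value of every local minimum or maximum is an endpoint of a bar, and points of
  one sublevel set in different components give independent classes in degree 0. So \<open>f\<close> is piecewise
  monotone and factors as \<open>G \<circ> \<Phi>\<close>, where \<open>\<Phi>\<close> is its arc length, a monotone map of degree one, and \<open>G\<close> has
  constant speed. Up to finitely many choices \<open>G\<close> is determined by the list of its critical values; a
  monotone reparametrisation does not change the barcode, so the fiber is a finite union of orbits of
  such \<open>G\<close>.

  Since \<open>G\<close> has constant speed, the variation of \<open>G \<circ> \<Phi>\<close> recovers \<open>\<Phi>\<close> up to a constant, and it does so
  in a Lipschitz way for the uniform distance because the number of monotone pieces is bounded. Therefore
  distinct orbits have positive distance, \<open>\<Phi> \<mapsto> G \<circ> \<Phi>\<close> is an open map whose fibers are the cosets of the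
  discrete group of periods of \<open>G\<close>, and contracting each \<open>\<Phi>\<close> linearly to the translation by \<open>\<Phi> 0\<close> retracts
  the orbit onto the circle of translates of \<open>G\<close>.
\<close>

section \<open>Linear algebra of chains\<close>

text \<open>The obstacle is that \<open>f\<close> is merely continuous: it can have plateaus and a
  priori infinitely many oscillations, so there is no list of critical points to start from. Finite
  alternating sequences of values replace it. Each low node of such a sequence yields a minimum at
  one of the \<open>card E\<close> endpoint values, minima of equal value lie in different
  components of that sublevel set and number at most \<open>size D\<^sub>0\<close>, and of two
  consecutive interior nodes one is low; this is the origin of
  \<open>2 * (card E * size D\<^sub>0) + 2\<close>. Plateaus of \<open>f\<close> go into \<Phi>,
  which is why the orbits are taken under the closure of the homeomorphism group. A second obstacle
  is to tell homology classes apart. Two cochains do this: the indicator of a union of components in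
  degree 0 and the winding number in degree 1. All estimates take place among periodic functions on
  the line with the supremum metric, which describes the compact-open topology.\<close>

definition scale :: "'k::field \<Rightarrow> ('a \<Rightarrow>\<^sub>0 'k) \<Rightarrow> 'a \<Rightarrow>\<^sub>0 'k" where
  "scale r c = Poly_Mapping.map ((*) r) c"

lemma lookup_scale [simp]: "Poly_Mapping.lookup (scale r c) x = r * Poly_Mapping.lookup c x"
  unfolding scale_def by (simp add: map.rep_eq when_def)

lemma scale_add: "scale r (a + b) = scale r a + scale r b"
  by (rule poly_mapping_eqI) (simp add: lookup_add algebra_simps)

lemma scale_add_left: "scale (r + s) a = scale r a + scale s a"
  by (rule poly_mapping_eqI) (simp add: lookup_add algebra_simps)

lemma scale_diff: "scale r (a - b) = scale r a - scale r b"
  by (rule poly_mapping_eqI) (simp add: lookup_minus algebra_simps)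

lemma scale_diff_left: "scale (r - s) a = scale r a - scale s a"
  by (rule poly_mapping_eqI) (simp add: lookup_minus algebra_simps)

lemma scale_scale [simp]: "scale r (scale s a) = scale (r * s) a"
  by (rule poly_mapping_eqI) (simp add: algebra_simps)

lemma scale_one [simp]: "scale 1 a = a"
  by (rule poly_mapping_eqI) simp

lemma scale_zero [simp]: "scale 0 a = 0" "scale r 0 = 0"
  by (rule poly_mapping_eqI, simp)+

lemma scale_minus_one: "scale (-1) a = - a"
  by (rule poly_mapping_eqI) simp

lemma scale_sum: "scale r (\<Sum>i\<in>I. f i) = (\<Sum>i\<in>I. scale r (f i))"
  by (induction I rule: infinite_finite_induct) (auto simp: scale_add)

lemma scale_sum_left: "scale (\<Sum>i\<in>I. f i) a = (\<Sum>i\<in>I. scale (f i) a)"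
  by (induction I rule: infinite_finite_induct) (auto simp: scale_add_left)

lemma scale_single [simp]: "scale r (Poly_Mapping.single x s) = Poly_Mapping.single x (r * s)"
  by (rule poly_mapping_eqI) (simp add: lookup_single when_def)

lemma keys_scale_subset: "Poly_Mapping.keys (scale r c) \<subseteq> Poly_Mapping.keys c"
  by (auto simp: in_keys_iff)

text \<open>The linear extension to chains of a map given on the basis of simplices. Boundaries and
  push-forwards are brought to this form, so that their identities reduce to a single
  simplex.\<close>

definition lext :: "('a \<Rightarrow> ('b \<Rightarrow>\<^sub>0 'k)) \<Rightarrow> ('a \<Rightarrow>\<^sub>0 'k::field) \<Rightarrow> 'b \<Rightarrow>\<^sub>0 'k" where
  "lext g c = (\<Sum>x\<in>Poly_Mapping.keys c. scale (Poly_Mapping.lookup c x) (g x))"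

lemma lext_superset:
  assumes "finite A" "Poly_Mapping.keys c \<subseteq> A"
  shows "lext g c = (\<Sum>x\<in>A. scale (Poly_Mapping.lookup c x) (g x))"
  unfolding lext_def using assms
  by (intro sum.mono_neutral_left) (auto simp: in_keys_iff)

lemma lext_add: "lext g (a + b) = lext g a + lext g b"
proof -
  let ?A = "Poly_Mapping.keys a \<union> Poly_Mapping.keys b"
  have "Poly_Mapping.keys (a + b) \<subseteq> ?A" by (rule keys_add)
  then show ?thesis
    using lext_superset[of ?A "a + b" g] lext_superset[of ?A a g] lext_superset[of ?A b g]
    by (simp add: lookup_add scale_add_left sum.distrib)
qed

lemma lext_scale: "lext g (scale r a) = scale r (lext g a)"
  using lext_superset[of "Poly_Mapping.keys a" "scale r a" g] keys_scale_subset[of r a]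
  by (simp add: lext_def scale_sum)

lemma lext_zero [simp]: "lext g 0 = 0"
  by (simp add: lext_def)

lemma lext_diff: "lext g (a - b) = lext g a - lext g b"
  using lext_add[of g "a - b" b] by (simp add: algebra_simps)

lemma lext_sum: "lext g (\<Sum>i\<in>I. f i) = (\<Sum>i\<in>I. lext g (f i))"
  by (induction I rule: infinite_finite_induct) (auto simp: lext_add)

lemma lext_single [simp]: "lext g (Poly_Mapping.single x r) = scale r (g x)"
  using lext_superset[of "{x}" "Poly_Mapping.single x r" g] by simp

lemma lext_fun_diff: "lext (\<lambda>x. g x - h x) c = lext g c - lext h c"
  by (simp add: lext_def scale_diff sum_subtractf)

lemma lext_id: "lext (\<lambda>x. Poly_Mapping.single x 1) c = c"
proof (rule poly_mapping_eqI)
  fix y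
  show "Poly_Mapping.lookup (lext (\<lambda>x. Poly_Mapping.single x 1) c) y = Poly_Mapping.lookup c y"
    by (auto simp: lext_def lookup_sum lookup_single in_keys_iff when_def if_distrib sum.delta cong: if_cong)
qed

lemma lext_lext: "lext g (lext h c) = lext (\<lambda>x. lext g (h x)) c"
  unfolding lext_def[of h] lext_def[of "\<lambda>x. lext g (h x)"]
  by (simp add: lext_sum lext_scale)

lemma lext_cong: "(\<And>x. x \<in> Poly_Mapping.keys c \<Longrightarrow> g x = h x) \<Longrightarrow> lext g c = lext h c"
  by (simp add: lext_def)

text \<open>Evaluation of the cochain \<open>g\<close> on a chain. The cochains that matter are
  \<open>indic\<close> in degree 0 and \<open>winding\<close> in degree 1.\<close>

definition fext :: "('a \<Rightarrow> 'k) \<Rightarrow> ('a \<Rightarrow>\<^sub>0 'k::field) \<Rightarrow> 'k" where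
  "fext g c = (\<Sum>x\<in>Poly_Mapping.keys c. Poly_Mapping.lookup c x * g x)"

lemma fext_superset:
  assumes "finite A" "Poly_Mapping.keys c \<subseteq> A"
  shows "fext g c = (\<Sum>x\<in>A. Poly_Mapping.lookup c x * g x)"
  unfolding fext_def using assms
  by (intro sum.mono_neutral_left) (auto simp: in_keys_iff)

lemma fext_add: "fext g (a + b) = fext g a + fext g b"
proof -
  let ?A = "Poly_Mapping.keys a \<union> Poly_Mapping.keys b"
  have "Poly_Mapping.keys (a + b) \<subseteq> ?A" by (rule keys_add)
  then show ?thesis
    using fext_superset[of ?A "a + b" g] fext_superset[of ?A a g] fext_superset[of ?A b g]
    by (simp add: lookup_add algebra_simps sum.distrib)
qed

lemma fext_scale: "fext g (scale r a) = r * fext g a"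
  using fext_superset[of "Poly_Mapping.keys a" "scale r a" g] keys_scale_subset[of r a]
  by (simp add: fext_def sum_distrib_left mult.assoc)

lemma fext_zero [simp]: "fext g 0 = 0"
  by (simp add: fext_def)

lemma fext_fun_zero [simp]: "fext (\<lambda>_. 0) c = 0"
  by (simp add: fext_def)

lemma fext_diff: "fext g (a - b) = fext g a - fext g b"
  using fext_add[of g "a - b" b] by (simp add: algebra_simps)

lemma fext_sum: "fext g (\<Sum>i\<in>I. f i) = (\<Sum>i\<in>I. fext g (f i))"
  by (induction I rule: infinite_finite_induct) (auto simp: fext_add)

lemma fext_single [simp]: "fext g (Poly_Mapping.single x r) = r * g x"
  using fext_superset[of "{x}" "Poly_Mapping.single x r" g] by simp

lemma fext_lext: "fext g (lext h c) = fext (\<lambda>x. fext g (h x)) c"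
  unfolding lext_def[of h] fext_def[of "\<lambda>x. fext g (h x)"]
  by (simp add: fext_sum fext_scale)

lemma fext_cong: "(\<And>x. x \<in> Poly_Mapping.keys c \<Longrightarrow> g x = h x) \<Longrightarrow> fext g c = fext h c"
  by (simp add: fext_def)

text \<open>When every simplex contributes a multiple of one chain \<open>l\<close>, the whole chain
  contributes the value of a cochain times \<open>l\<close>. With \<open>l\<close> a generator this
  reads off the coefficient of a homology class.\<close>

lemma lext_const_scale: "lext (\<lambda>x. scale (g x) l) c = scale (fext g c) l"
  by (simp add: lext_def fext_def scale_sum_left)

section \<open>Chains, cycles and boundaries\<close>

lemma kboundary_eq:
  "p > 0 \<Longrightarrow> kboundary p c = lext (\<lambda>\<sigma>. \<Sum>k\<le>p. Poly_Mapping.single (singular_face p k \<sigma>) ((-1) ^ k)) c"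
  by (simp add: kboundary_def lext_def scale_sum mult.commute)

lemma kboundary_0 [simp]: "kboundary 0 c = 0"
  by (simp add: kboundary_def)

lemma kboundary_add: "kboundary p (a + b) = kboundary p a + kboundary p b"
  by (cases "p = 0") (simp_all add: kboundary_eq lext_add)

lemma kboundary_scale: "kboundary p (scale r a) = scale r (kboundary p a)"
  by (cases "p = 0") (simp_all add: kboundary_eq lext_scale)

lemma kboundary_zero [simp]: "kboundary p 0 = 0"
  by (cases "p = 0") (simp_all add: kboundary_eq)

lemma kchains_zero [simp]: "0 \<in> kchains p X"
  by (simp add: kchains_def)

lemma kchains_add: "a \<in> kchains p X \<Longrightarrow> b \<in> kchains p X \<Longrightarrow> a + b \<in> kchains p X"
  using keys_add[of a b] by (auto simp: kchains_def)

lemma kchains_scale: "a \<in> kchains p X \<Longrightarrow> scale r a \<in> kchains p X"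
  using keys_scale_subset[of r a] by (auto simp: kchains_def)

lemma kchains_single: "singular_simplex p X \<sigma> \<Longrightarrow> Poly_Mapping.single \<sigma> r \<in> kchains p X"
  by (simp add: kchains_def)

definition chain_subspace :: "('a \<Rightarrow>\<^sub>0 'k::field) set \<Rightarrow> bool" where
  "chain_subspace B \<longleftrightarrow> 0 \<in> B \<and> (\<forall>a\<in>B. \<forall>b\<in>B. a + b \<in> B) \<and> (\<forall>r. \<forall>a\<in>B. scale r a \<in> B)"

lemma chain_subspaceD:
  assumes "chain_subspace B"
  shows "0 \<in> B" "a \<in> B \<Longrightarrow> b \<in> B \<Longrightarrow> a + b \<in> B" "a \<in> B \<Longrightarrow> scale r a \<in> B"
    "a \<in> B \<Longrightarrow> - a \<in> B" "a \<in> B \<Longrightarrow> b \<in> B \<Longrightarrow> a - b \<in> B"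
proof -
  show 1: "0 \<in> B" "\<And>a b. a \<in> B \<Longrightarrow> b \<in> B \<Longrightarrow> a + b \<in> B" "\<And>r a. a \<in> B \<Longrightarrow> scale r a \<in> B"
    using assms by (auto simp: chain_subspace_def)
  show 2: "\<And>a. a \<in> B \<Longrightarrow> - a \<in> B" using 1(3)[of _ "-1"] by (simp add: scale_minus_one)
  show "\<And>a b. a \<in> B \<Longrightarrow> b \<in> B \<Longrightarrow> a - b \<in> B" using 1(2) 2 by (metis diff_conv_add_uminus)
qed

lemma chain_subspace_sum: "chain_subspace B \<Longrightarrow> (\<And>i. i \<in> I \<Longrightarrow> f i \<in> B) \<Longrightarrow> (\<Sum>i\<in>I. f i) \<in> B"
  by (induction I rule: infinite_finite_induct) (auto simp: chain_subspaceD)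

lemma chain_subspace_lext: "chain_subspace B \<Longrightarrow> (\<And>x. x \<in> Poly_Mapping.keys c \<Longrightarrow> g x \<in> B) \<Longrightarrow> lext g c \<in> B"
  unfolding lext_def by (intro chain_subspace_sum chain_subspaceD) auto

lemma chain_subspace_kchains: "chain_subspace (kchains p X)"
  by (simp add: chain_subspace_def kchains_add kchains_scale)

lemma chain_subspace_kcycles: "chain_subspace (kcycles p X)"
  by (simp add: chain_subspace_def kcycles_def kchains_add kchains_scale kboundary_add kboundary_scale)

lemma chain_subspace_kboundaries: "chain_subspace (kboundaries p X)"
  unfolding chain_subspace_def kboundaries_def
proof (intro conjI ballI allI)
  show "0 \<in> kboundary (Suc p) ` kchains (Suc p) X" by (rule image_eqI[of _ _ 0]) auto
qed (auto simp: kboundary_add[symmetric] kboundary_scale[symmetric] kchains_add kchains_scale)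

lemma kchains_mono:
  "S \<subseteq> S' \<Longrightarrow> kchains p (top_of_set S) \<subseteq> kchains p (top_of_set S')"
  unfolding kchains_def using singular_simplex_mono by blast

lemma kcycles_mono:
  "S \<subseteq> S' \<Longrightarrow> kcycles p (top_of_set S) \<subseteq> kcycles p (top_of_set S')"
  unfolding kcycles_def using kchains_mono by blast

lemma kboundaries_mono:
  "S \<subseteq> S' \<Longrightarrow> kboundaries p (top_of_set S) \<subseteq> kboundaries p (top_of_set S')"
  unfolding kboundaries_def using kchains_mono by blast

section \<open>Simplices of dimension at most two\<close>

definition point_simplex :: "'a \<Rightarrow> (nat \<Rightarrow> real) \<Rightarrow> 'a" where
  "point_simplex z = restrict (\<lambda>_. z) (standard_simplex 0)"

text \<open>The parameter is the barycentric coordinate of vertex 1, so face 0, which omits vertex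
  0, is the end point \<open>\<gamma> 1\<close>. \<open>triangle_simplex\<close> follows the same
  convention with the coordinates of vertices 1 and 2.\<close>

definition edge_simplex :: "(real \<Rightarrow> 'a) \<Rightarrow> (nat \<Rightarrow> real) \<Rightarrow> 'a" where
  "edge_simplex \<gamma> = restrict (\<lambda>x. \<gamma> (x 1)) (standard_simplex 1)"

definition triangle_simplex :: "(real \<times> real \<Rightarrow> 'a) \<Rightarrow> (nat \<Rightarrow> real) \<Rightarrow> 'a" where
  "triangle_simplex L = restrict (\<lambda>x. L (x 1, x 2)) (standard_simplex 2)"

definition triangle :: "(real \<times> real) set" where
  "triangle = {(a, b). 0 \<le> a \<and> 0 \<le> b \<and> a + b \<le> 1}"

lemma simplex_1D: "x \<in> standard_simplex (Suc 0) \<Longrightarrow> x 1 \<in> {0..1}" "x \<in> standard_simplex (Suc 0) \<Longrightarrow> x 0 = 1 - x 1"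
  by (auto simp: standard_simplex_def)

lemma simplex_2D: "x \<in> standard_simplex 2 \<Longrightarrow> (x 1, x 2) \<in> triangle" "x \<in> standard_simplex 2 \<Longrightarrow> x 0 = 1 - x 1 - x 2"
  by (auto simp: standard_simplex_def triangle_def numeral_2_eq_2) (metis add_increasing order_refl add.assoc add.commute)

text \<open>The inverse of the projection to coordinate 1. Composing an arbitrary singular simplex
  with it recovers a path on the unit interval.\<close>

definition edge_coords :: "real \<Rightarrow> nat \<Rightarrow> real" where
  "edge_coords t = (\<lambda>i. if i = 0 then 1 - t else if i = 1 then t else 0)"

definition triangle_coords :: "real \<times> real \<Rightarrow> nat \<Rightarrow> real" where
  "triangle_coords u = (\<lambda>i. if i = 0 then 1 - fst u - snd u else if i = 1 then fst u else if i = 2 then snd u else 0)"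

lemma edge_coords_in: "t \<in> {0..1} \<Longrightarrow> edge_coords t \<in> standard_simplex 1"
  by (auto simp: standard_simplex_def edge_coords_def)

lemma triangle_coords_in: "u \<in> triangle \<Longrightarrow> triangle_coords u \<in> standard_simplex 2"
  by (auto simp: standard_simplex_def triangle_coords_def triangle_def numeral_2_eq_2)

lemma edge_coords_eq: "x \<in> standard_simplex 1 \<Longrightarrow> edge_coords (x 1) = x"
  by (auto simp: standard_simplex_def edge_coords_def fun_eq_iff)

lemma triangle_coords_eq:
  assumes "x \<in> standard_simplex 2" shows "triangle_coords (x 1, x 2) = x"
proof
  fix i :: nat
  have "i > 2 \<or> i = 0 \<or> i = 1 \<or> i = 2" by linarith
  then show "triangle_coords (x 1, x 2) i = x i"
    using assms simplex_2D(2)[OF assms] by (auto simp: standard_simplex_def triangle_coords_def)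
qed

lemma continuous_map_edge_coords: "continuous_map (top_of_set {0..1}) (subtopology (powertop_real UNIV) (standard_simplex 1)) edge_coords"
proof -
  have "continuous_map (top_of_set {0..1}) euclideanreal (\<lambda>t. edge_coords t i)" for i
    unfolding edge_coords_def by (cases "i = 0"; cases "i = 1") (auto intro!: continuous_intros)
  then show ?thesis
    unfolding continuous_map_in_subtopology continuous_map_componentwise
    using edge_coords_in by (auto simp: image_subset_iff Pi_iff)
qed

lemma continuous_map_triangle_coords: "continuous_map (top_of_set triangle) (subtopology (powertop_real UNIV) (standard_simplex 2)) triangle_coords"
proof -
  have "continuous_map (top_of_set triangle) euclideanreal (\<lambda>t. triangle_coords t i)" for i
    unfolding triangle_coords_def by (cases "i = 0"; cases "i = 1"; cases "i = 2") (auto intro!: continuous_intros)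
  then show ?thesis
    unfolding continuous_map_in_subtopology continuous_map_componentwise
    using triangle_coords_in by (auto simp: image_subset_iff Pi_iff)
qed

lemma singular_simplex_edge_simplex:
  assumes "continuous_on {0..1} \<gamma>" "\<And>t. t \<in> {0..1} \<Longrightarrow> \<gamma> t \<in> S"
  shows "singular_simplex (Suc 0) (top_of_set S) (edge_simplex \<gamma>)"
proof -
  have "continuous_map (subtopology (powertop_real UNIV) (standard_simplex 1)) (top_of_set {0..1}) (\<lambda>x. x 1)"
    unfolding continuous_map_in_subtopology
    using simplex_1D by (auto intro!: continuous_map_from_subtopology continuous_map_product_projection)
  moreover have "continuous_map (top_of_set {0..1}) (top_of_set S) \<gamma>"
    using assms by (auto simp: continuous_map_in_subtopology)
  ultimately have "continuous_map (subtopology (powertop_real UNIV) (standard_simplex 1)) (top_of_set S) (\<gamma> \<circ> (\<lambda>x. x 1))"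
    by (rule continuous_map_compose)
  then show ?thesis
    unfolding singular_simplex_def edge_simplex_def
    by (auto elim!: continuous_map_eq)
qed

lemma singular_simplex_triangle_simplex:
  assumes "continuous_on triangle L" "\<And>u. u \<in> triangle \<Longrightarrow> L u \<in> S"
  shows "singular_simplex 2 (top_of_set S) (triangle_simplex L)"
proof -
  have "continuous_map (subtopology (powertop_real UNIV) (standard_simplex 2)) (top_of_set triangle) (\<lambda>x. (x 1, x 2))"
  proof -
    have "continuous_map (subtopology (powertop_real UNIV) (standard_simplex 2)) (prod_topology euclideanreal euclideanreal) (\<lambda>x. (x 1, x 2))"
      by (intro continuous_map_pairedI continuous_map_from_subtopology continuous_map_product_projection) auto
    then have "continuous_map (subtopology (powertop_real UNIV) (standard_simplex 2)) euclidean (\<lambda>x. (x 1::real, x 2::real))"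
      by (simp only: prod_topology_euclidean)
    then show ?thesis
      unfolding continuous_map_in_subtopology using simplex_2D by auto
  qed
  moreover have "continuous_map (top_of_set triangle) (top_of_set S) L"
    using assms by (auto simp: continuous_map_in_subtopology)
  ultimately have "continuous_map (subtopology (powertop_real UNIV) (standard_simplex 2)) (top_of_set S) (L \<circ> (\<lambda>x. (x 1, x 2)))"
    by (rule continuous_map_compose)
  then show ?thesis
    unfolding singular_simplex_def triangle_simplex_def
    by (auto elim!: continuous_map_eq)
qed

lemma singular_simplex_1E:
  assumes "singular_simplex (Suc 0) (top_of_set S) \<sigma>"
  obtains \<gamma> where "continuous_on {0..1} \<gamma>" "\<And>t. t \<in> {0..1} \<Longrightarrow> \<gamma> t \<in> S" "\<sigma> = edge_simplex \<gamma>"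
proof
  have c: "continuous_map (top_of_set {0..1}) (top_of_set S) (\<sigma> \<circ> edge_coords)"
    using assms by (intro continuous_map_compose[OF continuous_map_edge_coords]) (simp add: singular_simplex_def)
  then show "continuous_on {0..1} (\<sigma> \<circ> edge_coords)" by (simp add: continuous_map_in_subtopology)
  show "(\<sigma> \<circ> edge_coords) t \<in> S" if "t \<in> {0..1}" for t
    using c that by (auto simp: continuous_map_in_subtopology)
  show "\<sigma> = edge_simplex (\<sigma> \<circ> edge_coords)"
    using assms edge_coords_eq by (auto simp: singular_simplex_def edge_simplex_def extensional_def restrict_def)
qed

lemma singular_simplex_2E:
  assumes "singular_simplex 2 (top_of_set S) \<sigma>"
  obtains L where "continuous_on triangle L" "\<And>u. u \<in> triangle \<Longrightarrow> L u \<in> S" "\<sigma> = triangle_simplex L"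
proof
  have c: "continuous_map (top_of_set triangle) (top_of_set S) (\<sigma> \<circ> triangle_coords)"
    using assms by (intro continuous_map_compose[OF continuous_map_triangle_coords]) (simp add: singular_simplex_def)
  then show "continuous_on triangle (\<sigma> \<circ> triangle_coords)" by (simp add: continuous_map_in_subtopology)
  show "(\<sigma> \<circ> triangle_coords) t \<in> S" if "t \<in> triangle" for t
    using c that by (auto simp: continuous_map_in_subtopology)
  show "\<sigma> = triangle_simplex (\<sigma> \<circ> triangle_coords)"
    using assms triangle_coords_eq by (auto simp: singular_simplex_def triangle_simplex_def extensional_def restrict_def)
qed

lemma singular_simplex_point_simplex: "singular_simplex 0 (top_of_set S) (point_simplex z) \<longleftrightarrow> z \<in> S"
proof -
  obtain x :: "nat \<Rightarrow> real" where x: "x \<in> standard_simplex 0" using nonempty_standard_simplex by blast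
  show ?thesis
  proof
    assume "singular_simplex 0 (top_of_set S) (point_simplex z)"
    then show "z \<in> S"
      using x by (auto simp: singular_simplex_def point_simplex_def continuous_map_in_subtopology Pi_iff image_subset_iff)
  next
    assume "z \<in> S"
    then show "singular_simplex 0 (top_of_set S) (point_simplex z)"
      unfolding singular_simplex_def point_simplex_def
      by (auto intro!: continuous_map_eq[of _ _ "\<lambda>_. z"])
  qed
qed

lemma singular_simplex_0E:
  assumes "singular_simplex 0 (top_of_set S) \<sigma>"
  obtains z where "z \<in> S" "\<sigma> = point_simplex z"
proof -
  have "\<sigma> x = point_simplex (\<sigma> (\<lambda>j. if j = 0 then 1 else 0)) x" for x
    using assms by (cases "x = (\<lambda>j. if j = 0 then 1 else 0)")
      (auto simp: singular_simplex_def point_simplex_def standard_simplex_0 extensional_def)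
  then have "\<sigma> = point_simplex (\<sigma> (\<lambda>j. if j = 0 then 1 else 0))" by blast
  then show ?thesis using that assms singular_simplex_point_simplex by metis
qed

lemma point_simplex_inject [simp]: "point_simplex z = point_simplex w \<longleftrightarrow> z = w"
  unfolding point_simplex_def using nonempty_standard_simplex[of 0] by (auto simp: restrict_def fun_eq_iff)

lemma kchains_0E:
  assumes "c \<in> kchains 0 (top_of_set S)" "\<sigma> \<in> Poly_Mapping.keys c"
  obtains z where "z \<in> S" "\<sigma> = point_simplex z"
  using assms singular_simplex_0E unfolding kchains_def by blast

lemma edge_simplex_cong: "(\<And>t. t \<in> {0..1} \<Longrightarrow> \<gamma> t = \<delta> t) \<Longrightarrow> edge_simplex \<gamma> = edge_simplex \<delta>"
  using simplex_1D by (auto simp: edge_simplex_def fun_eq_iff restrict_def)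

lemma face_edge_simplex_0: "singular_face (Suc 0) 0 (edge_simplex \<gamma>) = point_simplex (\<gamma> 1)"
  by (auto simp: singular_face_def edge_simplex_def point_simplex_def standard_simplex_0 simplical_face_def fun_eq_iff restrict_def standard_simplex_def)

lemma face_edge_simplex_1: "singular_face (Suc 0) (Suc 0) (edge_simplex \<gamma>) = point_simplex (\<gamma> 0)"
  by (auto simp: singular_face_def edge_simplex_def point_simplex_def standard_simplex_0 simplical_face_def fun_eq_iff restrict_def standard_simplex_def)

lemma face_triangle_simplex:
  "singular_face 2 0 (triangle_simplex L) = edge_simplex (\<lambda>t. L (1 - t, t))"
  "singular_face 2 (Suc 0) (triangle_simplex L) = edge_simplex (\<lambda>t. L (0, t))"
  "singular_face 2 2 (triangle_simplex L) = edge_simplex (\<lambda>t. L (t, 0))"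
proof -
  have *: "simplical_face k x \<in> standard_simplex 2" if "x \<in> standard_simplex (Suc 0)" "k \<le> 2" for k and x :: "nat \<Rightarrow> real"
    using simplical_face_in_standard_simplex[of 2 k x] that by simp
  have eq: "(triangle_simplex L \<circ> simplical_face k) x = L (simplical_face k x 1, simplical_face k x 2)"
    if "x \<in> standard_simplex (Suc 0)" "k \<le> 2" for k and x :: "nat \<Rightarrow> real"
    using *[OF that] by (simp add: triangle_simplex_def)
  have r: "singular_face 2 k (triangle_simplex L) = edge_simplex (\<lambda>t. L (simplical_face k (edge_coords t) 1, simplical_face k (edge_coords t) 2))"
    if "k \<le> 2" for k
    unfolding singular_face_def edge_simplex_def using that
    by (auto simp: eq[simplified] edge_coords_eq[simplified] intro!: restrict_ext)
  show "singular_face 2 0 (triangle_simplex L) = edge_simplex (\<lambda>t. L (1 - t, t))"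
    "singular_face 2 (Suc 0) (triangle_simplex L) = edge_simplex (\<lambda>t. L (0, t))"
    "singular_face 2 2 (triangle_simplex L) = edge_simplex (\<lambda>t. L (t, 0))"
    by (simp_all add: r simplical_face_def edge_coords_def)
qed

lemma kboundary_edge_simplex:
  "kboundary (Suc 0) (Poly_Mapping.single (edge_simplex \<gamma>) r) = Poly_Mapping.single (point_simplex (\<gamma> 1)) r - Poly_Mapping.single (point_simplex (\<gamma> 0)) r"
  by (simp add: kboundary_eq face_edge_simplex_0 face_edge_simplex_1 single_uminus[symmetric] scale_add)

lemma kboundary_triangle_simplex:
  "kboundary 2 (Poly_Mapping.single (triangle_simplex L) r) =
     Poly_Mapping.single (edge_simplex (\<lambda>t. L (1 - t, t))) r - Poly_Mapping.single (edge_simplex (\<lambda>t. L (0, t))) r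
     + Poly_Mapping.single (edge_simplex (\<lambda>t. L (t, 0))) r"
  by (simp add: kboundary_eq numeral_2_eq_2 face_triangle_simplex[unfolded numeral_2_eq_2] single_uminus[symmetric] scale_add)

section \<open>Lifts and arcs\<close>

lemma cis_eq_iff: "cis x = cis y \<longleftrightarrow> (\<exists>k::int. x = y + 2 * pi * of_int k)"
proof -
  have "cis x = cis y \<longleftrightarrow> sin x = sin y \<and> cos x = cos y" by (auto simp: complex_eq_iff)
  also have "\<dots> \<longleftrightarrow> (\<exists>k::int. x = y + 2 * pi * of_int k)" by (simp add: sin_cos_eq_iff)
  finally show ?thesis .
qed

lemma cis_shift [simp]: "cis (x + 2 * pi * of_int k) = cis x"
  using cis_eq_iff by blast

lemma cis_window:
  obtains k :: int where "t + 2 * pi * of_int k \<in> {a..<a + 2 * pi}"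
proof
  define x where "x = (t - a) / (2 * pi)"
  have t: "t = a + 2 * pi * x" by (simp add: x_def)
  have x: "0 \<le> x - of_int \<lfloor>x\<rfloor>" "x - of_int \<lfloor>x\<rfloor> < 1" by linarith+
  have "2 * pi * (x - of_int \<lfloor>x\<rfloor>) \<ge> 0" "2 * pi * (x - of_int \<lfloor>x\<rfloor>) < 2 * pi"
    using x by (auto simp: mult_less_cancel_left1)
  then show "t + 2 * pi * of_int (- \<lfloor>x\<rfloor>) \<in> {a..<a + 2 * pi}"
    by (simp add: t algebra_simps)
qed

lemma sphere_cis: "z \<in> sphere 0 1 \<Longrightarrow> z = cis (Arg z)"
  by (subst cis_Arg) (auto simp: sgn_div_norm)

lemma sphere_cisE:
  assumes "z \<in> sphere 0 1" obtains t where "z = cis t"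
  using sphere_cis[OF assms] that by blast

text \<open>A nowhere zero function on a contractible set has a continuous logarithm; as the modulus
  is 1, its imaginary part is a lift. Convex domains cover intervals, triangles and the whole
  line.\<close>

lemma convex_lift:
  fixes g :: "'a::euclidean_space \<Rightarrow> complex"
  assumes "convex T" "continuous_on T g" "\<And>x. x \<in> T \<Longrightarrow> norm (g x) = 1"
  obtains L :: "'a \<Rightarrow> real" where "continuous_on T L" "\<And>x. x \<in> T \<Longrightarrow> g x = cis (L x)"
proof -
  have nz: "g x \<noteq> 0" if "x \<in> T" for x using assms(3)[OF that] by auto
  obtain h where h: "continuous_on T h" "\<And>x. x \<in> T \<Longrightarrow> g x = exp (h x)"
    using continuous_logarithm_on_contractible[OF assms(2) convex_imp_contractible[OF assms(1)] nz] by metis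
  have "g x = cis (Im (h x))" if "x \<in> T" for x
  proof -
    have "exp (Re (h x)) = 1" using assms(3)[OF that] h(2)[OF that] by simp
    then show ?thesis using h(2)[OF that] by (simp add: exp_eq_polar)
  qed
  moreover have "continuous_on T (\<lambda>x. Im (h x))" using h(1) by (intro continuous_intros)
  ultimately show ?thesis using that by blast
qed

text \<open>The difference of two lifts, divided by \<open>2 * pi\<close>, is continuous with
  integer values, hence constant on a connected set.\<close>

lemma lift_unique:
  fixes F G :: "'a::topological_space \<Rightarrow> real"
  assumes "connected T" "continuous_on T F" "continuous_on T G" "\<And>t. t \<in> T \<Longrightarrow> cis (F t) = cis (G t)"
  obtains k :: int where "\<And>t. t \<in> T \<Longrightarrow> F t = G t + 2 * pi * of_int k"
proof (cases "T = {}")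
  case True then show ?thesis using that by blast
next
  case False
  let ?D = "\<lambda>t. (F t - G t) / (2 * pi)"
  have int: "?D t \<in> \<int>" if t: "t \<in> T" for t
  proof -
    obtain k :: int where "F t = G t + 2 * pi * of_int k" using assms(4)[OF t] cis_eq_iff by blast
    then show ?thesis by simp
  qed
  have "?D constant_on T"
  proof (rule continuous_discrete_range_constant[OF assms(1)])
    show "continuous_on T ?D" using assms(2,3) by (intro continuous_intros) auto
    fix x assume x: "x \<in> T"
    have "1 \<le> norm (?D y - ?D x)" if "y \<in> T" "?D y \<noteq> ?D x" for y
    proof -
      have "?D y - ?D x \<in> \<int>" using int[OF that(1)] int[OF x] by (rule Ints_diff)
      then obtain k :: int where k: "?D y - ?D x = of_int k" by (auto elim: Ints_cases)
      with that(2) have "k \<noteq> 0" by auto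
      then have "(1::real) \<le> \<bar>of_int k\<bar>" by linarith
      then show ?thesis unfolding k real_norm_def .
    qed
    then show "\<exists>e>0. \<forall>y. y \<in> T \<and> ?D y \<noteq> ?D x \<longrightarrow> e \<le> norm (?D y - ?D x)"
      using zero_less_one by blast
  qed
  then obtain c where c: "\<And>t. t \<in> T \<Longrightarrow> ?D t = c" by (auto simp: constant_on_def)
  obtain t0 where "t0 \<in> T" using False by blast
  then obtain k :: int where "c = of_int k" using c int by (metis Ints_cases)
  then have "F t = G t + 2 * pi * of_int k" if "t \<in> T" for t
    using c[OF that] by (simp add: field_simps)
  then show ?thesis using that by blast
qed

lemma segment_split_real:
  fixes a b c :: real shows "closed_segment a c \<subseteq> closed_segment a b \<union> closed_segment b c"
  by (auto simp: closed_segment_eq_real_ivl)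

lemma segment_subset_image:
  fixes F :: "real \<Rightarrow> real"
  assumes "continuous_on {a..b} F" "s \<in> {a..b}" "t \<in> {a..b}"
  shows "closed_segment (F s) (F t) \<subseteq> F ` {a..b}"
proof -
  have "connected (F ` {a..b})" using assms(1) by (intro connected_continuous_image) auto
  then have "convex (F ` {a..b})" by (simp add: is_interval_connected_1 is_interval_convex_1[symmetric])
  then show ?thesis using assms(2,3) by (intro closed_segment_subset) auto
qed

lemma cis_shift_image: "cis ` closed_segment (a + 2 * pi * of_int k) (b + 2 * pi * of_int k) = cis ` closed_segment a b"
proof -
  have "closed_segment (a + 2 * pi * of_int k) (b + 2 * pi * of_int k) = (\<lambda>x. x + 2 * pi * of_int k) ` closed_segment a b"
    using closed_segment_translation[of "2 * pi * of_int k" a b] by (simp add: add.commute)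
  then show ?thesis by (simp add: image_image)
qed

text \<open>This replaces path components of a subset of the circle: a path lifts to the line, and
  its lift covers the segment between the lifted ends (\<open>simplex_arc_connected\<close>). The
  lifts \<open>a\<close> and \<open>b\<close> are free, so the arc can run in either
  direction.\<close>

definition arc_connected :: "complex set \<Rightarrow> complex \<Rightarrow> complex \<Rightarrow> bool" where
  "arc_connected S z w \<longleftrightarrow> (\<exists>a b. z = cis a \<and> w = cis b \<and> cis ` closed_segment a b \<subseteq> S)"

lemma arc_connected_sym: "arc_connected S z w \<Longrightarrow> arc_connected S w z"
  unfolding arc_connected_def by (metis closed_segment_commute)

text \<open>Translating both lifts by the same period does not change the arc, so one lift can be
  prescribed and only the relative number \<open>k\<close> of turns remains.\<close>

lemma arc_connected_cis_iff:
  "arc_connected S (cis a) (cis b) \<longleftrightarrow> (\<exists>k::int. cis ` closed_segment a (b + 2 * pi * of_int k) \<subseteq> S)"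
proof
  assume "arc_connected S (cis a) (cis b)"
  then obtain a' b' where *: "cis a = cis a'" "cis b = cis b'" "cis ` closed_segment a' b' \<subseteq> S"
    unfolding arc_connected_def by blast
  obtain k l :: int where kl: "a' = a + 2 * pi * of_int k" "b' = b + 2 * pi * of_int l"
    using *(1,2) cis_eq_iff by metis
  have "b' = (b + 2 * pi * of_int (l - k)) + 2 * pi * of_int k" using kl(2) by (simp add: algebra_simps)
  then have "cis ` closed_segment a (b + 2 * pi * of_int (l - k)) \<subseteq> S"
    using *(3) kl(1) cis_shift_image by metis
  then show "\<exists>k::int. cis ` closed_segment a (b + 2 * pi * of_int k) \<subseteq> S" by blast
next
  assume "\<exists>k::int. cis ` closed_segment a (b + 2 * pi * of_int k) \<subseteq> S"
  then show "arc_connected S (cis a) (cis b)" unfolding arc_connected_def by (metis cis_shift)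
qed

lemma arc_connected_refl: "z \<in> S \<Longrightarrow> S \<subseteq> sphere 0 1 \<Longrightarrow> arc_connected S z z"
proof -
  assume "z \<in> S" "S \<subseteq> sphere 0 1"
  then have "z = cis (Arg z)" by (intro sphere_cis) blast
  then show ?thesis unfolding arc_connected_def using \<open>z \<in> S\<close>
    by (intro exI[of _ "Arg z"]) auto
qed

lemma arc_connected_trans:
  assumes "arc_connected S x y" "arc_connected S y z" shows "arc_connected S x z"
proof -
  obtain a b where 1: "x = cis a" "y = cis b" "cis ` closed_segment a b \<subseteq> S"
    using assms(1) unfolding arc_connected_def by blast
  obtain b' c where 2: "y = cis b'" "z = cis c" using assms(2) unfolding arc_connected_def by blast
  obtain k :: int where k: "cis ` closed_segment b (c + 2 * pi * of_int k) \<subseteq> S"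
    using assms(2) 1 2 arc_connected_cis_iff by metis
  have "cis ` closed_segment a (c + 2 * pi * of_int k) \<subseteq> S"
    using 1(3) k segment_split_real[of a "c + 2 * pi * of_int k" b] by blast
  then show ?thesis using 1 2 arc_connected_cis_iff by blast
qed

definition lifted_simplex :: "(real \<Rightarrow> real) \<Rightarrow> (nat \<Rightarrow> real) \<Rightarrow> complex" where
  "lifted_simplex F = edge_simplex (\<lambda>t. cis (F t))"

definition seg :: "real \<Rightarrow> real \<Rightarrow> real \<Rightarrow> real" where
  "seg a b = (\<lambda>t. a + t * (b - a))"

lemma seg_simps [simp]: "seg a b 0 = a" "seg a b 1 = b"
  by (auto simp: seg_def)

lemma continuous_on_seg [continuous_intros]: "continuous_on A (seg a b)"
  unfolding seg_def by (intro continuous_intros)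

lemma seg_in: "t \<in> {0..1} \<Longrightarrow> seg a b t \<in> closed_segment a b"
  unfolding seg_def in_segment by (intro exI[of _ t]) (auto simp: algebra_simps)

lemma singular_simplex_lifted_simplex:
  assumes "continuous_on {0..1} F" "\<And>t. t \<in> {0..1} \<Longrightarrow> cis (F t) \<in> S"
  shows "singular_simplex (Suc 0) (top_of_set S) (lifted_simplex F)"
  unfolding lifted_simplex_def by (intro singular_simplex_edge_simplex continuous_intros assms)

lemma lifted_simplex_cong: "(\<And>t. t \<in> {0..1} \<Longrightarrow> cis (F t) = cis (G t)) \<Longrightarrow> lifted_simplex F = lifted_simplex G"
  unfolding lifted_simplex_def by (rule edge_simplex_cong) auto

text \<open>The free window for \<open>F 0\<close> lets the lift be adapted to a missing point
  \<open>cis \<beta>\<close> or to a fundamental domain.\<close>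

lemma singular_simplex_spE:
  assumes "singular_simplex (Suc 0) (top_of_set S) \<sigma>" "S \<subseteq> sphere 0 1"
  obtains F where "continuous_on {0..1} F" "\<And>t. t \<in> {0..1} \<Longrightarrow> cis (F t) \<in> S" "\<sigma> = lifted_simplex F" "F 0 \<in> {\<beta>..<\<beta> + 2 * pi}"
proof -
  obtain \<gamma> where \<gamma>: "continuous_on {0..1} \<gamma>" "\<And>t. t \<in> {0..1} \<Longrightarrow> \<gamma> t \<in> S" "\<sigma> = edge_simplex \<gamma>"
    using singular_simplex_1E[OF assms(1)] by blast
  have "norm (\<gamma> t) = 1" if "t \<in> {0..1}" for t using \<gamma>(2)[OF that] assms(2) by auto
  then obtain F where F: "continuous_on {0..1} F" "\<And>t. t \<in> {0..1} \<Longrightarrow> \<gamma> t = cis (F t)"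
    using convex_lift[OF _ \<gamma>(1)] by (metis convex_real_interval(5))
  obtain k :: int where k: "F 0 + 2 * pi * of_int k \<in> {\<beta>..<\<beta> + 2 * pi}" by (rule cis_window)
  let ?F = "\<lambda>t. F t + 2 * pi * of_int k"
  have eq: "cis (?F t) = \<gamma> t" if "t \<in> {0..1}" for t using F(2)[OF that] by (metis cis_shift)
  show ?thesis
  proof
    show "continuous_on {0..1} ?F" using F(1) by (intro continuous_intros)
    show "\<And>t. t \<in> {0..1} \<Longrightarrow> cis (?F t) \<in> S" using eq \<gamma>(2) by presburger
    show "\<sigma> = lifted_simplex ?F" unfolding \<gamma>(3) lifted_simplex_def by (rule edge_simplex_cong) (use eq in presburger)
  qed (rule k)
qed

section \<open>Degree zero\<close>

lemma kboundary_lifted_simplex: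
  "kboundary (Suc 0) (Poly_Mapping.single (lifted_simplex F) r) =
     Poly_Mapping.single (point_simplex (cis (F 1))) r - Poly_Mapping.single (point_simplex (cis (F 0))) r"
  unfolding lifted_simplex_def by (rule kboundary_edge_simplex)

lemma arc_connected_boundary:
  assumes "arc_connected S z w"
  shows "Poly_Mapping.single (point_simplex w) r - Poly_Mapping.single (point_simplex z) r \<in> (kboundaries 0 (top_of_set S) :: ('k::field, complex) kchain set)"
proof -
  obtain a b where 1: "z = cis a" "w = cis b" "cis ` closed_segment a b \<subseteq> S"
    using assms(1) unfolding arc_connected_def by blast
  have "singular_simplex (Suc 0) (top_of_set S) (lifted_simplex (seg a b))"
    using 1(3) seg_in by (intro singular_simplex_lifted_simplex continuous_intros) blast
  then have "Poly_Mapping.single (lifted_simplex (seg a b)) r \<in> kchains (Suc 0) (top_of_set S)" for r :: 'k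
    by (rule kchains_single)
  then have "kboundary (Suc 0) (Poly_Mapping.single (lifted_simplex (seg a b)) r) \<in> kboundaries 0 (top_of_set S)"
    unfolding kboundaries_def by (rule imageI)
  then show ?thesis by (simp only: kboundary_lifted_simplex seg_simps 1)
qed

text \<open>The 0-cochain dual to a set of points; it is a cocycle when \<open>P\<close> is a union
  of components.\<close>

definition indic :: "complex set \<Rightarrow> ((nat \<Rightarrow> real) \<Rightarrow> complex) \<Rightarrow> 'k::field" where
  "indic P \<sigma> = (if \<sigma> \<in> point_simplex ` P then 1 else 0)"

lemma indic_point_simplex [simp]: "indic P (point_simplex z) = (if z \<in> P then 1 else 0)"
  by (auto simp: indic_def)

lemma simplex_arc_connected:
  fixes F :: "real \<Rightarrow> real"
  assumes "continuous_on {0..1} F" "\<And>t. t \<in> {0..1} \<Longrightarrow> cis (F t) \<in> S"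
  shows "arc_connected S (cis (F 0)) (cis (F 1))"
proof -
  have "closed_segment (F 0) (F 1) \<subseteq> F ` {0..1}" using segment_subset_image[OF assms(1)] by simp
  then have "cis ` closed_segment (F 0) (F 1) \<subseteq> S" using assms(2) by blast
  then show ?thesis unfolding arc_connected_def by blast
qed

text \<open>A 1-simplex joins points of one component, so both its ends lie in \<open>P\<close> or
  neither does, and the cochain vanishes on its boundary.\<close>

lemma indic_boundary:
  assumes "S \<subseteq> sphere 0 1" "c \<in> kboundaries 0 (top_of_set S)"
    and P: "\<And>z w. arc_connected S z w \<Longrightarrow> z \<in> P \<longleftrightarrow> w \<in> P"
  shows "fext (indic P) c = (0::'k::field)"
proof -
  obtain d where d: "d \<in> kchains (Suc 0) (top_of_set S)" "c = kboundary (Suc 0) d"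
    using assms(2) unfolding kboundaries_def by auto
  have "fext (indic P) (\<Sum>k\<le>Suc 0. Poly_Mapping.single (singular_face (Suc 0) k \<sigma>) ((-1) ^ k)) = (0::'k)"
    if "\<sigma> \<in> Poly_Mapping.keys d" for \<sigma>
  proof -
    have "singular_simplex (Suc 0) (top_of_set S) \<sigma>" using d that by (auto simp: kchains_def)
    from singular_simplex_spE[OF this assms(1)] obtain F where
      F: "continuous_on {0..1} F" "\<And>t. t \<in> {0..1} \<Longrightarrow> cis (F t) \<in> S" "\<sigma> = lifted_simplex F" by metis
    have "cis (F 0) \<in> P \<longleftrightarrow> cis (F 1) \<in> P" using P simplex_arc_connected[OF F(1,2)] by blast
    then show ?thesis by (simp add: F(3) lifted_simplex_def face_edge_simplex_0 face_edge_simplex_1 fext_add)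
  qed
  then have "fext (\<lambda>\<sigma>. fext (indic P) (\<Sum>k\<le>Suc 0. Poly_Mapping.single (singular_face (Suc 0) k \<sigma>) ((-1) ^ k))) d
    = fext (\<lambda>_. 0::'k) d" by (intro fext_cong) blast
  then show ?thesis
    by (simp only: d(2) kboundary_eq[OF zero_less_Suc] fext_lext fext_fun_zero)
qed

lemma point_simplex_diff_boundary_iff:
  assumes "S \<subseteq> sphere 0 1" "z \<in> S"
  shows "Poly_Mapping.single (point_simplex w) 1 - Poly_Mapping.single (point_simplex z) 1 \<in> (kboundaries 0 (top_of_set S) :: ('k::field, complex) kchain set)
     \<longleftrightarrow> arc_connected S z w"
proof
  let ?P = "{w. arc_connected S z w}"
  assume "Poly_Mapping.single (point_simplex w) 1 - Poly_Mapping.single (point_simplex z) 1 \<in> (kboundaries 0 (top_of_set S) :: ('k::field, complex) kchain set)"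
  then have "fext (indic ?P) (Poly_Mapping.single (point_simplex w) 1 - Poly_Mapping.single (point_simplex z) (1::'k)) = (0::'k)"
    using arc_connected_trans arc_connected_sym by (intro indic_boundary[OF assms(1)]) blast+
  moreover have "arc_connected S z z" using arc_connected_refl assms by blast
  ultimately show "arc_connected S z w" by (auto simp: fext_diff split: if_splits)
qed (rule arc_connected_boundary)

section \<open>Degree one\<close>

lemma convex_triangle: "convex triangle"
proof -
  have "triangle = {u. (1, 0) \<bullet> u \<ge> 0} \<inter> {u. (0, 1) \<bullet> u \<ge> 0} \<inter> {u. (1, 1) \<bullet> u \<le> 1}"
    by (auto simp: triangle_def inner_prod_def)
  moreover have "convex ({u. (1, 0) \<bullet> u \<ge> 0} \<inter> {u. (0, 1) \<bullet> u \<ge> 0} \<inter> {u. (1, 1) \<bullet> u \<le> (1::real)} :: (real \<times> real) set)"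
    by (intro convex_Int convex_halfspace_ge convex_halfspace_le)
  ultimately show ?thesis by simp
qed

lemma triangle_boundary:
  assumes "continuous_on triangle L" "\<And>u. u \<in> triangle \<Longrightarrow> cis (L u) \<in> S"
  shows "Poly_Mapping.single (lifted_simplex (\<lambda>t. L (1 - t, t))) 1 - Poly_Mapping.single (lifted_simplex (\<lambda>t. L (0, t))) 1
     + Poly_Mapping.single (lifted_simplex (\<lambda>t. L (t, 0))) 1 \<in> (kboundaries (Suc 0) (top_of_set S) :: ('k::field, complex) kchain set)"
proof -
  have "singular_simplex 2 (top_of_set S) (triangle_simplex (\<lambda>u. cis (L u)))"
    by (intro singular_simplex_triangle_simplex continuous_intros assms)
  then have "Poly_Mapping.single (triangle_simplex (\<lambda>u. cis (L u))) (1::'k) \<in> kchains 2 (top_of_set S)"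
    by (rule kchains_single)
  then have "kboundary 2 (Poly_Mapping.single (triangle_simplex (\<lambda>u. cis (L u))) (1::'k)) \<in> kboundaries (Suc 0) (top_of_set S)"
    unfolding kboundaries_def numeral_2_eq_2[symmetric] by (rule imageI)
  then show ?thesis by (simp only: kboundary_triangle_simplex lifted_simplex_def)
qed

text \<open>The boundary of a constant triangle is the alternating sum of three equal edges, which
  leaves one of them.\<close>

lemma const_boundary:
  assumes "cis a \<in> S"
  shows "Poly_Mapping.single (lifted_simplex (\<lambda>t. a)) 1 \<in> (kboundaries (Suc 0) (top_of_set S) :: ('k::field, complex) kchain set)"
  using triangle_boundary[of "\<lambda>_. a" S] assms by simp

text \<open>The square is cut along its diagonal into two triangles whose common edge
  cancels.\<close>

lemma square_boundary:
  assumes "continuous_on ({0..1} \<times> {0..1}) G"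
    and "\<And>s t. s \<in> {0..1} \<Longrightarrow> t \<in> {0..1} \<Longrightarrow> cis (G (s, t)) \<in> S"
  shows "Poly_Mapping.single (lifted_simplex (\<lambda>t. G (t, 0))) 1 + Poly_Mapping.single (lifted_simplex (\<lambda>t. G (1, t))) 1
     - Poly_Mapping.single (lifted_simplex (\<lambda>t. G (0, t))) 1 - Poly_Mapping.single (lifted_simplex (\<lambda>t. G (t, 1))) 1
     \<in> (kboundaries (Suc 0) (top_of_set S) :: ('k::field, complex) kchain set)"
proof -
  let ?B = "kboundaries (Suc 0) (top_of_set S) :: ('k::field, complex) kchain set"
  have m1: "(\<lambda>u. (fst u + snd u, snd u)) ` triangle \<subseteq> {0..1} \<times> {0..1::real}" by (auto simp: triangle_def)
  have m2: "(\<lambda>u. (snd u, fst u + snd u)) ` triangle \<subseteq> {0..1} \<times> {0..1::real}" by (auto simp: triangle_def)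
  have c1: "continuous_on triangle (\<lambda>u. G (fst u + snd u, snd u))"
    by (rule continuous_on_compose2[OF assms(1) _ m1]) (intro continuous_intros)
  have c2: "continuous_on triangle (\<lambda>u. G (snd u, fst u + snd u))"
    by (rule continuous_on_compose2[OF assms(1) _ m2]) (intro continuous_intros)
  have 1: "Poly_Mapping.single (lifted_simplex (\<lambda>t. G (1, t))) 1 - Poly_Mapping.single (lifted_simplex (\<lambda>t. G (t, t))) 1
     + Poly_Mapping.single (lifted_simplex (\<lambda>t. G (t, 0))) 1 \<in> ?B"
  proof -
    have "cis (G (fst u + snd u, snd u)) \<in> S" if "u \<in> triangle" for u using assms(2) that by (auto simp: triangle_def)
    from triangle_boundary[OF c1 this] show ?thesis by simp
  qed
  have 2: "Poly_Mapping.single (lifted_simplex (\<lambda>t. G (t, 1))) 1 - Poly_Mapping.single (lifted_simplex (\<lambda>t. G (t, t))) 1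
     + Poly_Mapping.single (lifted_simplex (\<lambda>t. G (0, t))) 1 \<in> ?B"
  proof -
    have "cis (G (snd u, fst u + snd u)) \<in> S" if "u \<in> triangle" for u using assms(2) that by (auto simp: triangle_def)
    from triangle_boundary[OF c2 this] show ?thesis by simp
  qed
  show ?thesis
    using chain_subspaceD(5)[OF chain_subspace_kboundaries 1 2] by (simp add: algebra_simps)
qed

text \<open>Apply the square to the linear homotopy, in the lift, from the constant \<open>a\<close>
  to \<open>F\<close>; the constant edge is itself a boundary. A path is thereby homologous to the
  difference of the straight paths from \<open>a\<close> to its ends.\<close>

lemma cone_boundary:
  assumes "continuous_on {0..1} F" "\<And>t. t \<in> {0..1} \<Longrightarrow> cis ` closed_segment a (F t) \<subseteq> S"
  shows "Poly_Mapping.single (lifted_simplex F) 1 - Poly_Mapping.single (lifted_simplex (seg a (F 1))) 1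
     + Poly_Mapping.single (lifted_simplex (seg a (F 0))) 1 \<in> (kboundaries (Suc 0) (top_of_set S) :: ('k::field, complex) kchain set)"
proof -
  let ?B = "kboundaries (Suc 0) (top_of_set S) :: ('k::field, complex) kchain set"
  let ?G = "\<lambda>u. a + snd u * (F (fst u) - a)"
  have "continuous_on ({0..1} \<times> {0..1}) ?G"
    by (intro continuous_intros continuous_on_compose2[OF assms(1)]) auto
  moreover have "cis (?G (s, t)) \<in> S" if "s \<in> {0..1}" "t \<in> {0..1}" for s t
    using assms(2)[OF that(1)] seg_in[OF that(2), of a "F s"] by (auto simp: seg_def)
  ultimately have *: "Poly_Mapping.single (lifted_simplex (\<lambda>t. a)) 1 + Poly_Mapping.single (lifted_simplex (seg a (F 1))) 1
     - Poly_Mapping.single (lifted_simplex (seg a (F 0))) 1 - Poly_Mapping.single (lifted_simplex F) 1 \<in> ?B"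
    using square_boundary[of ?G S] by (simp add: seg_def)
  have "cis a \<in> S" using assms(2)[of 0] by auto
  then have "Poly_Mapping.single (lifted_simplex (\<lambda>t. a)) 1 \<in> ?B" by (rule const_boundary)
  from chain_subspaceD(5)[OF chain_subspace_kboundaries this *] show ?thesis by (simp add: algebra_simps)
qed

definition vertex0 :: "nat \<Rightarrow> real" where "vertex0 = (\<lambda>j. if j = 0 then 1 else 0)"

lemma point_simplex_vertex0 [simp]: "point_simplex z vertex0 = z"
  by (simp add: point_simplex_def vertex0_def)

text \<open>
  A simplex is homologous to the difference of chosen paths \<open>p\<close> to its end points, up to a multiple of
  \<open>l\<close>; for a cycle the paths cancel.
\<close>

lemma H1_reduce:
  fixes p :: "complex \<Rightarrow> ('k::field, complex) kchain"
  assumes S: "S \<subseteq> sphere 0 1"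
    and red: "\<And>F. continuous_on {0..1} F \<Longrightarrow> (\<And>t. t \<in> {0..1} \<Longrightarrow> cis (F t) \<in> S) \<Longrightarrow> F 0 \<in> {\<beta>..<\<beta> + 2 * pi} \<Longrightarrow>
       Poly_Mapping.single (lifted_simplex F) 1 - (p (cis (F 1)) - p (cis (F 0))) - scale (n (lifted_simplex F)) l \<in> kboundaries (Suc 0) (top_of_set S)"
    and c: "c \<in> kcycles (Suc 0) (top_of_set S)"
  shows "c - scale (fext n c) l \<in> kboundaries (Suc 0) (top_of_set S)"
proof -
  let ?q = "\<lambda>\<sigma>. p (\<sigma> vertex0)"
  let ?bd = "\<lambda>\<sigma>. \<Sum>k\<le>Suc 0. Poly_Mapping.single (singular_face (Suc 0) k \<sigma>) ((-1) ^ k)"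
  let ?r = "\<lambda>\<sigma>. Poly_Mapping.single \<sigma> 1 - lext ?q (?bd \<sigma>) - scale (n \<sigma>) l"
  have "lext ?r c \<in> kboundaries (Suc 0) (top_of_set S)"
  proof (rule chain_subspace_lext[OF chain_subspace_kboundaries])
    fix \<sigma> assume "\<sigma> \<in> Poly_Mapping.keys c"
    then have "singular_simplex (Suc 0) (top_of_set S) \<sigma>" using c by (auto simp: kcycles_def kchains_def)
    from singular_simplex_spE[OF this S] obtain F where
      F: "continuous_on {0..1} F" "\<And>t. t \<in> {0..1} \<Longrightarrow> cis (F t) \<in> S" "\<sigma> = lifted_simplex F" "F 0 \<in> {\<beta>..<\<beta> + 2 * pi}" by metis
    have "lext ?q (?bd \<sigma>) = p (cis (F 1)) - p (cis (F 0))"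
      by (simp add: F(3) lifted_simplex_def face_edge_simplex_0 face_edge_simplex_1 lext_add scale_minus_one)
    then show "?r \<sigma> \<in> kboundaries (Suc 0) (top_of_set S)"
      using red[OF F(1,2,4)] F(3) by simp
  qed
  moreover have "lext ?r c = c - lext ?q (kboundary (Suc 0) c) - scale (fext n c) l"
    by (simp only: lext_fun_diff lext_id lext_const_scale kboundary_eq[OF zero_less_Suc] lext_lext)
  moreover have "kboundary (Suc 0) c = 0" using c by (simp add: kcycles_def)
  ultimately show ?thesis by simp
qed

text \<open>To leave the open window the lift would have to take one of its end values, and both
  project to \<open>cis \<beta>\<close>.\<close>

lemma avoid_window:
  fixes F :: "real \<Rightarrow> real"
  assumes "continuous_on {0..1} F" "F 0 \<in> {\<beta>..<\<beta> + 2 * pi}" "\<And>t. t \<in> {0..1} \<Longrightarrow> cis (F t) \<noteq> cis \<beta>" "t \<in> {0..1}"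
  shows "\<beta> < F t \<and> F t < \<beta> + 2 * pi"
proof (rule ccontr)
  assume n: "\<not> ?thesis"
  have sub: "closed_segment (F 0) (F t) \<subseteq> F ` {0..1}" using segment_subset_image[OF assms(1)] assms(4) by simp
  have "\<beta> \<in> closed_segment (F 0) (F t) \<or> \<beta> + 2 * pi \<in> closed_segment (F 0) (F t)"
    using n assms(2) by (auto simp: closed_segment_eq_real_ivl)
  then obtain s where "s \<in> {0..1}" "F s = \<beta> \<or> F s = \<beta> + 2 * pi" using sub by (force simp: image_iff)
  moreover have "cis (\<beta> + 2 * pi) = cis \<beta>" using cis_shift[of \<beta> 1] by simp
  ultimately show False using assms(3) by metis
qed

lemma cis_inj_window:
  assumes "\<beta> < x" "x < \<beta> + 2 * pi" "\<beta> < y" "y < \<beta> + 2 * pi" "cis x = cis y"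
  shows "x = y"
proof -
  obtain k :: int where k: "x = y + 2 * pi * of_int k" using assms(5) cis_eq_iff by blast
  have "\<bar>2 * pi * of_int k\<bar> < 2 * pi" using k assms by linarith
  then have "\<bar>of_int k :: real\<bar> < 1" by (simp add: abs_mult mult_less_cancel_left2)
  then have "k = 0" by linarith
  then show ?thesis using k by simp
qed

text \<open>Lifted to the open window at \<beta>, \<open>S\<close> becomes a subset of an interval.
  Its components are then intervals too, and each can be coned off from any of its points.\<close>

lemma H1_proper:
  fixes c :: "('k::field, complex) kchain"
  assumes S: "S \<subseteq> sphere 0 1 - {cis \<beta>}" and c: "c \<in> kcycles (Suc 0) (top_of_set S)"
  shows "c \<in> kboundaries (Suc 0) (top_of_set S)"
proof -
  define \<theta> where "\<theta> z = (SOME x. \<beta> < x \<and> x < \<beta> + 2 * pi \<and> cis x = z)" for z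
  have \<theta>: "\<theta> (cis x) = x" if "\<beta> < x" "x < \<beta> + 2 * pi" for x
    unfolding \<theta>_def
  proof (rule some_equality)
    show "y = x" if "\<beta> < y \<and> y < \<beta> + 2 * pi \<and> cis y = cis x" for y
      using cis_inj_window that \<open>\<beta> < x\<close> \<open>x < \<beta> + 2 * pi\<close> by blast
  qed (use that in simp)
  \<comment> \<open>The predicate depends on \<open>z\<close> only through its component, so the
    choice operator returns the same base point on a whole component, and the cones over a path have
    one apex.\<close>
  define b where "b z = (SOME b. cis ` closed_segment b (\<theta> z) \<subseteq> S)" for z
  define p where "p z = Poly_Mapping.single (lifted_simplex (seg (b z) (\<theta> z))) (1::'k)" for z
  have S1: "S \<subseteq> sphere 0 1" using S by blast
  have "c - scale (fext (\<lambda>_. 0) c) 0 \<in> kboundaries (Suc 0) (top_of_set S)"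
  proof (rule H1_reduce[OF S1 _ c, where p = p and \<beta> = \<beta>])
    fix F :: "real \<Rightarrow> real" assume F: "continuous_on {0..1} F" "\<And>t. t \<in> {0..1} \<Longrightarrow> cis (F t) \<in> S" "F 0 \<in> {\<beta>..<\<beta> + 2 * pi}"
    have ne: "cis (F t) \<noteq> cis \<beta>" if "t \<in> {0..1}" for t using F(2)[OF that] S by auto
    have th: "\<theta> (cis (F t)) = F t" if "t \<in> {0..1}" for t
      using \<theta> avoid_window[OF F(1,3) ne that] by blast
    have sub: "cis ` closed_segment (F s) (F t) \<subseteq> S" if "s \<in> {0..1}" "t \<in> {0..1}" for s t
      using segment_subset_image[OF F(1) that] F(2) by blast
    have "cis ` closed_segment b' (F s) \<subseteq> S" if "cis ` closed_segment b' (F t) \<subseteq> S" "s \<in> {0..1}" "t \<in> {0..1}" for b' s t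
      using that(1) sub[OF that(3,2)] segment_split_real[of b' "F s" "F t"] by blast
    then have iff: "(cis ` closed_segment b' (F s) \<subseteq> S) = (cis ` closed_segment b' (F t) \<subseteq> S)" if "s \<in> {0..1}" "t \<in> {0..1}" for b' s t
      using that by (intro iffI) simp_all
    then have beq: "b (cis (F s)) = b (cis (F t))" if "s \<in> {0..1}" "t \<in> {0..1}" for s t
      by (simp only: b_def th[OF that(1)] th[OF that(2)] iff[OF that])
    have "cis ` closed_segment (b (cis (F t))) (F t) \<subseteq> S" if "t \<in> {0..1}" for t
    proof -
      have "cis ` closed_segment (F t) (F t) \<subseteq> S" using F(2) that by simp
      then show ?thesis unfolding b_def th[OF that] by (rule someI)
    qed
    then have "cis ` closed_segment (b (cis (F 0))) (F t) \<subseteq> S" if "t \<in> {0..1}" for t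
      using that beq[of 0 t] by auto
    from cone_boundary[OF F(1) this]
    have "Poly_Mapping.single (lifted_simplex F) 1 - Poly_Mapping.single (lifted_simplex (seg (b (cis (F 0))) (F 1))) 1
       + Poly_Mapping.single (lifted_simplex (seg (b (cis (F 0))) (F 0))) (1::'k) \<in> kboundaries (Suc 0) (top_of_set S)" .
    then show "Poly_Mapping.single (lifted_simplex F) 1 - (p (cis (F 1)) - p (cis (F 0))) - scale 0 0
       \<in> kboundaries (Suc 0) (top_of_set S)"
      unfolding p_def using th[of 0] th[of 1] beq[of 0 1] by (simp add: algebra_simps)
  qed
  then show ?thesis by simp
qed

text \<open>
  A cocycle counting signed crossings of the point \<open>cis \<beta>\<close>; on cycles it is the winding number. The
  choice of the lift is irrelevant.
\<close>

definition winding :: "real \<Rightarrow> ((nat \<Rightarrow> real) \<Rightarrow> complex) \<Rightarrow> 'k::field" where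
  "winding \<beta> \<sigma> = (let F = SOME F. continuous_on {0..1} F \<and> \<sigma> = lifted_simplex F in
     of_int (\<lfloor>(F 1 - \<beta>) / (2 * pi)\<rfloor> - \<lfloor>(F 0 - \<beta>) / (2 * pi)\<rfloor>))"

lemma edge_simplex_inj: "edge_simplex \<gamma> = edge_simplex \<delta> \<Longrightarrow> t \<in> {0..1} \<Longrightarrow> \<gamma> t = \<delta> t"
proof -
  assume a: "edge_simplex \<gamma> = edge_simplex \<delta>" "t \<in> {0..1}"
  then have "edge_simplex \<gamma> (edge_coords t) = edge_simplex \<delta> (edge_coords t)" by simp
  then show ?thesis using edge_coords_in[OF a(2)] by (simp add: edge_simplex_def edge_coords_def)
qed

text \<open>Another lift differs by \<open>2 * pi * of_int k\<close>, which adds \<open>k\<close> to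
  both floors.\<close>

lemma winding_lifted_simplex:
  assumes "continuous_on {0..1} F"
  shows "winding \<beta> (lifted_simplex F) = (of_int (\<lfloor>(F 1 - \<beta>) / (2 * pi)\<rfloor> - \<lfloor>(F 0 - \<beta>) / (2 * pi)\<rfloor>) :: 'k::field)"
proof -
  define G where "G = (SOME G. continuous_on {0..1} G \<and> lifted_simplex F = lifted_simplex G)"
  have G: "continuous_on {0..1} G" "lifted_simplex F = lifted_simplex G"
    using someI[of "\<lambda>G. continuous_on {0..1} G \<and> lifted_simplex F = lifted_simplex G" F] assms by (auto simp: G_def)
  have "cis (G t) = cis (F t)" if "t \<in> {0..1}" for t using G(2) edge_simplex_inj[OF _ that] unfolding lifted_simplex_def by metis
  then obtain k :: int where k: "\<And>t. t \<in> {0..1} \<Longrightarrow> G t = F t + 2 * pi * of_int k"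
    using lift_unique[OF _ G(1) assms] by (metis connected_Icc)
  have "\<lfloor>(G t - \<beta>) / (2 * pi)\<rfloor> = \<lfloor>(F t - \<beta>) / (2 * pi)\<rfloor> + k" if "t \<in> {0..1}" for t
  proof -
    have "(G t - \<beta>) / (2 * pi) = (F t - \<beta>) / (2 * pi) + of_int k"
      using k[OF that] by (simp add: field_simps)
    then show ?thesis by simp
  qed
  then show ?thesis unfolding winding_def G_def[symmetric] by (simp add: Let_def)
qed

text \<open>The triangle is lifted as a whole, so its three edges share the lifts of the vertices
  and the floor terms cancel in the alternating sum.\<close>

lemma winding_boundary:
  assumes "S \<subseteq> sphere 0 1" "c \<in> kboundaries (Suc 0) (top_of_set S)"
  shows "fext (winding \<beta>) c = (0::'k::field)"
proof -
  obtain d where d: "d \<in> kchains 2 (top_of_set S)" "c = kboundary 2 d"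
    using assms(2) unfolding kboundaries_def by (auto simp: numeral_2_eq_2)
  have "fext (winding \<beta>) (\<Sum>k\<le>2. Poly_Mapping.single (singular_face 2 k \<sigma>) ((-1) ^ k)) = (0::'k)"
    if "\<sigma> \<in> Poly_Mapping.keys d" for \<sigma>
  proof -
    have "singular_simplex 2 (top_of_set S) \<sigma>" using d that by (auto simp: kchains_def)
    then obtain L where L: "continuous_on triangle L" "\<And>u. u \<in> triangle \<Longrightarrow> L u \<in> S" "\<sigma> = triangle_simplex L"
      using singular_simplex_2E by blast
    have "norm (L u) = 1" if "u \<in> triangle" for u using L(2)[OF that] assms(1) by auto
    then obtain M where M: "continuous_on triangle M" "\<And>u. u \<in> triangle \<Longrightarrow> L u = cis (M u)"
      using convex_lift[OF convex_triangle L(1)] by metis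
    have e: "edge_simplex (\<lambda>t. L (1 - t, t)) = lifted_simplex (\<lambda>t. M (1 - t, t))" "edge_simplex (\<lambda>t. L (0, t)) = lifted_simplex (\<lambda>t. M (0, t))"
      "edge_simplex (\<lambda>t. L (t, 0)) = lifted_simplex (\<lambda>t. M (t, 0))"
      unfolding lifted_simplex_def using M(2) by (auto intro!: edge_simplex_cong simp: triangle_def)
    have cM: "continuous_on {0..1} (\<lambda>t. M (1 - t, t))" "continuous_on {0..1} (\<lambda>t. M (0, t))"
      "continuous_on {0..1} (\<lambda>t. M (t, 0))"
      by (auto intro!: continuous_on_compose2[OF M(1)] continuous_intros simp: triangle_def)
    show ?thesis
      by (simp add: L(3) numeral_2_eq_2 face_triangle_simplex[unfolded numeral_2_eq_2] e fext_add winding_lifted_simplex[OF cM(1)] winding_lifted_simplex[OF cM(2)] winding_lifted_simplex[OF cM(3)])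
  qed
  then have "fext (\<lambda>\<sigma>. fext (winding \<beta>) (\<Sum>k\<le>2. Poly_Mapping.single (singular_face 2 k \<sigma>) ((-1) ^ k))) d
    = fext (\<lambda>_. 0::'k) d" by (intro fext_cong) blast
  then show ?thesis
    by (simp only: d(2) kboundary_eq[OF zero_less_numeral] fext_lext fext_fun_zero)
qed

lemma winding_avoid:
  assumes S: "S \<subseteq> sphere 0 1 - {cis \<beta>}" and c: "c \<in> kchains (Suc 0) (top_of_set S)"
  shows "fext (winding \<beta>) c = (0::'k::field)"
proof -
  have "winding \<beta> \<sigma> = (0::'k)" if "\<sigma> \<in> Poly_Mapping.keys c" for \<sigma>
  proof -
    have "singular_simplex (Suc 0) (top_of_set S) \<sigma>" using c that by (auto simp: kchains_def)
    from singular_simplex_spE[OF this, of \<beta>] S obtain F where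
      F: "continuous_on {0..1} F" "\<And>t. t \<in> {0..1} \<Longrightarrow> cis (F t) \<in> S" "\<sigma> = lifted_simplex F" "F 0 \<in> {\<beta>..<\<beta> + 2 * pi}" by blast
    have "\<beta> < F t \<and> F t < \<beta> + 2 * pi" if "t \<in> {0..1}" for t
      using S F(2) by (intro avoid_window[OF F(1,4) _ that]) auto
    then have "\<lfloor>(F t - \<beta>) / (2 * pi)\<rfloor> = 0" if "t \<in> {0..1}" for t
      using that by (auto simp: floor_eq_iff field_simps less_imp_le)
    then show ?thesis by (simp add: F(3) winding_lifted_simplex[OF F(1)])
  qed
  then show ?thesis by (simp add: fext_def)
qed

definition loop :: "('k::field, complex) kchain" where
  "loop = Poly_Mapping.single (lifted_simplex (seg 0 (2 * pi))) 1"

lemma winding_loop: "fext (winding \<beta>) loop = (1::'k::field)"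
proof -
  have e: "(2 * pi - \<beta>) / (2 * pi) = - \<beta> / (2 * pi) + of_int 1" by (simp add: field_simps)
  have "\<lfloor>(2 * pi - \<beta>) / (2 * pi)\<rfloor> = \<lfloor>- \<beta> / (2 * pi)\<rfloor> + 1" unfolding e by (simp only: floor_add_int[symmetric])
  then show ?thesis by (simp add: loop_def winding_lifted_simplex continuous_on_seg)
qed

lemma loop_cycle: "loop \<in> kcycles (Suc 0) circle"
proof -
  have "singular_simplex (Suc 0) circle (lifted_simplex (seg 0 (2 * pi)))"
    by (intro singular_simplex_lifted_simplex continuous_intros) simp
  then show ?thesis
    by (simp add: loop_def kcycles_def kchains_single kboundary_lifted_simplex)
qed

text \<open>By \<open>add\<close>, concatenation of straight paths is additive modulo boundaries,
  since a segment that starts at a multiple of \<open>2 * pi\<close> projects to the same simplex as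
  one that starts at 0. Induction on \<open>m\<close> in both directions then counts loops.\<close>

lemma seg_wind:
  "Poly_Mapping.single (lifted_simplex (seg 0 (2 * pi * of_int m + y))) 1 - Poly_Mapping.single (lifted_simplex (seg 0 y)) 1
     - scale (of_int m) loop \<in> (kboundaries (Suc 0) circle :: ('k::field, complex) kchain set)"
proof -
  let ?B = "kboundaries (Suc 0) circle :: ('k::field, complex) kchain set"
  let ?f = "\<lambda>x. Poly_Mapping.single (lifted_simplex (seg 0 x)) (1::'k)"
  have add: "?f (2 * pi * of_int j + y) - ?f (2 * pi * of_int j) - ?f y \<in> ?B" for j :: int and y
  proof -
    have "lifted_simplex (seg (2 * pi * of_int j) (2 * pi * of_int j + y)) = lifted_simplex (seg 0 y)"
      by (rule lifted_simplex_cong) (simp add: seg_def add.commute[of "2 * pi * of_int j"])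
    moreover have "Poly_Mapping.single (lifted_simplex (seg (2 * pi * of_int j) (2 * pi * of_int j + y))) 1
        - ?f (2 * pi * of_int j + y) + ?f (2 * pi * of_int j) \<in> ?B"
    proof -
      have "cis ` closed_segment 0 x \<subseteq> sphere 0 1" for x by auto
      from cone_boundary[where F = "seg (2 * pi * of_int j) (2 * pi * of_int j + y)" and a = 0, OF continuous_on_seg this]
      show ?thesis by (simp only: seg_simps)
    qed
    ultimately have "?f y - ?f (2 * pi * of_int j + y) + ?f (2 * pi * of_int j) \<in> ?B" by simp
    from chain_subspaceD(4)[OF chain_subspace_kboundaries this] show ?thesis by (simp add: algebra_simps)
  qed
  have l: "?f (2 * pi) = loop" by (simp add: loop_def)
  have m: "?f (2 * pi * of_int m) - scale (of_int m) loop \<in> ?B"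
  proof (induction m rule: int_induct[of _ 0])
    case base
    show ?case using const_boundary[of 0 "sphere 0 1"] by (simp add: seg_def)
  next
    case (step1 i)
    have "?f (2 * pi * of_int (i + 1)) - ?f (2 * pi * of_int i) - loop \<in> ?B"
      using add[of i "2 * pi"] l by (simp add: algebra_simps)
    from chain_subspaceD(2)[OF chain_subspace_kboundaries this step1(2)] show ?case
      by (simp add: scale_add_left algebra_simps)
  next
    case (step2 i)
    have "?f (2 * pi * of_int i) - ?f (2 * pi * of_int (i - 1)) - loop \<in> ?B"
      using add[of "i - 1" "2 * pi"] l by (simp add: algebra_simps)
    from chain_subspaceD(5)[OF chain_subspace_kboundaries step2(2) this] show ?case
      by (simp add: scale_diff_left algebra_simps)
  qed
  show ?thesis using chain_subspaceD(2)[OF chain_subspace_kboundaries add[of m y] m] by (simp add: algebra_simps)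
qed

text \<open>The path attached to a point runs from 0 to its representative in
  \<open>[0, 2 * pi)\<close>. Coning a simplex from 0 leaves, besides these paths, the full turns of
  its end point, and their number is its winding number.\<close>

lemma H1_circle:
  fixes c :: "('k::field, complex) kchain"
  assumes c: "c \<in> kcycles (Suc 0) circle"
  shows "c - scale (fext (winding 0) c) loop \<in> kboundaries (Suc 0) circle"
proof -
  define \<theta> where "\<theta> x = x - 2 * pi * of_int \<lfloor>x / (2 * pi)\<rfloor>" for x
  define \<theta>' where "\<theta>' z = (SOME y. \<exists>x. z = cis x \<and> y = \<theta> x)" for z
  have th: "\<theta>' (cis x) = \<theta> x" for x
  proof -
    have "\<exists>y. cis x = cis y \<and> \<theta>' (cis x) = \<theta> y"
      unfolding \<theta>'_def by (rule someI_ex) blast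
    then obtain y where y: "cis x = cis y" "\<theta>' (cis x) = \<theta> y" by blast
    then obtain k :: int where k: "x = y + 2 * pi * of_int k" using cis_eq_iff by blast
    have "x / (2 * pi) = y / (2 * pi) + of_int k" by (simp add: k field_simps)
    then have "\<lfloor>x / (2 * pi)\<rfloor> = \<lfloor>y / (2 * pi)\<rfloor> + k" by simp
    then have "\<theta> x = \<theta> y" by (simp add: \<theta>_def k algebra_simps)
    then show ?thesis using y by simp
  qed
  define p where "p z = Poly_Mapping.single (lifted_simplex (seg 0 (\<theta>' z))) (1::'k)" for z
  show ?thesis
  proof (rule H1_reduce[OF order_refl _ c, where p = p and \<beta> = 0])
    fix F :: "real \<Rightarrow> real" assume F: "continuous_on {0..1} F" "F 0 \<in> {0..<0 + 2 * pi}"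
    \<comment> \<open>The lift starts in the fundamental domain, so only the floor at its end
      counts.\<close>
    have z: "\<lfloor>F 0 / (2 * pi)\<rfloor> = 0" using F(2) by (simp add: floor_eq_iff field_simps)
    define m where "m = \<lfloor>F 1 / (2 * pi)\<rfloor>"
    have k: "winding 0 (lifted_simplex F) = (of_int m :: 'k)" by (simp add: winding_lifted_simplex[OF F(1)] z m_def)
    have 1: "Poly_Mapping.single (lifted_simplex F) 1 - Poly_Mapping.single (lifted_simplex (seg 0 (F 1))) 1
       + Poly_Mapping.single (lifted_simplex (seg 0 (F 0))) (1::'k) \<in> kboundaries (Suc 0) circle"
      by (rule cone_boundary[OF F(1)]) auto
    have 2: "Poly_Mapping.single (lifted_simplex (seg 0 (F 1))) 1 - Poly_Mapping.single (lifted_simplex (seg 0 (\<theta> (F 1)))) 1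
     - scale (of_int m) loop \<in> (kboundaries (Suc 0) circle :: ('k::field, complex) kchain set)"
      using seg_wind[of m "\<theta> (F 1)"] by (simp add: \<theta>_def m_def)
    have "\<theta> (F 0) = F 0" by (simp add: \<theta>_def z)
    then show "Poly_Mapping.single (lifted_simplex F) 1 - (p (cis (F 1)) - p (cis (F 0))) - scale (winding 0 (lifted_simplex F)) loop
       \<in> kboundaries (Suc 0) circle"
      using chain_subspaceD(2)[OF chain_subspace_kboundaries 1 2] by (simp add: p_def th k algebra_simps)
  qed
qed

section \<open>Homology classes\<close>

definition homology_class :: "nat \<Rightarrow> 'a topology \<Rightarrow> ('k::field, 'a) kchain \<Rightarrow> ('k, 'a) kchain set" where
  "homology_class p X z = {z + b | b. b \<in> kboundaries p X}"

lemma carrier_khomology: "carrier (khomology p X) = homology_class p X ` kcycles p X"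
  by (auto simp: khomology_def homology_class_def)

lemma homology_class_eq_iff: "homology_class p X z = homology_class p X w \<longleftrightarrow> z - w \<in> kboundaries p X"
proof
  assume "homology_class p X z = homology_class p X w"
  moreover have "z \<in> homology_class p X z" using chain_subspaceD(1)[OF chain_subspace_kboundaries] by (force simp: homology_class_def)
  ultimately obtain b where "z = w + b" "b \<in> kboundaries p X" by (auto simp: homology_class_def)
  then show "z - w \<in> kboundaries p X" by simp
next
  assume d: "z - w \<in> kboundaries p X"
  have "homology_class p X z \<subseteq> homology_class p X w" if "z - w \<in> kboundaries p X" for z w
  proof
    fix x assume "x \<in> homology_class p X z"
    then obtain b where b: "x = z + b" "b \<in> kboundaries p X" by (auto simp: homology_class_def)
    then have "x = w + ((z - w) + b)" by simp
    then show "x \<in> homology_class p X w" using chain_subspaceD(2)[OF chain_subspace_kboundaries that b(2)] unfolding homology_class_def by blast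
  qed
  moreover have "w - z \<in> kboundaries p X" using chain_subspaceD(4)[OF chain_subspace_kboundaries d] by simp
  ultimately show "homology_class p X z = homology_class p X w" using d by blast
qed

lemma add_khomology: "homology_class p X z \<oplus>\<^bsub>khomology p X\<^esub> homology_class p X w = homology_class p X (z + w)"
proof -
  have "{a + b | a b. a \<in> homology_class p X z \<and> b \<in> homology_class p X w} = homology_class p X (z + w)"
  proof (intro equalityI subsetI)
    fix x assume "x \<in> {a + b | a b. a \<in> homology_class p X z \<and> b \<in> homology_class p X w}"
    then obtain b c where "x = (z + b) + (w + c)" "b \<in> kboundaries p X" "c \<in> kboundaries p X"
      by (auto simp: homology_class_def)
    then show "x \<in> homology_class p X (z + w)"
      using chain_subspaceD(2)[OF chain_subspace_kboundaries] unfolding homology_class_def by (force simp: algebra_simps)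
  next
    fix x assume "x \<in> homology_class p X (z + w)"
    then obtain b where b: "x = (z + b) + (w + 0)" "b \<in> kboundaries p X" by (auto simp: homology_class_def algebra_simps)
    then show "x \<in> {a + b | a b. a \<in> homology_class p X z \<and> b \<in> homology_class p X w}"
      using chain_subspaceD(1)[OF chain_subspace_kboundaries] unfolding homology_class_def by blast
  qed
  then show ?thesis by (simp add: khomology_def)
qed

lemma smult_khomology: "r \<odot>\<^bsub>khomology p X\<^esub> homology_class p X z = homology_class p X (scale r z)"
proof -
  have "{scale r a + b | a b. a \<in> homology_class p X z \<and> b \<in> kboundaries p X} = homology_class p X (scale r z)"
  proof (intro equalityI subsetI)
    fix x assume "x \<in> {scale r a + b | a b. a \<in> homology_class p X z \<and> b \<in> kboundaries p X}"
    then obtain b c where bc: "x = scale r (z + b) + c" "b \<in> kboundaries p X" "c \<in> kboundaries p X"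
      by (auto simp: homology_class_def)
    then have "x = scale r z + (scale r b + c)" by (simp add: scale_add)
    then show "x \<in> homology_class p X (scale r z)"
      using chain_subspaceD(2)[OF chain_subspace_kboundaries chain_subspaceD(3)[OF chain_subspace_kboundaries bc(2)] bc(3)] unfolding homology_class_def by blast
  next
    fix x assume "x \<in> homology_class p X (scale r z)"
    then obtain b where b: "x = scale r (z + 0) + b" "b \<in> kboundaries p X" by (auto simp: homology_class_def)
    then show "x \<in> {scale r a + b | a b. a \<in> homology_class p X z \<and> b \<in> kboundaries p X}"
      using chain_subspaceD(1)[OF chain_subspace_kboundaries] unfolding homology_class_def by blast
  qed
  then show ?thesis by (simp add: khomology_def scale_def)
qed

definition sublevel_set :: "(complex \<Rightarrow> real) \<Rightarrow> real \<Rightarrow> complex set" where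
  "sublevel_set f x = {z \<in> sphere 0 1. f z \<le> x}"

lemma sublevel_sublevel_set: "sublevel f x = top_of_set (sublevel_set f x)"
proof -
  have "sphere 0 1 \<inter> {z. f z \<le> x} = sublevel_set f x" by (auto simp: sublevel_set_def)
  then show ?thesis by (simp add: sublevel_def subtopology_subtopology)
qed

lemma sublevel_set_mono: "x \<le> y \<Longrightarrow> sublevel_set f x \<subseteq> sublevel_set f y"
  by (auto simp: sublevel_set_def)

lemma sublevel_set_sphere: "sublevel_set f x \<subseteq> sphere 0 1"
  by (auto simp: sublevel_set_def)

lemma pmap_sublevel:
  assumes "x \<le> y"
  shows "pmap (sublevel_homology k f) x y (homology_class k (sublevel f x) z) = homology_class k (sublevel f y) z"
proof -
  have sub: "kboundaries k (sublevel f x) \<subseteq> kboundaries k (sublevel f y)"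
    unfolding sublevel_sublevel_set by (intro kboundaries_mono sublevel_set_mono assms)
  have "{a + b | a b. a \<in> homology_class k (sublevel f x) z \<and> b \<in> kboundaries k (sublevel f y)} = homology_class k (sublevel f y) z"
  proof (intro equalityI subsetI)
    fix u assume "u \<in> {a + b | a b. a \<in> homology_class k (sublevel f x) z \<and> b \<in> kboundaries k (sublevel f y)}"
    then obtain b c where "u = z + (b + c)" "b \<in> kboundaries k (sublevel f y)" "c \<in> kboundaries k (sublevel f y)"
      using sub by (auto simp: homology_class_def add.assoc)
    then show "u \<in> homology_class k (sublevel f y) z"
      using chain_subspaceD(2)[OF chain_subspace_kboundaries] unfolding homology_class_def by blast
  next
    fix u assume "u \<in> homology_class k (sublevel f y) z"
    then obtain b where "u = (z + 0) + b" "b \<in> kboundaries k (sublevel f y)" by (auto simp: homology_class_def)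
    then show "u \<in> {a + b | a b. a \<in> homology_class k (sublevel f x) z \<and> b \<in> kboundaries k (sublevel f y)}"
      using chain_subspaceD(1)[OF chain_subspace_kboundaries] unfolding homology_class_def by blast
  qed
  then show ?thesis by (simp add: sublevel_homology_def)
qed

lemma linear_iso_iff:
  "h \<in> linear_iso V W \<longleftrightarrow> bij_betw h (carrier V) (carrier W) \<and>
     (\<forall>x\<in>carrier V. \<forall>y\<in>carrier V. h (x \<oplus>\<^bsub>V\<^esub> y) = h x \<oplus>\<^bsub>W\<^esub> h y) \<and>
     (\<forall>r. \<forall>v\<in>carrier V. h (r \<odot>\<^bsub>V\<^esub> v) = r \<odot>\<^bsub>W\<^esub> h v)"
  by (auto simp: linear_iso_def iso_def hom_def bij_betw_def)

text \<open>Injectivity and surjectivity are checked modulo boundaries, so that no chain map in the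
  opposite direction has to be supplied.\<close>

lemma linear_iso_khomology:
  fixes T :: "('k::field, 'a) kchain \<Rightarrow> ('k, 'b) kchain"
  assumes lin: "\<And>a b. T (a + b) = T a + T b" "\<And>r a. T (scale r a) = scale r (T a)"
    and Z: "\<And>z. z \<in> kcycles p X \<Longrightarrow> T z \<in> kcycles p Y"
    and B: "\<And>z. z \<in> kboundaries p X \<Longrightarrow> T z \<in> kboundaries p Y"
    and inj: "\<And>z. z \<in> kcycles p X \<Longrightarrow> T z \<in> kboundaries p Y \<Longrightarrow> z \<in> kboundaries p X"
    and surj: "\<And>w. w \<in> kcycles p Y \<Longrightarrow> \<exists>z\<in>kcycles p X. w - T z \<in> kboundaries p Y"
  shows "\<exists>h\<in>linear_iso (khomology p X) (khomology p Y). \<forall>z. h (homology_class p X z) = homology_class p Y (T z)"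
proof -
  have diff: "T (a - b) = T a - T b" for a b
    using lin(1)[of "a - b" b] by (simp add: algebra_simps)
  define h where "h A = homology_class p Y (T (SOME z. A = homology_class p X z))" for A
  have h: "h (homology_class p X z) = homology_class p Y (T z)" for z
  proof -
    have "homology_class p X z = homology_class p X (SOME w. homology_class p X z = homology_class p X w)" by (rule someI) simp
    then have "(SOME w. homology_class p X z = homology_class p X w) - z \<in> kboundaries p X" by (metis homology_class_eq_iff)
    then show ?thesis unfolding h_def homology_class_eq_iff using B diff by metis
  qed
  have "bij_betw h (carrier (khomology p X)) (carrier (khomology p Y))"
    unfolding bij_betw_def carrier_khomology
  proof
    show "inj_on h (homology_class p X ` kcycles p X)"
    proof (clarsimp simp: inj_on_def h homology_class_eq_iff)
      fix z w assume "z \<in> kcycles p X" "w \<in> kcycles p X" "T z - T w \<in> kboundaries p Y"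
      then show "z - w \<in> kboundaries p X"
        using inj[of "z - w"] chain_subspaceD(5)[OF chain_subspace_kcycles] diff by metis
    qed
    show "h ` homology_class p X ` kcycles p X = homology_class p Y ` kcycles p Y"
    proof
      show "h ` homology_class p X ` kcycles p X \<subseteq> homology_class p Y ` kcycles p Y" using Z by (auto simp: h)
      show "homology_class p Y ` kcycles p Y \<subseteq> h ` homology_class p X ` kcycles p X"
      proof clarify
        fix w :: "('k, 'b) kchain" assume "w \<in> kcycles p Y"
        then obtain z where "z \<in> kcycles p X" "w - T z \<in> kboundaries p Y" using surj by blast
        then show "homology_class p Y w \<in> h ` homology_class p X ` kcycles p X"
          by (auto simp: image_image h homology_class_eq_iff)
      qed
    qed
  qed
  then have "h \<in> linear_iso (khomology p X) (khomology p Y)"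
    unfolding linear_iso_iff carrier_khomology
    by (auto simp: add_khomology smult_khomology h lin)
  then show ?thesis using h by blast
qed

lemma pers_isomorphic_trans:
  assumes "pers_isomorphic M N" "pers_isomorphic N P"
  shows "pers_isomorphic M P"
proof -
  obtain \<theta> where \<theta>: "\<And>x. \<theta> x \<in> linear_iso (pspace M x) (pspace N x)"
     "\<And>x y v. x \<le> y \<Longrightarrow> v \<in> carrier (pspace M x) \<Longrightarrow> \<theta> y (pmap M x y v) = pmap N x y (\<theta> x v)"
    using assms(1) unfolding pers_isomorphic_def by blast
  obtain \<eta> where \<eta>: "\<And>x. \<eta> x \<in> linear_iso (pspace N x) (pspace P x)"
     "\<And>x y v. x \<le> y \<Longrightarrow> v \<in> carrier (pspace N x) \<Longrightarrow> \<eta> y (pmap N x y v) = pmap P x y (\<eta> x v)"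
    using assms(2) unfolding pers_isomorphic_def by blast
  have c: "\<theta> x v \<in> carrier (pspace N x)" if "v \<in> carrier (pspace M x)" for x v
    using \<theta>(1)[of x] that by (auto simp: linear_iso_iff bij_betw_def)
  have "\<eta> x \<circ> \<theta> x \<in> linear_iso (pspace M x) (pspace P x)" for x
    using \<theta>(1)[of x] \<eta>(1)[of x] c by (auto simp: linear_iso_iff intro: bij_betw_trans)
  then show ?thesis
    unfolding pers_isomorphic_def using \<theta>(2) \<eta>(2) c by (intro exI[of _ "\<lambda>x. \<eta> x \<circ> \<theta> x"]) auto
qed

text \<open>Inverting the maps requires carriers closed under the operations and under
  \<open>pmap\<close>. Arbitrary records do not guarantee this, sublevel homology does; hence one
  side is fixed.\<close>

lemma pers_isomorphic_sublevel_sym: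
  assumes "pers_isomorphic (sublevel_homology k f) N"
  shows "pers_isomorphic N (sublevel_homology k f)"
proof -
  let ?M = "sublevel_homology k f"
  obtain \<theta> where \<theta>: "\<And>x. \<theta> x \<in> linear_iso (pspace ?M x) (pspace N x)"
     "\<And>x y v. x \<le> y \<Longrightarrow> v \<in> carrier (pspace ?M x) \<Longrightarrow> \<theta> y (pmap ?M x y v) = pmap N x y (\<theta> x v)"
    using assms(1) unfolding pers_isomorphic_def by blast
  have lifted_simplex: "pspace ?M x = khomology k (sublevel f x)" for x by (simp add: sublevel_homology_def)
  define \<eta> where "\<eta> x = inv_into (carrier (pspace ?M x)) (\<theta> x)" for x
  have bij: "bij_betw (\<theta> x) (carrier (pspace ?M x)) (carrier (pspace N x))" for x
    using \<theta>(1)[of x] by (simp add: linear_iso_iff)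
  have inv: "\<eta> x (\<theta> x v) = v" if "v \<in> carrier (pspace ?M x)" for x v
    unfolding \<eta>_def using bij that by (meson bij_betw_inv_into_left)
  have ex: "\<exists>v\<in>carrier (pspace ?M x). w = \<theta> x v" if "w \<in> carrier (pspace N x)" for x w
    using bij[of x] that unfolding bij_betw_def by blast
  have closed: "a \<oplus>\<^bsub>pspace ?M x\<^esub> b \<in> carrier (pspace ?M x)" "r \<odot>\<^bsub>pspace ?M x\<^esub> a \<in> carrier (pspace ?M x)"
    if "a \<in> carrier (pspace ?M x)" "b \<in> carrier (pspace ?M x)" for a b r x
    using that chain_subspaceD(2,3)[OF chain_subspace_kcycles] unfolding lifted_simplex carrier_khomology
    by (auto simp: add_khomology smult_khomology intro!: imageI)
  have pm: "pmap ?M x y v \<in> carrier (pspace ?M y)" if v: "v \<in> carrier (pspace ?M x)" and xy: "x \<le> y" for x y v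
  proof -
    obtain z where z: "v = homology_class k (sublevel f x) z" "z \<in> kcycles k (sublevel f x)"
      using v unfolding lifted_simplex carrier_khomology by blast
    have "z \<in> kcycles k (sublevel f y)"
      using z(2) kcycles_mono[OF sublevel_set_mono[OF xy]] unfolding sublevel_sublevel_set by blast
    then show ?thesis unfolding z(1) pmap_sublevel[OF xy] lifted_simplex carrier_khomology by blast
  qed
  have "\<eta> x \<in> linear_iso (pspace N x) (pspace ?M x)" for x
    unfolding linear_iso_iff
  proof (intro conjI ballI allI)
    show "bij_betw (\<eta> x) (carrier (pspace N x)) (carrier (pspace ?M x))"
      unfolding \<eta>_def using bij by (rule bij_betw_inv_into)
  next
    fix a b assume "a \<in> carrier (pspace N x)" "b \<in> carrier (pspace N x)"
    then obtain a' b' where ab: "a' \<in> carrier (pspace ?M x)" "a = \<theta> x a'" "b' \<in> carrier (pspace ?M x)" "b = \<theta> x b'"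
      using ex by meson
    have "a \<oplus>\<^bsub>pspace N x\<^esub> b = \<theta> x (a' \<oplus>\<^bsub>pspace ?M x\<^esub> b')"
      using \<theta>(1)[of x] ab unfolding linear_iso_iff by metis
    then show "\<eta> x (a \<oplus>\<^bsub>pspace N x\<^esub> b) = \<eta> x a \<oplus>\<^bsub>pspace ?M x\<^esub> \<eta> x b"
      using ab inv closed by metis
  next
    fix r a assume "a \<in> carrier (pspace N x)"
    then obtain a' where ab: "a' \<in> carrier (pspace ?M x)" "a = \<theta> x a'" using ex by meson
    have "r \<odot>\<^bsub>pspace N x\<^esub> a = \<theta> x (r \<odot>\<^bsub>pspace ?M x\<^esub> a')"
      using \<theta>(1)[of x] ab unfolding linear_iso_iff by metis
    then show "\<eta> x (r \<odot>\<^bsub>pspace N x\<^esub> a) = r \<odot>\<^bsub>pspace ?M x\<^esub> \<eta> x a"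
      using ab inv closed by metis
  qed
  moreover have "\<eta> y (pmap N x y w) = pmap ?M x y (\<eta> x w)" if xy: "x \<le> y" and w: "w \<in> carrier (pspace N x)" for x y w
  proof -
    obtain v where v: "v \<in> carrier (pspace ?M x)" "w = \<theta> x v" using ex[OF w] by blast
    then have "pmap N x y w = \<theta> y (pmap ?M x y v)" using \<theta>(2)[OF xy v(1)] by simp
    then show ?thesis using inv pm[OF v(1) xy] v by metis
  qed
  ultimately show ?thesis unfolding pers_isomorphic_def by blast
qed

section \<open>Coordinates with respect to a barcode\<close>

definition bars :: "(real \<times> ereal) multiset \<Rightarrow> ((real \<times> ereal) \<times> nat) set" where
  "bars D = {(I, j). j < count D I}"

lemma bars_Sigma: "bars D = (SIGMA I:set_mset D. {..<count D I})"
  by (auto simp: bars_def) (metis count_inI not_less0)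

lemma finite_bars: "finite (bars D)"
  unfolding bars_Sigma by auto

lemma card_bars: "card (bars D) = size D"
  unfolding bars_Sigma by (simp add: size_multiset_overloaded_eq)

text \<open>An isomorphism onto the barcode module, transported to cycles:
  \<open>\<tau> x z j\<close> is the component along bar \<open>j\<close> of the class of
  \<open>z\<close> in the sublevel set at \<open>x\<close>. Later arguments then handle cycles and
  field elements in place of cosets and extensional functions.\<close>

definition coordinates :: "nat \<Rightarrow> (complex \<Rightarrow> real) \<Rightarrow> (real \<times> ereal) multiset \<Rightarrow>
    (real \<Rightarrow> ('k::field, complex) kchain \<Rightarrow> (real \<times> ereal) \<times> nat \<Rightarrow> 'k) \<Rightarrow> bool" where
  "coordinates k f D \<tau> \<longleftrightarrow>
     (\<forall>x. \<forall>z\<in>kcycles k (sublevel f x). \<forall>w\<in>kcycles k (sublevel f x). \<forall>j\<in>bars D. \<tau> x (z + w) j = \<tau> x z j + \<tau> x w j) \<and>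
     (\<forall>x r. \<forall>z\<in>kcycles k (sublevel f x). \<forall>j\<in>bars D. \<tau> x (scale r z) j = r * \<tau> x z j) \<and>
     (\<forall>x. \<forall>z\<in>kcycles k (sublevel f x). (\<forall>j\<in>bars D. \<tau> x z j = 0) \<longleftrightarrow> z \<in> kboundaries k (sublevel f x)) \<and>
     (\<forall>x. \<forall>z\<in>kcycles k (sublevel f x). \<forall>j\<in>bars D. \<not> in_bar (fst j) x \<longrightarrow> \<tau> x z j = 0) \<and>
     (\<forall>x v. (\<forall>j\<in>bars D. \<not> in_bar (fst j) x \<longrightarrow> v j = 0) \<longrightarrow> (\<exists>z\<in>kcycles k (sublevel f x). \<forall>j\<in>bars D. \<tau> x z j = v j)) \<and>
     (\<forall>x y. x \<le> y \<longrightarrow> (\<forall>z\<in>kcycles k (sublevel f x). \<forall>j\<in>bars D.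
       \<tau> y z j = (if in_bar (fst j) x \<and> in_bar (fst j) y then \<tau> x z j else 0)))"

lemma coordinatesD:
  fixes \<tau> :: "real \<Rightarrow> ('k::field, complex) kchain \<Rightarrow> (real \<times> ereal) \<times> nat \<Rightarrow> 'k"
  assumes "coordinates k f D \<tau>"
  shows
    "\<And>x z w j. z \<in> kcycles k (sublevel f x) \<Longrightarrow> w \<in> kcycles k (sublevel f x) \<Longrightarrow> j \<in> bars D \<Longrightarrow> \<tau> x (z + w) j = \<tau> x z j + \<tau> x w j"
    and "\<And>x z r j. z \<in> kcycles k (sublevel f x) \<Longrightarrow> j \<in> bars D \<Longrightarrow> \<tau> x (scale r z) j = r * \<tau> x z j"
    and "\<And>x z. z \<in> kcycles k (sublevel f x) \<Longrightarrow> (\<forall>j\<in>bars D. \<tau> x z j = 0) \<longleftrightarrow> z \<in> kboundaries k (sublevel f x)"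
    and "\<And>x z j. z \<in> kcycles k (sublevel f x) \<Longrightarrow> j \<in> bars D \<Longrightarrow> \<not> in_bar (fst j) x \<Longrightarrow> \<tau> x z j = 0"
    and "\<And>x v. (\<And>j. j \<in> bars D \<Longrightarrow> \<not> in_bar (fst j) x \<Longrightarrow> v j = 0) \<Longrightarrow> \<exists>z\<in>kcycles k (sublevel f x). \<forall>j\<in>bars D. \<tau> x z j = v j"
    and "\<And>x y z j. x \<le> y \<Longrightarrow> z \<in> kcycles k (sublevel f x) \<Longrightarrow> j \<in> bars D \<Longrightarrow>
       \<tau> y z j = (if in_bar (fst j) x \<and> in_bar (fst j) y then \<tau> x z j else 0)"
proof -
  note c = assms[unfolded coordinates_def]
  note c2 = c[THEN conjunct2] note c3 = c2[THEN conjunct2] note c4 = c3[THEN conjunct2]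
  note c5 = c4[THEN conjunct2]
  show "\<And>x z w j. z \<in> kcycles k (sublevel f x) \<Longrightarrow> w \<in> kcycles k (sublevel f x) \<Longrightarrow> j \<in> bars D \<Longrightarrow> \<tau> x (z + w) j = \<tau> x z j + \<tau> x w j"
    by (rule c[THEN conjunct1, rule_format])
  show "\<And>x z r j. z \<in> kcycles k (sublevel f x) \<Longrightarrow> j \<in> bars D \<Longrightarrow> \<tau> x (scale r z) j = r * \<tau> x z j"
    by (rule c2[THEN conjunct1, rule_format])
  show "\<And>x z. z \<in> kcycles k (sublevel f x) \<Longrightarrow> (\<forall>j\<in>bars D. \<tau> x z j = 0) \<longleftrightarrow> z \<in> kboundaries k (sublevel f x)"
    by (rule c3[THEN conjunct1, THEN spec, THEN bspec])
  show "\<And>x z j. z \<in> kcycles k (sublevel f x) \<Longrightarrow> j \<in> bars D \<Longrightarrow> \<not> in_bar (fst j) x \<Longrightarrow> \<tau> x z j = 0"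
    by (rule c4[THEN conjunct1, rule_format])
  show "\<And>x v. (\<And>j. j \<in> bars D \<Longrightarrow> \<not> in_bar (fst j) x \<Longrightarrow> v j = 0) \<Longrightarrow> \<exists>z\<in>kcycles k (sublevel f x). \<forall>j\<in>bars D. \<tau> x z j = v j"
    by (rule c5[THEN conjunct1, rule_format])
  show "\<And>x y z j. x \<le> y \<Longrightarrow> z \<in> kcycles k (sublevel f x) \<Longrightarrow> j \<in> bars D \<Longrightarrow>
       \<tau> y z j = (if in_bar (fst j) x \<and> in_bar (fst j) y then \<tau> x z j else 0)"
    by (rule c5[THEN conjunct2, rule_format])
qed

lemma has_PH_coordinates:
  fixes K :: "'k::field itself"
  assumes "has_PH K k f D"
  obtains \<tau> :: "real \<Rightarrow> ('k, complex) kchain \<Rightarrow> (real \<times> ereal) \<times> nat \<Rightarrow> 'k" where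
    "coordinates k f D \<tau>"
proof -
  let ?M = "sublevel_homology k f :: ('k, ('k, complex) kchain set) pers_module"
  let ?N = "barcode_module D :: ('k, (real \<times> ereal) \<times> nat \<Rightarrow> 'k) pers_module"
  obtain \<theta> where \<theta>: "\<And>x. \<theta> x \<in> linear_iso (pspace ?M x) (pspace ?N x)"
     "\<And>x y v. x \<le> y \<Longrightarrow> v \<in> carrier (pspace ?M x) \<Longrightarrow> \<theta> y (pmap ?M x y v) = pmap ?N x y (\<theta> x v)"
    using assms(1) unfolding has_PH_def pers_isomorphic_def by blast
  have spM: "pspace ?M x = khomology k (sublevel f x)" for x by (simp add: sublevel_homology_def)
  have int: "case j of (I, i) \<Rightarrow> interval_module I = interval_module (fst j)" for j :: "(real \<times> ereal) \<times> nat"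
    by (cases j) auto
  have car: "carrier (pspace ?N x) = {v \<in> extensional (bars D). \<forall>j\<in>bars D. \<not> in_bar (fst j) x \<longrightarrow> v j = 0}" for x
  proof -
    have "finite {j \<in> bars D. P j}" for P using finite_bars by (rule rev_finite_subset) auto
    then show ?thesis
      by (auto simp: barcode_module_def pers_sum_def interval_module_def PiE_iff case_prod_beta bars_def[symmetric] split: if_splits)
  qed
  have addN: "(v \<oplus>\<^bsub>pspace ?N x\<^esub> w) j = v j + w j" if "j \<in> bars D" for v w x j
    using that by (simp add: barcode_module_def pers_sum_def interval_module_def case_prod_beta bars_def[symmetric])
  have smultN: "(r \<odot>\<^bsub>pspace ?N x\<^esub> v) j = r * v j" if "j \<in> bars D" for v r x j
    using that by (simp add: barcode_module_def pers_sum_def interval_module_def case_prod_beta bars_def[symmetric])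
  have pmapN: "(pmap ?N x y v) j = (if in_bar (fst j) x \<and> in_bar (fst j) y then v j else 0)" if "j \<in> bars D" for v x y j
    using that by (simp add: barcode_module_def pers_sum_def interval_module_def case_prod_beta bars_def[symmetric])
  define \<tau> where "\<tau> x z = \<theta> x (homology_class k (sublevel f x) z)" for x z
  have bij: "bij_betw (\<theta> x) (carrier (pspace ?M x)) (carrier (pspace ?N x))" for x
    using \<theta>(1)[of x] by (simp add: linear_iso_iff)
  have cM: "homology_class k (sublevel f x) z \<in> carrier (pspace ?M x)" if "z \<in> kcycles k (sublevel f x)" for x z
    using that by (simp add: spM carrier_khomology)
  have cN: "\<tau> x z \<in> carrier (pspace ?N x)" if "z \<in> kcycles k (sublevel f x)" for x z
    unfolding \<tau>_def using bij cM[OF that] by (meson bij_betw_apply)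
  have t1: "\<tau> x (z + w) j = \<tau> x z j + \<tau> x w j"
    if "z \<in> kcycles k (sublevel f x)" "w \<in> kcycles k (sublevel f x)" "j \<in> bars D" for x z w j
  proof -
    have "\<tau> x (z + w) = \<theta> x (homology_class k (sublevel f x) z \<oplus>\<^bsub>pspace ?M x\<^esub> homology_class k (sublevel f x) w)"
      by (simp add: \<tau>_def spM add_khomology)
    also have "\<dots> = \<tau> x z \<oplus>\<^bsub>pspace ?N x\<^esub> \<tau> x w"
      unfolding \<tau>_def using \<theta>(1)[of x] cM[OF that(1)] cM[OF that(2)] by (simp add: linear_iso_iff)
    finally show ?thesis by (simp add: addN that)
  qed
  have t2: "\<tau> x (scale r z) j = r * \<tau> x z j"
    if "z \<in> kcycles k (sublevel f x)" "j \<in> bars D" for x z r j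
  proof -
    have "\<tau> x (scale r z) = \<theta> x (r \<odot>\<^bsub>pspace ?M x\<^esub> homology_class k (sublevel f x) z)"
      by (simp add: \<tau>_def spM smult_khomology)
    also have "\<dots> = r \<odot>\<^bsub>pspace ?N x\<^esub> \<tau> x z"
      unfolding \<tau>_def using \<theta>(1)[of x] cM[OF that(1)] by (simp add: linear_iso_iff)
    finally show ?thesis by (simp add: smultN that)
  qed
  show ?thesis
  proof (rule that[of \<tau>], unfold coordinates_def, intro conjI allI ballI impI)
    show "\<tau> x (z + w) j = \<tau> x z j + \<tau> x w j"
      if "z \<in> kcycles k (sublevel f x)" "w \<in> kcycles k (sublevel f x)" "j \<in> bars D" for x z w j
      using t1 that by blast
    show "\<tau> x (scale r z) j = r * \<tau> x z j"
      if "z \<in> kcycles k (sublevel f x)" "j \<in> bars D" for x z r j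
      using t2 that by blast
    show "(\<forall>j\<in>bars D. \<tau> x z j = 0) \<longleftrightarrow> z \<in> kboundaries k (sublevel f x)" if z: "z \<in> kcycles k (sublevel f x)" for x z
    proof -
      have z0: "0 \<in> kcycles k (sublevel f x)" by (rule chain_subspaceD(1)[OF chain_subspace_kcycles])
      have t0: "\<tau> x 0 j = 0" if "j \<in> bars D" for j
        using t2[OF z0 that, of 0] by simp
      have ext: "\<tau> x z \<in> extensional (bars D)" "\<tau> x 0 \<in> extensional (bars D)"
        using cN[OF z] cN[OF z0] unfolding car by simp_all
      have "(\<forall>j\<in>bars D. \<tau> x z j = 0) \<longleftrightarrow> \<tau> x z = \<tau> x 0"
      proof
        assume "\<forall>j\<in>bars D. \<tau> x z j = 0"
        then show "\<tau> x z = \<tau> x 0" using t0 by (intro extensionalityI[OF ext]) simp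
      qed (use t0 in simp)
      also have "\<dots> \<longleftrightarrow> homology_class k (sublevel f x) z = homology_class k (sublevel f x) 0"
        unfolding \<tau>_def by (rule inj_on_eq_iff[OF bij_betw_imp_inj_on[OF bij] cM[OF z] cM[OF z0]])
      also have "\<dots> \<longleftrightarrow> z \<in> kboundaries k (sublevel f x)" by (simp add: homology_class_eq_iff)
      finally show ?thesis .
    qed
    show "\<tau> x z j = 0" if "z \<in> kcycles k (sublevel f x)" "j \<in> bars D" "\<not> in_bar (fst j) x" for x z j
      using cN[OF that(1)] that(2,3) unfolding car by blast
    show "\<exists>z\<in>kcycles k (sublevel f x). \<forall>j\<in>bars D. \<tau> x z j = v j"
      if v: "\<forall>j\<in>bars D. \<not> in_bar (fst j) x \<longrightarrow> v j = 0" for x v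
    proof -
      have "restrict v (bars D) \<in> carrier (pspace ?N x)" using v unfolding car by auto
      then obtain A where A: "A \<in> carrier (pspace ?M x)" "restrict v (bars D) = \<theta> x A"
        using bij[of x] unfolding bij_betw_def by blast
      then obtain z where z: "z \<in> kcycles k (sublevel f x)" "A = homology_class k (sublevel f x) z"
        unfolding spM carrier_khomology by blast
      have "\<forall>j\<in>bars D. \<tau> x z j = v j"
        unfolding \<tau>_def z(2)[symmetric] A(2)[symmetric] by simp
      then show ?thesis using z(1) by blast
    qed
    show "\<tau> y z j = (if in_bar (fst j) x \<and> in_bar (fst j) y then \<tau> x z j else 0)"
      if "x \<le> y" "z \<in> kcycles k (sublevel f x)" "j \<in> bars D" for x y z j
      using \<theta>(2)[OF that(1) cM[OF that(2)]] pmapN[OF that(3)]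
      by (simp add: pmap_sublevel[OF that(1)] \<tau>_def)
  qed
qed

lemma in_bar_no_endpoint:
  assumes "x \<le> y" "\<And>b d. (b, d) \<in># D \<Longrightarrow> \<not> (x < b \<and> b \<le> y) \<and> \<not> (ereal x < d \<and> d \<le> ereal y)" "j \<in> bars D"
  shows "in_bar (fst j) x \<longleftrightarrow> in_bar (fst j) y"
proof -
  obtain b d i where j: "j = ((b, d), i)" by (metis surj_pair)
  then have "(b, d) \<in># D" using assms(3) by (auto simp: bars_Sigma)
  from assms(2)[OF this] have n: "\<not> (x < b \<and> b \<le> y)" "\<not> (ereal x < d \<and> d \<le> ereal y)" by auto
  have "ereal x \<le> ereal y" using assms(1) by simp
  then have "b \<le> x \<longleftrightarrow> b \<le> y" "ereal x < d \<longleftrightarrow> ereal y < d"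
    using n assms(1) by (linarith, meson le_less_trans not_le)
  then show ?thesis unfolding j in_bar_def by simp
qed

text \<open>The same bars are alive at \<open>x\<close> and at \<open>y\<close>, so the inclusion
  induces an isomorphism; its surjectivity and injectivity are stated for cycles. The excluded range
  is open at \<open>x\<close> and closed at \<open>y\<close> because bars contain their birth but
  not their death.\<close>

lemma has_PH_stable:
  fixes K :: "'k::field itself"
  assumes "has_PH K k f D" "x \<le> y"
    "\<And>b d. (b, d) \<in># D \<Longrightarrow> \<not> (x < b \<and> b \<le> y) \<and> \<not> (ereal x < d \<and> d \<le> ereal y)"
  shows "\<And>w :: ('k, complex) kchain. w \<in> kcycles k (sublevel f y) \<Longrightarrow> \<exists>z\<in>kcycles k (sublevel f x). w - z \<in> kboundaries k (sublevel f y)"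
    and "\<And>z :: ('k, complex) kchain. z \<in> kcycles k (sublevel f x) \<Longrightarrow> z \<in> kboundaries k (sublevel f y) \<Longrightarrow> z \<in> kboundaries k (sublevel f x)"
proof -
  obtain \<tau> :: "real \<Rightarrow> ('k, complex) kchain \<Rightarrow> (real \<times> ereal) \<times> nat \<Rightarrow> 'k" where "coordinates k f D \<tau>"
    using has_PH_coordinates[OF assms(1)] by blast
  note t = coordinatesD[OF this]
  have ib: "in_bar (fst j) x \<longleftrightarrow> in_bar (fst j) y" if "j \<in> bars D" for j
    using in_bar_no_endpoint[OF assms(2,3) that] by blast
  have xy: "\<tau> y z j = \<tau> x z j" if "z \<in> kcycles k (sublevel f x)" "j \<in> bars D" for z j
    using t(6)[OF assms(2) that] t(4)[OF that] ib[OF that(2)] by auto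
  have sub: "kcycles k (sublevel f x) \<subseteq> (kcycles k (sublevel f y) :: ('k, complex) kchain set)"
    unfolding sublevel_sublevel_set by (intro kcycles_mono sublevel_set_mono assms)
  show "\<exists>z\<in>kcycles k (sublevel f x). w - z \<in> kboundaries k (sublevel f y)" if w: "w \<in> kcycles k (sublevel f y)" for w :: "('k, complex) kchain"
  proof -
    have "\<tau> y w j = 0" if "j \<in> bars D" "\<not> in_bar (fst j) x" for j using t(4)[OF w that(1)] ib that by blast
    then obtain z where z: "z \<in> kcycles k (sublevel f x)" "\<forall>j\<in>bars D. \<tau> x z j = \<tau> y w j" using t(5)[of x "\<tau> y w"] by blast
    have zy: "z \<in> kcycles k (sublevel f y)" using z(1) sub by blast
    have d: "w - z = w + scale (-1) z" by (simp add: scale_minus_one)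
    have "\<tau> y (w - z) j = 0" if "j \<in> bars D" for j
      unfolding d using t(1)[OF w chain_subspaceD(3)[OF chain_subspace_kcycles zy] that] t(2)[OF zy that] xy[OF z(1) that] z(2) that by simp
    then show ?thesis using t(3)[OF chain_subspaceD(5)[OF chain_subspace_kcycles w zy]] z(1) by blast
  qed
  show "z \<in> kboundaries k (sublevel f x)" if z: "z \<in> kcycles k (sublevel f x)" "z \<in> kboundaries k (sublevel f y)" for z :: "('k, complex) kchain"
  proof -
    have zy: "z \<in> kcycles k (sublevel f y)" using z(1) sub by blast
    have "\<forall>j\<in>bars D. \<tau> x z j = 0" using t(3)[OF zy] z(2) xy[OF z(1)] by simp
    then show ?thesis using t(3)[OF z(1)] by blast
  qed
qed

text \<open>Gaussian elimination: the equation \<open>j0\<close> removes the unknown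
  \<open>i0\<close>, \<open>M'\<close> is the remaining matrix, and \<open>s\<close> gives
  \<open>i0\<close> the value that solves \<open>j0\<close>.\<close>

lemma homogeneous_system:
  fixes M :: "'i \<Rightarrow> 'j \<Rightarrow> 'k::field"
  assumes "finite J" "finite I" "card J < card I"
  shows "\<exists>r. (\<exists>i\<in>I. r i \<noteq> 0) \<and> (\<forall>j\<in>J. (\<Sum>i\<in>I. r i * M i j) = 0)"
  using assms
proof (induction J arbitrary: I M rule: finite_induct)
  case empty
  then have "I \<noteq> {}" by auto
  then show ?case by (intro exI[of _ "\<lambda>_. 1"]) auto
next
  case (insert j0 J)
  show ?case
  proof (cases "\<forall>i\<in>I. M i j0 = 0")
    case True
    have "card J < card I" using insert by simp
    then obtain r where "\<exists>i\<in>I. r i \<noteq> 0" "\<forall>j\<in>J. (\<Sum>i\<in>I. r i * M i j) = 0"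
      using insert.IH insert.prems(1) by blast
    then show ?thesis using True by (intro exI[of _ r]) auto
  next
    case False
    then obtain i0 where i0: "i0 \<in> I" "M i0 j0 \<noteq> 0" by blast
    define M' where "M' i j = M i j - M i j0 / M i0 j0 * M i0 j" for i j
    have "card J < card (I - {i0})" using insert i0 by simp
    then obtain r where r: "\<exists>i\<in>I - {i0}. r i \<noteq> 0" "\<forall>j\<in>J. (\<Sum>i\<in>I - {i0}. r i * M' i j) = 0"
      using insert.IH[of "I - {i0}" M'] insert.prems(1) by auto
    define s where "s i = (if i = i0 then - (\<Sum>i\<in>I - {i0}. r i * M i j0) / M i0 j0 else r i)" for i
    have sum: "(\<Sum>i\<in>I. s i * M i j) = s i0 * M i0 j + (\<Sum>i\<in>I - {i0}. r i * M i j)" for j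
      using i0 insert.prems(1) by (subst sum.remove[of I i0]) (auto simp: s_def)
    have "(\<Sum>i\<in>I. s i * M i j) = 0" if "j \<in> J" for j
    proof -
      have "0 = (\<Sum>i\<in>I - {i0}. r i * M' i j)" using r(2) that by simp
      also have "\<dots> = (\<Sum>i\<in>I - {i0}. r i * M i j) - (\<Sum>i\<in>I - {i0}. r i * M i j0) / M i0 j0 * M i0 j"
        by (simp add: M'_def right_diff_distrib sum_subtractf sum_distrib_right sum_divide_distrib mult.assoc)
      finally show ?thesis unfolding sum by (simp add: s_def)
    qed
    moreover have "(\<Sum>i\<in>I. s i * M i j0) = 0" unfolding sum using i0 by (simp add: s_def)
    moreover have "\<exists>i\<in>I. s i \<noteq> 0" using r(1) by (auto simp: s_def)
    ultimately show ?thesis by (intro exI[of _ s]) auto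
  qed
qed

section \<open>What the barcode says about sublevel sets\<close>

lemma kcycles_0: "kcycles 0 X = kchains 0 X"
  by (simp add: kcycles_def)

lemma point_simplex_chain: "z \<in> sublevel_set f x \<Longrightarrow> Poly_Mapping.single (point_simplex z) r \<in> kcycles 0 (sublevel f x)"
  unfolding sublevel_sublevel_set kcycles_0 by (intro kchains_single) (simp add: singular_simplex_point_simplex)

text \<open>Points in different components have independent classes in degree 0, and the dimension
  is at most the number of bars. Independence holds because the indicator of the component of
  \<open>z i\<close> extracts the coefficient \<open>r i\<close> from a relation.\<close>

lemma has_PH_card_components:
  fixes K :: "'k::field itself"
  assumes "has_PH K 0 f D" "finite I" "\<And>i. i \<in> I \<Longrightarrow> z i \<in> sublevel_set f x"
    and nc: "\<And>i j. i \<in> I \<Longrightarrow> j \<in> I \<Longrightarrow> i \<noteq> j \<Longrightarrow> \<not> arc_connected (sublevel_set f x) (z i) (z j)"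
  shows "card I \<le> size D"
proof (rule ccontr)
  assume "\<not> card I \<le> size D"
  then have card: "card (bars D) < card I" by (simp add: card_bars)
  obtain \<tau> :: "real \<Rightarrow> ('k, complex) kchain \<Rightarrow> (real \<times> ereal) \<times> nat \<Rightarrow> 'k" where "coordinates 0 f D \<tau>"
    using has_PH_coordinates[OF assms(1)] by blast
  note t = coordinatesD[OF this]
  let ?p = "\<lambda>i. Poly_Mapping.single (point_simplex (z i)) (1::'k)"
  have p: "?p i \<in> kcycles 0 (sublevel f x)" if "i \<in> I" for i using point_simplex_chain assms(3) that by blast
  obtain r where r: "\<exists>i\<in>I. r i \<noteq> 0" "\<forall>j\<in>bars D. (\<Sum>i\<in>I. r i * \<tau> x (?p i) j) = 0"
    using homogeneous_system[OF finite_bars assms(2) card, of "\<lambda>i. \<tau> x (?p i)"] by blast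
  have tsum: "\<tau> x (\<Sum>i\<in>A. scale (r i) (?p i)) j = (\<Sum>i\<in>A. r i * \<tau> x (?p i) j)" if "A \<subseteq> I" and j: "j \<in> bars D" for A j
    using finite_subset[OF that(1) assms(2)] that(1)
  proof (induction A rule: finite_induct)
    case empty
    show ?case using t(2)[OF chain_subspaceD(1)[OF chain_subspace_kcycles] j, of x 0] by simp
  next
    case (insert a A)
    have 1: "(\<Sum>i\<in>A. scale (r i) (?p i)) \<in> kcycles 0 (sublevel f x)"
      using insert.prems p by (intro chain_subspace_sum[OF chain_subspace_kcycles] chain_subspaceD(3)[OF chain_subspace_kcycles]) blast
    have 2: "scale (r a) (?p a) \<in> kcycles 0 (sublevel f x)"
      using insert.prems p by (intro chain_subspaceD(3)[OF chain_subspace_kcycles]) blast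
    have "a \<in> I" "A \<subseteq> I" using insert.prems by auto
    then show ?case
      by (simp only: sum.insert[OF insert.hyps] t(1)[OF 2 1 j] t(2)[OF p j] insert.IH)
  qed
  let ?c = "\<Sum>i\<in>I. scale (r i) (?p i)"
  have cc: "?c \<in> kcycles 0 (sublevel f x)"
    using p by (intro chain_subspace_sum[OF chain_subspace_kcycles] chain_subspaceD(3)[OF chain_subspace_kcycles])
  have "\<forall>j\<in>bars D. \<tau> x ?c j = 0" using tsum[OF order_refl] r(2) by presburger
  then have c: "?c \<in> kboundaries 0 (top_of_set (sublevel_set f x))"
    using t(3)[OF cc] unfolding sublevel_sublevel_set by blast
  have "r i = 0" if i: "i \<in> I" for i
  proof -
    let ?P = "{w. arc_connected (sublevel_set f x) (z i) w}"
    have "z i \<in> ?P" using arc_connected_refl assms(3)[OF i] sublevel_set_sphere by blast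
    moreover have "z j \<notin> ?P" if "j \<in> I" "j \<noteq> i" for j using nc i that by auto
    ultimately have "fext (indic ?P) ?c = (\<Sum>j\<in>I. if j = i then r i else 0)"
      unfolding fext_sum by (intro sum.cong) (auto simp: fext_scale)
    moreover have "fext (indic ?P) ?c = 0"
      by (rule indic_boundary[OF sublevel_set_sphere c]) (use arc_connected_trans arc_connected_sym in blast)
    ultimately show ?thesis using i assms(2) by simp
  qed
  then show False using r(1) by blast
qed

text \<open>Read in terms of components, the isomorphism in degree 0 says that between the two
  levels no component is born and no two merge.\<close>

lemma has_PH_0_stable:
  fixes K :: "'k::field itself"
  assumes "has_PH K 0 f D" "x \<le> y"
    "\<And>b d. (b, d) \<in># D \<Longrightarrow> \<not> (x < b \<and> b \<le> y) \<and> \<not> (ereal x < d \<and> d \<le> ereal y)"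
  shows "\<And>p. p \<in> sublevel_set f y \<Longrightarrow> \<exists>q\<in>sublevel_set f x. arc_connected (sublevel_set f y) p q"
    and "\<And>p q. p \<in> sublevel_set f x \<Longrightarrow> q \<in> sublevel_set f x \<Longrightarrow> arc_connected (sublevel_set f y) p q \<Longrightarrow> arc_connected (sublevel_set f x) p q"
proof -
  show "\<exists>q\<in>sublevel_set f x. arc_connected (sublevel_set f y) p q" if p: "p \<in> sublevel_set f y" for p
  proof (rule ccontr)
    assume n: "\<not> ?thesis"
    let ?P = "{w. arc_connected (sublevel_set f y) p w}"
    obtain z :: "('k, complex) kchain" where z: "z \<in> kcycles 0 (sublevel f x)"
      "Poly_Mapping.single (point_simplex p) 1 - z \<in> kboundaries 0 (top_of_set (sublevel_set f y))"
      using has_PH_stable(1)[OF assms point_simplex_chain[OF p], of 1] unfolding sublevel_sublevel_set by blast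
    have "fext (indic ?P) (Poly_Mapping.single (point_simplex p) 1 - z) = 0"
      by (rule indic_boundary[OF sublevel_set_sphere z(2)]) (use arc_connected_trans arc_connected_sym in blast)
    moreover have "fext (indic ?P) z = fext (\<lambda>_. 0) z"
    proof (rule fext_cong)
      fix \<sigma> assume "\<sigma> \<in> Poly_Mapping.keys z"
      then obtain q where "q \<in> sublevel_set f x" "\<sigma> = point_simplex q"
        using z(1) kchains_0E unfolding sublevel_sublevel_set kcycles_0 by metis
      then show "indic ?P \<sigma> = (0::'k)" using n by auto
    qed
    moreover have "arc_connected (sublevel_set f y) p p" using arc_connected_refl p sublevel_set_sphere by blast
    ultimately show False by (simp add: fext_diff)
  qed
  show "arc_connected (sublevel_set f x) p q" if pq: "p \<in> sublevel_set f x" "q \<in> sublevel_set f x" "arc_connected (sublevel_set f y) p q" for p q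
  proof -
    let ?c = "Poly_Mapping.single (point_simplex q) 1 - Poly_Mapping.single (point_simplex p) (1::'k)"
    have cc: "?c \<in> kcycles 0 (sublevel f x)"
      by (intro chain_subspaceD(5)[OF chain_subspace_kcycles] point_simplex_chain pq)
    moreover have "?c \<in> kboundaries 0 (sublevel f y)"
      unfolding sublevel_sublevel_set by (rule arc_connected_boundary[OF pq(3)])
    ultimately have "?c \<in> kboundaries 0 (sublevel f x)" using has_PH_stable(2)[OF assms] by blast
    then show ?thesis unfolding sublevel_sublevel_set using point_simplex_diff_boundary_iff[OF sublevel_set_sphere pq(1)] by blast
  qed
qed

text \<open>The full circle carries \<open>loop\<close>, of winding number 1, whereas a cycle that
  misses a point has winding number 0 when crossings are counted at that point. So the circle can
  only be completed at an endpoint of a bar.\<close>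

lemma has_PH_1_stable:
  fixes K :: "'k::field itself"
  assumes "has_PH K (Suc 0) f D" "x \<le> y"
    "\<And>b d. (b, d) \<in># D \<Longrightarrow> \<not> (x < b \<and> b \<le> y) \<and> \<not> (ereal x < d \<and> d \<le> ereal y)"
    and y: "sublevel_set f y = sphere 0 1"
  shows "sublevel_set f x = sphere 0 1"
proof (rule ccontr)
  assume "sublevel_set f x \<noteq> sphere 0 1"
  then obtain w where w: "w \<in> sphere 0 1" "w \<notin> sublevel_set f x" using sublevel_set_sphere by blast
  have "w = cis (Arg w)" by (rule sphere_cis[OF w(1)])
  then obtain \<beta> where \<beta>: "sublevel_set f x \<subseteq> sphere 0 1 - {cis \<beta>}" using w sublevel_set_sphere[of f x] by (intro that[of "Arg w"]) auto
  have "loop \<in> (kcycles (Suc 0) (sublevel f y) :: ('k, complex) kchain set)"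
    unfolding sublevel_sublevel_set y by (rule loop_cycle)
  then obtain z :: "('k, complex) kchain" where z: "z \<in> kcycles (Suc 0) (sublevel f x)"
      "loop - z \<in> kboundaries (Suc 0) (sublevel f y)"
    using has_PH_stable(1)[OF assms(1-3)] by blast
  have "fext (winding \<beta>) (loop - z) = 0"
    using winding_boundary[OF sublevel_set_sphere] z(2) unfolding sublevel_sublevel_set by blast
  moreover have "fext (winding \<beta>) z = 0"
    using winding_avoid[OF \<beta>] z(1) unfolding sublevel_sublevel_set kcycles_def by blast
  ultimately show False by (simp add: fext_diff winding_loop)
qed

section \<open>Monotone lifts\<close>

definition monotone_lift :: "(real \<Rightarrow> real) \<Rightarrow> bool" where
  "monotone_lift \<Phi> \<longleftrightarrow> continuous_on UNIV \<Phi> \<and> mono \<Phi> \<and> (\<forall>t. \<Phi> (t + 2 * pi) = \<Phi> t + 2 * pi)"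

text \<open>The increment \<open>c\<close> is \<open>2 * pi\<close> for lifts of degree one and 0
  for periodic functions.\<close>

lemma shift_int:
  fixes \<Phi> :: "real \<Rightarrow> real"
  assumes "\<And>t. \<Phi> (t + 2 * pi) = \<Phi> t + c"
  shows "\<Phi> (t + 2 * pi * of_int k) = \<Phi> t + c * of_int k"
proof (induction k rule: int_induct[of _ 0])
  case (step1 i)
  then show ?case using assms[of "t + 2 * pi * of_int i"] by (simp add: algebra_simps)
next
  case (step2 i)
  then show ?case using assms[of "t + 2 * pi * of_int (i - 1)"] by (simp add: algebra_simps)
qed simp

lemma monotone_lift_shift: "monotone_lift \<Phi> \<Longrightarrow> \<Phi> (t + 2 * pi * of_int k) = \<Phi> t + 2 * pi * of_int k"
  by (rule shift_int) (simp add: monotone_lift_def)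

lemma monotone_lift_surj:
  assumes "monotone_lift \<Phi>" shows "\<exists>t. \<Phi> t = y"
proof -
  obtain n :: nat where n: "\<bar>y - \<Phi> 0\<bar> / (2 * pi) < of_nat n" using reals_Archimedean2 by blast
  then have "\<bar>y - \<Phi> 0\<bar> < 2 * pi * of_nat n" by (simp add: field_simps)
  moreover have "\<Phi> (2 * pi * of_nat n) = \<Phi> 0 + 2 * pi * of_nat n" "\<Phi> (- (2 * pi * of_nat n)) = \<Phi> 0 - 2 * pi * of_nat n"
    using monotone_lift_shift[OF assms, of 0 "int n"] monotone_lift_shift[OF assms, of 0 "- int n"] by simp_all
  ultimately have "\<Phi> (- (2 * pi * of_nat n)) \<le> y" "y \<le> \<Phi> (2 * pi * of_nat n)" by linarith+
  moreover have "continuous_on {- (2 * pi * of_nat n)..2 * pi * of_nat n} \<Phi>"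
    using assms continuous_on_subset unfolding monotone_lift_def by blast
  moreover have "- (2 * pi * of_nat n) \<le> 2 * pi * real n" by simp
  ultimately show ?thesis using IVT'[of \<Phi> "- (2 * pi * of_nat n)" y "2 * pi * of_nat n"] by blast
qed

section \<open>Invariance of the barcode under monotone reparametrisation\<close>

definition push :: "nat \<Rightarrow> ('a \<Rightarrow> 'b) \<Rightarrow> ('k::field, 'a) kchain \<Rightarrow> ('k, 'b) kchain" where
  "push p \<phi> = lext (\<lambda>\<sigma>. Poly_Mapping.single (simplex_map p \<phi> \<sigma>) 1)"

lemma kboundary_push:
  fixes \<phi> :: "'a \<Rightarrow> 'b" and c :: "('k::field, 'a) kchain"
  shows "kboundary p (push p \<phi> c) = push (p - 1) \<phi> (kboundary p c)"
proof (cases "p = 0")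
  case False
  then have p: "p > 0" by simp
  have "singular_face p k (simplex_map p \<phi> \<sigma>) = simplex_map (p - 1) \<phi> (singular_face p k \<sigma>)" if "k \<le> p" for k and \<sigma> :: "(nat \<Rightarrow> real) \<Rightarrow> 'a"
    using p that by (simp add: singular_face_simplex_map) (auto simp: simplex_map_def singular_face_def)
  then have "(\<Sum>k\<le>p. Poly_Mapping.single (singular_face p k (simplex_map p \<phi> \<sigma>)) ((-1) ^ k)) =
     (\<Sum>k\<le>p. Poly_Mapping.single (simplex_map (p - 1) \<phi> (singular_face p k \<sigma>)) ((-1) ^ k :: 'k))" for \<sigma> :: "(nat \<Rightarrow> real) \<Rightarrow> 'a"
    by (intro sum.cong) auto
  then show ?thesis
    unfolding push_def kboundary_eq[OF p] lext_lext by (intro lext_cong) (simp add: lext_sum)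
qed (simp add: push_def)

lemma push_chains:
  assumes "continuous_map X Y \<phi>" "c \<in> kchains p X"
  shows "push p \<phi> c \<in> kchains p Y"
  unfolding push_def
  by (rule chain_subspace_lext[OF chain_subspace_kchains])
     (use assms singular_simplex_simplex_map in \<open>fastforce simp: kchains_def\<close>)

lemma push_cycles:
  assumes "continuous_map X Y \<phi>" "c \<in> kcycles p X"
  shows "push p \<phi> c \<in> kcycles p Y"
  using assms push_chains[OF assms(1)] by (auto simp: kcycles_def kboundary_push) (simp add: push_def)

lemma push_boundaries:
  assumes "continuous_map X Y \<phi>" "c \<in> kboundaries p X"
  shows "push p \<phi> c \<in> kboundaries p Y"
proof -
  obtain d where "d \<in> kchains (Suc p) X" "c = kboundary (Suc p) d" using assms(2) by (auto simp: kboundaries_def)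
  then have "push p \<phi> c = kboundary (Suc p) (push (Suc p) \<phi> d)" "push (Suc p) \<phi> d \<in> kchains (Suc p) Y"
    using push_chains[OF assms(1)] by (auto simp: kboundary_push)
  then show ?thesis by (auto simp: kboundaries_def)
qed

lemma simplex_map_point_simplex: "simplex_map 0 \<phi> (point_simplex z) = point_simplex (\<phi> z)"
  by (auto simp: simplex_map_def point_simplex_def)

lemma simplex_map_lifted_simplex:
  assumes "\<And>t. \<phi> (cis t) = cis (\<Phi> t)"
  shows "simplex_map (Suc 0) \<phi> (lifted_simplex F) = lifted_simplex (\<lambda>t. \<Phi> (F t))"
  by (auto simp: simplex_map_def lifted_simplex_def edge_simplex_def assms)

section \<open>Homology of a subset of the circle and of its preimage under a monotone map of degree
  one\<close>

context
  fixes \<phi> :: "complex \<Rightarrow> complex" and \<Phi> :: "real \<Rightarrow> real" and S S' :: "complex set"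
  assumes \<Phi>: "monotone_lift \<Phi>" and \<phi>: "\<And>t. \<phi> (cis t) = cis (\<Phi> t)"
    and S: "S \<subseteq> sphere 0 1" and S': "S' = {z \<in> sphere 0 1. \<phi> z \<in> S}"
    and cont: "continuous_map (top_of_set S') (top_of_set S) \<phi>"
begin

text \<open>This is where monotonicity enters: \<Phi> maps a segment into the segment between the
  images of its ends, so an arc in \<open>S\<close> between the image points forces an arc above it
  into \<open>S'\<close>.\<close>

lemma arc_connected_pullback:
  assumes "z \<in> sphere 0 1" "w \<in> sphere 0 1" "arc_connected S (\<phi> z) (\<phi> w)"
  shows "arc_connected S' z w"
proof -
  obtain s t where st: "z = cis s" "w = cis t" using assms(1,2) sphere_cisE by metis
  obtain k :: int where k: "cis ` closed_segment (\<Phi> s) (\<Phi> t + 2 * pi * of_int k) \<subseteq> S"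
    using assms(3) unfolding st \<phi> arc_connected_cis_iff by blast
  have m: "mono \<Phi>" using \<Phi> by (simp add: monotone_lift_def)
  have "\<Phi> u \<in> closed_segment (\<Phi> s) (\<Phi> t + 2 * pi * of_int k)" if "u \<in> closed_segment s (t + 2 * pi * of_int k)" for u
  proof -
    let ?t = "t + 2 * pi * of_int k"
    have "(s \<le> u \<and> u \<le> ?t) \<or> (?t \<le> u \<and> u \<le> s)"
      using that by (auto simp: closed_segment_eq_real_ivl split: if_splits)
    then have "(\<Phi> s \<le> \<Phi> u \<and> \<Phi> u \<le> \<Phi> ?t) \<or> (\<Phi> ?t \<le> \<Phi> u \<and> \<Phi> u \<le> \<Phi> s)"
      using monoD[OF m] by blast
    then show ?thesis unfolding monotone_lift_shift[OF \<Phi>] by (auto simp: closed_segment_eq_real_ivl)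
  qed
  then have "cis ` closed_segment s (t + 2 * pi * of_int k) \<subseteq> S'"
    unfolding S' using k \<phi> by auto
  then show ?thesis unfolding st arc_connected_cis_iff by blast
qed

lemma image_sphere: "z \<in> sphere 0 1 \<Longrightarrow> \<phi> z \<in> sphere 0 1"
  by (erule sphere_cisE) (simp add: \<phi>)

lemma preimage_point: "\<exists>z\<in>sphere 0 1. \<phi> z = w" if w: "w \<in> sphere 0 1"
proof -
  obtain y where y: "w = cis y" using sphere_cisE[OF w] by blast
  obtain t where "\<Phi> t = y" using monotone_lift_surj[OF \<Phi>] by blast
  then show ?thesis using \<phi>[of t] y by (intro bexI[of _ "cis t"]) auto
qed

text \<open>A set-theoretic section \<psi> gives an inverse \<open>Q\<close> on points. It need not
  be continuous: points with connected images are connected by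
  \<open>arc_connected_pullback\<close>, so \<open>Q\<close> respects boundaries.\<close>

lemma push_0_iso:
  "\<exists>h\<in>linear_iso (khomology 0 (top_of_set S')) (khomology 0 (top_of_set S) :: ('k::field, ('k, complex) kchain set) module).
     \<forall>z. h (homology_class 0 (top_of_set S') z) = homology_class 0 (top_of_set S) (push 0 \<phi> z)"
proof (rule linear_iso_khomology)
  have S'1: "S' \<subseteq> sphere 0 1" using S' by blast
  obtain \<psi> where \<psi>: "\<And>w. w \<in> S \<Longrightarrow> \<psi> w \<in> sphere 0 1 \<and> \<phi> (\<psi> w) = w"
    using preimage_point S by (metis subset_iff)
  then have \<psi>S: "\<psi> w \<in> S'" if "w \<in> S" for w using that S' by simp
  define Q where "Q = lext (\<lambda>\<sigma>. Poly_Mapping.single (point_simplex (\<psi> (\<sigma> vertex0))) (1::'k))"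
  have Qb: "Q c \<in> kboundaries 0 (top_of_set S')" if c: "c \<in> kboundaries 0 (top_of_set S)" for c
  proof -
    obtain d where d: "d \<in> kchains (Suc 0) (top_of_set S)" "c = kboundary (Suc 0) d" using c by (auto simp: kboundaries_def)
    show ?thesis unfolding d(2) Q_def kboundary_eq[OF zero_less_Suc] lext_lext
    proof (rule chain_subspace_lext[OF chain_subspace_kboundaries])
      fix \<sigma> assume "\<sigma> \<in> Poly_Mapping.keys d"
      then have "singular_simplex (Suc 0) (top_of_set S) \<sigma>" using d by (auto simp: kchains_def)
      from singular_simplex_spE[OF this S] obtain F where
        F: "continuous_on {0..1} F" "\<And>t. t \<in> {0..1} \<Longrightarrow> cis (F t) \<in> S" "\<sigma> = lifted_simplex F" by metis
      have "arc_connected S (cis (F 0)) (cis (F 1))" by (rule simplex_arc_connected[OF F(1,2)])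
      moreover have "cis (F 0) \<in> S" "cis (F 1) \<in> S" using F(2) by auto
      ultimately have "arc_connected S' (\<psi> (cis (F 0))) (\<psi> (cis (F 1)))"
        using \<psi> arc_connected_pullback by metis
      then have "Poly_Mapping.single (point_simplex (\<psi> (cis (F 1)))) 1 - Poly_Mapping.single (point_simplex (\<psi> (cis (F 0)))) (1::'k) \<in> kboundaries 0 (top_of_set S')"
        by (rule arc_connected_boundary)
      moreover have "lext (\<lambda>\<sigma>. Poly_Mapping.single (point_simplex (\<psi> (\<sigma> vertex0))) 1)
            (\<Sum>k\<le>Suc 0. Poly_Mapping.single (singular_face (Suc 0) k \<sigma>) ((- 1) ^ k))
          = Poly_Mapping.single (point_simplex (\<psi> (cis (F 1)))) 1 - Poly_Mapping.single (point_simplex (\<psi> (cis (F 0)))) (1::'k)"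
        by (simp add: F(3) lifted_simplex_def face_edge_simplex_0 face_edge_simplex_1 lext_add lext_diff single_uminus)
      ultimately show "lext (\<lambda>\<sigma>. Poly_Mapping.single (point_simplex (\<psi> (\<sigma> vertex0))) (1::'k))
            (\<Sum>k\<le>Suc 0. Poly_Mapping.single (singular_face (Suc 0) k \<sigma>) ((- 1) ^ k)) \<in> kboundaries 0 (top_of_set S')"
        by simp
    qed
  qed
  show "push 0 \<phi> (a + b) = push 0 \<phi> a + push 0 \<phi> b" for a b :: "('k, complex) kchain"
    by (simp add: push_def lext_add)
  show "push 0 \<phi> (scale r a) = scale r (push 0 \<phi> a)" for r and a :: "('k, complex) kchain"
    by (simp add: push_def lext_scale)
  show "push 0 \<phi> z \<in> kcycles 0 (top_of_set S)" if "z \<in> kcycles 0 (top_of_set S')" for z :: "('k, complex) kchain"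
    by (rule push_cycles[OF cont that])
  show "push 0 \<phi> z \<in> kboundaries 0 (top_of_set S)" if "z \<in> kboundaries 0 (top_of_set S')" for z :: "('k, complex) kchain"
    by (rule push_boundaries[OF cont that])
  show "z \<in> kboundaries 0 (top_of_set S')"
    if z: "z \<in> kcycles 0 (top_of_set S')" "push 0 \<phi> z \<in> kboundaries 0 (top_of_set S)" for z :: "('k, complex) kchain"
  proof -
    have "lext (\<lambda>\<sigma>. Poly_Mapping.single \<sigma> 1 - Q (Poly_Mapping.single (simplex_map 0 \<phi> \<sigma>) 1)) z \<in> kboundaries 0 (top_of_set S')"
    proof (rule chain_subspace_lext[OF chain_subspace_kboundaries])
      fix \<sigma> assume "\<sigma> \<in> Poly_Mapping.keys z"
      then obtain w where w: "w \<in> S'" "\<sigma> = point_simplex w" using z(1) kchains_0E unfolding kcycles_0 by metis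
      then have wS: "\<phi> w \<in> S" "w \<in> sphere 0 1" using S' by auto
      have "arc_connected S (\<phi> (\<psi> (\<phi> w))) (\<phi> w)" using \<psi>[OF wS(1)] arc_connected_refl[OF wS(1) S] by simp
      then have "arc_connected S' (\<psi> (\<phi> w)) w" using arc_connected_pullback \<psi>[OF wS(1)] wS by blast
      from arc_connected_boundary[OF this, of "1::'k"]
      show "Poly_Mapping.single \<sigma> 1 - Q (Poly_Mapping.single (simplex_map 0 \<phi> \<sigma>) 1) \<in> kboundaries 0 (top_of_set S')"
        by (simp add: w(2) simplex_map_point_simplex Q_def)
    qed
    then have "z - Q (push 0 \<phi> z) \<in> kboundaries 0 (top_of_set S')"
      by (simp add: lext_fun_diff lext_id push_def Q_def lext_lext)
    from chain_subspaceD(2)[OF chain_subspace_kboundaries this Qb[OF z(2)]] show ?thesis by simp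
  qed
  show "\<exists>z\<in>kcycles 0 (top_of_set S'). w - push 0 \<phi> z \<in> kboundaries 0 (top_of_set S)"
    if w: "w \<in> kcycles 0 (top_of_set S)" for w :: "('k, complex) kchain"
  proof
    show "Q w \<in> kcycles 0 (top_of_set S')"
      unfolding Q_def kcycles_0
    proof (rule chain_subspace_lext[OF chain_subspace_kchains])
      fix \<sigma> assume "\<sigma> \<in> Poly_Mapping.keys w"
      then obtain u where u: "u \<in> S" "\<sigma> = point_simplex u" using w kchains_0E unfolding kcycles_0 by metis
      then show "Poly_Mapping.single (point_simplex (\<psi> (\<sigma> vertex0))) (1::'k) \<in> kchains 0 (top_of_set S')"
        using \<psi>S by (simp add: kchains_single singular_simplex_point_simplex)
    qed
    have "push 0 \<phi> (Q w) = lext (\<lambda>\<sigma>. Poly_Mapping.single \<sigma> 1) w"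
      unfolding push_def Q_def lext_lext
    proof (rule lext_cong)
      fix \<sigma> assume "\<sigma> \<in> Poly_Mapping.keys w"
      then obtain u where u: "u \<in> S" "\<sigma> = point_simplex u" using w kchains_0E unfolding kcycles_0 by metis
      then show "lext (\<lambda>\<sigma>. Poly_Mapping.single (simplex_map 0 \<phi> \<sigma>) 1) (Poly_Mapping.single (point_simplex (\<psi> (\<sigma> vertex0))) 1)
        = Poly_Mapping.single \<sigma> (1::'k)"
        using \<psi> by (simp add: simplex_map_point_simplex)
    qed
    then show "w - push 0 \<phi> (Q w) \<in> kboundaries 0 (top_of_set S)"
      by (simp add: lext_id chain_subspaceD(1)[OF chain_subspace_kboundaries])
  qed
qed

text \<open>The lift gains \<open>2 * pi\<close> over a period, hence the image has winding number 1
  and is homologous to \<open>loop\<close> by \<open>H1_circle\<close>.\<close>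

lemma push_loop: "loop - push (Suc 0) \<phi> loop \<in> (kboundaries (Suc 0) circle :: ('k::field, complex) kchain set)"
  if "S = sphere 0 1"
proof -
  have \<Phi>0: "\<Phi> (2 * pi) = \<Phi> 0 + 2 * pi" using \<Phi> unfolding monotone_lift_def by (metis add_0)
  have S'1: "S' = sphere 0 1" unfolding S' that using image_sphere by auto
  have cont': "continuous_map circle circle \<phi>" using cont by (simp only: that S'1)
  have c: "push (Suc 0) \<phi> loop \<in> (kcycles (Suc 0) circle :: ('k, complex) kchain set)"
    by (rule push_cycles[OF cont' loop_cycle])
  have e: "push (Suc 0) \<phi> loop = Poly_Mapping.single (lifted_simplex (\<lambda>t. \<Phi> (seg 0 (2 * pi) t))) (1::'k)"
    unfolding push_def loop_def lext_single by (subst simplex_map_lifted_simplex[of \<phi> \<Phi>, OF \<phi>]) (rule scale_one)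
  have "continuous_on {0..1} (\<lambda>t. \<Phi> (seg 0 (2 * pi) t))"
    by (rule continuous_on_compose2[of UNIV \<Phi>]) (use \<Phi> continuous_on_seg in \<open>auto simp: monotone_lift_def\<close>)
  moreover have "\<lfloor>(\<Phi> 0 + 2 * pi) / (2 * pi)\<rfloor> = \<lfloor>\<Phi> 0 / (2 * pi)\<rfloor> + 1" by (simp add: add_divide_distrib)
  ultimately have "fext (winding 0) (push (Suc 0) \<phi> loop) = (1::'k)"
    unfolding e by (simp add: winding_lifted_simplex \<Phi>0)
  then have "push (Suc 0) \<phi> loop - loop \<in> (kboundaries (Suc 0) circle :: ('k, complex) kchain set)"
    using H1_circle[OF c] by simp
  from chain_subspaceD(4)[OF chain_subspace_kboundaries this] show ?thesis by simp
qed

text \<open>Either \<open>S\<close> is the whole circle and both groups are generated by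
  \<open>loop\<close>, or \<open>S\<close> misses a point; then \<open>S'\<close> misses a preimage
  of it and both groups vanish by \<open>H1_proper\<close>.\<close>

lemma push_1_iso:
  "\<exists>h\<in>linear_iso (khomology (Suc 0) (top_of_set S')) (khomology (Suc 0) (top_of_set S) :: ('k::field, ('k, complex) kchain set) module).
     \<forall>z. h (homology_class (Suc 0) (top_of_set S') z) = homology_class (Suc 0) (top_of_set S) (push (Suc 0) \<phi> z)"
proof (rule linear_iso_khomology)
  have S'1: "S' \<subseteq> sphere 0 1" using S' by blast
  show add: "push (Suc 0) \<phi> (a + b) = push (Suc 0) \<phi> a + push (Suc 0) \<phi> b" for a b :: "('k, complex) kchain"
    by (simp add: push_def lext_add)
  show scale: "push (Suc 0) \<phi> (scale r a) = scale r (push (Suc 0) \<phi> a)" for r and a :: "('k, complex) kchain"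
    by (simp add: push_def lext_scale)
  show "push (Suc 0) \<phi> z \<in> kcycles (Suc 0) (top_of_set S)" if "z \<in> kcycles (Suc 0) (top_of_set S')" for z :: "('k, complex) kchain"
    by (rule push_cycles[OF cont that])
  show bd: "push (Suc 0) \<phi> z \<in> kboundaries (Suc 0) (top_of_set S)" if "z \<in> kboundaries (Suc 0) (top_of_set S')" for z :: "('k, complex) kchain"
    by (rule push_boundaries[OF cont that])
  have diff: "push (Suc 0) \<phi> (a - b) = push (Suc 0) \<phi> a - push (Suc 0) \<phi> b" for a b :: "('k, complex) kchain"
    by (simp add: push_def lext_diff)
  consider "S = sphere 0 1" | w where "w \<in> sphere 0 1" "w \<notin> S" using S by blast
  then have "(\<forall>z :: ('k, complex) kchain. z \<in> kcycles (Suc 0) (top_of_set S') \<longrightarrow> push (Suc 0) \<phi> z \<in> kboundaries (Suc 0) (top_of_set S) \<longrightarrow> z \<in> kboundaries (Suc 0) (top_of_set S')) \<and>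
     (\<forall>w :: ('k, complex) kchain. w \<in> kcycles (Suc 0) (top_of_set S) \<longrightarrow> (\<exists>z\<in>kcycles (Suc 0) (top_of_set S'). w - push (Suc 0) \<phi> z \<in> kboundaries (Suc 0) (top_of_set S)))"
  proof cases
    case 1
    have S'2: "S' = sphere 0 1" unfolding S' 1 using image_sphere by auto
    show ?thesis unfolding 1 S'2
    proof (intro conjI allI impI)
      fix z :: "('k, complex) kchain" assume z: "z \<in> kcycles (Suc 0) circle" "push (Suc 0) \<phi> z \<in> kboundaries (Suc 0) circle"
      have b: "z - scale (fext (winding 0) z) loop \<in> kboundaries (Suc 0) circle" by (rule H1_circle[OF z(1)])
      then have "push (Suc 0) \<phi> z - scale (fext (winding 0) z) (push (Suc 0) \<phi> loop) \<in> kboundaries (Suc 0) circle"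
        using bd[unfolded 1 S'2, OF b] by (simp only: diff scale)
      from chain_subspaceD(5)[OF chain_subspace_kboundaries z(2) this]
      have "scale (fext (winding 0) z) (push (Suc 0) \<phi> loop) \<in> kboundaries (Suc 0) circle" by simp
      then have "fext (winding 0) z * fext (winding 0) (push (Suc 0) \<phi> loop) = 0"
        unfolding fext_scale[symmetric] by (rule winding_boundary[OF order_refl])
      moreover have "fext (winding 0) (loop - push (Suc 0) \<phi> loop) = (0::'k)"
        by (rule winding_boundary[OF order_refl push_loop[OF 1]])
      ultimately have "fext (winding 0) z = 0" by (simp add: fext_diff winding_loop)
      then show "z \<in> kboundaries (Suc 0) circle" using b by simp
    next
      fix w :: "('k, complex) kchain" assume w: "w \<in> kcycles (Suc 0) circle"
      let ?r = "fext (winding 0) w"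
      have "scale ?r loop \<in> kcycles (Suc 0) circle" by (intro chain_subspaceD(3)[OF chain_subspace_kcycles] loop_cycle)
      moreover have "w - scale ?r loop \<in> kboundaries (Suc 0) circle" by (rule H1_circle[OF w])
      moreover have "scale ?r (loop - push (Suc 0) \<phi> loop) \<in> kboundaries (Suc 0) circle"
        by (intro chain_subspaceD(3)[OF chain_subspace_kboundaries] push_loop[OF 1])
      ultimately show "\<exists>z\<in>kcycles (Suc 0) circle. w - push (Suc 0) \<phi> z \<in> kboundaries (Suc 0) circle"
        using chain_subspaceD(2)[OF chain_subspace_kboundaries, of "w - scale ?r loop" "Suc 0" circle "scale ?r (loop - push (Suc 0) \<phi> loop)"]
        by (intro bexI[of _ "scale ?r loop"]) (simp_all add: scale scale_diff)
    qed
  next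
    case 2
    then obtain v where v: "v \<in> sphere 0 1" "\<phi> v = w" using preimage_point by blast
    have "w = cis (Arg w)" "v = cis (Arg v)" using sphere_cis 2(1) v(1) by blast+
    then have "S \<subseteq> sphere 0 1 - {cis (Arg w)}" "S' \<subseteq> sphere 0 1 - {cis (Arg v)}"
      using S S' 2(2) v(2) by auto
    then have "z \<in> kboundaries (Suc 0) (top_of_set S')" if "z \<in> kcycles (Suc 0) (top_of_set S')" for z :: "('k, complex) kchain"
      using H1_proper that by blast
    moreover have "z - push (Suc 0) \<phi> 0 \<in> kboundaries (Suc 0) (top_of_set S)" if "z \<in> kcycles (Suc 0) (top_of_set S)" for z :: "('k, complex) kchain"
      using H1_proper that \<open>S \<subseteq> sphere 0 1 - {cis (Arg w)}\<close> by (simp add: push_def)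
    ultimately show ?thesis using chain_subspaceD(1)[OF chain_subspace_kcycles] by blast
  qed
  then show "\<And>z :: ('k, complex) kchain. z \<in> kcycles (Suc 0) (top_of_set S') \<Longrightarrow> push (Suc 0) \<phi> z \<in> kboundaries (Suc 0) (top_of_set S) \<Longrightarrow> z \<in> kboundaries (Suc 0) (top_of_set S')"
    "\<And>w :: ('k, complex) kchain. w \<in> kcycles (Suc 0) (top_of_set S) \<Longrightarrow> \<exists>z\<in>kcycles (Suc 0) (top_of_set S'). w - push (Suc 0) \<phi> z \<in> kboundaries (Suc 0) (top_of_set S)"
    by blast+
qed

end

text \<open>A continuous surjection from a compact space to a Hausdorff space is a quotient map.
  Continuity on the circle can thus be tested on one period.\<close>

lemma quotient_map_cis: "quotient_map (top_of_set {a..a + 2 * pi}) circle cis"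
proof (rule continuous_imp_quotient_map)
  show "continuous_map (top_of_set {a..a + 2 * pi}) circle cis"
    by (auto simp: continuous_map_in_subtopology intro!: continuous_intros)
  show "compact_space (top_of_set {a..a + 2 * pi})" by (simp add: compact_space_subtopology)
  show "Hausdorff_space circle" by (simp add: Hausdorff_space_subtopology)
  show "cis ` topspace (top_of_set {a..a + 2 * pi}) = topspace circle"
  proof
    show "topspace circle \<subseteq> cis ` topspace (top_of_set {a..a + 2 * pi})"
    proof
      fix z :: complex assume "z \<in> topspace circle"
      then have "z \<in> sphere 0 1" by simp
      then obtain t where t: "z = cis t" by (rule sphere_cisE)
      obtain k :: int where "t + 2 * pi * of_int k \<in> {a..<a + 2 * pi}" by (rule cis_window)
      then show "z \<in> cis ` topspace (top_of_set {a..a + 2 * pi})"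
        using t by (intro image_eqI[of _ _ "t + 2 * pi * of_int k"]) auto
    qed
  qed auto
qed

lemma continuous_on_circle:
  assumes "continuous_on {a..a + 2 * pi} (\<lambda>t. g (cis t))"
  shows "continuous_on (sphere 0 1) g"
proof -
  have "continuous_map (top_of_set {a..a + 2 * pi}) euclidean (g \<circ> cis)"
    using assms by (simp add: comp_def)
  then have "continuous_map circle euclidean g"
    by (rule continuous_compose_quotient_map[OF quotient_map_cis])
  then show ?thesis by simp
qed

lemma continuous_lifted:
  assumes "monotone_lift \<Phi>" "\<And>t. \<phi> (cis t) = cis (\<Phi> t)"
  shows "continuous_on (sphere 0 1) \<phi>"
proof (rule continuous_on_circle[of 0])
  have "continuous_on {0..2 * pi} \<Phi>" using assms(1) continuous_on_subset unfolding monotone_lift_def by blast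
  then show "continuous_on {0..0 + 2 * pi} (\<lambda>t. \<phi> (cis t))"
    unfolding assms(2) by (intro continuous_intros) simp
qed

lemma has_PH_reparametrise:
  fixes K :: "'k::field itself"
  assumes "monotone_lift \<Phi>" "\<And>t. \<phi> (cis t) = cis (\<Phi> t)" "\<And>z. z \<in> sphere 0 1 \<Longrightarrow> g z = f (\<phi> z)"
    and k: "k = 0 \<or> k = Suc 0"
  shows "has_PH K k g D \<longleftrightarrow> has_PH K k f D"
proof -
  have \<phi>s: "\<phi> z \<in> sphere 0 1" if "z \<in> sphere 0 1" for z
    using that by (rule sphere_cisE) (simp add: assms(2))
  have sublevel_set: "sublevel_set g x = {z \<in> sphere 0 1. \<phi> z \<in> sublevel_set f x}" for x
    using assms(3) \<phi>s by (auto simp: sublevel_set_def)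
  have cont: "continuous_map (top_of_set (sublevel_set g x)) (top_of_set (sublevel_set f x)) \<phi>" for x
    using continuous_on_subset[OF continuous_lifted[OF assms(1,2)] sublevel_set_sphere[of g x]] sublevel_set[of x]
    by (auto simp: continuous_map_in_subtopology)
  have "\<exists>h\<in>linear_iso (khomology k (sublevel g x)) (khomology k (sublevel f x) :: ('k, ('k, complex) kchain set) module).
     \<forall>z. h (homology_class k (sublevel g x) z) = homology_class k (sublevel f x) (push k \<phi> z)" for x
    using k
  proof
    assume "k = 0"
    show ?thesis unfolding \<open>k = 0\<close> sublevel_sublevel_set
      by (rule push_0_iso[OF assms(1,2) sublevel_set_sphere sublevel_set cont])
  next
    assume "k = Suc 0"
    show ?thesis unfolding \<open>k = Suc 0\<close> sublevel_sublevel_set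
      by (rule push_1_iso[OF assms(1,2) sublevel_set_sphere sublevel_set cont])
  qed
  then have "\<forall>x. \<exists>h. h \<in> linear_iso (khomology k (sublevel g x)) (khomology k (sublevel f x) :: ('k, ('k, complex) kchain set) module) \<and>
     (\<forall>z. h (homology_class k (sublevel g x) z) = homology_class k (sublevel f x) (push k \<phi> z))" unfolding Bex_def by (rule allI)
  from choice[OF this] obtain h where h: "\<And>x. h x \<in> linear_iso (khomology k (sublevel g x)) (khomology k (sublevel f x) :: ('k, ('k, complex) kchain set) module)"
     "\<And>x z. h x (homology_class k (sublevel g x) z) = homology_class k (sublevel f x) (push k \<phi> z)" by auto
  have "pers_isomorphic (sublevel_homology k g :: ('k, ('k, complex) kchain set) pers_module) (sublevel_homology k f :: ('k, ('k, complex) kchain set) pers_module)"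
    unfolding pers_isomorphic_def
  proof (intro exI[of _ h] conjI allI impI ballI)
    show "h x \<in> linear_iso (pspace (sublevel_homology k g) x) (pspace (sublevel_homology k f) x)" for x
      using h(1) by (simp add: sublevel_homology_def)
    fix x y :: real and v :: "('k, complex) kchain set" assume xy: "x \<le> y" and "v \<in> carrier (pspace (sublevel_homology k g) x)"
    then obtain z where "v = homology_class k (sublevel g x) z"
      by (auto simp: sublevel_homology_def carrier_khomology)
    then show "h y (pmap (sublevel_homology k g) x y v) = pmap (sublevel_homology k f) x y (h x v)"
      by (simp add: pmap_sublevel[OF xy] h(2))
  qed
  then show ?thesis
    unfolding has_PH_def using pers_isomorphic_trans pers_isomorphic_sublevel_sym by blast
qed

section \<open>Constant functions\<close>

lemma kchains_empty: "kchains p (top_of_set {}) = {0}"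
proof -
  have "c = 0" if "c \<in> kchains p (top_of_set {})" for c :: "('k::field, 'a) kchain"
  proof -
    have "\<not> singular_simplex p (top_of_set {} :: 'a topology) \<sigma>" for \<sigma>
      by (intro singular_simplex_empty) simp
    then have "Poly_Mapping.keys c \<subseteq> {}" using that unfolding kchains_def by blast
    then show ?thesis by simp
  qed
  then show ?thesis by auto
qed

text \<open>The sublevel sets are empty below \<open>c\<close> and equal to the circle from
  \<open>c\<close> on, where the homology is spanned by the class of \<open>g\<close>. So every bar
  is born at \<open>c\<close> and never dies, and there is exactly one.\<close>

lemma const_barcode:
  fixes K :: "'k::field itself"
  assumes PH: "has_PH K k f D" and f: "\<And>z. z \<in> sphere 0 1 \<Longrightarrow> f z = c"
    and g: "(g :: ('k, complex) kchain) \<in> kcycles k circle" "g \<notin> kboundaries k circle"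
    and gen: "\<And>z. z \<in> kcycles k circle \<Longrightarrow> \<exists>r. z - scale r g \<in> kboundaries k circle"
  shows "D = {#(c, \<infinity>)#}"
proof -
  obtain \<tau> :: "real \<Rightarrow> ('k, complex) kchain \<Rightarrow> (real \<times> ereal) \<times> nat \<Rightarrow> 'k" where "coordinates k f D \<tau>"
    using has_PH_coordinates[OF PH] by blast
  note t = coordinatesD[OF this]
  have low: "sublevel f x = top_of_set {}" if "x < c" for x
    unfolding sublevel_sublevel_set sublevel_set_def using f that by (metis (no_types, lifting) Collect_empty_eq not_less)
  have high: "sublevel f x = circle" if "c \<le> x" for x
  proof -
    have "sublevel_set f x = sphere 0 1" unfolding sublevel_set_def using f that by auto
    then show ?thesis by (simp add: sublevel_sublevel_set)
  qed
  have unit: "\<exists>z\<in>kcycles k circle. \<tau> c z j = 1 \<and> (\<forall>j'\<in>bars D. j' \<noteq> j \<longrightarrow> \<tau> c z j' = 0)" if j: "j \<in> bars D" "in_bar (fst j) c" for j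
    using t(5)[of c "\<lambda>j'. if j' = j then 1 else 0"] j unfolding high[OF order_refl] by force
  have endpoints: "b = c \<and> d = \<infinity>" if bd: "(b, d) \<in># D" for b d
  proof -
    have j: "((b, d), 0) \<in> bars D" using bd by (auto simp: bars_Sigma)
    have "ereal b < d" using PH bd by (auto simp: has_PH_def barcode_def)
    then have ib: "in_bar (b, d) b" by (simp add: in_bar_def)
    obtain z where z: "z \<in> kcycles k (sublevel f b)" "\<tau> b z ((b, d), 0) = 1"
      using t(5)[of b "\<lambda>j'. if j' = ((b, d), 0) then 1 else 0"] j ib by force
    have zB: "z \<notin> kboundaries k (sublevel f b)" using t(3)[OF z(1)] z(2) j by auto
    \<comment> \<open>A bar born below \<open>c\<close> would require a nonzero class in the empty
      set.\<close>
    have "c \<le> b"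
    proof (rule ccontr)
      assume "\<not> c \<le> b"
      then have "z = 0" using z(1) kchains_empty unfolding kcycles_def by (auto simp: low)
      then show False using zB chain_subspaceD(1)[OF chain_subspace_kboundaries] by blast
    qed
    \<comment> \<open>If the bar were born after \<open>c\<close>, its class at \<open>b\<close>
      would come from a cycle at \<open>c\<close>, where the bar is not yet alive, and would have
      coordinate 0 along it.\<close>
    have "b = c"
    proof (rule ccontr)
      assume "b \<noteq> c"
      with \<open>c \<le> b\<close> have "c < b" by simp
      have "z \<in> kcycles k (sublevel f c)" using z(1) high[OF \<open>c \<le> b\<close>] high[OF order_refl] by simp
      from t(6)[OF \<open>c \<le> b\<close> this j] have "\<tau> b z ((b, d), 0) = 0" using \<open>c < b\<close> by (simp add: in_bar_def)
      then show False using z(2) by simp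
    qed
    obtain z where z: "z \<in> kcycles k circle" "\<tau> c z ((b, d), 0) = 1" "\<forall>j'\<in>bars D. j' \<noteq> ((b, d), 0) \<longrightarrow> \<tau> c z j' = 0"
      using unit[OF j] ib \<open>b = c\<close> by auto
    \<comment> \<open>At a finite death \<open>y\<close> the class would vanish although the
      sublevel sets at \<open>c\<close> and \<open>y\<close> agree.\<close>
    have "d = \<infinity>"
    proof (rule ccontr)
      assume "d \<noteq> \<infinity>"
      then obtain y where y: "d = ereal y" "c < y" using \<open>ereal b < d\<close> \<open>b = c\<close> by (cases d) auto
      have zc: "z \<in> kcycles k (sublevel f c)" "z \<in> kcycles k (sublevel f y)" using z(1) high y by auto
      have "\<tau> y z j' = 0" if "j' \<in> bars D" for j'
        using t(6)[OF less_imp_le[OF y(2)] zc(1) that] z(3) that y by (cases "j' = ((b, d), 0)") (auto simp: in_bar_def)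
      then have "z \<in> kboundaries k (sublevel f c)" using t(3)[OF zc(2)] high y by auto
      then show False using t(3)[OF zc(1)] z(2) j by auto
    qed
    with \<open>b = c\<close> show ?thesis by simp
  qed
  have gc: "g \<in> kcycles k (sublevel f c)" "g \<notin> kboundaries k (sublevel f c)" using g high by auto
  have "bars D \<noteq> {}" using t(3)[OF gc(1)] gc(2) by auto
  have tg: "\<exists>r. \<forall>j\<in>bars D. \<tau> c z j = r * \<tau> c g j" if z: "z \<in> kcycles k circle" for z
  proof -
    obtain r where r: "z - scale r g \<in> kboundaries k circle" using gen[OF z] by blast
    have g': "scale r g \<in> kcycles k (sublevel f c)" "z - scale r g \<in> kcycles k (sublevel f c)"
      using gc(1) z unfolding high[OF order_refl] by (auto intro!: chain_subspaceD(3,5)[OF chain_subspace_kcycles])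
    have "\<tau> c z j = r * \<tau> c g j" if "j \<in> bars D" for j
    proof -
      have "\<tau> c (scale r g + (z - scale r g)) j = r * \<tau> c g j + \<tau> c (z - scale r g) j"
        using t(1)[OF g' that] t(2)[OF gc(1) that] by simp
      moreover have "\<tau> c (z - scale r g) j = 0" using t(3)[OF g'(2)] r high[of c] that by auto
      ultimately show ?thesis by simp
    qed
    then show ?thesis by blast
  qed
  \<comment> \<open>All coordinate vectors are multiples of that of \<open>g\<close>, so the unit
    vectors of two bars cannot both occur.\<close>
  have one: "j = j'" if jj: "j \<in> bars D" "j' \<in> bars D" for j j'
  proof (rule ccontr)
    assume ne: "j \<noteq> j'"
    have ib: "in_bar (fst i) c" if "i \<in> bars D" for i
    proof -
      obtain b d n where i: "i = ((b, d), n)" by (metis surj_pair)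
      then have "(b, d) \<in># D" using that by (auto simp: bars_Sigma)
      from endpoints[OF this] show ?thesis using i by (simp add: in_bar_def)
    qed
    obtain z where "z \<in> kcycles k circle" "\<tau> c z j = 1" "\<forall>i\<in>bars D. i \<noteq> j \<longrightarrow> \<tau> c z i = 0"
      using unit[OF jj(1) ib[OF jj(1)]] by blast
    moreover obtain z' where "z' \<in> kcycles k circle" "\<tau> c z' j' = 1"
      using unit[OF jj(2) ib[OF jj(2)]] by blast
    ultimately have z: "z \<in> kcycles k circle" "\<tau> c z j = 1" "\<tau> c z j' = 0"
      "z' \<in> kcycles k circle" "\<tau> c z' j' = 1" using ne jj by auto
    obtain r r' where "\<forall>j\<in>bars D. \<tau> c z j = r * \<tau> c g j" "\<forall>j\<in>bars D. \<tau> c z' j = r' * \<tau> c g j"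
      using tg[OF z(1)] tg[OF z(4)] by blast
    then have "1 = r * \<tau> c g j" "0 = r * \<tau> c g j'" "1 = r' * \<tau> c g j'" using jj z by auto
    then show False by auto
  qed
  obtain j0 where j0: "bars D = {j0}" using \<open>bars D \<noteq> {}\<close> one by blast
  then have "size D = 1" using card_bars[of D] by simp
  then obtain I where "D = {#I#}" using size_1_singleton_mset by blast
  then show ?thesis using endpoints by (cases I) auto
qed

lemma const_trivial:
  fixes K :: "'k::field itself"
  assumes PH: "has_PH K 0 f D\<^sub>0" "has_PH K (Suc 0) f D\<^sub>1" and f: "\<And>z. z \<in> sphere 0 1 \<Longrightarrow> f z = c"
  shows "trivial_barcode D\<^sub>0 D\<^sub>1"
proof -
  have all: "arc_connected (sphere 0 1) 1 w" if "w \<in> sphere 0 1" for w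
    unfolding arc_connected_def using sphere_cis[OF that] by (intro exI[of _ 0] exI[of _ "Arg w"]) auto
  have "D\<^sub>0 = {#(c, \<infinity>)#}"
  proof (rule const_barcode[OF PH(1) f, of "Poly_Mapping.single (point_simplex 1) 1"])
    show "Poly_Mapping.single (point_simplex 1) (1::'k) \<in> kcycles 0 circle"
      unfolding kcycles_0 by (intro kchains_single) (simp add: singular_simplex_point_simplex)
    show "Poly_Mapping.single (point_simplex 1) (1::'k) \<notin> kboundaries 0 circle"
    proof
      assume "Poly_Mapping.single (point_simplex 1) (1::'k) \<in> kboundaries 0 circle"
      from indic_boundary[OF order_refl this, of UNIV] show False by simp
    qed
    fix z :: "('k, complex) kchain" assume z: "z \<in> kcycles 0 circle"
    have "lext (\<lambda>\<sigma>. Poly_Mapping.single \<sigma> 1 - scale 1 (Poly_Mapping.single (point_simplex 1) 1)) z \<in> kboundaries 0 circle"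
    proof (rule chain_subspace_lext[OF chain_subspace_kboundaries])
      fix \<sigma> assume "\<sigma> \<in> Poly_Mapping.keys z"
      then obtain w where "w \<in> sphere 0 1" "\<sigma> = point_simplex w" using z kchains_0E unfolding kcycles_0 by metis
      then show "Poly_Mapping.single \<sigma> 1 - scale 1 (Poly_Mapping.single (point_simplex 1) (1::'k)) \<in> kboundaries 0 circle"
        using arc_connected_boundary[OF all, of w 1] by simp
    qed
    then have "z - scale (fext (\<lambda>_. 1) z) (Poly_Mapping.single (point_simplex 1) 1) \<in> kboundaries 0 circle"
      by (simp only: lext_fun_diff lext_id lext_const_scale)
    then show "\<exists>r. z - scale r (Poly_Mapping.single (point_simplex 1) 1) \<in> kboundaries 0 circle" by blast
  qed
  moreover have "D\<^sub>1 = {#(c, \<infinity>)#}"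
  proof (rule const_barcode[OF PH(2) f, of loop])
    show "(loop :: ('k, complex) kchain) \<in> kcycles (Suc 0) circle" by (rule loop_cycle)
    show "(loop :: ('k, complex) kchain) \<notin> kboundaries (Suc 0) circle"
      using winding_boundary[OF order_refl, of loop 0] winding_loop[of 0] by (metis zero_neq_one)
    show "\<exists>r. z - scale r loop \<in> kboundaries (Suc 0) circle" if "z \<in> kcycles (Suc 0) circle" for z :: "('k, complex) kchain"
      using H1_circle[OF that] by blast
  qed
  ultimately show ?thesis unfolding trivial_barcode_def by blast
qed

section \<open>Extrema and oscillation of a function with finite barcode\<close>

definition endpoints :: "(real \<times> ereal) multiset \<Rightarrow> real set" where
  "endpoints D = {y. \<exists>I. I \<in># D \<and> (fst I = y \<or> snd I = ereal y)}"

lemma finite_endpoints: "finite (endpoints D)"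
proof (rule finite_subset)
  show "endpoints D \<subseteq> fst ` set_mset D \<union> (\<lambda>I. real_of_ereal (snd I)) ` set_mset D"
  proof
    fix y assume "y \<in> endpoints D"
    then obtain I where I: "I \<in># D" "fst I = y \<or> snd I = ereal y" unfolding endpoints_def by blast
    from I(2) show "y \<in> fst ` set_mset D \<union> (\<lambda>I. real_of_ereal (snd I)) ` set_mset D"
    proof
      assume "snd I = ereal y"
      then have "y = real_of_ereal (snd I)" by simp
      then show ?thesis using I(1) by blast
    qed (use I(1) in blast)
  qed
qed simp

lemma no_endpoint:
  assumes "\<And>e. e \<in> endpoints D \<Longrightarrow> \<not> (x < e \<and> e \<le> y)" "(b, d) \<in># D"
  shows "\<not> (x < b \<and> b \<le> y) \<and> \<not> (ereal x < d \<and> d \<le> ereal y)"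
proof
  have "b \<in> endpoints D" using assms(2) unfolding endpoints_def by force
  then show "\<not> (x < b \<and> b \<le> y)" using assms(1) by blast
  show "\<not> (ereal x < d \<and> d \<le> ereal y)"
  proof
    assume h: "ereal x < d \<and> d \<le> ereal y"
    then obtain e where e: "d = ereal e" by (cases d) auto
    then have "e \<in> endpoints D" using assms(2) unfolding endpoints_def by force
    then show False using assms(1) h e by auto
  qed
qed

text \<open>Finitely many values leave a gap below \<open>m\<close>; with \<open>E\<close> the set
  of endpoints, the homology of sublevel sets does not change across it.\<close>

lemma gap_below:
  fixes E :: "real set"
  assumes "finite E" "m \<notin> E" "x0 < m"
  obtains x where "x0 \<le> x" "x < m" "\<And>e. e \<in> E \<Longrightarrow> \<not> (x < e \<and> e \<le> m)"
proof
  let ?A = "insert x0 {e \<in> E. e < m}"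
  have finite_E: "finite ?A" using assms(1) by simp
  show "x0 \<le> Max ?A" using finite_E by simp
  show "Max ?A < m" using finite_E assms(3) by simp
  show "\<not> (Max ?A < e \<and> e \<le> m)" if "e \<in> E" for e
  proof
    assume h: "Max ?A < e \<and> e \<le> m"
    then have "e < m" using that assms(2) by (metis order_le_less)
    then have "e \<le> Max ?A" using finite_E that by simp
    then show False using h by simp
  qed
qed

definition alternating :: "(real \<Rightarrow> real) \<Rightarrow> nat \<Rightarrow> (nat \<Rightarrow> real) \<Rightarrow> bool" where
  "alternating H r t \<longleftrightarrow> (\<forall>i<r. t i < t (Suc i)) \<and>
     (\<forall>i. 0 < i \<and> i < r \<longrightarrow> (H (t i) - H (t (i - 1))) * (H (t (Suc i)) - H (t i)) < 0)"

text \<open>\<open>E\<close> contains the critical values and \<open>N\<close> bounds the number of monotone pieces over one period.\<close>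

definition tame :: "(real \<Rightarrow> real) \<Rightarrow> real set \<Rightarrow> nat \<Rightarrow> bool" where
  "tame H E N \<longleftrightarrow> continuous_on UNIV H \<and> (\<forall>t. H (t + 2 * pi) = H t) \<and>
     (\<forall>s t u. s < t \<and> t < u \<and> u \<le> s + 2 * pi \<and> H t < H s \<and> H t < H u \<longrightarrow>
        (\<exists>p\<in>{s<..<u}. H p \<in> E \<and> (\<forall>x\<in>{s..u}. H p \<le> H x))) \<and>
     (\<forall>s t u. s < t \<and> t < u \<and> u \<le> s + 2 * pi \<and> H s < H t \<and> H u < H t \<longrightarrow>
        (\<exists>p\<in>{s<..<u}. H p \<in> E \<and> (\<forall>x\<in>{s..u}. H x \<le> H p))) \<and>
     (\<exists>p. H p \<in> E \<and> (\<forall>x. H p \<le> H x)) \<and>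
     (\<forall>a r t. alternating H r t \<and> a \<le> t 0 \<and> t r \<le> a + 2 * pi \<longrightarrow> r \<le> N)"

lemma periodic_int:
  fixes H :: "real \<Rightarrow> real"
  assumes "\<And>t. H (t + 2 * pi) = H t" shows "H (t + 2 * pi * of_int k) = H t"
  using shift_int[of H 0 t k] assms by simp

section \<open>Critical values and oscillation of a function with a given barcode\<close>

context
  fixes K :: "'k::field itself" and f :: "complex \<Rightarrow> real" and D\<^sub>0 D\<^sub>1 :: "(real \<times> ereal) multiset" and H :: "real \<Rightarrow> real" and E :: "real set"
  assumes cont: "continuous_on (sphere 0 1) f"
    and PH0: "has_PH K 0 f D\<^sub>0" and PH1: "has_PH K (Suc 0) f D\<^sub>1"
    and H: "\<And>t. H t = f (cis t)" and E: "E = endpoints D\<^sub>0 \<union> endpoints D\<^sub>1"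
begin

lemma finite_E: "finite E"
  using E finite_endpoints by simp

lemma H_continuous: "continuous_on A H"
proof -
  have "continuous_on UNIV (\<lambda>t. f (cis t))"
    by (rule continuous_on_compose2[OF cont]) (auto intro!: continuous_intros)
  then show ?thesis using continuous_on_subset H by (metis (no_types, lifting) continuous_on_cong subset_UNIV)
qed

lemma H_periodic: "H (t + 2 * pi * of_int k) = H t"
  unfolding H by simp

lemma sublevel_set_cis: "cis t \<in> sublevel_set f x \<longleftrightarrow> H t \<le> x"
  unfolding H by (simp add: sublevel_set_def)

lemma sublevel_set_cisE: assumes "q \<in> sublevel_set f x" obtains b where "q = cis b" "H b \<le> x"
  using assms by (metis sublevel_set_sphere sublevel_set_cis sphere_cisE subset_iff)

lemma arc_connected_sublevel_set: "arc_connected (sublevel_set f x) (cis a) (cis b) \<longleftrightarrow> (\<exists>k::int. \<forall>y\<in>closed_segment a (b + 2 * pi * of_int k). H y \<le> x)"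
  unfolding arc_connected_cis_iff by (auto simp: image_subset_iff sublevel_set_cis)

text \<open>If the value were not an endpoint, no component would be born between a slightly lower
  level and \<open>H p\<close>, so \<open>p\<close> would be joined inside its own sublevel set to a
  strictly lower point. That arc has to leave the interval from \<open>s\<close> to \<open>u\<close>
  through one of its ends, where \<open>H\<close> is higher.\<close>

lemma valley_value:
  assumes "H p < H s" "H p < H u" "s < p" "p < u" "\<And>x. x \<in> {s..u} \<Longrightarrow> H p \<le> H x"
  shows "H p \<in> E"
proof (rule ccontr)
  assume "H p \<notin> E"
  then obtain x where x: "x < H p" "\<And>e. e \<in> E \<Longrightarrow> \<not> (x < e \<and> e \<le> H p)"
    using gap_below[OF finite_E, of "H p" "H p - 1"] by auto
  have no: "\<not> (x < b \<and> b \<le> H p) \<and> \<not> (ereal x < d \<and> d \<le> ereal (H p))" if "(b, d) \<in># D\<^sub>0" for b d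
    using no_endpoint[OF _ that] x(2) E by blast
  have "cis p \<in> sublevel_set f (H p)" by (simp add: sublevel_set_cis)
  then obtain q where "q \<in> sublevel_set f x" "arc_connected (sublevel_set f (H p)) (cis p) q"
    using has_PH_0_stable(1)[OF PH0 less_imp_le[OF x(1)] no] by blast
  then obtain b where b: "H b \<le> x" "arc_connected (sublevel_set f (H p)) (cis p) (cis b)" using sublevel_set_cisE by metis
  then obtain k :: int where k: "\<And>y. y \<in> closed_segment p (b + 2 * pi * of_int k) \<Longrightarrow> H y \<le> H p"
    unfolding arc_connected_sublevel_set by blast
  let ?b = "b + 2 * pi * of_int k"
  have "H ?b < H p" using b(1) x(1) H_periodic by simp
  then have "?b \<notin> {s..u}" using assms(5) by force
  then have "s \<in> closed_segment p ?b \<or> u \<in> closed_segment p ?b"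
    using assms(3,4) by (auto simp: closed_segment_eq_real_ivl)
  then show False using k assms(1,2) by force
qed

text \<open>The argument of \<open>valley_value\<close>, except that the lower sublevel set is now
  empty.\<close>

lemma min_value:
  assumes "\<And>x. H p \<le> H x" shows "H p \<in> E"
proof (rule ccontr)
  assume "H p \<notin> E"
  then obtain x where x: "x < H p" "\<And>e. e \<in> E \<Longrightarrow> \<not> (x < e \<and> e \<le> H p)"
    using gap_below[OF finite_E, of "H p" "H p - 1"] by auto
  have no: "\<not> (x < b \<and> b \<le> H p) \<and> \<not> (ereal x < d \<and> d \<le> ereal (H p))" if "(b, d) \<in># D\<^sub>0" for b d
    using no_endpoint[OF _ that] x(2) E by blast
  have "cis p \<in> sublevel_set f (H p)" by (simp add: sublevel_set_cis)
  then obtain q where "q \<in> sublevel_set f x" using has_PH_0_stable(1)[OF PH0 less_imp_le[OF x(1)] no] by blast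
  then obtain b where "H b \<le> x" using sublevel_set_cisE by metis
  then show False using assms[of b] x(1) by simp
qed

text \<open>At the level of a peak either the circle is completed, which changes degree 1, or the
  two sides \<open>s\<close> and \<open>u\<close> become connected over \<open>p\<close>, which
  changes degree 0. In the second case a higher point \<open>w\<close> blocks the way round the
  other side.\<close>

lemma peak_value:
  assumes "H s < H p" "H u < H p" "s < p" "p < u" "u \<le> s + 2 * pi" "\<And>x. x \<in> {s..u} \<Longrightarrow> H x \<le> H p"
  shows "H p \<in> E"
proof (rule ccontr)
  assume "H p \<notin> E"
  then obtain x where x0: "max (H s) (H u) \<le> x" and x: "x < H p" "\<And>e. e \<in> E \<Longrightarrow> \<not> (x < e \<and> e \<le> H p)"
    using gap_below[OF finite_E, of "H p" "max (H s) (H u)"] assms(1,2) by auto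
  show False
  proof (cases "\<exists>w. H p < H w")
    case False
    have no: "\<not> (x < b \<and> b \<le> H p) \<and> \<not> (ereal x < d \<and> d \<le> ereal (H p))" if "(b, d) \<in># D\<^sub>1" for b d
      using no_endpoint[OF _ that] x(2) E by blast
    have "z \<in> sublevel_set f (H p)" if z: "z \<in> sphere 0 1" for z
    proof -
      obtain t where "z = cis t" using sphere_cisE[OF z] by blast
      then show ?thesis using False by (simp add: sublevel_set_cis not_less)
    qed
    then have "sublevel_set f (H p) = sphere 0 1" using sublevel_set_sphere by blast
    then have "sublevel_set f x = sphere 0 1" using has_PH_1_stable[OF PH1 less_imp_le[OF x(1)] no] by blast
    then have "cis p \<in> sublevel_set f x" by simp
    then show False using x(1) by (simp add: sublevel_set_cis)
  next
    case True
    then obtain w where w: "H p < H w" by blast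
    \<comment> \<open>Moved to the period that starts at \<open>s\<close>, the point
      \<open>w\<close> lies beyond \<open>u\<close>, because \<open>H\<close> does not exceed
      \<open>H p\<close> between \<open>s\<close> and \<open>u\<close>.\<close>
    obtain k :: int where k: "w + 2 * pi * of_int k \<in> {s..<s + 2 * pi}" using cis_window by blast
    let ?w = "w + 2 * pi * of_int k"
    have Hw: "H p < H ?w" using w H_periodic by simp
    then have wu: "u < ?w" "?w < s + 2 * pi" using assms(6)[of ?w] k by (force, simp)
    have no: "\<not> (x < b \<and> b \<le> H p) \<and> \<not> (ereal x < d \<and> d \<le> ereal (H p))" if "(b, d) \<in># D\<^sub>0" for b d
      using no_endpoint[OF _ that] x(2) E by blast
    have "arc_connected (sublevel_set f (H p)) (cis s) (cis u)"
      unfolding arc_connected_sublevel_set using assms(3,4,6) by (intro exI[of _ 0]) (auto simp: closed_segment_eq_real_ivl)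
    moreover have "cis s \<in> sublevel_set f x" "cis u \<in> sublevel_set f x" using x0 by (simp_all add: sublevel_set_cis)
    ultimately have "arc_connected (sublevel_set f x) (cis s) (cis u)"
      using has_PH_0_stable(2)[OF PH0 less_imp_le[OF x(1)] no] by blast
    then obtain j :: int where j: "\<And>y. y \<in> closed_segment s (u + 2 * pi * of_int j) \<Longrightarrow> H y \<le> x"
      unfolding arc_connected_sublevel_set by blast
    show False
    \<comment> \<open>For \<open>j \<ge> 0\<close> the lifted arc from \<open>s\<close> runs forward
      over \<open>p\<close>; for \<open>j < 0\<close> it runs backward over \<open>w\<close> shifted
      by one period.\<close>
    proof (cases "0 \<le> j")
      case True
      then have "0 \<le> 2 * pi * of_int j" by simp
      then have "p \<in> closed_segment s (u + 2 * pi * of_int j)"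
        using assms(3,4) by (simp add: closed_segment_eq_real_ivl)
      then show False using j x(1) by force
    next
      case False
      then have "of_int j \<le> (-1::real)" by linarith
      then have "2 * pi * of_int j \<le> - (2 * pi)" using mult_left_mono[of "of_int j" "-1" "2 * pi"] by simp
      then have "?w + 2 * pi * of_int (-1) \<in> closed_segment s (u + 2 * pi * of_int j)"
        using wu assms(5) by (simp add: closed_segment_eq_real_ivl)
      moreover have "H (?w + 2 * pi * of_int (-1)) = H ?w" by (rule H_periodic)
      ultimately show False using j Hw x(1) by fastforce
    qed
  qed
qed

lemma valley_point:
  assumes "s < t" "t < u" "H t < H s" "H t < H u"
  shows "\<exists>p\<in>{s<..<u}. H p \<in> E \<and> (\<forall>x\<in>{s..u}. H p \<le> H x)"
proof -
  obtain p where p: "p \<in> {s..u}" "\<And>x. x \<in> {s..u} \<Longrightarrow> H p \<le> H x"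
    using continuous_attains_inf[of "{s..u}" H] H_continuous assms(1,2) by fastforce
  have "H p \<le> H t" using p(2)[of t] assms(1,2) by simp
  then have "H p < H s" "H p < H u" using assms(3,4) by linarith+
  moreover then have "p \<noteq> s" "p \<noteq> u" by auto
  then have "s < p" "p < u" using p(1) by auto
  ultimately show ?thesis using valley_value p(2) by (intro bexI[of _ p]) auto
qed

lemma peak_point:
  assumes "s < t" "t < u" "u \<le> s + 2 * pi" "H s < H t" "H u < H t"
  shows "\<exists>p\<in>{s<..<u}. H p \<in> E \<and> (\<forall>x\<in>{s..u}. H x \<le> H p)"
proof -
  obtain p where p: "p \<in> {s..u}" "\<And>x. x \<in> {s..u} \<Longrightarrow> H x \<le> H p"
    using continuous_attains_sup[of "{s..u}" H] H_continuous assms(1,2) by fastforce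
  have "H t \<le> H p" using p(2)[of t] assms(1,2) by simp
  then have "H s < H p" "H u < H p" using assms(4,5) by linarith+
  moreover then have "p \<noteq> s" "p \<noteq> u" by auto
  then have "s < p" "p < u" using p(1) by auto
  ultimately show ?thesis using peak_value assms(3) p(2) by (intro bexI[of _ p]) auto
qed

text \<open>\<open>V\<close> collects the low nodes and \<open>p i\<close> is a minimum found around
  the node \<open>i\<close>. The neighbours of a low node exceed its minimum value \<open>e\<close>,
  so in the sublevel set at \<open>e\<close> they separate the minima of value \<open>e\<close> from
  each other, in both directions around the circle.\<close>

lemma alternation_bound:
  assumes alt: "alternating H r t" and a: "a \<le> t 0" "t r \<le> a + 2 * pi"
  shows "r \<le> 2 * (card E * size D\<^sub>0) + 2"
proof -
  have step: "t i < t (Suc i)" if "i < r" for i using alt that by (simp add: alternating_def)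
  have le: "t i \<le> t j" if "i \<le> j" "j \<le> r" for i j
    using that
  proof (induction j rule: dec_induct)
    case (step n)
    then show ?case using \<open>\<And>i. i < r \<Longrightarrow> t i < t (Suc i)\<close>[of n] by simp
  qed simp
  define V where "V = {i. 0 < i \<and> i < r \<and> H (t i) < H (t (i - 1)) \<and> H (t i) < H (t (Suc i))}"
  have finV: "finite V" by (rule finite_subset[of _ "{..r}"]) (auto simp: V_def)
  have "\<exists>p. t (i - 1) < p \<and> p < t (Suc i) \<and> H p \<in> E \<and> H p \<le> H (t i)" if i: "i \<in> V" for i
  proof -
    have i': "0 < i" "i < r" "H (t i) < H (t (i - 1))" "H (t i) < H (t (Suc i))" using i by (auto simp: V_def)
    have s: "t (i - 1) < t i" "t i < t (Suc i)" using step[of "i - 1"] step[of i] i' by auto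
    obtain p where "p \<in> {t (i - 1)<..<t (Suc i)}" "H p \<in> E" "\<forall>x\<in>{t (i - 1)..t (Suc i)}. H p \<le> H x"
      using valley_point[OF s i'(3,4)] by blast
    then show ?thesis using s by (intro exI[of _ p]) auto
  qed
  then obtain p where p: "\<And>i. i \<in> V \<Longrightarrow> t (i - 1) < p i" "\<And>i. i \<in> V \<Longrightarrow> p i < t (Suc i)"
    "\<And>i. i \<in> V \<Longrightarrow> H (p i) \<in> E" "\<And>i. i \<in> V \<Longrightarrow> H (p i) \<le> H (t i)" by metis
  have fib: "card {i \<in> V. H (p i) = e} \<le> size D\<^sub>0" for e
  proof (rule has_PH_card_components[OF PH0, where z = "\<lambda>i. cis (p i)" and x = e])
    show "finite {i \<in> V. H (p i) = e}" using finV by simp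
    show "cis (p i) \<in> sublevel_set f e" if "i \<in> {i \<in> V. H (p i) = e}" for i using that by (simp add: sublevel_set_cis)
    have nc: "\<not> arc_connected (sublevel_set f e) (cis (p i)) (cis (p j))" if i: "i \<in> V" "H (p i) = e" and j: "j \<in> V" "H (p j) = e" and ij: "i < j" for i j
    proof
      assume "arc_connected (sublevel_set f e) (cis (p i)) (cis (p j))"
      then obtain k :: int where k: "\<And>y. y \<in> closed_segment (p i) (p j + 2 * pi * of_int k) \<Longrightarrow> H y \<le> e"
        unfolding arc_connected_sublevel_set by blast
      \<comment> \<open>Two neighbouring nodes cannot both be low, so the high node after
        \<open>i\<close> lies before \<open>p j\<close>.\<close>
      have "j \<noteq> Suc i" using i(1) j(1) by (auto simp: V_def)
      with ij have sij: "Suc i \<le> j - 1" by simp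
      have ir: "0 < i" "j < r" "H (t i) < H (t (i - 1))" "H (t i) < H (t (Suc i))" using i(1) j(1) by (auto simp: V_def)
      have big: "e < H (t (i - 1))" "e < H (t (Suc i))" using p(4)[OF i(1)] i(2) ir by linarith+
      have jr: "j - 1 \<le> r" "i - 1 \<le> r" "Suc j \<le> r" using ir ij by simp_all
      have 1: "p i < t (Suc i)" "t (Suc i) < p j" using p(2)[OF i(1)] p(1)[OF j(1)] le[OF sij jr(1)] by linarith+
      have 2: "t (i - 1) < p i" "p j - 2 * pi < t (i - 1)"
        using p(1)[OF i(1)] p(2)[OF j(1)] le[OF _ jr(2), of 0] le[OF jr(3) order_refl] a by simp_all
      show False
      \<comment> \<open>Forward the arc crosses the high node after \<open>i\<close>; backward it
        crosses the high node before \<open>i\<close>, since all nodes lie within one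
        period.\<close>
      proof (cases "0 \<le> k")
        case True
        then have "0 \<le> 2 * pi * of_int k" by simp
        then have "t (Suc i) \<in> closed_segment (p i) (p j + 2 * pi * of_int k)"
          using 1 by (simp add: closed_segment_eq_real_ivl)
        then show False using k big by force
      next
        case False
        then have "of_int k \<le> (-1::real)" by linarith
        then have "2 * pi * of_int k \<le> - (2 * pi)" using mult_left_mono[of "of_int k" "-1" "2 * pi"] by simp
        then have "t (i - 1) \<in> closed_segment (p i) (p j + 2 * pi * of_int k)"
          using 2 by (simp add: closed_segment_eq_real_ivl)
        then show False using k big by force
      qed
    qed
    show "\<not> arc_connected (sublevel_set f e) (cis (p i)) (cis (p j))" if "i \<in> {i \<in> V. H (p i) = e}" "j \<in> {i \<in> V. H (p i) = e}" "i \<noteq> j" for i j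
      using nc[of i j] nc[of j i] that arc_connected_sym by (cases "i < j") auto
  qed
  have "V = (\<Union>e\<in>E. {i \<in> V. H (p i) = e})" using p(3) by auto
  then have "card V \<le> (\<Sum>e\<in>E. card {i \<in> V. H (p i) = e})" using card_UN_le[OF finite_E] by metis
  also have "\<dots> \<le> (\<Sum>e\<in>E. size D\<^sub>0)" by (rule sum_mono) (rule fib)
  finally have cV: "card V \<le> card E * size D\<^sub>0" by simp
  \<comment> \<open>Of two consecutive interior nodes one is low. This accounts for all but two of
    the \<open>r\<close> steps, hence the final \<open>+ 2\<close>.\<close>
  have "{1..<r - 1} \<subseteq> V \<union> (\<lambda>i. i - 1) ` V"
  proof
    fix i assume i: "i \<in> {1..<r - 1}"
    then have "(H (t i) - H (t (i - 1))) * (H (t (Suc i)) - H (t i)) < 0"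
      "(H (t (Suc i)) - H (t i)) * (H (t (Suc (Suc i))) - H (t (Suc i))) < 0"
      using alt by (auto simp: alternating_def dest: spec[of _ "Suc i"])
    then have "i \<in> V \<or> Suc i \<in> V" using i by (auto simp: V_def mult_less_0_iff)
    then show "i \<in> V \<union> (\<lambda>i. i - 1) ` V" by force
  qed
  then have "card {1..<r - 1} \<le> card (V \<union> (\<lambda>i. i - 1) ` V)" using finV by (intro card_mono) auto
  also have "\<dots> \<le> card V + card V" using card_Un_le card_image_le[OF finV] by (meson add_left_mono order_trans)
  finally show ?thesis using cV by simp
qed

lemma tame_lift: "tame H E (2 * (card E * size D\<^sub>0) + 2)"
  unfolding tame_def
proof (intro conjI allI impI)
  show "continuous_on UNIV H" by (rule H_continuous)
  show "H (t + 2 * pi) = H t" for t using H_periodic[of t 1] by simp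
  show "\<exists>p. H p \<in> E \<and> (\<forall>x. H p \<le> H x)"
  proof -
    obtain p where p: "\<And>x. x \<in> {0..2 * pi} \<Longrightarrow> H p \<le> H x"
      using continuous_attains_inf[of "{0..2 * pi}" H] H_continuous by fastforce
    have "H p \<le> H x" for x
    proof -
      obtain k :: int where "x + 2 * pi * of_int k \<in> {0..<0 + 2 * pi}" by (rule cis_window)
      then show ?thesis using p[of "x + 2 * pi * of_int k"] H_periodic[of x k] by simp
    qed
    then show ?thesis using min_value by blast
  qed
qed (use valley_point peak_point alternation_bound in auto)

end

section \<open>Partitions and variation\<close>

text \<open>Nodes may coincide, since truncation and monotone reparametrisation produce repeated
  nodes.\<close>

definition is_partition :: "real \<Rightarrow> real \<Rightarrow> nat \<Rightarrow> (nat \<Rightarrow> real) \<Rightarrow> bool" where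
  "is_partition a b r t \<longleftrightarrow> t 0 = a \<and> t r = b \<and> (\<forall>i<r. t i \<le> t (Suc i))"

definition variation :: "(real \<Rightarrow> real) \<Rightarrow> nat \<Rightarrow> (nat \<Rightarrow> real) \<Rightarrow> real" where
  "variation H r t = (\<Sum>i<r. \<bar>H (t (Suc i)) - H (t i)\<bar>)"

lemma is_partition_le:
  assumes "is_partition a b r t" "i \<le> j" "j \<le> r" shows "t i \<le> t j"
  using assms(2,3)
proof (induction j rule: dec_induct)
  case (step n)
  then have "t n \<le> t (Suc n)" using assms(1) by (simp add: is_partition_def)
  then show ?case using step by simp
qed simp

lemma is_partition_bounds:
  assumes "is_partition a b r t" "i \<le> r" shows "a \<le> t i" "t i \<le> b"
  using is_partition_le[OF assms(1), of 0 i] is_partition_le[OF assms(1), of i r] assms by (auto simp: is_partition_def)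

lemma is_partition_piece:
  assumes "is_partition a b r t" "a \<le> x" "x < b"
  obtains i where "i < r" "t i \<le> x" "x \<le> t (Suc i)"
proof -
  define i where "i = Max {i. i \<le> r \<and> t i \<le> x}"
  have fin: "finite {i. i \<le> r \<and> t i \<le> x}" by simp
  have ne: "0 \<in> {i. i \<le> r \<and> t i \<le> x}" using assms by (simp add: is_partition_def)
  have "i \<in> {i. i \<le> r \<and> t i \<le> x}" using Max_in[OF fin] ne unfolding i_def by blast
  then have i: "i \<le> r" "t i \<le> x" by simp_all
  have "i \<noteq> r" using i assms by (auto simp: is_partition_def)
  then have "i < r" using i by simp
  moreover have "\<not> t (Suc i) \<le> x"
  proof
    assume "t (Suc i) \<le> x"
    then have "Suc i \<le> i" using Max_ge[OF fin, of "Suc i"] \<open>i < r\<close> unfolding i_def by auto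
    then show False by simp
  qed
  ultimately show ?thesis using that i by simp
qed

lemma sum_split_pair:
  fixes d :: "nat \<Rightarrow> real"
  assumes "Suc m < r"
  shows "(\<Sum>i<r. d i) = (\<Sum>i<m. d i) + d m + d (Suc m) + (\<Sum>i=Suc (Suc m)..<r. d i)"
proof -
  have "(\<Sum>i<r. d i) = (\<Sum>i<m. d i) + (\<Sum>i=m..<r. d i)"
    using sum.atLeastLessThan_concat[of 0 m r d] assms by (simp add: lessThan_atLeast0)
  then show ?thesis using assms by (simp add: sum.atLeast_Suc_lessThan)
qed

lemma sum_split_one:
  fixes d :: "nat \<Rightarrow> real"
  assumes "m < r"
  shows "(\<Sum>i<r. d i) = (\<Sum>i<m. d i) + d m + (\<Sum>i=Suc m..<r. d i)"
proof -
  have "(\<Sum>i<r. d i) = (\<Sum>i<m. d i) + (\<Sum>i=m..<r. d i)"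
    using sum.atLeastLessThan_concat[of 0 m r d] assms by (simp add: lessThan_atLeast0)
  then show ?thesis using assms by (simp add: sum.atLeast_Suc_lessThan)
qed

section \<open>Inserting, removing and moving a node of a partition\<close>

definition insert_node :: "nat \<Rightarrow> real \<Rightarrow> (nat \<Rightarrow> real) \<Rightarrow> nat \<Rightarrow> real" where
  "insert_node m s t j = (if j \<le> m then t j else if j = Suc m then s else t (j - 1))"

definition remove_node :: "nat \<Rightarrow> (nat \<Rightarrow> real) \<Rightarrow> nat \<Rightarrow> real" where
  "remove_node m t j = (if j \<le> m then t j else t (Suc j))"

lemma remove_node_insert_node [simp]: "remove_node m (insert_node m s t) = t"
  by (auto simp: remove_node_def insert_node_def fun_eq_iff)

lemma variation_remove_node:
  assumes "m < r"
  shows "variation H (Suc r) t = variation H r (remove_node m t) - \<bar>H (t (Suc (Suc m))) - H (t m)\<bar>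
     + \<bar>H (t (Suc m)) - H (t m)\<bar> + \<bar>H (t (Suc (Suc m))) - H (t (Suc m))\<bar>"
proof -
  let ?d = "\<lambda>i. \<bar>H (t (Suc i)) - H (t i)\<bar>"
  let ?e = "\<lambda>i. \<bar>H (remove_node m t (Suc i)) - H (remove_node m t i)\<bar>"
  have "(\<Sum>i<m. ?e i) = (\<Sum>i<m. ?d i)" by (intro sum.cong) (auto simp: remove_node_def)
  moreover have "(\<Sum>i=Suc m..<r. ?e i) = (\<Sum>i=Suc (Suc m)..<Suc r. ?d i)"
    unfolding sum.shift_bounds_Suc_ivl[of ?d] by (intro sum.cong) (auto simp: remove_node_def)
  moreover have "?e m = \<bar>H (t (Suc (Suc m))) - H (t m)\<bar>" by (simp add: remove_node_def)
  ultimately show ?thesis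
    unfolding variation_def sum_split_one[OF assms, of ?e] using sum_split_pair[of m "Suc r" ?d] assms by simp
qed

lemma variation_insert_node:
  assumes "m < r"
  shows "variation H (Suc r) (insert_node m s t) = variation H r t - \<bar>H (t (Suc m)) - H (t m)\<bar>
     + \<bar>H s - H (t m)\<bar> + \<bar>H (t (Suc m)) - H s\<bar>"
  using variation_remove_node[OF assms, of H "insert_node m s t"] by (simp add: insert_node_def)

lemma variation_upd:
  assumes "Suc m < r"
  shows "variation H r (t(Suc m := p)) = variation H r t - \<bar>H (t (Suc m)) - H (t m)\<bar> - \<bar>H (t (Suc (Suc m))) - H (t (Suc m))\<bar>
     + \<bar>H p - H (t m)\<bar> + \<bar>H (t (Suc (Suc m))) - H p\<bar>"
proof -
  let ?d = "\<lambda>i. \<bar>H (t (Suc i)) - H (t i)\<bar>"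
  let ?e = "\<lambda>i. \<bar>H ((t(Suc m := p)) (Suc i)) - H ((t(Suc m := p)) i)\<bar>"
  have "(\<Sum>i<m. ?e i) = (\<Sum>i<m. ?d i)" by (intro sum.cong) auto
  moreover have "(\<Sum>i=Suc (Suc m)..<r. ?e i) = (\<Sum>i=Suc (Suc m)..<r. ?d i)" by (intro sum.cong) auto
  ultimately show ?thesis
    unfolding variation_def using sum_split_pair[OF assms, of ?d] sum_split_pair[OF assms, of ?e] by simp
qed

lemma is_partition_remove_node:
  assumes "is_partition a b (Suc r) t" "m < r"
  shows "is_partition a b r (remove_node m t)"
  using assms is_partition_le[OF assms(1), of m "Suc (Suc m)"]
  unfolding is_partition_def remove_node_def by (auto simp: le_Suc_eq not_le) (metis Suc_leI Suc_mono antisym_conv2 not_less)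

lemma is_partition_insert_node:
  assumes "is_partition a b r t" "m < r" "t m \<le> s" "s \<le> t (Suc m)"
  shows "is_partition a b (Suc r) (insert_node m s t)"
  unfolding is_partition_def
proof (intro conjI allI impI)
  show "insert_node m s t 0 = a" "insert_node m s t (Suc r) = b" using assms by (auto simp: is_partition_def insert_node_def)
  fix i assume "i < Suc r"
  then have "i < m \<or> i = m \<or> i = Suc m \<or> Suc m < i" "i \<noteq> 0 \<longrightarrow> i - 1 < r" by auto
  then show "insert_node m s t i \<le> insert_node m s t (Suc i)"
    using assms unfolding is_partition_def insert_node_def
    by (auto dest: spec[of _ i] spec[of _ "i - 1"])
qed

lemma is_partition_upd:
  assumes "is_partition a b r t" "Suc m < r" "t m \<le> p" "p \<le> t (Suc (Suc m))"
  shows "is_partition a b r (t(Suc m := p))"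
  using assms unfolding is_partition_def by (auto simp: less_Suc_eq)

section \<open>Partitions of greatest variation over one period\<close>

context
  fixes H :: "real \<Rightarrow> real" and E :: "real set" and N :: nat and a b :: real
  assumes tame: "tame H E N" and finE: "finite E" and aE: "H a \<in> E" and b: "b = a + 2 * pi"
begin

text \<open>The period starts where \<open>H\<close> takes a value in \<open>E\<close>, so both end
  nodes of a partition are admissible from the outset.\<close>

lemma right_end_in_E: "H b \<in> E"
  using aE tame unfolding b tame_def by metis

lemma a_less_b: "a < b"
  unfolding b by simp

text \<open>
  A partition with the least number of nodes among those of at least the given variation alternates
  strictly, which bounds its length; among these, one with the most nodes at values in \<open>E\<close> has no other
  nodes, since a node can be moved to the extremum between its neighbours.
\<close>

lemma refine_partition:
  assumes "is_partition a b r0 t0"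
  obtains r t where "is_partition a b r t" "r \<le> N" "variation H r0 t0 \<le> variation H r t" "\<And>i. i \<le> r \<Longrightarrow> H (t i) \<in> E"
proof -
  let ?P = "\<lambda>r t. is_partition a b r t \<and> variation H r0 t0 \<le> variation H r t"
  define r where "r = (LEAST r. \<exists>t. ?P r t)"
  have ex: "\<exists>t. ?P r t" unfolding r_def by (rule LeastI[of _ r0]) (use assms in blast)
  have least: "\<not> ?P r' t" if "r' < r" for r' t
    using not_less_Least[of r' "\<lambda>r. \<exists>t. ?P r t"] that unfolding r_def by blast
  let ?c = "\<lambda>t. card {i. i \<le> r \<and> H (t i) \<in> E}"
  have "\<exists>t. ?P r t \<and> (\<forall>t'. ?P r t' \<longrightarrow> ?c t' \<le> ?c t)"
  proof -
    obtain t where t: "?P r t" using ex by blast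
    have "?c t' < r + 2" for t'
    proof -
      have "{i. i \<le> r \<and> H (t' i) \<in> E} \<subseteq> {..r}" by auto
      from card_mono[OF _ this] show ?thesis by simp
    qed
    then show ?thesis
      using ex_has_greatest_nat[of "?P r" t ?c "r + 2"] t by blast
  qed
  then obtain t where t: "is_partition a b r t" "variation H r0 t0 \<le> variation H r t"
    and mx: "\<And>t'. ?P r t' \<Longrightarrow> ?c t' \<le> ?c t" by blast
  \<comment> \<open>Otherwise the two increments have the same sign or one of them vanishes, and
    dropping the node between them keeps the variation.\<close>
  have alt1: "(H (t (Suc m)) - H (t m)) * (H (t (Suc (Suc m))) - H (t (Suc m))) < 0" if m: "Suc m < r" for m
  proof (rule ccontr)
    assume n: "\<not> ?thesis"
    obtain r' where r': "r = Suc r'" using m by (cases r) auto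
    then have mr: "m < r'" using m by simp
    have "\<bar>H (t (Suc (Suc m))) - H (t m)\<bar> = \<bar>H (t (Suc m)) - H (t m)\<bar> + \<bar>H (t (Suc (Suc m))) - H (t (Suc m))\<bar>"
      using n by (auto simp: not_less zero_le_mult_iff)
    then have "variation H r t = variation H r' (remove_node m t)" unfolding r' using variation_remove_node[OF mr, of H t] by simp
    then have "?P r' (remove_node m t)" using t is_partition_remove_node[of a b r' t m] mr r' by auto
    then show False using least r' by blast
  qed
  have strict: "t i < t (Suc i)" if i: "i < r" for i
  proof (rule ccontr)
    assume "\<not> t i < t (Suc i)"
    then have eq: "t i = t (Suc i)" using t(1) i by (force simp: is_partition_def)
    show False
    proof (cases "Suc i < r")
      case True
      then show False using alt1[OF True] eq by simp
    next
      case False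
      then have ri: "r = Suc i" using i by simp
      show False
      proof (cases i)
        case 0
        then show False using t(1) eq ri a_less_b by (simp add: is_partition_def)
      next
        case (Suc m)
        then show False using alt1[of m] eq ri by simp
      qed
    qed
  qed
  have "alternating H r t"
    unfolding alternating_def
  proof (intro conjI allI impI)
    show "(H (t i) - H (t (i - 1))) * (H (t (Suc i)) - H (t i)) < 0" if "0 < i \<and> i < r" for i
      using alt1[of "i - 1"] that by simp
  qed (rule strict)
  moreover have "a \<le> t 0" "t r \<le> a + 2 * pi" using t(1) b by (auto simp: is_partition_def)
  ultimately have "r \<le> N" using tame unfolding tame_def by blast
  moreover have "H (t i) \<in> E" if i: "i \<le> r" for i
  proof (rule ccontr)
    assume nE: "H (t i) \<notin> E"
    then have "i \<noteq> 0" "i \<noteq> r" using t(1) aE right_end_in_E unfolding is_partition_def by metis+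
    then obtain m where m: "i = Suc m" "Suc m < r" using i by (cases i) auto
    let ?s = "t m" and ?x = "t (Suc m)" and ?u = "t (Suc (Suc m))"
    have su: "?s < ?x" "?x < ?u" "?u \<le> ?s + 2 * pi"
      using strict[of m] strict[of "Suc m"] m is_partition_bounds[OF t(1), of m] is_partition_bounds[OF t(1), of "Suc (Suc m)"] b by auto
    have "\<exists>p\<in>{?s<..<?u}. H p \<in> E \<and> \<bar>H ?x - H ?s\<bar> + \<bar>H ?u - H ?x\<bar> \<le> \<bar>H p - H ?s\<bar> + \<bar>H ?u - H p\<bar>"
    proof -
      consider "H ?x < H ?s" "H ?x < H ?u" | "H ?s < H ?x" "H ?u < H ?x"
        using alt1[OF m(2)] by (auto simp: mult_less_0_iff)
      then show ?thesis
      proof cases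
        case 1
        then obtain p where p: "p \<in> {?s<..<?u}" "H p \<in> E" "\<forall>y\<in>{?s..?u}. H p \<le> H y"
          using tame su unfolding tame_def by meson
        then have "H p \<le> H ?x" using su by simp
        then show ?thesis using p 1 by (intro bexI[of _ p]) auto
      next
        case 2
        then obtain p where p: "p \<in> {?s<..<?u}" "H p \<in> E" "\<forall>y\<in>{?s..?u}. H y \<le> H p"
          using tame su unfolding tame_def by meson
        then have "H ?x \<le> H p" using su by simp
        then show ?thesis using p 2 by (intro bexI[of _ p]) auto
      qed
    qed
    then obtain p where p: "?s < p" "p < ?u" "H p \<in> E"
      "\<bar>H ?x - H ?s\<bar> + \<bar>H ?u - H ?x\<bar> \<le> \<bar>H p - H ?s\<bar> + \<bar>H ?u - H p\<bar>" by auto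
    let ?t = "t(Suc m := p)"
    have "?P r ?t" using is_partition_upd[OF t(1) m(2)] p variation_upd[OF m(2), of H t p] t(2) by auto
    then have "?c ?t \<le> ?c t" by (rule mx)
    moreover have "{j. j \<le> r \<and> H (?t j) \<in> E} = insert i {j. j \<le> r \<and> H (t j) \<in> E}"
      using m p(3) i by auto
    ultimately show False using nE by simp
  qed
  ultimately show ?thesis using that t by blast
qed

text \<open>By \<open>refine_partition\<close> it suffices to consider partitions with at most
  \<open>N\<close> pieces and node values in \<open>E\<close>. Their variations are computed from
  finitely many possible data, so a maximum exists.\<close>

lemma optimal_partition:
  obtains r t where "is_partition a b r t" "r \<le> N" "\<And>i. i \<le> r \<Longrightarrow> H (t i) \<in> E"
    "\<And>r' t'. is_partition a b r' t' \<Longrightarrow> variation H r' t' \<le> variation H r t"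
proof -
  let ?Q = "\<lambda>r t. is_partition a b r t \<and> r \<le> N \<and> (\<forall>i\<le>r. H (t i) \<in> E)"
  define W where "W = {variation H r t | r t. ?Q r t}"
  have "W \<subseteq> (\<lambda>(r, x). \<Sum>i<r. \<bar>x (Suc i) - x i\<bar>) ` ({..N} \<times> ({..N} \<rightarrow>\<^sub>E insert 0 E))"
  proof
    fix w assume "w \<in> W"
    then obtain r t where rt: "w = variation H r t" "?Q r t" unfolding W_def by blast
    \<comment> \<open>Values beyond the last node are padded by 0, so that all lengths share one
      finite function space.\<close>
    let ?x = "\<lambda>i\<in>{..N}. if i \<le> r then H (t i) else 0"
    have "w = (\<Sum>i<r. \<bar>?x (Suc i) - ?x i\<bar>)" unfolding rt(1) variation_def
      using rt(2) by (intro sum.cong) auto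
    moreover have "?x \<in> {..N} \<rightarrow>\<^sub>E insert 0 E" using rt(2) by auto
    ultimately show "w \<in> (\<lambda>(r, x). \<Sum>i<r. \<bar>x (Suc i) - x i\<bar>) ` ({..N} \<times> ({..N} \<rightarrow>\<^sub>E insert 0 E))"
      using rt(2) by (intro image_eqI[of _ _ "(r, ?x)"]) auto
  qed
  moreover have "finite ({..N} \<times> ({..N} \<rightarrow>\<^sub>E insert 0 E))"
    using finE by (intro finite_cartesian_product finite_PiE) auto
  ultimately have finW: "finite W" using finite_surj by blast
  have triv: "is_partition a b 1 (\<lambda>i. if i = 0 then a else b)" using a_less_b by (simp add: is_partition_def)
  have up: "\<exists>w\<in>W. variation H r' t' \<le> w" if p: "is_partition a b r' t'" for r' t'
    by (rule refine_partition[OF p]) (auto simp: W_def)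
  then have "W \<noteq> {}" using triv by blast
  then have "Max W \<in> W" using finW by simp
  then obtain r t where rt: "Max W = variation H r t" "?Q r t" unfolding W_def by auto
  have "variation H r' t' \<le> variation H r t" if "is_partition a b r' t'" for r' t'
    using up[OF that] Max_ge[OF finW] unfolding rt(1)[symmetric] by (meson order_trans)
  then show ?thesis using that rt by blast
qed

text \<open>Otherwise inserting \<open>s\<close> and \<open>u\<close> as nodes would increase the variation.\<close>

lemma optimal_monotone:
  assumes t: "is_partition a b r t" and opt: "\<And>r' t'. is_partition a b r' t' \<Longrightarrow> variation H r' t' \<le> variation H r t"
    and i: "i < r" and su: "t i \<le> s" "s \<le> u" "u \<le> t (Suc i)"
  shows "\<bar>H u - H (t i)\<bar> = \<bar>H s - H (t i)\<bar> + \<bar>H u - H s\<bar>"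
proof -
  let ?t1 = "insert_node i s t"
  let ?t2 = "insert_node (Suc i) u ?t1"
  have 1: "is_partition a b (Suc r) ?t1" using is_partition_insert_node[OF t i] su by simp
  have v: "?t1 (Suc i) = s" "?t1 (Suc (Suc i)) = t (Suc i)" "?t1 i = t i" by (auto simp: insert_node_def)
  have "is_partition a b (Suc (Suc r)) ?t2" using is_partition_insert_node[OF 1, of "Suc i" u] su i v by simp
  then have "variation H (Suc (Suc r)) ?t2 \<le> variation H r t" by (rule opt)
  then have "\<bar>H s - H (t i)\<bar> + \<bar>H u - H s\<bar> + \<bar>H (t (Suc i)) - H u\<bar> \<le> \<bar>H (t (Suc i)) - H (t i)\<bar>"
    using variation_insert_node[of "Suc i" "Suc r" H u ?t1] variation_insert_node[OF i, of H s t] i v by simp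
  then show ?thesis by linarith
qed

text \<open>\<open>W\<close> is the total variation of \<open>H\<close> up to a point, computed
  along a single optimal partition: on each piece \<open>H\<close> is monotone by
  \<open>optimal_monotone\<close>, so the piece contributes its absolute increment.\<close>

lemma arc_length:
  obtains W r t where "continuous_on {a..b} W" "W a = 0" "\<And>s u. a \<le> s \<Longrightarrow> s \<le> u \<Longrightarrow> u \<le> b \<Longrightarrow> \<bar>H u - H s\<bar> \<le> W u - W s"
    "is_partition a b r t" "r \<le> N" "\<And>i. i \<le> r \<Longrightarrow> H (t i) \<in> E" "W b = variation H r t"
proof -
  obtain r t where t: "is_partition a b r t" "r \<le> N" "\<And>i. i \<le> r \<Longrightarrow> H (t i) \<in> E"
    and opt: "\<And>r' t'. is_partition a b r' t' \<Longrightarrow> variation H r' t' \<le> variation H r t" using optimal_partition by blast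
  \<comment> \<open>\<open>C i x\<close> is \<open>x\<close> clamped to piece \<open>i\<close>:
    pieces beyond \<open>x\<close> contribute nothing to \<open>W x\<close>, and pieces before it
    their whole increment.\<close>
  define C where "C i x = max (t i) (min x (t (Suc i)))" for i and x :: real
  define W where "W x = (\<Sum>i<r. \<bar>H (C i x) - H (t i)\<bar>)" for x
  have cH: "continuous_on UNIV H" using tame by (simp add: tame_def)
  have step: "t i \<le> t (Suc i)" if "i < r" for i using t(1) that by (simp add: is_partition_def)
  show ?thesis
  proof (rule that[OF _ _ _ t])
    show "continuous_on {a..b} W"
      unfolding W_def C_def
      by (intro continuous_intros continuous_on_compose2[OF cH]) auto
    show "W a = 0"
      unfolding W_def
    proof (rule sum.neutral, rule ballI)
      fix i assume i: "i \<in> {..<r}"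
      then have "a \<le> t i" "t i \<le> t (Suc i)" using is_partition_bounds(1)[OF t(1), of i] step by auto
      then have "C i a = t i" by (simp add: C_def)
      then show "\<bar>H (C i a) - H (t i)\<bar> = 0" by simp
    qed
    show "W b = variation H r t"
      unfolding W_def variation_def
    proof (rule sum.cong[OF refl])
      fix i assume i: "i \<in> {..<r}"
      then have "t (Suc i) \<le> b" "t i \<le> t (Suc i)" using is_partition_bounds(2)[OF t(1), of "Suc i"] step by auto
      then have "C i b = t (Suc i)" by (simp add: C_def)
      then show "\<bar>H (C i b) - H (t i)\<bar> = \<bar>H (t (Suc i)) - H (t i)\<bar>" by simp
    qed
    show "\<bar>H u - H s\<bar> \<le> W u - W s" if su: "a \<le> s" "s \<le> u" "u \<le> b" for s u
    proof -
      \<comment> \<open>Without absolute values the clamped increments telescope, which recovers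
        \<open>H\<close> and gives the comparison with \<open>W\<close>.\<close>
      have tel: "(\<Sum>i<n. H (C i x) - H (t i)) = H (min x (t n)) - H a" if "a \<le> x" "n \<le> r" for n x
        using that(2)
      proof (induction n)
        case 0
        then show ?case using that(1) t(1) by (simp add: is_partition_def)
      next
        case (Suc n)
        have "t n \<le> t (Suc n)" using step Suc by simp
        then have "H (C n x) - H (t n) + H (min x (t n)) = H (min x (t (Suc n)))"
          unfolding C_def by (cases "x \<le> t n") (auto simp: min_def max_def)
        then show ?case using Suc by simp
      qed
      have "W u - W s = (\<Sum>i<r. \<bar>H (C i u) - H (C i s)\<bar>)"
        unfolding W_def sum_subtractf[symmetric]
      proof (rule sum.cong[OF refl])
        fix i assume i: "i \<in> {..<r}"
        have "t i \<le> C i s" "C i s \<le> C i u" "C i u \<le> t (Suc i)" using su step i by (auto simp: C_def)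
        from optimal_monotone[OF t(1) opt _ this] i
        show "\<bar>H (C i u) - H (t i)\<bar> - \<bar>H (C i s) - H (t i)\<bar> = \<bar>H (C i u) - H (C i s)\<bar>" by simp
      qed
      also have "\<dots> \<ge> \<bar>\<Sum>i<r. H (C i u) - H (C i s)\<bar>" by (rule sum_abs)
      also have "(\<Sum>i<r. H (C i u) - H (C i s)) = (\<Sum>i<r. H (C i u) - H (t i)) - (\<Sum>i<r. H (C i s) - H (t i))"
        by (simp add: sum_subtractf)
      also have "\<dots> = H u - H s"
        using tel[of u r] tel[of s r] su t(1) by (simp add: is_partition_def)
      finally show ?thesis .
    qed
  qed
qed

end

section \<open>Normal form\<close>

text \<open>The partition attains the Lipschitz bound: \<open>2 * pi * L\<close> is the greatest
  variation that the bound allows over a period. Hence \<open>G\<close> is affine with slope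
  \<open>L\<close> or \<open>- L\<close> between nodes, and \<open>L\<close> is the variation per
  unit length.\<close>

definition constant_speed :: "real set \<Rightarrow> nat \<Rightarrow> real \<Rightarrow> (real \<Rightarrow> real) \<Rightarrow> bool" where
  "constant_speed E N L G \<longleftrightarrow> 0 < L \<and> (\<forall>x y. \<bar>G x - G y\<bar> \<le> L * \<bar>x - y\<bar>) \<and> (\<forall>t. G (t + 2 * pi) = G t) \<and>
     (\<exists>r\<le>N. \<exists>t. is_partition 0 (2 * pi) r t \<and> (\<forall>i\<le>r. G (t i) \<in> E) \<and> variation G r t = 2 * pi * L)"

text \<open>The extension passes through the circle: \<open>u\<close> descends along
  \<open>cis\<close>, is continuous there by the quotient property, and is pulled back to the
  line.\<close>

lemma periodic_extension:
  fixes u :: "real \<Rightarrow> real"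
  assumes "continuous_on {a..a + 2 * pi} u" "u (a + 2 * pi) = u a"
  obtains v where "continuous_on UNIV v" "\<And>t. v (t + 2 * pi) = v t" "\<And>t. t \<in> {a..a + 2 * pi} \<Longrightarrow> v t = u t"
proof -
  define g where "g z = u (SOME t. t \<in> {a..a + 2 * pi} \<and> cis t = z)" for z
  have g: "g (cis t) = u t" if t: "t \<in> {a..a + 2 * pi}" for t
  proof -
    define s where "s = (SOME s. s \<in> {a..a + 2 * pi} \<and> cis s = cis t)"
    have s: "s \<in> {a..a + 2 * pi}" "cis s = cis t" using someI[of "\<lambda>s. s \<in> {a..a + 2 * pi} \<and> cis s = cis t" t] t unfolding s_def by auto
    obtain k :: int where k: "s = t + 2 * pi * of_int k" using s(2) cis_eq_iff by blast
    have "\<bar>2 * pi * of_int k\<bar> \<le> 2 * pi" using k s(1) t by auto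
    then have "\<bar>of_int k :: real\<bar> \<le> 1" by (simp add: abs_mult)
    \<comment> \<open>Two parameters of the same point are equal or are the two ends of the
      interval, where \<open>u\<close> agrees.\<close>
    then have "k = 0 \<or> k = 1 \<or> k = -1" by linarith
    then have "u s = u t"
    proof (elim disjE)
      assume "k = 1"
      then have "s = a + 2 * pi" "t = a" using k s(1) t by auto
      then show ?thesis using assms(2) by simp
    next
      assume "k = -1"
      then have "t = a + 2 * pi" "s = a" using k s(1) t by auto
      then show ?thesis using assms(2) by simp
    qed (use k in simp)
    then show ?thesis unfolding g_def s_def[symmetric] .
  qed
  have "continuous_on {a..a + 2 * pi} (\<lambda>t. g (cis t))" by (rule continuous_on_eq[OF assms(1)]) (simp add: g)
  then have cg: "continuous_on (sphere 0 1) g" by (rule continuous_on_circle)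
  show ?thesis
  proof
    show "continuous_on UNIV (\<lambda>t. g (cis t))"
      by (rule continuous_on_compose2[OF cg]) (auto intro!: continuous_intros)
    show "g (cis (t + 2 * pi)) = g (cis t)" for t using cis_shift[of t 1] by simp
  qed (rule g)
qed

text \<open>Chaining over consecutive periods carries the comparison of \<open>H\<close> with arc
  length from single periods to the line.\<close>

lemma transitive_extension:
  fixes P :: "real \<Rightarrow> real \<Rightarrow> bool"
  assumes loc: "\<And>k s u. a + 2 * pi * of_int k \<le> s \<Longrightarrow> s \<le> u \<Longrightarrow> u \<le> a + 2 * pi * of_int k + 2 * pi \<Longrightarrow> P s u"
    and tr: "\<And>s t u. P s t \<Longrightarrow> P t u \<Longrightarrow> P s u" and su: "s \<le> u"
  shows "P s u"
proof -
  obtain j :: int where j: "s + 2 * pi * of_int j \<in> {a..<a + 2 * pi}" by (rule cis_window)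
  define k where "k = - j"
  have k: "a + 2 * pi * of_int k \<le> s" "s < a + 2 * pi * of_int k + 2 * pi" using j by (auto simp: k_def)
  have "\<forall>u\<ge>s. u \<le> a + 2 * pi * of_int k + 2 * pi * (of_nat n + 1) \<longrightarrow> P s u" for n :: nat
  proof (induction n)
    case 0
    then show ?case using loc[of k s] k by auto
  next
    case (Suc n)
    show ?case
    proof (intro allI impI)
      fix u assume u: "s \<le> u" "u \<le> a + 2 * pi * of_int k + 2 * pi * (of_nat (Suc n) + 1)"
      let ?m = "a + 2 * pi * of_int k + 2 * pi * (of_nat n + 1)"
      show "P s u"
      proof (cases "u \<le> ?m")
        case True then show ?thesis using Suc u by blast
      next
        case False
        have "0 \<le> 2 * pi * real n" "2 * pi * (real n + 1) = 2 * pi * real n + 2 * pi" by (simp_all add: algebra_simps)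
        then have "s \<le> ?m" using k by linarith
        then have "P s ?m" using Suc by blast
        moreover have "P ?m u"
          using loc[of "k + int n + 1" ?m u] False u(2) by (simp add: algebra_simps)
        ultimately show ?thesis by (rule tr)
      qed
    qed
  qed
  moreover obtain n :: nat where "(u - (a + 2 * pi * of_int k)) / (2 * pi) < of_nat n" using reals_Archimedean2 by blast
  then have 1: "u - (a + 2 * pi * of_int k) < 2 * pi * of_nat n" by (simp add: field_simps)
  have "2 * pi * (of_nat n + 1) = 2 * pi * of_nat n + 2 * pi" by (simp add: algebra_simps)
  then have "u \<le> a + 2 * pi * of_int k + 2 * pi * (of_nat n + 1)" using 1 pi_gt_zero by linarith
  ultimately show ?thesis using su by blast
qed

lemma normal_form:
  assumes tame: "tame H E N" and finE: "finite E" and nc: "\<not> (\<forall>t. H t = H 0)"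
  obtains \<Phi> G L where "monotone_lift \<Phi>" "constant_speed E N L G" "\<And>t. H t = G (\<Phi> t)"
proof -
  obtain a where a: "H a \<in> E" using tame unfolding tame_def by blast
  define b where "b = a + 2 * pi"
  have per: "H (t + 2 * pi * of_int k) = H t" for t k using tame by (intro periodic_int) (simp add: tame_def)
  obtain W r t where W: "continuous_on {a..b} W" "W a = 0" "\<And>s u. a \<le> s \<Longrightarrow> s \<le> u \<Longrightarrow> u \<le> b \<Longrightarrow> \<bar>H u - H s\<bar> \<le> W u - W s"
    and t: "is_partition a b r t" "r \<le> N" "\<And>i. i \<le> r \<Longrightarrow> H (t i) \<in> E" and Wb: "W b = variation H r t"
    using arc_length[OF tame finE a b_def] by blast
  \<comment> \<open>This scaling makes \<open>W x / L\<close> increase by \<open>2 * pi\<close> over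
    a period, so that \<Phi> has degree one.\<close>
  define L where "L = W b / (2 * pi)"
  have "W b > 0"
  proof (rule ccontr)
    assume n: "\<not> W b > 0"
    have "H x = H a" for x
    proof -
      obtain k :: int where k: "x + 2 * pi * of_int k \<in> {a..<a + 2 * pi}" by (rule cis_window)
      have "\<bar>H (x + 2 * pi * of_int k) - H a\<bar> \<le> W (x + 2 * pi * of_int k) - W a"
        "\<bar>H b - H (x + 2 * pi * of_int k)\<bar> \<le> W b - W (x + 2 * pi * of_int k)"
        using W(3) k by (auto simp: b_def)
      then show ?thesis using n W(2) per[of x k] by linarith
    qed
    then show False using nc by metis
  qed
  then have L: "L > 0" by (simp add: L_def)
  have LW: "W b = 2 * pi * L" by (simp add: L_def)
  \<comment> \<open>After subtracting \<open>x\<close> the two ends of the period carry equal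
    values, so the deviation from the identity can be extended periodically.\<close>
  have c1: "continuous_on {a..a + 2 * pi} (\<lambda>x. W x / L - x)"
    using W(1) L unfolding b_def by (intro continuous_intros) auto
  have c2: "W (a + 2 * pi) / L - (a + 2 * pi) = W a / L - a" using LW L W(2) by (simp add: b_def field_simps)
  obtain v where v: "continuous_on UNIV v" "\<And>t. v (t + 2 * pi) = v t"
    "\<And>t. t \<in> {a..a + 2 * pi} \<Longrightarrow> v t = W t / L - t"
    using periodic_extension[OF c1 c2] by blast
  define \<Phi> where "\<Phi> x = x + v x" for x
  have \<Phi>W: "\<Phi> x = W x / L" if "x \<in> {a..b}" for x using v(3) that by (simp add: \<Phi>_def b_def)
  have \<Phi>per: "\<Phi> (x + 2 * pi * of_int k) = \<Phi> x + 2 * pi * of_int k" for x k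
    by (rule shift_int) (simp add: \<Phi>_def v(2))
  have main: "\<bar>H u - H s\<bar> \<le> L * (\<Phi> u - \<Phi> s)" if su: "s \<le> u" for s u
  proof (rule transitive_extension[OF _ _ su])
    fix k :: int and s u assume k: "a + 2 * pi * of_int k \<le> s" "s \<le> u" "u \<le> a + 2 * pi * of_int k + 2 * pi"
    let ?s = "s + 2 * pi * of_int (- k)" and ?u = "u + 2 * pi * of_int (- k)"
    have su': "a \<le> ?s" "?s \<le> ?u" "?u \<le> b" using k by (auto simp: b_def)
    have "\<bar>H ?u - H ?s\<bar> \<le> W ?u - W ?s" by (rule W(3)[OF su'])
    also have "\<dots> = L * (\<Phi> ?u - \<Phi> ?s)" using \<Phi>W[of ?u] \<Phi>W[of ?s] su' L by (simp add: field_simps)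
    finally show "\<bar>H u - H s\<bar> \<le> L * (\<Phi> u - \<Phi> s)" unfolding per \<Phi>per by simp
  next
    fix s t u assume "\<bar>H t - H s\<bar> \<le> L * (\<Phi> t - \<Phi> s)" "\<bar>H u - H t\<bar> \<le> L * (\<Phi> u - \<Phi> t)"
    then show "\<bar>H u - H s\<bar> \<le> L * (\<Phi> u - \<Phi> s)" by (simp add: algebra_simps)
  qed
  have "mono \<Phi>"
  proof (rule monoI)
    fix s u :: real assume "s \<le> u"
    then have "0 \<le> L * (\<Phi> u - \<Phi> s)" using main[of s u] by (meson abs_ge_zero order_trans)
    then show "\<Phi> s \<le> \<Phi> u" using L by (simp add: zero_le_mult_iff)
  qed
  moreover have "continuous_on UNIV \<Phi>" unfolding \<Phi>_def using v(1) by (intro continuous_intros)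
  moreover have "\<Phi> (x + 2 * pi) = \<Phi> x + 2 * pi" for x using \<Phi>per[of x 1] by simp
  ultimately have ml: "monotone_lift \<Phi>" by (simp add: monotone_lift_def)
  have lip: "\<bar>H u - H s\<bar> \<le> L * \<bar>\<Phi> u - \<Phi> s\<bar>" for s u
  proof (cases "s \<le> u")
    case True
    then show ?thesis using main[OF True] monoD[OF \<open>mono \<Phi>\<close> True] by simp
  next
    case False
    then have "u \<le> s" by simp
    then show ?thesis using main[of u s] monoD[OF \<open>mono \<Phi>\<close> \<open>u \<le> s\<close>] by (simp add: abs_minus_commute)
  qed
  \<comment> \<open>By \<open>lip\<close>, \<open>H\<close> is constant on the fibers of \<Phi>, so
    the choice of a preimage is immaterial.\<close>
  define G where "G y = H (SOME t. \<Phi> t = y)" for y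
  have G: "G (\<Phi> t) = H t" for t
  proof -
    have "\<Phi> (SOME s. \<Phi> s = \<Phi> t) = \<Phi> t" by (rule someI) simp
    then show ?thesis using lip[of "SOME s. \<Phi> s = \<Phi> t" t] unfolding G_def by simp
  qed
  have "constant_speed E N L G"
    unfolding constant_speed_def
  proof (intro conjI allI)
    show "\<bar>G x - G y\<bar> \<le> L * \<bar>x - y\<bar>" for x y
    proof -
      obtain u s where "\<Phi> u = x" "\<Phi> s = y" using monotone_lift_surj[OF ml] by metis
      then show ?thesis using lip[where u = u and s = s] G by metis
    qed
    show "G (y + 2 * pi) = G y" for y
    proof -
      obtain s where s: "\<Phi> s = y" using monotone_lift_surj[OF ml] by metis
      then have "\<Phi> (s + 2 * pi) = y + 2 * pi" using ml by (simp add: monotone_lift_def)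
      then show ?thesis using G s per[of s 1] by (metis mult.right_neutral of_int_1)
    qed
    have ti: "t i \<in> {a..b}" if "i \<le> r" for i using is_partition_bounds[OF t(1) that] by simp
    have "is_partition 0 (2 * pi) r (\<lambda>i. \<Phi> (t i))"
      using t(1) \<Phi>W[of a] \<Phi>W[of b] W(2) LW L monoD[OF \<open>mono \<Phi>\<close>] unfolding is_partition_def by (auto simp: b_def)
    moreover have "variation G r (\<lambda>i. \<Phi> (t i)) = 2 * pi * L" using Wb LW by (simp add: variation_def G)
    ultimately show "\<exists>r\<le>N. \<exists>t. is_partition 0 (2 * pi) r t \<and> (\<forall>i\<le>r. G (t i) \<in> E) \<and> variation G r t = 2 * pi * L"
      using t G by (intro exI[of _ r] conjI exI[of _ "\<lambda>i. \<Phi> (t i)"]) auto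
  qed (rule L)
  then show ?thesis using that ml G by metis
qed

section \<open>Constant speed functions\<close>

text \<open>The part of \<open>constant_speed\<close> that bounds variation from above; one of the
  two functions in \<open>variation_estimate\<close> enters only through this bound.\<close>

definition lipschitz_periodic :: "real \<Rightarrow> (real \<Rightarrow> real) \<Rightarrow> bool" where
  "lipschitz_periodic L G \<longleftrightarrow> 0 < L \<and> (\<forall>x y. \<bar>G x - G y\<bar> \<le> L * \<bar>x - y\<bar>) \<and> (\<forall>t. G (t + 2 * pi) = G t)"

text \<open>\<open>G\<close> is affine with slope \<open>\<plusminus>L\<close> on each of \<open>n\<close> pieces of the interval from \<open>a\<close> to \<open>b\<close>.\<close>

definition speed_partition :: "real \<Rightarrow> (real \<Rightarrow> real) \<Rightarrow> real \<Rightarrow> real \<Rightarrow> nat \<Rightarrow> bool" where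
  "speed_partition L G a b n \<longleftrightarrow> (\<exists>t. is_partition a b n t \<and> (\<forall>i<n. \<bar>G (t (Suc i)) - G (t i)\<bar> = L * (t (Suc i) - t i)))"

text \<open>The deficits in the Lipschitz bound are nonnegative and sum to 0.\<close>

lemma lip_pieces:
  assumes "\<And>x y. \<bar>G x - G y\<bar> \<le> L * \<bar>x - y\<bar>" "is_partition a b r t" "variation G r t = L * (b - a)" "i < r"
  shows "\<bar>G (t (Suc i)) - G (t i)\<bar> = L * (t (Suc i) - t i)"
proof -
  have le: "0 \<le> L * (t (Suc i) - t i) - \<bar>G (t (Suc i)) - G (t i)\<bar>" if "i < r" for i
    using assms(1)[of "t (Suc i)" "t i"] assms(2) that by (auto simp: is_partition_def)
  have "(\<Sum>i<r. L * (t (Suc i) - t i)) = L * (b - a)"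
    using assms(2) by (simp add: sum_distrib_left[symmetric] sum_lessThan_telescope is_partition_def)
  then have "(\<Sum>i<r. L * (t (Suc i) - t i) - \<bar>G (t (Suc i)) - G (t i)\<bar>) = 0"
    using assms(3) by (simp add: sum_subtractf variation_def)
  then have "\<forall>i\<in>{..<r}. L * (t (Suc i) - t i) - \<bar>G (t (Suc i)) - G (t i)\<bar> = 0"
    using le by (subst (asm) sum_nonneg_eq_0_iff) auto
  then show ?thesis using assms(4) by simp
qed

text \<open>A loss on one part of the interval could not be made up on the other, as the bound is
  attained between the ends.\<close>

lemma lip_linear:
  fixes G :: "real \<Rightarrow> real"
  assumes "\<And>x y. \<bar>G x - G y\<bar> \<le> L * \<bar>x - y\<bar>" "\<bar>G v - G u\<bar> = L * (v - u)" "u \<le> y" "y \<le> v"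
  shows "G y = G u + sgn (G v - G u) * L * (y - u)"
proof -
  have 1: "\<bar>G y - G u\<bar> \<le> L * (y - u)" "\<bar>G v - G y\<bar> \<le> L * (v - y)"
    using assms(1)[of y u] assms(1)[of v y] assms(3,4) by auto
  have 2: "L * (v - u) = L * (v - y) + L * (y - u)" by (simp add: algebra_simps)
  consider "G v - G u > 0" | "G v - G u < 0" | "G v = G u" by linarith
  then show ?thesis
  proof cases
    case 3
    then show ?thesis using assms(2) 1 2 by auto
  qed (use assms(2) 1 2 in auto)
qed

lemma constant_speed_lipschitz_periodic: "constant_speed E N L G \<Longrightarrow> lipschitz_periodic L G"
  by (simp add: constant_speed_def lipschitz_periodic_def)

lemma constant_speed_speed_partition:
  assumes "constant_speed E N L G" obtains r where "r \<le> N" "speed_partition L G 0 (2 * pi) r"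
proof -
  obtain r t where r: "r \<le> N" "is_partition 0 (2 * pi) r t" "variation G r t = 2 * pi * L" using assms unfolding constant_speed_def by blast
  have "speed_partition L G 0 (2 * pi) r" unfolding speed_partition_def
  proof (intro exI[of _ t] conjI allI impI r(2))
    fix i assume "i < r"
    from lip_pieces[OF _ r(2) _ this] show "\<bar>G (t (Suc i)) - G (t i)\<bar> = L * (t (Suc i) - t i)"
      using assms r(3) unfolding constant_speed_def by (simp add: mult.commute)
  qed
  then show ?thesis using that r by blast
qed

lemma speed_partition_shift:
  assumes "lipschitz_periodic L G" "speed_partition L G a b n" shows "speed_partition L G (a + 2 * pi * of_int k) (b + 2 * pi * of_int k) n"
proof -
  obtain t where t: "is_partition a b n t" "\<forall>i<n. \<bar>G (t (Suc i)) - G (t i)\<bar> = L * (t (Suc i) - t i)" using assms(2) by (auto simp: speed_partition_def)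
  have "G (x + 2 * pi * of_int k) = G x" for x using assms(1) by (intro periodic_int) (simp add: lipschitz_periodic_def)
  then show ?thesis unfolding speed_partition_def using t
    by (intro exI[of _ "\<lambda>i. t i + 2 * pi * of_int k"]) (simp add: is_partition_def)
qed

lemma speed_partition_concat:
  assumes "speed_partition L G a b n" "speed_partition L G b c m" shows "speed_partition L G a c (n + m)"
proof -
  obtain t where t: "is_partition a b n t" "\<forall>i<n. \<bar>G (t (Suc i)) - G (t i)\<bar> = L * (t (Suc i) - t i)" using assms(1) by (auto simp: speed_partition_def)
  obtain s where s: "is_partition b c m s" "\<forall>i<m. \<bar>G (s (Suc i)) - G (s i)\<bar> = L * (s (Suc i) - s i)" using assms(2) by (auto simp: speed_partition_def)
  define u where "u i = (if i \<le> n then t i else s (i - n))" for i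
  have u: "(i < n \<and> u i = t i \<and> u (Suc i) = t (Suc i)) \<or> (i - n < m \<and> u i = s (i - n) \<and> u (Suc i) = s (Suc (i - n)))"
    if "i < n + m" for i
  proof (cases "i < n")
    case False
    then have "u i = s (i - n)" using t(1) s(1) by (cases "i = n") (auto simp: u_def is_partition_def)
    then show ?thesis using False that by (auto simp: u_def Suc_diff_le)
  qed (simp add: u_def)
  show ?thesis unfolding speed_partition_def
  proof (intro exI[of _ u] conjI allI impI)
    show "\<bar>G (u (Suc i)) - G (u i)\<bar> = L * (u (Suc i) - u i)" if "i < n + m" for i
      using u[OF that] t(2) s(2) by auto
    show "is_partition a c (n + m) u" unfolding is_partition_def
    proof (intro conjI allI impI)
      show "u 0 = a" using t(1) by (simp add: u_def is_partition_def)
      show "u (n + m) = c" using t(1) s(1) by (auto simp: u_def is_partition_def)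
      show "u i \<le> u (Suc i)" if "i < n + m" for i using u[OF that] t(1) s(1) by (auto simp: is_partition_def)
    qed
  qed
qed

text \<open>The nodes are clamped to the smaller interval. A piece either collapses to a point or
  shrinks to a subinterval on which \<open>G\<close> is still affine with slope \<open>L\<close> or
  \<open>- L\<close>.\<close>

lemma speed_partition_truncate:
  assumes G: "lipschitz_periodic L G" and q: "speed_partition L G a b n" and ab: "a \<le> a'" "a' \<le> b'" "b' \<le> b"
  shows "speed_partition L G a' b' n"
proof -
  obtain t where t: "is_partition a b n t" "\<forall>i<n. \<bar>G (t (Suc i)) - G (t i)\<bar> = L * (t (Suc i) - t i)" using q by (auto simp: speed_partition_def)
  define u where "u i = max a' (min b' (t i))" for i
  show ?thesis unfolding speed_partition_def
  proof (intro exI[of _ u] conjI allI impI)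
    show "is_partition a' b' n u"
      unfolding is_partition_def u_def
    proof (intro conjI allI impI)
      fix i assume "i < n"
      then have "t i \<le> t (Suc i)" using t(1) by (simp add: is_partition_def)
      then show "max a' (min b' (t i)) \<le> max a' (min b' (t (Suc i)))" by auto
    qed (use t(1) ab in \<open>auto simp: is_partition_def\<close>)
    fix i assume i: "i < n"
    then have ti: "t i \<le> t (Suc i)" using t(1) by (simp add: is_partition_def)
    show "\<bar>G (u (Suc i)) - G (u i)\<bar> = L * (u (Suc i) - u i)"
    proof (cases "u i = u (Suc i)")
      case False
      then have b: "t i \<le> u i" "u i \<le> u (Suc i)" "u (Suc i) \<le> t (Suc i)" using ti ab by (auto simp: u_def)
      have lip: "\<And>x y. \<bar>G x - G y\<bar> \<le> L * \<bar>x - y\<bar>" and L: "0 < L" using G by (auto simp: lipschitz_periodic_def)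
      let ?D = "G (t (Suc i)) - G (t i)"
      have "\<bar>?D\<bar> = L * (t (Suc i) - t i)" using t(2) i by blast
      then have e: "G (u i) = G (t i) + sgn ?D * L * (u i - t i)" "G (u (Suc i)) = G (t i) + sgn ?D * L * (u (Suc i) - t i)"
        by (rule lip_linear[OF lip]; use b in linarith)+
      have ne: "?D \<noteq> 0"
      proof
        assume "?D = 0"
        then have "t (Suc i) = t i" using \<open>\<bar>?D\<bar> = L * (t (Suc i) - t i)\<close> L by simp
        then show False using b False by simp
      qed
      have "G (u (Suc i)) - G (u i) = sgn ?D * (L * (u (Suc i) - u i))" unfolding e by (simp add: algebra_simps)
      then have "\<bar>G (u (Suc i)) - G (u i)\<bar> = \<bar>sgn ?D\<bar> * \<bar>L * (u (Suc i) - u i)\<bar>" by (metis abs_mult)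
      moreover have "\<bar>sgn ?D\<bar> = 1" using ne by (simp add: abs_sgn_eq)
      moreover have "0 \<le> L * (u (Suc i) - u i)" using L b by simp
      ultimately show ?thesis by simp
    qed simp
  qed
qed

text \<open>Two consecutive translates of the basic period cover a window of length at most
  \<open>2 * pi\<close>, hence the factor 2.\<close>

lemma constant_speed_speed_partition_window:
  assumes G: "constant_speed E N L G" and ab: "a \<le> b" "b \<le> a + 2 * pi"
  obtains n where "n \<le> 2 * N" "speed_partition L G a b n"
proof -
  obtain r where r: "r \<le> N" "speed_partition L G 0 (2 * pi) r" using constant_speed_speed_partition[OF G] by blast
  obtain k :: int where k: "a + 2 * pi * of_int k \<in> {0..<0 + 2 * pi}" by (rule cis_window)
  have l: "lipschitz_periodic L G" using G by (rule constant_speed_lipschitz_periodic)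
  have "speed_partition L G (0 + 2 * pi * of_int (-k)) (2 * pi + 2 * pi * of_int (-k)) r"
    "speed_partition L G (0 + 2 * pi * of_int (1 - k)) (2 * pi + 2 * pi * of_int (1 - k)) r"
    using speed_partition_shift[OF l r(2)] by blast+
  moreover have "2 * pi + 2 * pi * of_int (-k) = 0 + 2 * pi * of_int (1 - k)" by (simp add: algebra_simps)
  ultimately have q: "speed_partition L G (0 + 2 * pi * of_int (-k)) (2 * pi + 2 * pi * of_int (1 - k)) (r + r)"
    using speed_partition_concat by metis
  have "2 * pi * of_int (1 - k) = 2 * pi - 2 * pi * of_int k" by (simp add: algebra_simps)
  then have "0 + 2 * pi * of_int (-k) \<le> a" "b \<le> 2 * pi + 2 * pi * of_int (1 - k)" using k ab by auto
  then have "speed_partition L G a b (r + r)" using ab(1) by (intro speed_partition_truncate[OF l q])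
  then show ?thesis using that[of "r + r"] r(1) by simp
qed

text \<open>
  The left-hand side is the variation of \<open>G \<circ> \<Phi>\<close>, which is attained on a partition with at most \<open>2 * N\<close>
  pieces; the variation of \<open>G' \<circ> \<Phi>'\<close> is at most the first term on the right.
\<close>

lemma variation_estimate:
  assumes G: "constant_speed E N L G" and G': "lipschitz_periodic L' G'" and m: "monotone_lift \<Phi>" "monotone_lift \<Phi>'"
    and e: "\<And>t. \<bar>G (\<Phi> t) - G' (\<Phi>' t)\<bar> \<le> \<epsilon>" and ab: "a \<le> b" "b \<le> a + 2 * pi"
  shows "L * (\<Phi> b - \<Phi> a) \<le> L' * (\<Phi>' b - \<Phi>' a) + 4 * real N * \<epsilon>"
proof -
  have mono: "mono \<Phi>" "mono \<Phi>'" using m by (auto simp: monotone_lift_def)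
  have "\<Phi> a \<le> \<Phi> b" "\<Phi> b \<le> \<Phi> a + 2 * pi"
    using monoD[OF mono(1) ab(1)] monoD[OF mono(1) ab(2)] m(1) by (auto simp: monotone_lift_def)
  then obtain n where n: "n \<le> 2 * N" "speed_partition L G (\<Phi> a) (\<Phi> b) n" using constant_speed_speed_partition_window[OF G] by blast
  obtain t where t: "is_partition (\<Phi> a) (\<Phi> b) n t" "\<forall>i<n. \<bar>G (t (Suc i)) - G (t i)\<bar> = L * (t (Suc i) - t i)" using n(2) by (auto simp: speed_partition_def)
  \<comment> \<open>A section of \<Phi> over the interval from \<open>\<Phi> a\<close> to
    \<open>\<Phi> b\<close>, clamped to the interval from \<open>a\<close> to \<open>b\<close>. No
    continuity is claimed; it is monotone because \<Phi> is.\<close>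
  define S where "S y = max a (min b (SOME s. \<Phi> s = y))" for y
  have S: "\<Phi> (S y) = y" if "y \<in> {\<Phi> a..\<Phi> b}" for y
  proof -
    define s where "s = (SOME s. \<Phi> s = y)"
    have s: "\<Phi> s = y" unfolding s_def using monotone_lift_surj[OF m(1)] by (rule someI_ex)
    have "s \<le> a \<Longrightarrow> \<Phi> s \<le> \<Phi> a" "b \<le> s \<Longrightarrow> \<Phi> b \<le> \<Phi> s" using monoD[OF mono(1)] by blast+
    then show ?thesis using s that ab(1) unfolding S_def s_def[symmetric] by (auto simp: max_def min_def)
  qed
  have Sab: "S y \<in> {a..b}" for y using ab by (auto simp: S_def)
  have Smono: "S y \<le> S y'" if "y \<in> {\<Phi> a..\<Phi> b}" "y' \<in> {\<Phi> a..\<Phi> b}" "y \<le> y'" for y y'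
  proof (rule ccontr)
    assume n: "\<not> S y \<le> S y'"
    then have "\<Phi> (S y') \<le> \<Phi> (S y)" using monoD[OF mono(1)] by (meson le_cases)
    then have "y' = y" using S that by simp
    then show False using n by simp
  qed
  have tin: "t i \<in> {\<Phi> a..\<Phi> b}" if "i \<le> n" for i using is_partition_bounds[OF t(1) that] by simp
  have eps: "0 \<le> \<epsilon>" using e[of 0] by (meson abs_ge_zero order_trans)
  have "L * (\<Phi> b - \<Phi> a) = (\<Sum>i<n. L * (t (Suc i) - t i))"
    using t(1) by (simp add: sum_distrib_left[symmetric] sum_lessThan_telescope is_partition_def)
  also have "\<dots> = (\<Sum>i<n. \<bar>G (t (Suc i)) - G (t i)\<bar>)" using t(2) by simp
  also have "\<dots> \<le> (\<Sum>i<n. L' * (\<Phi>' (S (t (Suc i))) - \<Phi>' (S (t i))) + 2 * \<epsilon>)"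
  proof (rule sum_mono)
    fix i assume i: "i \<in> {..<n}"
    let ?s = "S (t i)" and ?u = "S (t (Suc i))"
    have eq: "\<Phi> ?s = t i" "\<Phi> ?u = t (Suc i)" using S tin i by auto
    have "\<bar>G (\<Phi> ?u) - G (\<Phi> ?s)\<bar> \<le> \<bar>G' (\<Phi>' ?u) - G' (\<Phi>' ?s)\<bar> + 2 * \<epsilon>"
      using e[of ?u] e[of ?s] by linarith
    also have "\<bar>G' (\<Phi>' ?u) - G' (\<Phi>' ?s)\<bar> \<le> L' * \<bar>\<Phi>' ?u - \<Phi>' ?s\<bar>" using G' by (simp add: lipschitz_periodic_def)
    also have "?s \<le> ?u" using Smono[of "t i" "t (Suc i)"] tin i t(1) by (auto simp: is_partition_def)
    then have "\<bar>\<Phi>' ?u - \<Phi>' ?s\<bar> = \<Phi>' ?u - \<Phi>' ?s" using monoD[OF mono(2)] by force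
    finally show "\<bar>G (t (Suc i)) - G (t i)\<bar> \<le> L' * (\<Phi>' ?u - \<Phi>' ?s) + 2 * \<epsilon>" by (simp add: eq)
  qed
  also have "\<dots> = L' * (\<Phi>' (S (t n)) - \<Phi>' (S (t 0))) + n * (2 * \<epsilon>)"
    by (simp add: sum.distrib sum_distrib_left[symmetric] sum_lessThan_telescope[of "\<lambda>i. \<Phi>' (S (t i))"])
  \<comment> \<open>At most \<open>2 * N\<close> pieces, with an error of at most \<epsilon> at each
    of the two ends, give \<open>4 * N * \<epsilon>\<close>.\<close>
  also have "\<dots> \<le> L' * (\<Phi>' b - \<Phi>' a) + 4 * real N * \<epsilon>"
  proof -
    have "\<Phi>' (S (t n)) \<le> \<Phi>' b" "\<Phi>' a \<le> \<Phi>' (S (t 0))" using monoD[OF mono(2)] Sab by (meson atLeastAtMost_iff)+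
    then have "L' * (\<Phi>' (S (t n)) - \<Phi>' (S (t 0))) \<le> L' * (\<Phi>' b - \<Phi>' a)" using G' by (intro mult_left_mono) (auto simp: lipschitz_periodic_def)
    moreover have "real n \<le> 2 * real N" using n(1) by linarith
    then have "real n * (2 * \<epsilon>) \<le> 2 * real N * (2 * \<epsilon>)" using eps by (intro mult_right_mono) auto
    ultimately show ?thesis by linarith
  qed
  finally show ?thesis .
qed

text \<open>Used in both directions, \<open>variation_estimate\<close> compares arc lengths. Over a
  full period this compares the speeds; for equal speeds it bounds how far
  \<open>\<Phi>' - \<Phi>\<close> is from being constant.\<close>

lemma shift_estimate:
  assumes G: "constant_speed E N L G" and G': "constant_speed E' N L' G'" and m: "monotone_lift \<Phi>" "monotone_lift \<Phi>'"
    and e: "\<And>t. \<bar>G (\<Phi> t) - G' (\<Phi>' t)\<bar> \<le> \<epsilon>"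
  shows "\<bar>L - L'\<bar> \<le> 4 * real N * \<epsilon>"
    and "L = L' \<Longrightarrow> \<bar>\<Phi>' t - \<Phi> t - (\<Phi>' 0 - \<Phi> 0)\<bar> \<le> 4 * real N * \<epsilon> / L"
proof -
  have e': "\<bar>G' (\<Phi>' t) - G (\<Phi> t)\<bar> \<le> \<epsilon>" for t using e[of t] by (simp add: abs_minus_commute)
  have eps: "0 \<le> \<epsilon>" using e[of 0] by (meson abs_ge_zero order_trans)
  have est: "\<bar>L * (\<Phi> b - \<Phi> a) - L' * (\<Phi>' b - \<Phi>' a)\<bar> \<le> 4 * real N * \<epsilon>" if "a \<le> b" "b \<le> a + 2 * pi" for a b
    using variation_estimate[OF G constant_speed_lipschitz_periodic[OF G'] m e that] variation_estimate[OF G' constant_speed_lipschitz_periodic[OF G] m(2,1) e' that] by linarith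
  have "\<bar>L * (2 * pi) - L' * (2 * pi)\<bar> \<le> 4 * real N * \<epsilon>"
    using est[of 0 "0 + 2 * pi"] m unfolding monotone_lift_def by (metis add_diff_cancel_left' order_refl add_0 less_eq_real_def pi_gt_zero zero_less_mult_iff zero_less_numeral)
  then have "\<bar>L - L'\<bar> * (2 * pi) \<le> 4 * real N * \<epsilon>" by (simp add: left_diff_distrib[symmetric] abs_mult)
  moreover have "\<bar>L - L'\<bar> * 1 \<le> \<bar>L - L'\<bar> * (2 * pi)" using pi_gt3 by (intro mult_left_mono) auto
  ultimately show "\<bar>L - L'\<bar> \<le> 4 * real N * \<epsilon>" by (metis mult.right_neutral order_trans)
  show "\<bar>\<Phi>' t - \<Phi> t - (\<Phi>' 0 - \<Phi> 0)\<bar> \<le> 4 * real N * \<epsilon> / L" if LL: "L = L'"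
  proof -
    have L: "0 < L" using G by (simp add: constant_speed_def)
    obtain k :: int where k: "t + 2 * pi * of_int k \<in> {0..<0 + 2 * pi}" by (rule cis_window)
    let ?t = "t + 2 * pi * of_int k"
    have "L * \<bar>\<Phi>' ?t - \<Phi> ?t - (\<Phi>' 0 - \<Phi> 0)\<bar> = \<bar>L * (\<Phi> ?t - \<Phi> 0) - L' * (\<Phi>' ?t - \<Phi>' 0)\<bar>"
    proof -
      have "L * (\<Phi> ?t - \<Phi> 0) - L' * (\<Phi>' ?t - \<Phi>' 0) = - (L * (\<Phi>' ?t - \<Phi> ?t - (\<Phi>' 0 - \<Phi> 0)))"
        unfolding LL[symmetric] by (simp add: algebra_simps)
      then show ?thesis using L by (simp only: abs_minus_cancel abs_mult abs_of_pos)
    qed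
    also have "\<dots> \<le> 4 * real N * \<epsilon>" using est[of 0 ?t] k by simp
    finally have "\<bar>\<Phi>' ?t - \<Phi> ?t - (\<Phi>' 0 - \<Phi> 0)\<bar> \<le> 4 * real N * \<epsilon> / L" using L by (simp add: field_simps)
    moreover have "\<Phi>' ?t - \<Phi> ?t = \<Phi>' t - \<Phi> t" using monotone_lift_shift[OF m(1), of t k] monotone_lift_shift[OF m(2), of t k] by linarith
    ultimately show ?thesis by simp
  qed
qed

text \<open>The case of error 0 in \<open>shift_estimate\<close>: the difference is constant, and
  surjectivity of \<Phi> turns the constant into a period of \<open>G\<close>.\<close>

lemma reparametrisation_unique:
  assumes G: "constant_speed E N L G" and m: "monotone_lift \<Phi>" "monotone_lift \<Phi>'" and e: "\<And>t. G (\<Phi> t) = G (\<Phi>' t)"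
  obtains c where "\<And>t. \<Phi>' t = \<Phi> t + c" "\<And>y. G (y + c) = G y"
proof
  have "\<bar>\<Phi>' t - \<Phi> t - (\<Phi>' 0 - \<Phi> 0)\<bar> \<le> 4 * real N * 0 / L" for t
    by (rule shift_estimate(2)[OF G G m]) (simp_all add: e)
  then show c: "\<Phi>' t = \<Phi> t + (\<Phi>' 0 - \<Phi> 0)" for t by (simp add: algebra_simps)
  show "G (y + (\<Phi>' 0 - \<Phi> 0)) = G y" for y
  proof -
    obtain t where "\<Phi> t = y" using monotone_lift_surj[OF m(1)] by blast
    then show ?thesis using e[of t] c[of t] by simp
  qed
qed

text \<open>Compactness supplies an exact symmetry, which the estimate alone does not. Along a
  sequence of counterexamples with errors tending to 0, the nearly constant shifts, reduced modulo
  \<open>2 * pi\<close>, accumulate at some \<open>s0\<close>, and translation by \<open>s0\<close>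
  relates \<open>G\<close> and \<open>G'\<close> exactly. With \<open>G' = G\<close> this yields
  openness of the orbit map, for two functions the separation of their orbits.\<close>

lemma close_reparametrisations:
  assumes G: "constant_speed E N L G" and G': "constant_speed E' N L' G'" and e: "0 < e"
  shows "\<exists>\<eta>>0. \<forall>\<Phi> \<Phi>'. monotone_lift \<Phi> \<longrightarrow> monotone_lift \<Phi>' \<longrightarrow> (\<forall>t. \<bar>G (\<Phi> t) - G' (\<Phi>' t)\<bar> \<le> \<eta>) \<longrightarrow>
     (\<exists>s. (\<forall>y. G' (y + s) = G y) \<and> (\<forall>t. \<bar>\<Phi> t + s - \<Phi>' t\<bar> \<le> e))"
proof (rule ccontr)
  assume neg: "\<not> ?thesis"
  have "\<exists>\<Phi> \<Phi>'. monotone_lift \<Phi> \<and> monotone_lift \<Phi>' \<and> (\<forall>t. \<bar>G (\<Phi> t) - G' (\<Phi>' t)\<bar> \<le> \<eta>) \<and>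
      \<not> (\<exists>s. (\<forall>y. G' (y + s) = G y) \<and> (\<forall>t. \<bar>\<Phi> t + s - \<Phi>' t\<bar> \<le> e))" if "0 < \<eta>" for \<eta>
    using neg that by blast
  from this[OF inverse_positive_iff_positive[THEN iffD2, OF of_nat_0_less_iff[THEN iffD2, OF zero_less_Suc]]]
  have "\<forall>n. \<exists>\<Phi> \<Phi>'. monotone_lift \<Phi> \<and> monotone_lift \<Phi>' \<and> (\<forall>t. \<bar>G (\<Phi> t) - G' (\<Phi>' t)\<bar> \<le> inverse (real (Suc n))) \<and>
      \<not> (\<exists>s. (\<forall>y. G' (y + s) = G y) \<and> (\<forall>t. \<bar>\<Phi> t + s - \<Phi>' t\<bar> \<le> e))" by blast
  then obtain \<Phi> \<Phi>' where m: "\<And>n. monotone_lift (\<Phi> n)" "\<And>n. monotone_lift (\<Phi>' n)"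
    and d: "\<And>n t. \<bar>G (\<Phi> n t) - G' (\<Phi>' n t)\<bar> \<le> inverse (real (Suc n))"
    and no: "\<And>n. \<not> (\<exists>s. (\<forall>y. G' (y + s) = G y) \<and> (\<forall>t. \<bar>\<Phi> n t + s - \<Phi>' n t\<bar> \<le> e))" by metis
  have L: "0 < L" "0 < L'" using G G' by (auto simp: constant_speed_def)
  have lim0: "(\<lambda>n. inverse (real (Suc n))) \<longlonglongrightarrow> 0" by (rule LIMSEQ_inverse_real_of_nat)
  have "\<bar>L - L'\<bar> \<le> 4 * real N * inverse (real (Suc n))" for n by (rule shift_estimate(1)[OF G G' m d])
  moreover have "(\<lambda>n. 4 * real N * inverse (real (Suc n))) \<longlonglongrightarrow> 4 * real N * 0" by (intro tendsto_intros lim0)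
  ultimately have "\<bar>L - L'\<bar> \<le> 0" by (intro LIMSEQ_le_const) auto
  then have LL: "L = L'" by simp
  have "\<forall>n. \<exists>k::int. (\<Phi>' n 0 - \<Phi> n 0) + 2 * pi * of_int k \<in> {0..<0 + 2 * pi}" using cis_window by metis
  then obtain k :: "nat \<Rightarrow> int" where k: "\<And>n. (\<Phi>' n 0 - \<Phi> n 0) + 2 * pi * of_int (k n) \<in> {0..<0 + 2 * pi}" by metis
  \<comment> \<open>As \<open>G'\<close> is periodic, only the shift modulo \<open>2 * pi\<close>
    matters, and its representative lies in a compact interval.\<close>
  define c where "c n = (\<Phi>' n 0 - \<Phi> n 0) + 2 * pi * of_int (k n)" for n
  have "c n \<in> {0..2 * pi}" for n using k[of n] by (auto simp: c_def)
  then have "\<forall>n. c n \<in> {0..2 * pi}" by blast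
  then obtain s0 \<sigma> where s0: "strict_mono \<sigma>" "(c \<circ> \<sigma>) \<longlonglongrightarrow> s0"
    using compact_Icc[of 0 "2 * pi"] unfolding compact_def by meson
  have per: "G' (y + 2 * pi * of_int j) = G' y" for y j using G' by (intro periodic_int) (simp add: constant_speed_def)
  let ?d = "\<lambda>n. 4 * real N * inverse (real (Suc n)) / L + \<bar>c n - s0\<bar>"
  have close: "\<bar>\<Phi> n t + (s0 - 2 * pi * of_int (k n)) - \<Phi>' n t\<bar> \<le> ?d n" for n t
  proof -
    have "\<bar>\<Phi>' n t - \<Phi> n t - (\<Phi>' n 0 - \<Phi> n 0)\<bar> \<le> 4 * real N * inverse (real (Suc n)) / L"
      by (rule shift_estimate(2)[OF G G' m d LL])
    then show ?thesis unfolding c_def by linarith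
  qed
  have lim: "(\<lambda>n. ?d (\<sigma> n)) \<longlonglongrightarrow> 0"
  proof -
    have "(\<lambda>n. inverse (real (Suc (\<sigma> n)))) \<longlonglongrightarrow> 0" using LIMSEQ_subseq_LIMSEQ[OF lim0 s0(1)] by (simp add: comp_def)
    then have "(\<lambda>n. 4 * real N * inverse (real (Suc (\<sigma> n))) / L + \<bar>c (\<sigma> n) - s0\<bar>) \<longlonglongrightarrow> 4 * real N * 0 / L + \<bar>s0 - s0\<bar>"
      using s0(2) L by (intro tendsto_intros) (auto simp: comp_def)
    then show ?thesis by simp
  qed
  have sym: "G' (y + s0) = G y" for y
  proof -
    have "\<bar>G y - G' (y + s0)\<bar> \<le> inverse (real (Suc n)) + L' * ?d n" for n
    proof -
      obtain t where t: "\<Phi> n t = y" using monotone_lift_surj[OF m(1)] by blast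
      have "\<bar>G' (\<Phi>' n t) - G' (\<Phi> n t + (s0 - 2 * pi * of_int (k n)))\<bar> \<le> L' * \<bar>\<Phi>' n t - (\<Phi> n t + (s0 - 2 * pi * of_int (k n)))\<bar>"
        using G' by (simp add: constant_speed_def)
      also have "\<dots> \<le> L' * ?d n" using close[of n t] L by (intro mult_left_mono) (auto simp: abs_minus_commute)
      finally have 1: "\<bar>G' (\<Phi>' n t) - G' (\<Phi> n t + (s0 - 2 * pi * of_int (k n)))\<bar> \<le> L' * ?d n" .
      have "G' (\<Phi> n t + (s0 - 2 * pi * of_int (k n))) = G' (y + s0)"
        using per[of "\<Phi> n t + (s0 - 2 * pi * of_int (k n))" "k n"] t by (simp add: algebra_simps)
      then have 2: "\<bar>G' (\<Phi>' n t) - G' (y + s0)\<bar> \<le> L' * ?d n" using 1 by (simp only:)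
      have "\<bar>G y - G' (y + s0)\<bar> \<le> \<bar>G (\<Phi> n t) - G' (\<Phi>' n t)\<bar> + \<bar>G' (\<Phi>' n t) - G' (y + s0)\<bar>"
        unfolding t by (rule abs_triangle_ineq[of "G y - G' (\<Phi>' n t)" "G' (\<Phi>' n t) - G' (y + s0)", simplified])
      also have "\<dots> \<le> inverse (real (Suc n)) + L' * ?d n" using d[of n t] 2 by (rule add_mono)
      finally show ?thesis .
    qed
    moreover have "(\<lambda>n. inverse (real (Suc (\<sigma> n))) + L' * ?d (\<sigma> n)) \<longlonglongrightarrow> 0 + L' * 0"
      using LIMSEQ_subseq_LIMSEQ[OF lim0 s0(1)] lim by (intro tendsto_intros) (auto simp: comp_def)
    ultimately have "\<bar>G y - G' (y + s0)\<bar> \<le> 0 + L' * 0" by (intro LIMSEQ_le_const) auto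
    then show ?thesis by simp
  qed
  have "eventually (\<lambda>n. ?d (\<sigma> n) < e) sequentially" using order_tendstoD(2)[OF lim e] .
  then obtain n where n: "?d (\<sigma> n) < e" by (auto simp: eventually_sequentially)
  \<comment> \<open>The lifts themselves are not reduced modulo \<open>2 * pi\<close>, so the
    reduction is undone for the chosen index.\<close>
  have "\<forall>y. G' (y + (s0 - 2 * pi * of_int (k (\<sigma> n)))) = G y"
    using per[of "y + (s0 - 2 * pi * of_int (k (\<sigma> n)))" "k (\<sigma> n)" for y] sym by (simp add: algebra_simps)
  moreover have "\<forall>t. \<bar>\<Phi> (\<sigma> n) t + (s0 - 2 * pi * of_int (k (\<sigma> n))) - \<Phi>' (\<sigma> n) t\<bar> \<le> e"
    using close[of "\<sigma> n"] n by (meson less_imp_le order_trans)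
  ultimately show False using no[of "\<sigma> n"] by blast
qed

text \<open>The number of pieces and the values at the nodes determine \<open>G\<close>: their
  variation gives \<open>L\<close>, the absolute increments divided by \<open>L\<close> give the
  lengths of the pieces, and between nodes \<open>G\<close> is affine.\<close>

lemma finite_constant_speed:
  assumes "finite E" shows "finite {G. \<exists>L. constant_speed E N L G}"
proof -
  let ?P = "\<lambda>L G r t. r \<le> N \<and> is_partition 0 (2 * pi) r t \<and> (\<forall>i\<le>r. G (t i) \<in> E) \<and> variation G r t = 2 * pi * L"
  let ?R = "\<lambda>G p. constant_speed E N (fst p) G \<and> ?P (fst p) G (fst (snd p)) (snd (snd p))"
  have "\<forall>G\<in>{G. \<exists>L. constant_speed E N L G}. \<exists>p. ?R G p"
  proof
    fix G assume "G \<in> {G. \<exists>L. constant_speed E N L G}"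
    then obtain L where u: "constant_speed E N L G" by blast
    then obtain r t where "?P L G r t" unfolding constant_speed_def by auto
    then have "?R G (L, r, t)" using u by simp
    then show "\<exists>p. ?R G p" by blast
  qed
  from bchoice[OF this] obtain p where p: "\<forall>G\<in>{G. \<exists>L. constant_speed E N L G}. ?R G (p G)" ..
  define L r t where "L G = fst (p G)" and "r G = fst (snd (p G))" and "t G = snd (snd (p G))" for G
  have LP: "constant_speed E N (L G) G \<and> ?P (L G) G (r G) (t G)" if "G \<in> {G. \<exists>L. constant_speed E N L G}" for G
    unfolding L_def r_def t_def using p that by (rule bspec)
  define code where "code G = (r G, \<lambda>i\<in>{..N}. if i \<le> r G then G (t G i) else 0)" for G :: "real \<Rightarrow> real"
  have "code ` {G. \<exists>L. constant_speed E N L G} \<subseteq> {..N} \<times> ({..N} \<rightarrow>\<^sub>E insert 0 E)"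
  proof
    fix x assume "x \<in> code ` {G. \<exists>L. constant_speed E N L G}"
    then obtain G where G: "G \<in> {G. \<exists>L. constant_speed E N L G}" "x = code G" by blast
    show "x \<in> {..N} \<times> ({..N} \<rightarrow>\<^sub>E insert 0 E)" using LP[OF G(1)] unfolding G(2) code_def by auto
  qed
  moreover have "finite ({..N} \<times> ({..N} \<rightarrow>\<^sub>E insert 0 E))" using assms by (intro finite_cartesian_product finite_PiE) auto
  ultimately have "finite (code ` {G. \<exists>L. constant_speed E N L G})" by (rule finite_subset)
  moreover have "inj_on code {G. \<exists>L. constant_speed E N L G}"
  proof (rule inj_onI)
    fix G G' assume GG: "G \<in> {G. \<exists>L. constant_speed E N L G}" "G' \<in> {G. \<exists>L. constant_speed E N L G}" and c: "code G = code G'"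
    note u = LP[OF GG(1), THEN conjunct1] LP[OF GG(2), THEN conjunct1]
    note P = LP[OF GG(1), THEN conjunct2] LP[OF GG(2), THEN conjunct2]
    let ?n = "r G"
    have rr: "r G' = ?n" using c by (simp add: code_def)
    have val: "G (t G i) = G' (t G' i)" if "i \<le> ?n" for i
    proof -
      have "i \<le> N" using that P(1) by simp
      moreover have "snd (code G) i = snd (code G') i" using c by simp
      ultimately show ?thesis using that rr by (simp add: code_def)
    qed
    have "variation G ?n (t G) = variation G' ?n (t G')" unfolding variation_def using val by (intro sum.cong) auto
    then have LL: "L G' = L G" using P rr by simp
    have lip: "\<And>x y. \<bar>G x - G y\<bar> \<le> L G * \<bar>x - y\<bar>" "\<And>x y. \<bar>G' x - G' y\<bar> \<le> L G * \<bar>x - y\<bar>" and L0: "0 < L G"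
      using u LL by (auto simp: constant_speed_def)
    have p: "is_partition 0 (2 * pi) ?n (t G)" "is_partition 0 (2 * pi) ?n (t G')" using P rr by auto
    have pc: "\<bar>G (t G (Suc i)) - G (t G i)\<bar> = L G * (t G (Suc i) - t G i)"
        "\<bar>G' (t G' (Suc i)) - G' (t G' i)\<bar> = L G * (t G' (Suc i) - t G' i)" if "i < ?n" for i
      using lip_pieces[OF lip(1) p(1) _ that] lip_pieces[OF lip(2) p(2) _ that] P rr LL by (simp_all add: mult.commute)
    have tt: "t G i = t G' i" if "i \<le> ?n" for i
      using that
    proof (induction i)
      case 0 then show ?case using p by (simp add: is_partition_def)
    next
      case (Suc i)
      then have i: "i < ?n" "i \<le> ?n" by auto
      have "L G * (t G (Suc i) - t G i) = L G * (t G' (Suc i) - t G' i)"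
        by (simp only: pc[OF i(1), symmetric] val[OF i(2)] val[OF Suc.prems])
      then have "t G (Suc i) - t G i = t G' (Suc i) - t G' i" using L0 by (simp only: mult_cancel_left) auto
      then show ?case using Suc.IH[OF i(2)] by simp
    qed
    have eq: "G y = G' y" if y: "0 \<le> y" "y < 2 * pi" for y
    proof -
      obtain i where i: "i < ?n" "t G i \<le> y" "y \<le> t G (Suc i)" using is_partition_piece[OF p(1) y] by blast
      have "G y = G (t G i) + sgn (G (t G (Suc i)) - G (t G i)) * L G * (y - t G i)"
        by (rule lip_linear[OF lip(1) pc(1)[OF i(1)] i(2,3)])
      moreover have "G' y = G' (t G' i) + sgn (G' (t G' (Suc i)) - G' (t G' i)) * L G * (y - t G' i)"
        using i tt by (intro lip_linear[OF lip(2) pc(2)[OF i(1)]]) auto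
      ultimately show ?thesis using val[of i] val[of "Suc i"] tt[of i] i by simp
    qed
    show "G = G'"
    proof
      fix y
      obtain k :: int where k: "y + 2 * pi * of_int k \<in> {0..<0 + 2 * pi}" by (rule cis_window)
      have "G (y + 2 * pi * of_int k) = G y" "G' (y + 2 * pi * of_int k) = G' y"
        using u by (auto intro!: periodic_int simp: constant_speed_def)
      then show "G y = G' y" using eq[of "y + 2 * pi * of_int k"] k by simp
    qed
  qed
  ultimately show ?thesis by (rule finite_imageD)
qed

text \<open>The periods form a group. On a piece of positive length \<open>l\<close> the function is
  injective, so no positive period is shorter than \<open>l\<close>; since \<open>2 * pi\<close> is
  a period, a least positive one exists and generates the group.\<close>

lemma period_exists:
  assumes G: "constant_speed E N L G"
  obtains \<tau> where "0 < \<tau>" "\<And>c. (\<forall>y. G (y + c) = G y) \<longleftrightarrow> (\<exists>k::int. c = of_int k * \<tau>)"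
proof -
  let ?S = "{c. \<forall>y. G (y + c) = G y}"
  obtain r where "r \<le> N" "speed_partition L G 0 (2 * pi) r" using constant_speed_speed_partition[OF G] by blast
  then obtain t where t: "is_partition 0 (2 * pi) r t" "\<forall>i<r. \<bar>G (t (Suc i)) - G (t i)\<bar> = L * (t (Suc i) - t i)" by (auto simp: speed_partition_def)
  have L: "0 < L" and lip: "\<And>x y. \<bar>G x - G y\<bar> \<le> L * \<bar>x - y\<bar>" using G by (auto simp: constant_speed_def)
  obtain i where i: "i < r" "t i < t (Suc i)"
  proof (rule ccontr)
    assume n: "\<not> thesis"
    have "(\<Sum>i<r. t (Suc i) - t i) \<le> 0" using n that by (intro sum_nonpos) force
    then have "t r - t 0 \<le> 0" by (simp only: sum_lessThan_telescope)
    then show False using t(1) pi_gt_zero unfolding is_partition_def by linarith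
  qed
  define l where "l = t (Suc i) - t i"
  have l: "0 < l" using i by (simp add: l_def)
  have add: "a + b \<in> ?S" if "a \<in> ?S" "b \<in> ?S" for a b using that by (simp add: add.assoc[symmetric])
  have neg: "- a \<in> ?S" if "a \<in> ?S" for a
  proof clarify
    fix y show "G (y + - a) = G y" using that[THEN CollectD, THEN spec, of "y - a"] by simp
  qed
  have mult: "of_int k * a \<in> ?S" if a: "a \<in> ?S" for a and k :: int
  proof (induction k rule: int_induct[of _ 0])
    case (step1 i) then show ?case using add[OF step1(2) a] by (simp add: algebra_simps)
  next
    case (step2 i) then show ?case using add[OF step2(2) neg[OF a]] by (simp add: algebra_simps)
  qed simp
  have small: "c \<ge> l" if c: "c \<in> ?S" "0 < c" for c
  proof (rule ccontr)
    assume "\<not> l \<le> c"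
    then have y: "t i \<le> t i + c" "t i + c \<le> t (Suc i)" using c by (auto simp: l_def)
    let ?D = "G (t (Suc i)) - G (t i)"
    have D: "\<bar>?D\<bar> = L * l" using t(2) i by (simp add: l_def)
    have "G (t i + c) = G (t i) + sgn ?D * L * (t i + c - t i)"
      using lip_linear[OF lip _ y] t(2) i by blast
    moreover have "G (t i + c) = G (t i)" using c(1) by blast
    ultimately have "sgn ?D = 0" using L c(2) by simp
    then have "?D = 0" by (simp only: sgn_eq_0_iff)
    then show False using D L l by simp
  qed
  let ?P = "{c \<in> ?S. 0 < c}"
  have "2 * pi \<in> ?P" using G by (simp add: constant_speed_def)
  then have ne: "?P \<noteq> {}" by blast
  have bdd: "bdd_below ?P" by (rule bdd_belowI[of _ 0]) auto
  \<comment> \<open>A period within \<open>l\<close> of the infimum is already least: a smaller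
    positive one would differ from it by a positive period below \<open>l\<close>.\<close>
  obtain \<tau> where \<tau>: "\<tau> \<in> ?P" "\<tau> < Inf ?P + l"
    using cInf_lessD[OF ne, of "Inf ?P + l"] l by auto
  have least: "\<tau> \<le> c" if "c \<in> ?P" for c
  proof (rule ccontr)
    assume n: "\<not> \<tau> \<le> c"
    have "\<tau> - c \<in> ?S" using add[of \<tau> "- c"] neg[of c] \<tau>(1) that by simp
    then have "l \<le> \<tau> - c" using small n by simp
    moreover have "Inf ?P \<le> c" by (rule cInf_lower[OF that bdd])
    ultimately show False using \<tau>(2) by simp
  qed
  show ?thesis
  proof
    show "0 < \<tau>" using \<tau> by simp
    show "(\<forall>y. G (y + c) = G y) \<longleftrightarrow> (\<exists>k::int. c = of_int k * \<tau>)" for c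
    proof
      assume "\<forall>y. G (y + c) = G y"
      then have c: "c \<in> ?S" by simp
      define k where "k = \<lfloor>c / \<tau>\<rfloor>"
      have "\<tau> \<in> ?S" using \<tau> by simp
      from add[OF c neg[OF mult[OF this, of k]]] have d: "c - of_int k * \<tau> \<in> ?S" by simp
      have "of_int k \<le> c / \<tau>" "c / \<tau> < of_int k + 1" unfolding k_def by linarith+
      then have "0 \<le> c - of_int k * \<tau>" "c - of_int k * \<tau> < \<tau>" using \<open>0 < \<tau>\<close> by (auto simp: field_simps)
      then have "c - of_int k * \<tau> = 0" using least[of "c - of_int k * \<tau>"] d by force
      then show "\<exists>k::int. c = of_int k * \<tau>" by (intro exI[of _ k]) simp
    next
      assume "\<exists>k::int. c = of_int k * \<tau>"
      then show "\<forall>y. G (y + c) = G y" using mult \<tau>(1) by blast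
    qed
  qed
qed

section \<open>The compact-open topology and uniform convergence\<close>

lemma cmapsD: "f \<in> cmaps X Y \<Longrightarrow> continuous_map X Y f" "f \<in> cmaps X Y \<Longrightarrow> f \<in> extensional (topspace X)"
  by (auto simp: cmaps_def)

lemma openin_compact_open_subbasic:
  assumes "compactin X K" "openin Y U"
  shows "openin (compact_open_topology X Y) {f \<in> cmaps X Y. f ` K \<subseteq> U}"
  unfolding compact_open_topology_def using assms by (intro topology_generated_by_Basis) blast

text \<open>Finitely many of the sets \<open>O' x\<close> cover the compact space, and on the
  compact set \<open>K x\<close> the condition \<open>V x\<close> keeps \<open>g\<close> near
  \<open>f x\<close>. The radii \<open>e / 3\<close> and \<open>e / 2\<close> add up to less than
  \<open>e\<close>.\<close>

lemma compact_open_uniform_nbhd: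
  fixes f :: "'a \<Rightarrow> 'b::metric_space"
  assumes X: "compact_space X" and f: "f \<in> cmaps X (top_of_set S)" and e: "0 < e"
  obtains U where "openin (compact_open_topology X (top_of_set S)) U" "f \<in> U" "U \<subseteq> cmaps X (top_of_set S)"
    "\<And>g x. g \<in> U \<Longrightarrow> x \<in> topspace X \<Longrightarrow> dist (g x) (f x) < e"
proof -
  let ?Y = "top_of_set S"
  have circle_fun: "continuous_map X euclidean f" and fS: "\<And>x. x \<in> topspace X \<Longrightarrow> f x \<in> S"
    using cmapsD(1)[OF f] by (auto simp: continuous_map_in_subtopology)
  define O' where "O' x = {y \<in> topspace X. f y \<in> ball (f x) (e / 3)}" for x
  define K where "K x = {y \<in> topspace X. f y \<in> cball (f x) (e / 3)}" for x
  have "openin X (O' x)" for x unfolding O'_def by (rule openin_continuous_map_preimage[OF circle_fun]) simp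
  moreover have "topspace X \<subseteq> \<Union> (O' ` topspace X)" using e by (auto simp: O'_def)
  ultimately obtain \<F> where F: "finite \<F>" "\<F> \<subseteq> O' ` topspace X" "topspace X \<subseteq> \<Union>\<F>"
    using X unfolding compact_space_alt by (metis (no_types, lifting) image_iff)
  then obtain A where A: "finite A" "A \<subseteq> topspace X" "\<F> = O' ` A" by (meson finite_subset_image)
  have K: "compactin X (K x)" for x
    unfolding K_def by (intro closedin_compact_space[OF X] closedin_continuous_map_preimage[OF circle_fun]) simp
  define V where "V x = {g \<in> cmaps X ?Y. g ` K x \<subseteq> S \<inter> ball (f x) (e / 2)}" for x
  have V: "openin (compact_open_topology X ?Y) (V x)" for x
    unfolding V_def by (intro openin_compact_open_subbasic K) (simp add: openin_open_Int)
  let ?U = "cmaps X ?Y \<inter> \<Inter> (V ` A)"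
  show ?thesis
  proof
    have top: "openin (compact_open_topology X ?Y) (cmaps X ?Y)"
      using openin_topspace[of "compact_open_topology X ?Y"] by simp
    show "openin (compact_open_topology X ?Y) ?U"
    proof (cases "A = {}")
      case False
      then show ?thesis using A(1) V by (intro openin_Int[OF top] openin_Inter) auto
    qed (use top in simp)
    have "f \<in> V x" for x using f fS e unfolding V_def K_def by (auto simp: dist_commute)
    then show "f \<in> ?U" using f by blast
    show "dist (g x) (f x) < e" if g: "g \<in> ?U" and x: "x \<in> topspace X" for g x
    proof -
      obtain a where a: "a \<in> A" "x \<in> O' a" using F(3) A(3) x by blast
      then have "g \<in> V a" "x \<in> K a" "dist (f a) (f x) < e / 3" using g by (auto simp: O'_def K_def)
      then have "dist (f a) (g x) < e / 2" unfolding V_def by auto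
      then show ?thesis using dist_triangle3[of "g x" "f x" "f a"] \<open>dist (f a) (f x) < e / 3\<close> e by linarith
    qed
  qed simp
qed

text \<open>The compact image of \<open>K\<close> has a neighbourhood of positive radius inside the
  open set, so uniformly small changes stay in it.\<close>

lemma continuous_map_into_compact_open:
  fixes N :: "'m::metric_space \<Rightarrow> 'a \<Rightarrow> 'b::metric_space"
  assumes N: "\<And>h. h \<in> A \<Longrightarrow> N h \<in> cmaps X (top_of_set S)"
    and cont: "\<And>h e. h \<in> A \<Longrightarrow> 0 < e \<Longrightarrow> \<exists>d>0. \<forall>h'\<in>A. dist h' h < d \<longrightarrow> (\<forall>x\<in>topspace X. dist (N h' x) (N h x) < e)"
  shows "continuous_map (top_of_set A) (compact_open_topology X (top_of_set S)) N"
  unfolding compact_open_topology_def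
proof (rule continuous_on_generated_topo)
  show "N ` topspace (top_of_set A) \<subseteq> \<Union> {{f \<in> cmaps X (top_of_set S). f ` K \<subseteq> U} | K U. compactin X K \<and> openin (top_of_set S) U}"
  proof clarify
    fix h assume "h \<in> topspace (top_of_set A)"
    then have "N h \<in> {f \<in> cmaps X (top_of_set S). f ` {} \<subseteq> {}}" using N by simp
    then show "N h \<in> \<Union> {{f \<in> cmaps X (top_of_set S). f ` K \<subseteq> U} | K U. compactin X K \<and> openin (top_of_set S) U}"
      using compactin_empty openin_empty by blast
  qed
  fix W assume "W \<in> {{f \<in> cmaps X (top_of_set S). f ` K \<subseteq> U} | K U. compactin X K \<and> openin (top_of_set S) U}"
  then obtain K U where KU: "compactin X K" "openin (top_of_set S) U" "W = {f \<in> cmaps X (top_of_set S). f ` K \<subseteq> U}" by blast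
  obtain V where V: "open V" "U = S \<inter> V" using KU(2) by (auto simp: openin_open)
  have KX: "K \<subseteq> topspace X" using KU(1) by (rule compactin_subset_topspace)
  have "\<exists>d>0. \<forall>h'\<in>A. dist h' h < d \<longrightarrow> h' \<in> N -` W \<inter> topspace (top_of_set A)"
    if h: "h \<in> N -` W \<inter> topspace (top_of_set A)" for h
  proof -
    have hA: "h \<in> A" and hK: "N h ` K \<subseteq> V" using h KU(3) V(2) by auto
    have "continuous_map X euclidean (N h)" using cmapsD(1)[OF N[OF hA]] by (simp add: continuous_map_in_subtopology)
    then have "compact (N h ` K)" using image_compactin[OF KU(1)] by fastforce
    then obtain e where e: "0 < e" "(\<Union>x\<in>N h ` K. ball x e) \<subseteq> V"
      using compact_subset_open_imp_ball_epsilon_subset[OF _ V(1) hK] by blast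
    obtain d where d: "0 < d" "\<forall>h'\<in>A. dist h' h < d \<longrightarrow> (\<forall>x\<in>topspace X. dist (N h' x) (N h x) < e)"
      using cont[OF hA e(1)] by blast
    have "h' \<in> N -` W \<inter> topspace (top_of_set A)" if h': "h' \<in> A" "dist h' h < d" for h'
    proof -
      have "N h' x \<in> V" if "x \<in> K" for x
      proof -
        have "dist (N h' x) (N h x) < e" using d(2) h' that KX by blast
        then have "N h' x \<in> ball (N h x) e" by (simp add: dist_commute)
        then show ?thesis using e(2) that by blast
      qed
      moreover have "N h' x \<in> S" if "x \<in> K" for x
        using cmapsD(1)[OF N[OF h'(1)]] that KX by (auto simp: continuous_map_in_subtopology)
      ultimately show ?thesis using h' N by (auto simp: KU(3) V(2))
    qed
    then show ?thesis using d(1) by blast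
  qed
  then show "openin (top_of_set A) (N -` W \<inter> topspace (top_of_set A))"
    unfolding openin_euclidean_subtopology_iff by auto
qed

lemma continuous_map_into_metric:
  fixes f :: "'a \<Rightarrow> 'b::metric_space"
  assumes "\<And>x. x \<in> topspace X \<Longrightarrow> f x \<in> S"
    and nb: "\<And>x e. x \<in> topspace X \<Longrightarrow> 0 < e \<Longrightarrow> \<exists>U. openin X U \<and> x \<in> U \<and> (\<forall>y\<in>U. dist (f y) (f x) < e)"
  shows "continuous_map X (top_of_set S) f"
proof -
  have "openin X {x \<in> topspace X. f x \<in> V}" if V: "open V" for V
  proof (subst openin_subopen, intro ballI)
    fix x assume x: "x \<in> {x \<in> topspace X. f x \<in> V}"
    then obtain e where e: "0 < e" "ball (f x) e \<subseteq> V" using V by (auto simp: open_contains_ball)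
    obtain U where U: "openin X U" "x \<in> U" "\<forall>y\<in>U. dist (f y) (f x) < e" using nb[OF _ e(1)] x by blast
    have "U \<subseteq> {x \<in> topspace X. f x \<in> V}"
      using U(3) e(2) openin_subset[OF U(1)] by (auto simp: dist_commute subset_iff)
    then show "\<exists>T. openin X T \<and> x \<in> T \<and> T \<subseteq> {x \<in> topspace X. f x \<in> V}" using U by blast
  qed
  then have "continuous_map X euclidean f" by (auto simp: continuous_map_def)
  then show ?thesis using assms(1) by (auto simp: continuous_map_in_subtopology)
qed

text \<open>Preimages of subbasic sets are subbasic: \<open>K\<close> stays and \<open>U\<close> is
  replaced by its preimage under \<open>g\<close>.\<close>

lemma continuous_map_compose_compact_open:
  assumes "continuous_map Y Z g"
  shows "continuous_map (compact_open_topology X Y) (compact_open_topology X Z) (compose (topspace X) g)"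
proof -
  have comp: "compose (topspace X) g \<phi> \<in> cmaps X Z" if "\<phi> \<in> cmaps X Y" for \<phi>
    using continuous_map_compose[OF cmapsD(1)[OF that] assms]
    by (auto simp: cmaps_def compose_def elim: continuous_map_eq)
  show ?thesis
    unfolding compact_open_topology_def[of X Z]
  proof (rule continuous_on_generated_topo)
    show "compose (topspace X) g ` topspace (compact_open_topology X Y) \<subseteq> \<Union> {{f \<in> cmaps X Z. f ` K \<subseteq> U} | K U. compactin X K \<and> openin Z U}"
    proof clarify
      fix h assume "h \<in> topspace (compact_open_topology X Y)"
      then have "compose (topspace X) g h \<in> {f \<in> cmaps X Z. f ` {} \<subseteq> {}}" using comp by simp
      then show "compose (topspace X) g h \<in> \<Union> {{f \<in> cmaps X Z. f ` K \<subseteq> U} | K U. compactin X K \<and> openin Z U}"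
        using compactin_empty openin_empty by blast
    qed
    fix W assume "W \<in> {{f \<in> cmaps X Z. f ` K \<subseteq> U} | K U. compactin X K \<and> openin Z U}"
    then obtain K U where KU: "compactin X K" "openin Z U" "W = {f \<in> cmaps X Z. f ` K \<subseteq> U}" by blast
    have KX: "K \<subseteq> topspace X" using KU(1) by (rule compactin_subset_topspace)
    have "compose (topspace X) g -` W \<inter> topspace (compact_open_topology X Y)
        = {\<phi> \<in> cmaps X Y. \<phi> ` K \<subseteq> {y \<in> topspace Y. g y \<in> U}}"
    proof (intro equalityI subsetI)
      fix \<phi> assume p: "\<phi> \<in> compose (topspace X) g -` W \<inter> topspace (compact_open_topology X Y)"
      then have c: "\<phi> \<in> cmaps X Y" "compose (topspace X) g \<phi> ` K \<subseteq> U" using KU(3) by auto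
      then have "\<phi> x \<in> topspace Y \<and> g (\<phi> x) \<in> U" if "x \<in> K" for x
        using that KX cmapsD(1)[OF c(1)] by (auto simp: compose_def continuous_map_def)
      then show "\<phi> \<in> {\<phi> \<in> cmaps X Y. \<phi> ` K \<subseteq> {y \<in> topspace Y. g y \<in> U}}" using c by auto
    next
      fix \<phi> assume "\<phi> \<in> {\<phi> \<in> cmaps X Y. \<phi> ` K \<subseteq> {y \<in> topspace Y. g y \<in> U}}"
      then show "\<phi> \<in> compose (topspace X) g -` W \<inter> topspace (compact_open_topology X Y)"
        using comp KX by (auto simp: KU(3) compose_def)
    qed
    then show "openin (compact_open_topology X Y) (compose (topspace X) g -` W \<inter> topspace (compact_open_topology X Y))"
      using openin_compact_open_subbasic[OF KU(1) openin_continuous_map_preimage[OF assms KU(2)]] by simp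
  qed
qed

section \<open>Functions on the circle as periodic functions\<close>

abbreviation bfun :: "(real \<Rightarrow>\<^sub>C real) \<Rightarrow> real \<Rightarrow> real" where "bfun \<equiv> apply_bcontfun"

text \<open>The model of the real functions on the circle inside the bounded continuous functions on
  the line; by \<open>homeomorphic_maps_lift\<close> the supremum metric describes the compact-open
  topology.\<close>

definition periodic :: "(real \<Rightarrow>\<^sub>C real) set" where
  "periodic = {u. \<forall>t. bfun u (t + 2 * pi) = bfun u t}"

text \<open>\<open>circle_fun u\<close> is only meaningful for \<open>2 * pi\<close>-periodic \<open>u\<close>, for which the choice of \<^const>\<open>Arg\<close> does not matter.\<close>

definition circle_fun :: "(real \<Rightarrow> 'b) \<Rightarrow> complex \<Rightarrow> 'b" where
  "circle_fun u = restrict (\<lambda>z. u (Arg z)) (sphere 0 1)"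

lemma circle_fun_extensional [simp]: "circle_fun u \<in> extensional (sphere 0 1)"
  by (simp add: circle_fun_def)

lemma circle_fun_cis:
  assumes "\<And>t. u (t + 2 * pi) = u t" shows "circle_fun u (cis t) = u t"
proof -
  have shift: "u (s + 2 * pi * of_int k) = u s" for s and k :: int
  proof (induction k rule: int_induct[of _ 0])
    case (step1 i)
    then show ?case using assms[of "s + 2 * pi * of_int i"] by (simp add: algebra_simps)
  next
    case (step2 i)
    then show ?case using assms[of "s + 2 * pi * of_int (i - 1)"] by (simp add: algebra_simps)
  qed simp
  have "cis t \<in> sphere 0 1" by simp
  then have "cis t = cis (Arg (cis t))" by (rule sphere_cis)
  then obtain k :: int where "t = Arg (cis t) + 2 * pi * of_int k" using cis_eq_iff by blast
  then have "u t = u (Arg (cis t))" using shift by metis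
  then show ?thesis by (simp add: circle_fun_def)
qed

lemma circle_fun_eqI:
  assumes "f \<in> extensional (sphere 0 1)" "\<And>t. u (t + 2 * pi) = u t" "\<And>t. f (cis t) = u t"
  shows "f = circle_fun u"
proof (rule extensionalityI[OF assms(1) circle_fun_extensional])
  fix z :: complex assume "z \<in> sphere 0 1"
  then obtain t where "z = cis t" by (rule sphere_cisE)
  then show "f z = circle_fun u z" using assms(3) circle_fun_cis[of u, OF assms(2)] by simp
qed

lemma circle_fun_cmaps:
  assumes "continuous_on UNIV u" "\<And>t. u (t + 2 * pi) = u t" "\<And>t. u t \<in> S"
  shows "circle_fun u \<in> cmaps circle (top_of_set S)"
proof -
  have "continuous_on {0..0 + 2 * pi} (\<lambda>t. circle_fun u (cis t))"
    unfolding circle_fun_cis[of u, OF assms(2)] using assms(1) continuous_on_subset by blast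
  then have "continuous_on (sphere 0 1) (circle_fun u)" by (rule continuous_on_circle)
  moreover have "circle_fun u z \<in> S" if "z \<in> sphere 0 1" for z
    using that assms(3) by (simp add: circle_fun_def)
  ultimately show ?thesis by (auto simp: cmaps_def continuous_map_in_subtopology)
qed

lemma compact_circle: "compact_space circle"
  by (simp add: compact_space_subtopology)

lemma circle_function_lift:
  assumes "f \<in> cmaps circle (euclidean :: 'b::real_normed_vector topology)"
  shows "(\<lambda>t. f (cis t)) \<in> bcontfun"
proof -
  have c: "continuous_on (sphere 0 1) f" using cmapsD(1)[OF assms] by simp
  have "continuous_on UNIV (\<lambda>t. f (cis t))"
    by (rule continuous_on_compose2[OF c]) (auto intro!: continuous_intros)
  moreover have "bounded (f ` sphere 0 1)" using c by (intro compact_imp_bounded compact_continuous_image) auto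
  then have "bounded (range (\<lambda>t. f (cis t)))" by (rule bounded_subset) auto
  ultimately show ?thesis by (simp add: bcontfun_def)
qed

definition lift :: "(complex \<Rightarrow> real) \<Rightarrow> real \<Rightarrow>\<^sub>C real" where
  "lift f = Bcontfun (\<lambda>t. f (cis t))"

lemma lift_apply: "f \<in> cmaps circle euclideanreal \<Longrightarrow> bfun (lift f) t = f (cis t)"
  unfolding lift_def by (simp add: Bcontfun_inverse circle_function_lift)

lemma homeomorphic_maps_lift:
  "homeomorphic_maps circle_functions (top_of_set periodic) lift (\<lambda>u. circle_fun (bfun u))"
proof -
  have cfc: "circle_fun (bfun u) \<in> cmaps circle euclideanreal" if "u \<in> periodic" for u
    using circle_fun_cmaps[of "bfun u" UNIV] that by (auto simp: periodic_def)
  have cfs: "circle_fun (bfun u) (cis t) = bfun u t" if "u \<in> periodic" for u t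
    using that by (intro circle_fun_cis) (simp add: periodic_def)
  have lp: "lift f \<in> periodic" if "f \<in> cmaps circle euclideanreal" for f
  proof -
    have "cis (t + 2 * pi) = cis t" for t using cis_shift[of t 1] by simp
    then show ?thesis using lift_apply[OF that] by (simp add: periodic_def)
  qed
  have "continuous_map circle_functions (top_of_set periodic) lift"
  proof (rule continuous_map_into_metric)
    show "lift f \<in> periodic" if "f \<in> topspace circle_functions" for f using lp that by simp
    fix f and e :: real assume f: "f \<in> topspace circle_functions" and e: "0 < e"
    then have fc: "f \<in> cmaps circle (top_of_set UNIV)" by simp
    obtain U where U: "openin (compact_open_topology circle (top_of_set UNIV)) U" "f \<in> U" "U \<subseteq> cmaps circle (top_of_set UNIV)"
      "\<And>g x. g \<in> U \<Longrightarrow> x \<in> topspace circle \<Longrightarrow> dist (g x) (f x) < e / 2"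
      using compact_open_uniform_nbhd[OF compact_circle fc, of "e / 2"] e by auto
    have "dist (lift g) (lift f) < e" if g: "g \<in> U" for g
    proof -
      \<comment> \<open>Passing to the supremum turns the strict pointwise bound into a weak one,
        hence the half.\<close>
      have "dist (lift g) (lift f) \<le> e / 2"
      proof (rule dist_bound)
        fix t
        have gf: "g \<in> cmaps circle euclideanreal" "f \<in> cmaps circle euclideanreal" using U(3) g fc by auto
        show "dist (bfun (lift g) t) (bfun (lift f) t) \<le> e / 2"
          unfolding lift_apply[OF gf(1)] lift_apply[OF gf(2)] using U(4)[OF g, of "cis t"] by simp
      qed
      then show ?thesis using e by simp
    qed
    then show "\<exists>U. openin circle_functions U \<and> f \<in> U \<and> (\<forall>y\<in>U. dist (lift y) (lift f) < e)"
      using U by auto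
  qed
  moreover have "continuous_map (top_of_set periodic) (compact_open_topology circle (top_of_set UNIV)) (\<lambda>u. circle_fun (bfun u))"
  proof (rule continuous_map_into_compact_open)
    show "circle_fun (bfun u) \<in> cmaps circle (top_of_set UNIV)" if "u \<in> periodic" for u using cfc that by simp
    fix h and e :: real assume h: "h \<in> periodic" and e: "0 < e"
    have "dist (circle_fun (bfun h') x) (circle_fun (bfun h) x) < e" if "h' \<in> periodic" "dist h' h < e" "x \<in> topspace circle" for h' x
    proof -
      have "x \<in> sphere 0 1" using that(3) by simp
      then have "dist (circle_fun (bfun h') x) (circle_fun (bfun h) x) = dist (bfun h' (Arg x)) (bfun h (Arg x))" by (simp add: circle_fun_def)
      also have "\<dots> \<le> dist h' h" by (rule dist_bounded)
      finally show ?thesis using that(2) by simp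
    qed
    then show "\<exists>d>0. \<forall>h'\<in>periodic. dist h' h < d \<longrightarrow> (\<forall>x\<in>topspace circle. dist (circle_fun (bfun h') x) (circle_fun (bfun h) x) < e)"
      using e by blast
  qed
  moreover have "circle_fun (bfun (lift f)) = f" if f: "f \<in> cmaps circle euclideanreal" for f
  proof (rule circle_fun_eqI[symmetric])
    show "f \<in> extensional (sphere 0 1)" using cmapsD(2)[OF f] by simp
    show "bfun (lift f) (t + 2 * pi) = bfun (lift f) t" for t using lp[OF f] unfolding periodic_def by blast
    show "f (cis t) = bfun (lift f) t" for t by (rule lift_apply[OF f, symmetric])
  qed
  moreover have "lift (circle_fun (bfun u)) = u" if "u \<in> periodic" for u
    by (rule bcontfun_eqI) (simp only: lift_apply[OF cfc[OF that]] cfs[OF that])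
  ultimately show ?thesis unfolding homeomorphic_maps_def by simp
qed

section \<open>The monoid of monotone maps\<close>

text \<open>A monotone lift \<open>\<Phi>\<close> is represented by the bounded function \<open>\<Phi> t - t\<close>.\<close>

definition mono_shift :: "(real \<Rightarrow>\<^sub>C real) set" where
  "mono_shift = {v \<in> periodic. mono (\<lambda>t. t + bfun v t)}"

definition circle_map :: "(real \<Rightarrow>\<^sub>C real) \<Rightarrow> complex \<Rightarrow> complex" where
  "circle_map v = circle_fun (\<lambda>t. cis (t + bfun v t))"

lemma periodic_apply: "v \<in> periodic \<Longrightarrow> bfun v (t + 2 * pi) = bfun v t"
  by (simp add: periodic_def)

lemma circle_map_periodic: "v \<in> periodic \<Longrightarrow> cis (t + 2 * pi + bfun v (t + 2 * pi)) = cis (t + bfun v t)"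
proof -
  assume "v \<in> periodic"
  then have "t + 2 * pi + bfun v (t + 2 * pi) = (t + bfun v t) + 2 * pi * of_int 1"
    by (simp add: periodic_apply)
  then show ?thesis by (simp only: cis_shift)
qed

lemma circle_map_cis: "v \<in> periodic \<Longrightarrow> circle_map v (cis t) = cis (t + bfun v t)"
  unfolding circle_map_def by (rule circle_fun_cis) (rule circle_map_periodic)

lemma circle_map_cmaps: "v \<in> periodic \<Longrightarrow> circle_map v \<in> cmaps circle circle"
  unfolding circle_map_def by (rule circle_fun_cmaps) (auto intro!: continuous_intros circle_map_periodic)

lemma mono_shift_monotone_lift: "v \<in> mono_shift \<Longrightarrow> monotone_lift (\<lambda>t. t + bfun v t)"
  by (auto simp: mono_shift_def monotone_lift_def periodic_apply intro!: continuous_intros)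

lemma monotone_lift_mono_shift:
  assumes "monotone_lift \<Phi>" obtains v where "v \<in> mono_shift" "\<And>t. \<Phi> t = t + bfun v t"
proof -
  let ?v = "\<lambda>t. \<Phi> t - t"
  have p: "?v (t + 2 * pi) = ?v t" for t using assms by (simp add: monotone_lift_def)
  have c: "continuous_on UNIV ?v" using assms by (auto simp: monotone_lift_def intro!: continuous_intros)
  have "circle_fun ?v \<in> cmaps circle (top_of_set UNIV)" by (rule circle_fun_cmaps[OF c p]) simp
  then have "(\<lambda>t. circle_fun ?v (cis t)) \<in> bcontfun" by (intro circle_function_lift) simp
  then have b: "?v \<in> bcontfun" unfolding circle_fun_cis[of ?v, OF p] .
  show ?thesis
  proof
    show e: "\<Phi> t = t + bfun (Bcontfun ?v) t" for t using b by (simp add: Bcontfun_inverse)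
    show "Bcontfun ?v \<in> mono_shift" using assms p b by (simp add: mono_shift_def periodic_def Bcontfun_inverse monotone_lift_def)
  qed
qed

lemma dist_cis: "dist (cis a) (cis b) \<le> \<bar>a - b\<bar>"
proof -
  have "norm (cis a - cis b) \<le> 1 * norm (a - b)"
  proof (rule differentiable_bound[of UNIV cis "\<lambda>x h. h *\<^sub>R (\<i> * cis x)"])
    show "(cis has_derivative (\<lambda>h. h *\<^sub>R (\<i> * cis x))) (at x within UNIV)" for x
      by (auto intro!: derivative_eq_intros)
    show "onorm (\<lambda>h. h *\<^sub>R (\<i> * cis x)) \<le> 1" for x
      by (rule onorm_bound) (auto simp: norm_mult)
  qed auto
  then show ?thesis by (simp add: dist_norm)
qed

lemma continuous_map_circle_map:
  assumes "A \<subseteq> periodic"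
  shows "continuous_map (top_of_set A) (compact_open_topology circle circle) circle_map"
proof (rule continuous_map_into_compact_open)
  show "circle_map h \<in> cmaps circle circle" if "h \<in> A" for h using circle_map_cmaps assms that by blast
  fix h and e :: real assume h: "h \<in> A" and e: "0 < e"
  have "dist (circle_map h' x) (circle_map h x) < e" if "h' \<in> A" "dist h' h < e" "x \<in> topspace circle" for h' x
  proof -
    have "x \<in> sphere 0 1" using that(3) by simp
    then obtain t where t: "x = cis t" by (rule sphere_cisE)
    have p: "h \<in> periodic" "h' \<in> periodic" using h that assms by auto
    have "dist (circle_map h' x) (circle_map h x) \<le> \<bar>(t + bfun h' t) - (t + bfun h t)\<bar>"
      unfolding t circle_map_cis[OF p(1)] circle_map_cis[OF p(2)] by (rule dist_cis)
    also have "\<dots> = dist (bfun h' t) (bfun h t)" by (simp add: dist_real_def)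
    also have "\<dots> \<le> dist h' h" by (rule dist_bounded)
    finally show ?thesis using that(2) by simp
  qed
  then show "\<exists>d>0. \<forall>h'\<in>A. dist h' h < d \<longrightarrow> (\<forall>x\<in>topspace circle. dist (circle_map h' x) (circle_map h x) < e)"
    using e by blast
qed

lemma circle_map_Aut:
  assumes "v \<in> periodic" "strict_mono (\<lambda>t. t + bfun v t)"
  shows "circle_map v \<in> circle_Aut"
proof -
  let ?F = "\<lambda>t. t + bfun v t"
  have vm: "v \<in> mono_shift" using assms by (simp add: mono_shift_def strict_mono_mono)
  have c: "continuous_map circle circle (circle_map v)" using cmapsD(1)[OF circle_map_cmaps[OF assms(1)]] .
  have "homeomorphic_map circle circle (circle_map v)"
  proof (rule continuous_imp_homeomorphic_map[OF c])
    show "compact_space circle" by (rule compact_circle)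
    show "Hausdorff_space circle" by (simp add: Hausdorff_space_subtopology)
    show "circle_map v ` topspace circle = topspace circle"
    proof
      show "circle_map v ` topspace circle \<subseteq> topspace circle" using c by (auto simp: continuous_map_def)
      show "topspace circle \<subseteq> circle_map v ` topspace circle"
      proof
        fix z :: complex assume "z \<in> topspace circle"
        then have "z \<in> sphere 0 1" by simp
        then obtain y where y: "z = cis y" by (rule sphere_cisE)
        obtain t where "?F t = y" using monotone_lift_surj[OF mono_shift_monotone_lift[OF vm]] by blast
        then show "z \<in> circle_map v ` topspace circle"
          by (intro image_eqI[of _ _ "cis t"]) (simp_all add: y circle_map_cis[OF assms(1)])
      qed
    qed
    show "inj_on (circle_map v) (topspace circle)"
    proof (rule inj_onI)
      fix z w assume zw: "z \<in> topspace circle" "w \<in> topspace circle" "circle_map v z = circle_map v w"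
      have "z \<in> sphere 0 1" "w \<in> sphere 0 1" using zw by auto
      then obtain s t where st: "z = cis s" "w = cis t" using sphere_cisE by metis
      have "cis (?F s) = cis (?F t)" using zw(3) by (simp add: st circle_map_cis[OF assms(1)])
      then obtain k :: int where "?F s = ?F t + 2 * pi * of_int k" using cis_eq_iff by blast
      then have "?F s = ?F (t + 2 * pi * of_int k)" using monotone_lift_shift[OF mono_shift_monotone_lift[OF vm], of t k] by simp
      then have "s = t + 2 * pi * of_int k" using strict_mono_eq[OF assms(2)] by blast
      then show "z = w" by (simp add: st)
    qed
  qed
  moreover have "circle_map v \<in> extensional (sphere 0 1)" by (simp add: circle_map_def)
  moreover have "continuous_on UNIV ?F" by (intro continuous_intros continuous_on_apply_bcontfun)
  ultimately show ?thesis
    unfolding circle_Aut_def using assms(2) circle_map_cis[OF assms(1)] by blast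
qed

text \<open>The increment is \<open>2 * pi\<close> times an integer \<open>k\<close>, positive since
  \<open>F\<close> increases. For \<open>k > 1\<close> the intermediate value theorem gives a point
  strictly inside the period where \<open>F\<close> has grown by \<open>2 * pi\<close>, against
  injectivity of \<phi>.\<close>

lemma Aut_lift_shift:
  assumes inj: "inj_on \<phi> (sphere 0 1)" and F: "continuous_on UNIV F" "strict_mono F" "\<And>t. \<phi> (cis t) = cis (F t)"
  shows "F (t + 2 * pi) = F t + 2 * pi"
proof -
  have "cis (t + 2 * pi) = cis t" using cis_shift[of t 1] by simp
  then have "cis (F (t + 2 * pi)) = cis (F t)" using F(3)[of t] F(3)[of "t + 2 * pi"] by simp
  then obtain k :: int where k: "F (t + 2 * pi) = F t + 2 * pi * of_int k" using cis_eq_iff by blast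
  have "F t < F (t + 2 * pi)" using strict_monoD[OF F(2), of t "t + 2 * pi"] by simp
  then have "0 < 2 * pi * of_int k" using k by simp
  then have "0 < k" by (simp add: zero_less_mult_iff)
  moreover have "\<not> 1 < k"
  proof
    assume "1 < k"
    then have "2 * pi * 1 < 2 * pi * of_int k" by (intro mult_strict_left_mono) auto
    then have lt: "F t + 2 * pi < F (t + 2 * pi)" using k by simp
    have "continuous_on {t..t + 2 * pi} F" using F(1) continuous_on_subset by blast
    then obtain s where s: "t \<le> s" "s \<le> t + 2 * pi" "F s = F t + 2 * pi"
      using IVT'[of F t "F t + 2 * pi" "t + 2 * pi"] lt by auto
    have "cis (F s) = cis (F t)" using cis_shift[of "F t" 1] s(3) by simp
    then have "\<phi> (cis s) = \<phi> (cis t)" by (simp add: F(3))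
    then have "cis s = cis t" using inj by (auto dest: inj_onD)
    then obtain j :: int where j: "s = t + 2 * pi * of_int j" using cis_eq_iff by blast
    have ne: "s \<noteq> t" "s \<noteq> t + 2 * pi" using s(3) lt by auto
    have "2 * pi * 0 \<le> 2 * pi * of_int j" "2 * pi * of_int j \<le> 2 * pi * 1" using j s by auto
    from this(1) have "(0::real) \<le> of_int j" by (rule mult_left_le_imp_le) simp
    moreover from \<open>2 * pi * of_int j \<le> 2 * pi * 1\<close> have "of_int j \<le> (1::real)" by (rule mult_left_le_imp_le) simp
    ultimately have "j = 0 \<or> j = 1" by linarith
    then show False
    proof
      assume "j = 0" then show False using j ne(1) by simp
    next
      assume "j = 1" then show False using j ne(2) by simp
    qed
  qed
  ultimately have "k = 1" by simp
  then show ?thesis using k by simp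
qed

lemma Arg_near_one:
  assumes "0 < e"
  obtains d where "0 < d" "\<And>z. norm z = 1 \<Longrightarrow> dist z 1 < d \<Longrightarrow> z \<notin> \<real>\<^sub>\<le>\<^sub>0 \<and> \<bar>Arg z\<bar> < e"
proof -
  have "isCont Arg 1" by (rule continuous_at_Arg) simp
  then obtain d where d: "0 < d" "\<And>z. dist z 1 < d \<Longrightarrow> dist (Arg z) (Arg 1) < e"
    using assms unfolding continuous_at_eps_delta by blast
  show ?thesis
  proof
    \<comment> \<open>Within distance 1 of the point 1 there is no point of the closed negative
      axis, where \<open>Arg\<close> fails to be continuous.\<close>
    show "0 < min d 1" using d by simp
    fix z :: complex assume z: "norm z = 1" "dist z 1 < min d 1"
    have "z \<notin> \<real>\<^sub>\<le>\<^sub>0"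
    proof
      assume "z \<in> \<real>\<^sub>\<le>\<^sub>0"
      then obtain r where r: "z = of_real r" "r \<le> 0" by (auto simp: nonpos_Reals_def)
      then have "dist z 1 = \<bar>r - 1\<bar>" by (metis dist_of_real dist_real_def of_real_1)
      then show False using z r by simp
    qed
    then show "z \<notin> \<real>\<^sub>\<le>\<^sub>0 \<and> \<bar>Arg z\<bar> < e" using d(2)[of z] z by (simp add: dist_real_def)
  qed
qed

text \<open>A monotone lift is a uniform limit of strictly monotone ones, obtained by mixing in a
  little of the identity. Conversely, a map in the closure has a lift that is, up to constants,
  uniformly approximated by increasing lifts of degree one, and both monotonicity and degree survive
  the limit.\<close>

lemma circle_End_eq: "circle_End = circle_map ` mono_shift"
proof
  show "circle_map ` mono_shift \<subseteq> circle_End"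
  proof clarify
    fix v assume v: "v \<in> mono_shift"
    then have vp: "v \<in> periodic" by (simp add: mono_shift_def)
    have "\<exists>\<psi>. \<psi> \<in> circle_Aut \<and> \<psi> \<in> T" if T: "circle_map v \<in> T" "openin (compact_open_topology circle circle) T" for T
    proof -
      have "openin (top_of_set periodic) {u \<in> topspace (top_of_set periodic). circle_map u \<in> T}"
        by (rule openin_continuous_map_preimage[OF continuous_map_circle_map[OF order_refl] T(2)])
      then obtain d where d: "0 < d" "\<And>u. u \<in> periodic \<Longrightarrow> dist u v < d \<Longrightarrow> circle_map u \<in> T"
        unfolding openin_euclidean_subtopology_iff using vp T(1) by auto
      \<comment> \<open>The lift of \<open>?u\<close> is \<open>1 - s\<close> times that of
        \<open>v\<close> plus \<open>s\<close> times the identity, hence strictly increasing. The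
        number \<open>s\<close> is small enough to move \<open>v\<close> by less than
        \<open>d\<close>; adding 1 to the norm avoids a division by 0.\<close>
      define s where "s = min (1/2) (d / (2 * (norm v + 1)))"
      have s: "0 < s" "s < 1" using d(1) by (auto simp: s_def divide_simps add_nonneg_pos)
      let ?u = "(1 - s) *\<^sub>R v"
      have up: "?u \<in> periodic" using vp by (simp add: periodic_def)
      have "dist ?u v = norm (s *\<^sub>R v)"
        by (simp add: dist_norm scaleR_diff_left)
      also have "\<dots> = s * norm v" using s by simp
      also have "\<dots> \<le> d / (2 * (norm v + 1)) * norm v" by (intro mult_right_mono) (auto simp: s_def)
      also have "\<dots> < d" using d(1) by (simp add: divide_simps add_nonneg_pos)
      finally have "circle_map ?u \<in> T" using d(2)[OF up] by blast
      moreover have "circle_map ?u \<in> circle_Aut"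
      proof (rule circle_map_Aut[OF up], rule strict_monoI)
        fix x y :: real assume xy: "x < y"
        then have "x + bfun v x \<le> y + bfun v y" using v by (auto simp: mono_shift_def mono_def)
        then have "(1 - s) * (x + bfun v x) \<le> (1 - s) * (y + bfun v y)" using s by (intro mult_left_mono) auto
        moreover have "s * x < s * y" using s xy by simp
        ultimately show "x + bfun ?u x < y + bfun ?u y" by (simp add: algebra_simps)
      qed
      ultimately show ?thesis by blast
    qed
    then show "circle_map v \<in> circle_End"
      unfolding circle_End_def in_closure_of using circle_map_cmaps[OF vp] by auto
  qed
  show "circle_End \<subseteq> circle_map ` mono_shift"
  proof
    fix \<phi> assume phi: "\<phi> \<in> circle_End"
    then have pc: "\<phi> \<in> cmaps circle circle"
      unfolding circle_End_def using closure_of_subset_topspace by fastforce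
    have contp: "continuous_on (sphere 0 1) \<phi>" and ps: "\<And>z. z \<in> sphere 0 1 \<Longrightarrow> norm (\<phi> z) = 1"
      using cmapsD(1)[OF pc] by (auto simp: continuous_map_in_subtopology Pi_iff image_subset_iff)
    have "continuous_on UNIV (\<lambda>t. \<phi> (cis t))"
      by (rule continuous_on_compose2[OF contp]) (auto intro!: continuous_intros)
    then obtain \<Phi> :: "real \<Rightarrow> real" where \<Phi>: "continuous_on UNIV \<Phi>" "\<And>t. \<phi> (cis t) = cis (\<Phi> t)"
      using convex_lift[of UNIV "\<lambda>t. \<phi> (cis t)"] ps by (metis UNIV_I convex_UNIV mem_sphere_0 norm_cis)
    have appr: "\<exists>F c. strict_mono F \<and> (\<forall>t. F (t + 2 * pi) = F t + 2 * pi) \<and> (\<forall>t. \<bar>\<Phi> t - F t - c\<bar> < e)" if e: "0 < e" for e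
    proof -
      obtain d where d: "0 < d" "\<And>z. norm z = 1 \<Longrightarrow> dist z 1 < d \<Longrightarrow> z \<notin> \<real>\<^sub>\<le>\<^sub>0 \<and> \<bar>Arg z\<bar> < e"
        using Arg_near_one[OF e] by blast
      obtain U where U: "openin (compact_open_topology circle circle) U" "\<phi> \<in> U"
        "\<And>g x. g \<in> U \<Longrightarrow> x \<in> topspace circle \<Longrightarrow> dist (g x) (\<phi> x) < d"
        using compact_open_uniform_nbhd[OF compact_circle pc d(1)] by metis
      then obtain \<psi> where \<psi>: "\<psi> \<in> circle_Aut" "\<psi> \<in> U"
        using phi unfolding circle_End_def in_closure_of by blast
      then obtain F where F: "continuous_on UNIV F" "strict_mono F" "\<And>t. \<psi> (cis t) = cis (F t)"
        and hm: "homeomorphic_map circle circle \<psi>" unfolding circle_Aut_def by blast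
      have "inj_on \<psi> (sphere 0 1)" using homeomorphic_imp_injective_map[OF hm] by simp
      then have Fp: "F (t + 2 * pi) = F t + 2 * pi" for t by (rule Aut_lift_shift[OF _ F])
      \<comment> \<open>At each \<open>t\<close> this difference is close to a multiple of
        \<open>2 * pi\<close>. The principal argument of \<open>cis (D t)\<close> is a continuous
        lift of the same function, so by \<open>lift_unique\<close> the multiple is the same for all
        \<open>t\<close>.\<close>
      define D where "D t = \<Phi> t - F t" for t
      have near: "dist (cis (D t)) 1 < d" for t
      proof -
        have "dist (cis (D t)) 1 = norm (cis (- F t) * (cis (\<Phi> t) - cis (F t)))"
          by (simp add: dist_norm D_def right_diff_distrib cis_mult)
        also have "\<dots> = dist (\<psi> (cis t)) (\<phi> (cis t))" by (simp add: norm_mult dist_norm \<Phi>(2) F(3) norm_minus_commute)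
        also have "\<dots> < d" using U(3)[OF \<psi>(2), of "cis t"] by simp
        finally show ?thesis .
      qed
      have A: "cis (D t) \<notin> \<real>\<^sub>\<le>\<^sub>0" "\<bar>Arg (cis (D t))\<bar> < e" for t using d(2)[OF norm_cis near] by auto
      have cD: "continuous_on UNIV D" unfolding D_def using \<Phi>(1) F(1) by (intro continuous_intros)
      have "continuous_on UNIV (\<lambda>t. Arg (cis (D t)))"
      proof (rule continuous_at_imp_continuous_on, rule ballI)
        fix t
        have "continuous_on UNIV (\<lambda>t. cis (D t))" using cD by (intro continuous_intros)
        then have "isCont (\<lambda>t. cis (D t)) t" by (simp add: continuous_on_eq_continuous_at)
        then show "isCont (\<lambda>t. Arg (cis (D t))) t" by (rule isCont_o2[where f = "\<lambda>t. cis (D t)" and g = Arg]) (rule continuous_at_Arg[OF A(1)])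
      qed
      moreover have "cis (D t) = cis (Arg (cis (D t)))" for t by (rule sphere_cis) simp
      ultimately obtain k :: int where k: "\<And>t. D t = Arg (cis (D t)) + 2 * pi * of_int k"
        using lift_unique[of UNIV D "\<lambda>t. Arg (cis (D t))"] cD by (metis UNIV_I connected_UNIV)
      have "\<bar>\<Phi> t - F t - 2 * pi * of_int k\<bar> < e" for t
      proof -
        have "\<Phi> t - F t - 2 * pi * of_int k = Arg (cis (D t))" using k[of t] by (simp add: D_def)
        then show ?thesis using A(2)[of t] by simp
      qed
      then show ?thesis using F(2) Fp by blast
    qed
    have "mono \<Phi>"
    proof (rule monoI, rule field_le_epsilon)
      fix x y e :: real assume xy: "x \<le> y" and e: "0 < e"
      then obtain F c where F: "strict_mono F" "\<forall>t. \<bar>\<Phi> t - F t - c\<bar> < e / 2" using appr[of "e / 2"] by auto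
      have "F x \<le> F y" using F(1) xy by (simp add: strict_mono_less_eq)
      moreover have "\<bar>\<Phi> x - F x - c\<bar> < e / 2" "\<bar>\<Phi> y - F y - c\<bar> < e / 2" using F(2) by blast+
      ultimately show "\<Phi> x \<le> \<Phi> y + e" by linarith
    qed
    moreover have "\<Phi> (t + 2 * pi) = \<Phi> t + 2 * pi" for t
    proof -
      have "\<bar>\<Phi> (t + 2 * pi) - (\<Phi> t + 2 * pi)\<bar> \<le> 0 + e" if e: "0 < e" for e
      proof -
        obtain F c where F: "\<forall>t. F (t + 2 * pi) = F t + 2 * pi" "\<forall>t. \<bar>\<Phi> t - F t - c\<bar> < e / 2" using appr[of "e / 2"] e by auto
        have "\<bar>\<Phi> t - F t - c\<bar> < e / 2" "\<bar>\<Phi> (t + 2 * pi) - F (t + 2 * pi) - c\<bar> < e / 2" "F (t + 2 * pi) = F t + 2 * pi" using F by blast+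
        then show ?thesis by linarith
      qed
      then have "\<bar>\<Phi> (t + 2 * pi) - (\<Phi> t + 2 * pi)\<bar> \<le> 0" by (rule field_le_epsilon)
      then show ?thesis by simp
    qed
    ultimately have "monotone_lift \<Phi>" using \<Phi>(1) by (simp add: monotone_lift_def)
    then obtain v where v: "v \<in> mono_shift" "\<And>t. \<Phi> t = t + bfun v t" using monotone_lift_mono_shift by blast
    then have vp: "v \<in> periodic" by (simp add: mono_shift_def)
    have "\<phi> = circle_map v"
      unfolding circle_map_def using cmapsD(2)[OF pc] \<Phi>(2) v(2) circle_map_periodic[OF vp] by (intro circle_fun_eqI) auto
    then show "\<phi> \<in> circle_map ` mono_shift" using v(1) by blast
  qed
qed

section \<open>Orbits of constant speed functions\<close>

lemma mono_shift_periodic: "v \<in> mono_shift \<Longrightarrow> v \<in> periodic"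
  by (simp add: mono_shift_def)

lemma bfun_const: "bfun (const_bcontfun c) t = c"
  by (simp add: const_bcontfun.rep_eq)

lemma mono_shift_shift: "v \<in> mono_shift \<Longrightarrow> v + const_bcontfun c \<in> mono_shift"
  unfolding mono_shift_def periodic_def by (simp add: bfun_const mono_def add.assoc[symmetric])

lemma mono_shift_convex_comb:
  assumes "v \<in> mono_shift" "w \<in> mono_shift" "0 \<le> s" "s \<le> 1"
  shows "(1 - s) *\<^sub>R v + s *\<^sub>R w \<in> mono_shift"
proof -
  have "mono (\<lambda>t. t + bfun ((1 - s) *\<^sub>R v + s *\<^sub>R w) t)"
  proof (rule monoI)
    fix x y :: real assume xy: "x \<le> y"
    have h: "x + bfun v x \<le> y + bfun v y" "x + bfun w x \<le> y + bfun w y"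
      using assms(1,2) xy by (auto simp: mono_shift_def mono_def)
    have "(1 - s) * (x + bfun v x) + s * (x + bfun w x) \<le> (1 - s) * (y + bfun v y) + s * (y + bfun w y)"
      by (rule add_mono; rule mult_left_mono) (use h assms(3,4) in auto)
    then show "x + bfun ((1 - s) *\<^sub>R v + s *\<^sub>R w) x \<le> y + bfun ((1 - s) *\<^sub>R v + s *\<^sub>R w) y"
      by (simp add: algebra_simps)
  qed
  then show ?thesis using assms(1,2) by (simp add: mono_shift_def periodic_def)
qed

lemma const_mono_shift: "const_bcontfun c \<in> mono_shift"
  by (simp add: mono_shift_def periodic_def bfun_const mono_def)

lemma convex_mono_shift: "convex mono_shift"
  using mono_shift_convex_comb unfolding convex_alt by blast

definition orbit_map :: "(real \<Rightarrow> real) \<Rightarrow> (real \<Rightarrow>\<^sub>C real) \<Rightarrow> real \<Rightarrow>\<^sub>C real" where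
  "orbit_map G v = Bcontfun (\<lambda>t. G (t + bfun v t))"

text \<open>The product of a quotient map with an identity is in general not a quotient map, but
  openness is preserved. This allows the homotopy on the orbit to be defined on lifts first.\<close>

lemma open_map_prod_right:
  assumes "open_map X Y f"
  shows "open_map (prod_topology Z X) (prod_topology Z Y) (\<lambda>(u, x). (u, f x))"
  unfolding open_map_def
proof (intro allI impI)
  fix W assume W: "openin (prod_topology Z X) W"
  show "openin (prod_topology Z Y) ((\<lambda>(u, x). (u, f x)) ` W)"
    unfolding openin_prod_topology_alt
  proof (intro allI impI)
    fix u y assume "(u, y) \<in> (\<lambda>(u, x). (u, f x)) ` W"
    then obtain x where x: "(u, x) \<in> W" "y = f x" by auto
    then obtain A B where AB: "openin Z A" "openin X B" "u \<in> A" "x \<in> B" "A \<times> B \<subseteq> W"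
      using W unfolding openin_prod_topology_alt by meson
    have "A \<times> f ` B \<subseteq> (\<lambda>(u, x). (u, f x)) ` W"
      using AB(5) by force
    then show "\<exists>U V. openin Z U \<and> openin Y V \<and> u \<in> U \<and> y \<in> V \<and> U \<times> V \<subseteq> (\<lambda>(u, x). (u, f x)) ` W"
      using AB x assms unfolding open_map_def by blast
  qed
qed

text \<open>The classes of \<open>r\<close> are the fibers of \<open>q\<close>, and \<open>F\<close>
  sends a point of \<open>Y\<close> to the fiber over it.\<close>

lemma quotient_space_homeomorphic:
  assumes q: "quotient_map X Y q" and r: "r = {(x, y). x \<in> topspace X \<and> y \<in> topspace X \<and> q x = q y}"
  shows "Y homeomorphic_space quotient_space X r"
proof -
  define F where "F y = {x \<in> topspace X. q x = y}" for y
  have surj: "q ` topspace X = topspace Y" using q by (simp add: quotient_map_def)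
  have homology_class: "r `` {x} = F (q x)" if "x \<in> topspace X" for x using that by (auto simp: r F_def)
  have quo: "topspace X // r = F ` topspace Y"
  proof -
    have "topspace X // r = (\<lambda>x. r `` {x}) ` topspace X" by (auto simp: quotient_def)
    also have "\<dots> = (\<lambda>x. F (q x)) ` topspace X" by (intro image_cong refl homology_class)
    also have "\<dots> = F ` topspace Y" by (simp only: surj[symmetric] image_image)
    finally show ?thesis .
  qed
  have injF: "inj_on F (topspace Y)"
  proof (rule inj_onI)
    fix y y' assume y: "y \<in> topspace Y" "F y = F y'"
    from y(1) obtain x where "x \<in> topspace X" "q x = y" unfolding surj[symmetric] by blast
    then have "x \<in> F y" by (simp add: F_def)
    then have "x \<in> F y'" unfolding y(2) .
    then show "y = y'" using \<open>q x = y\<close> by (simp add: F_def)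
  qed
  have op: "openin (quotient_space X r) \<U> \<longleftrightarrow> \<U> \<subseteq> F ` topspace Y \<and> openin Y {y \<in> topspace Y. F y \<in> \<U>}" for \<U>
  proof -
    have "{x \<in> topspace X. r `` {x} \<in> \<U>} = {x \<in> topspace X. q x \<in> {y \<in> topspace Y. F y \<in> \<U>}}"
      using homology_class surj by auto
    moreover have "openin X {x \<in> topspace X. q x \<in> V} \<longleftrightarrow> openin Y V" if "V \<subseteq> topspace Y" for V
      using q that unfolding quotient_map_def by blast
    from this[of "{y \<in> topspace Y. F y \<in> \<U>}"]
    have "openin X {x \<in> topspace X. q x \<in> {y \<in> topspace Y. F y \<in> \<U>}} \<longleftrightarrow> openin Y {y \<in> topspace Y. F y \<in> \<U>}"
      by blast
    ultimately show ?thesis unfolding openin_quotient_space quo by (simp only:)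
  qed
  have top: "topspace (quotient_space X r) = F ` topspace Y"
  proof
    show "topspace (quotient_space X r) \<subseteq> F ` topspace Y" using op openin_topspace by blast
    have "{y \<in> topspace Y. F y \<in> F ` topspace Y} = topspace Y" by auto
    then have "openin (quotient_space X r) (F ` topspace Y)" unfolding op by simp
    then show "F ` topspace Y \<subseteq> topspace (quotient_space X r)" by (rule openin_subset)
  qed
  have "homeomorphic_map Y (quotient_space X r) F"
  proof (rule bijective_open_imp_homeomorphic_map)
    show "continuous_map Y (quotient_space X r) F"
      unfolding continuous_map_def using op top by auto
    show "open_map Y (quotient_space X r) F"
      unfolding open_map_def
    proof (intro allI impI)
      fix U assume U: "openin Y U"
      then have UY: "U \<subseteq> topspace Y" by (rule openin_subset)
      then have "{y \<in> topspace Y. F y \<in> F ` U} = U" using injF by (auto dest: inj_onD)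
      then show "openin (quotient_space X r) (F ` U)" unfolding op using U UY by auto
    qed
  qed (use top injF in auto)
  then show ?thesis by (rule homeomorphic_map_imp_homeomorphic_space)
qed

context
  fixes E :: "real set" and N :: nat and L :: real and G :: "real \<Rightarrow> real"
  assumes G: "constant_speed E N L G"
begin

lemma G_lip: "\<bar>G x - G y\<bar> \<le> L * \<bar>x - y\<bar>" and L_pos: "0 < L" and G_per: "G (t + 2 * pi) = G t"
  using G by (auto simp: constant_speed_def)

lemma G_cont: "continuous_on UNIV G"
  unfolding continuous_on_iff
proof (intro ballI allI impI)
  fix x e :: real assume e: "0 < e"
  have "dist (G y) (G x) < e" if "dist y x < e / L" for y
  proof -
    have "\<bar>G y - G x\<bar> \<le> L * \<bar>y - x\<bar>" by (rule G_lip)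
    also have "\<dots> < e" using that L_pos by (simp add: dist_real_def field_simps)
    finally show ?thesis by (simp add: dist_real_def)
  qed
  then show "\<exists>d>0. \<forall>x'\<in>UNIV. dist x' x < d \<longrightarrow> dist (G x') (G x) < e"
    using e L_pos by (intro exI[of _ "e / L"]) simp
qed

lemma G_shift_periodic: "v \<in> periodic \<Longrightarrow> G (t + 2 * pi + bfun v (t + 2 * pi)) = G (t + bfun v t)"
proof -
  assume "v \<in> periodic"
  then have "t + 2 * pi + bfun v (t + 2 * pi) = (t + bfun v t) + 2 * pi" by (simp add: periodic_apply)
  then show ?thesis by (simp only: G_per)
qed

lemma orbit_map_bcontfun: "v \<in> periodic \<Longrightarrow> (\<lambda>t. G (t + bfun v t)) \<in> bcontfun"
proof -
  assume v: "v \<in> periodic"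
  have "circle_fun (\<lambda>t. G (t + bfun v t)) \<in> cmaps circle (top_of_set UNIV)"
    by (rule circle_fun_cmaps) (auto simp: G_shift_periodic[OF v] intro!: continuous_intros continuous_on_compose2[OF G_cont])
  then have "(\<lambda>t. circle_fun (\<lambda>t. G (t + bfun v t)) (cis t)) \<in> bcontfun" by (intro circle_function_lift) simp
  moreover have "circle_fun (\<lambda>t. G (t + bfun v t)) (cis t) = G (t + bfun v t)" for t
    by (rule circle_fun_cis) (rule G_shift_periodic[OF v])
  ultimately show ?thesis by simp
qed

lemma orbit_map_apply: "v \<in> periodic \<Longrightarrow> bfun (orbit_map G v) t = G (t + bfun v t)"
  unfolding orbit_map_def by (simp add: Bcontfun_inverse orbit_map_bcontfun)

lemma orbit_map_periodic: "v \<in> periodic \<Longrightarrow> orbit_map G v \<in> periodic"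
  unfolding periodic_def[of] using G_shift_periodic orbit_map_apply by (simp add: periodic_def)

lemma dist_orbit_map:
  assumes "v \<in> periodic" "w \<in> periodic" shows "dist (orbit_map G v) (orbit_map G w) \<le> L * dist v w"
proof (rule dist_bound)
  fix t
  have "dist (bfun (orbit_map G v) t) (bfun (orbit_map G w) t) \<le> L * \<bar>(t + bfun v t) - (t + bfun w t)\<bar>"
    unfolding orbit_map_apply[OF assms(1)] orbit_map_apply[OF assms(2)] dist_real_def by (rule G_lip)
  also have "\<bar>(t + bfun v t) - (t + bfun w t)\<bar> = dist (bfun v t) (bfun w t)" by (simp add: dist_real_def)
  also have "L * \<dots> \<le> L * dist v w" using L_pos by (intro mult_left_mono dist_bounded) auto
  finally show "dist (bfun (orbit_map G v) t) (bfun (orbit_map G w) t) \<le> L * dist v w" .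
qed

lemma continuous_orbit_map: "continuous_on mono_shift (orbit_map G)"
  unfolding continuous_on_iff
proof (intro ballI allI impI)
  fix v and e :: real assume v: "v \<in> mono_shift" and e: "0 < e"
  have "dist (orbit_map G w) (orbit_map G v) < e" if "w \<in> mono_shift" "dist w v < e / L" for w
  proof -
    have "dist (orbit_map G w) (orbit_map G v) \<le> L * dist w v" using dist_orbit_map mono_shift_periodic v that by blast
    also have "\<dots> < e" using that L_pos by (simp add: field_simps)
    finally show ?thesis .
  qed
  then show "\<exists>d>0. \<forall>x'\<in>mono_shift. dist x' v < d \<longrightarrow> dist (orbit_map G x') (orbit_map G v) < e"
    using e L_pos by (intro exI[of _ "e / L"]) simp
qed

lemma orbit_map_eq_iff:
  assumes "v \<in> mono_shift" "w \<in> mono_shift"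
  shows "orbit_map G v = orbit_map G w \<longleftrightarrow> (\<exists>c. (\<forall>y. G (y + c) = G y) \<and> w = v + const_bcontfun c)"
proof
  assume eq: "orbit_map G v = orbit_map G w"
  have e: "G (t + bfun v t) = G (t + bfun w t)" for t
    using orbit_map_apply[OF mono_shift_periodic[OF assms(1)], of t] orbit_map_apply[OF mono_shift_periodic[OF assms(2)], of t] eq by simp
  obtain c where c: "\<And>t. t + bfun w t = t + bfun v t + c" "\<And>y. G (y + c) = G y"
    using reparametrisation_unique[OF G mono_shift_monotone_lift[OF assms(1)] mono_shift_monotone_lift[OF assms(2)] e] by blast
  have "w = v + const_bcontfun c"
  proof (rule bcontfun_eqI)
    show "bfun w t = bfun (v + const_bcontfun c) t" for t using c(1)[of t] by (simp add: bfun_const)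
  qed
  then show "\<exists>c. (\<forall>y. G (y + c) = G y) \<and> w = v + const_bcontfun c" using c(2) by blast
next
  assume "\<exists>c. (\<forall>y. G (y + c) = G y) \<and> w = v + const_bcontfun c"
  then obtain c where c: "\<And>y. G (y + c) = G y" "w = v + const_bcontfun c" by blast
  show "orbit_map G v = orbit_map G w"
  proof (rule bcontfun_eqI)
    show "bfun (orbit_map G v) t = bfun (orbit_map G w) t" for t
    proof -
      have "t + bfun w t = t + bfun v t + c" by (simp add: c(2) bfun_const)
      then show ?thesis
        by (simp only: orbit_map_apply[OF mono_shift_periodic[OF assms(1)]] orbit_map_apply[OF mono_shift_periodic[OF assms(2)]] c(1))
    qed
  qed
qed

text \<open>A nearby point of the orbit comes from some \<open>w\<close> whose lift is close to that
  of \<open>v\<close> up to a period \<open>s\<close> of \<open>G\<close>. Subtracting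
  \<open>s\<close> does not change the image and moves \<open>w\<close> into
  \<open>U\<close>.\<close>

lemma open_orbit_map: "open_map (top_of_set mono_shift) (top_of_set (orbit_map G ` mono_shift)) (orbit_map G)"
  unfolding open_map_def
proof (intro allI impI)
  fix U assume U: "openin (top_of_set mono_shift) U"
  then have UM: "U \<subseteq> mono_shift" using openin_subset by fastforce
  show "openin (top_of_set (orbit_map G ` mono_shift)) (orbit_map G ` U)"
    unfolding openin_euclidean_subtopology_iff
  proof (intro conjI ballI)
    show "orbit_map G ` U \<subseteq> orbit_map G ` mono_shift" using UM by blast
    fix h assume "h \<in> orbit_map G ` U"
    then obtain v where v: "v \<in> U" "h = orbit_map G v" by blast
    obtain e where e: "0 < e" "\<And>w. w \<in> mono_shift \<Longrightarrow> dist w v < e \<Longrightarrow> w \<in> U"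
      using U v(1) unfolding openin_euclidean_subtopology_iff by blast
    have "0 < e / 2" using e(1) by simp
    from close_reparametrisations[OF G G this]
    obtain \<eta> where \<eta>: "0 < \<eta>" "\<forall>\<Phi> \<Phi>'. monotone_lift \<Phi> \<longrightarrow> monotone_lift \<Phi>' \<longrightarrow> (\<forall>t. \<bar>G (\<Phi> t) - G (\<Phi>' t)\<bar> \<le> \<eta>) \<longrightarrow>
       (\<exists>s. (\<forall>y. G (y + s) = G y) \<and> (\<forall>t. \<bar>\<Phi> t + s - \<Phi>' t\<bar> \<le> e / 2))"
      by (elim exE conjE) (rule that)
    have "h' \<in> orbit_map G ` U" if h': "h' \<in> orbit_map G ` mono_shift" "dist h' h < \<eta>" for h'
    proof -
      obtain w where w: "w \<in> mono_shift" "h' = orbit_map G w" using h'(1) by blast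
      have vm: "v \<in> mono_shift" using v UM by blast
      have cl: "\<bar>G (t + bfun v t) - G (t + bfun w t)\<bar> \<le> \<eta>" for t
      proof -
        have "\<bar>G (t + bfun v t) - G (t + bfun w t)\<bar> = dist (bfun h' t) (bfun h t)"
          by (simp add: v(2) w(2) orbit_map_apply[OF mono_shift_periodic[OF vm]] orbit_map_apply[OF mono_shift_periodic[OF w(1)]] dist_real_def abs_minus_commute)
        also have "\<dots> \<le> dist h' h" by (rule dist_bounded)
        finally show ?thesis using h'(2) by simp
      qed
      from \<eta>(2)[THEN spec, THEN spec, THEN mp, OF mono_shift_monotone_lift[OF vm], THEN mp, OF mono_shift_monotone_lift[OF w(1)], THEN mp, OF allI[OF cl]]
      obtain s where s: "\<And>y. G (y + s) = G y" "\<And>t. \<bar>t + bfun v t + s - (t + bfun w t)\<bar> \<le> e / 2"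
        by blast
      let ?w = "w + const_bcontfun (- s)"
      have wm: "?w \<in> mono_shift" by (rule mono_shift_shift[OF w(1)])
      have "G (y + - s) = G y" for y using s(1)[of "y - s"] by simp
      then have "orbit_map G w = orbit_map G ?w" using orbit_map_eq_iff[OF w(1) wm] by blast
      moreover have "dist ?w v \<le> e / 2"
      proof (rule dist_bound)
        fix t
        have eq: "bfun ?w t - bfun v t = - (t + bfun v t + s - (t + bfun w t))" by (simp add: bfun_const)
        show "dist (bfun ?w t) (bfun v t) \<le> e / 2"
          unfolding dist_real_def eq abs_minus_cancel by (rule s(2))
      qed
      then have "?w \<in> U" using e wm by simp
      ultimately show ?thesis using w(2) by blast
    qed
    then show "\<exists>e>0. \<forall>h'\<in>orbit_map G ` mono_shift. dist h' h < e \<longrightarrow> h' \<in> orbit_map G ` U" using \<eta>(1) by blast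
  qed
qed

lemma quotient_orbit_map: "quotient_map (top_of_set mono_shift) (top_of_set (orbit_map G ` mono_shift)) (orbit_map G)"
  by (rule continuous_open_imp_quotient_map[OF _ open_orbit_map])
     (use continuous_orbit_map in \<open>auto simp: continuous_map_in_subtopology\<close>)

lemma circle_fun_G_cis: "circle_fun G (cis t) = G t"
  by (rule circle_fun_cis) (rule G_per)

lemma circle_fun_G_cmaps: "circle_fun G \<in> cmaps circle euclideanreal"
  using circle_fun_cmaps[of G UNIV, OF G_cont G_per] by simp

lemma compose_circle_map:
  assumes "v \<in> periodic" shows "compose (sphere 0 1) (circle_fun G) (circle_map v) = circle_fun (bfun (orbit_map G v))"
proof (rule circle_fun_eqI)
  show "bfun (orbit_map G v) (t + 2 * pi) = bfun (orbit_map G v) t" for t using orbit_map_periodic[OF assms] by (rule periodic_apply)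
  show "compose (sphere 0 1) (circle_fun G) (circle_map v) (cis t) = bfun (orbit_map G v) t" for t
    by (simp add: compose_def circle_map_cis[OF assms] circle_fun_G_cis orbit_map_apply[OF assms])
qed (simp add: compose_def)

lemma orbit_eq: "orbit_Id (circle_fun G) = (\<lambda>u. circle_fun (bfun u)) ` orbit_map G ` mono_shift"
proof -
  have "orbit_Id (circle_fun G) = (\<lambda>v. compose (sphere 0 1) (circle_fun G) (circle_map v)) ` mono_shift"
    unfolding orbit_Id_def circle_End_eq by blast
  also have "\<dots> = (\<lambda>v. circle_fun (bfun (orbit_map G v))) ` mono_shift"
    by (intro image_cong refl compose_circle_map mono_shift_periodic)
  finally show ?thesis by (simp add: image_image)
qed

lemma orbit_maps: "homeomorphic_maps (subtopology circle_functions (orbit_Id (circle_fun G))) (top_of_set (orbit_map G ` mono_shift)) lift (\<lambda>u. circle_fun (bfun u))"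
proof -
  let ?S = "\<lambda>u. circle_fun (bfun u)"
  have hm: "homeomorphic_maps circle_functions (top_of_set periodic) lift ?S" by (rule homeomorphic_maps_lift)
  have inv: "lift (?S u) = u" "?S u \<in> topspace circle_functions" if "u \<in> periodic" for u
    using hm that by (auto simp: homeomorphic_maps_def continuous_map_def)
  have sub: "orbit_map G ` mono_shift \<subseteq> periodic" using orbit_map_periodic mono_shift_periodic by blast
  have "orbit_Id (circle_fun G) \<subseteq> topspace circle_functions" unfolding orbit_eq using inv(2) sub by blast
  then have "lift ` (topspace circle_functions \<inter> orbit_Id (circle_fun G)) = lift ` orbit_Id (circle_fun G)" by (simp only: Int_absorb1)
  also have "\<dots> = (\<lambda>u. u) ` orbit_map G ` mono_shift"
    unfolding orbit_eq image_image using inv(1) orbit_map_periodic mono_shift_periodic by (intro image_cong) auto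
  also have "\<dots> = topspace (top_of_set periodic) \<inter> orbit_map G ` mono_shift" using sub by auto
  finally have "homeomorphic_maps (subtopology circle_functions (orbit_Id (circle_fun G))) (subtopology (top_of_set periodic) (orbit_map G ` mono_shift)) lift ?S"
    by (rule homeomorphic_maps_subtopologies[OF hm])
  moreover have "subtopology (top_of_set periodic) (orbit_map G ` mono_shift) = top_of_set (orbit_map G ` mono_shift)"
    using sub by (simp add: subtopology_subtopology Int_absorb1)
  ultimately show ?thesis by simp
qed

lemma orbit_path_connected: "path_connectedin circle_functions (orbit_Id (circle_fun G))"
proof -
  have "path_connected (orbit_map G ` mono_shift)"
    by (intro path_connected_continuous_image continuous_orbit_map convex_imp_path_connected convex_mono_shift)
  then have 1: "path_connectedin (top_of_set periodic) (orbit_map G ` mono_shift)"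
    using orbit_map_periodic mono_shift_periodic by (auto simp: path_connectedin_subtopology)
  have "continuous_map (top_of_set periodic) circle_functions (\<lambda>u. circle_fun (bfun u))"
    using homeomorphic_maps_lift by (simp add: homeomorphic_maps_def)
  from path_connectedin_continuous_map_image[OF this 1] show ?thesis unfolding orbit_eq .
qed

text \<open>Precomposed with \<open>circle_map\<close>, the map becomes the orbit map read on the
  circle, which is a quotient map; hence so is the second factor.\<close>

lemma orbit_quotient: "quotient_map circle_End_space (subtopology circle_functions (orbit_Id (circle_fun G))) (compose (sphere 0 1) (circle_fun G))"
proof (rule quotient_map_from_composition)
  show "continuous_map (top_of_set mono_shift) circle_End_space circle_map"
    unfolding continuous_map_in_subtopology
    using continuous_map_circle_map[of mono_shift] mono_shift_periodic circle_End_eq by auto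
  have "continuous_map (compact_open_topology circle circle) circle_functions (compose (topspace circle) (circle_fun G))"
    using cmapsD(1)[OF circle_fun_G_cmaps] by (rule continuous_map_compose_compact_open)
  then have "continuous_map (compact_open_topology circle circle) circle_functions (compose (sphere 0 1) (circle_fun G))" by simp
  moreover have "compose (sphere 0 1) (circle_fun G) ` circle_End \<subseteq> orbit_Id (circle_fun G)" unfolding orbit_Id_def by blast
  ultimately show "continuous_map circle_End_space (subtopology circle_functions (orbit_Id (circle_fun G))) (compose (sphere 0 1) (circle_fun G))"
    unfolding continuous_map_in_subtopology by (auto intro: continuous_map_from_subtopology)
  have "quotient_map (top_of_set (orbit_map G ` mono_shift)) (subtopology circle_functions (orbit_Id (circle_fun G))) (\<lambda>u. circle_fun (bfun u))"
    using orbit_maps unfolding homeomorphic_maps_map homeomorphic_map_def by blast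
  then have "quotient_map (top_of_set mono_shift) (subtopology circle_functions (orbit_Id (circle_fun G))) ((\<lambda>u. circle_fun (bfun u)) \<circ> orbit_map G)"
    using quotient_orbit_map by (intro quotient_map_compose)
  then show "quotient_map (top_of_set mono_shift) (subtopology circle_functions (orbit_Id (circle_fun G))) (compose (sphere 0 1) (circle_fun G) \<circ> circle_map)"
    by (rule quotient_map_eq) (simp add: compose_circle_map mono_shift_periodic)
qed

text \<open>A constant added to the lift is a rotation applied after the map, and that is the side
  on which the stabiliser acts.\<close>

lemma circle_map_add_const:
  assumes "v \<in> mono_shift"
  shows "circle_map (v + const_bcontfun c) = compose (sphere 0 1) (circle_map (const_bcontfun c)) (circle_map v)"
proof -
  have vp: "v \<in> periodic" using assms by (rule mono_shift_periodic)
  have w: "v + const_bcontfun c \<in> periodic" using mono_shift_shift[OF assms] by (rule mono_shift_periodic)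
  have cp: "const_bcontfun c \<in> periodic" using const_mono_shift by (rule mono_shift_periodic)
  have "compose (sphere 0 1) (circle_map (const_bcontfun c)) (circle_map v) = circle_fun (\<lambda>t. cis (t + bfun (v + const_bcontfun c) t))"
  proof (rule circle_fun_eqI)
    show "cis (t + 2 * pi + bfun (v + const_bcontfun c) (t + 2 * pi)) = cis (t + bfun (v + const_bcontfun c) t)" for t
      by (rule circle_map_periodic[OF w])
    show "compose (sphere 0 1) (circle_map (const_bcontfun c)) (circle_map v) (cis t) = cis (t + bfun (v + const_bcontfun c) t)" for t
      by (simp add: compose_def circle_map_cis[OF vp] circle_map_cis[OF cp] bfun_const add.assoc)
  qed (simp add: compose_def)
  then show ?thesis by (simp add: circle_map_def)
qed

text \<open>Maps with equal image differ by a period \<open>c\<close> of \<open>G\<close>, and the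
  rotation by \<open>c\<close> belongs to the stabiliser, so one generating step joins any two
  points of a fiber.\<close>

lemma stabiliser_rel_eq:
  "stabiliser_rel (circle_fun G) = {(\<phi>, \<psi>). \<phi> \<in> circle_End \<and> \<psi> \<in> circle_End \<and> compose (sphere 0 1) (circle_fun G) \<phi> = compose (sphere 0 1) (circle_fun G) \<psi>}"
proof -
  let ?R = "\<lambda>\<alpha> \<beta>. \<alpha> \<in> circle_End \<and> (\<exists>s \<in> stabiliser_Id (circle_fun G). \<beta> = compose (sphere 0 1) s \<alpha>)"
  let ?q = "compose (sphere 0 1) (circle_fun G)"
  have sph: "\<alpha> z \<in> sphere 0 1" if "\<alpha> \<in> circle_End" "z \<in> sphere 0 1" for \<alpha> z
  proof -
    have "continuous_map circle circle \<alpha>"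
      using that(1) cmapsD(1)[OF circle_map_cmaps[OF mono_shift_periodic]] unfolding circle_End_eq by blast
    then show ?thesis using that(2) by (auto simp: continuous_map_in_subtopology Pi_iff image_subset_iff)
  qed
  have step: "?q \<alpha> = ?q \<beta>" if ab: "?R \<alpha> \<beta>" for \<alpha> \<beta>
  proof -
    obtain s where s: "s \<in> circle_End" "?q s = circle_fun G" "\<beta> = compose (sphere 0 1) s \<alpha>" using ab unfolding stabiliser_Id_def by blast
    have "?q \<beta> z = ?q \<alpha> z" for z
    proof (cases "z \<in> sphere 0 1")
      case True
      have "?q \<beta> z = ?q s (\<alpha> z)" using True sph[of \<alpha> z] ab by (simp add: s(3) compose_def)
      also have "\<dots> = circle_fun G (\<alpha> z)" by (simp only: s(2))
      also have "\<dots> = ?q \<alpha> z" using True by (simp add: compose_def)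
      finally show ?thesis .
    qed (simp add: compose_def)
    then show ?thesis by auto
  qed
  have fwd: "?q \<phi> = ?q \<psi>" if "equivclp ?R \<phi> \<psi>" for \<phi> \<psi>
    using that
  proof (induction rule: equivclp_induct)
    case base then show ?case ..
  next
    case (step y z)
    then show ?case using \<open>\<And>\<beta> \<alpha>. ?R \<alpha> \<beta> \<Longrightarrow> ?q \<alpha> = ?q \<beta>\<close> by metis
  qed
  have bwd: "equivclp ?R \<phi> \<psi>" if p: "\<phi> \<in> circle_End" "\<psi> \<in> circle_End" "?q \<phi> = ?q \<psi>" for \<phi> \<psi>
  proof -
    obtain v w where v: "v \<in> mono_shift" "\<phi> = circle_map v" and w: "w \<in> mono_shift" "\<psi> = circle_map w" using p(1,2) unfolding circle_End_eq by blast
    have "circle_fun (bfun (orbit_map G v)) = circle_fun (bfun (orbit_map G w))"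
      using p(3) unfolding v(2) w(2) compose_circle_map[OF mono_shift_periodic[OF v(1)]] compose_circle_map[OF mono_shift_periodic[OF w(1)]] .
    moreover have "lift (circle_fun (bfun u)) = u" if "u \<in> periodic" for u
      using homeomorphic_maps_lift that by (simp add: homeomorphic_maps_def)
    ultimately have "orbit_map G v = orbit_map G w" using orbit_map_periodic mono_shift_periodic v(1) w(1) by metis
    then obtain c where c: "\<And>y. G (y + c) = G y" "w = v + const_bcontfun c" using orbit_map_eq_iff[OF v(1) w(1)] by blast
    let ?s = "circle_map (const_bcontfun c)"
    have "?q ?s = circle_fun G"
    proof -
      have cp: "const_bcontfun c \<in> periodic" using const_mono_shift by (rule mono_shift_periodic)
      have "?q ?s = circle_fun G"
        by (rule circle_fun_eqI) (simp_all add: compose_def G_per circle_map_cis[OF cp] bfun_const circle_fun_G_cis c(1))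
      then show ?thesis .
    qed
    then have "?s \<in> stabiliser_Id (circle_fun G)" unfolding stabiliser_Id_def circle_End_eq using const_mono_shift by blast
    moreover have "\<psi> = compose (sphere 0 1) ?s \<phi>" unfolding v(2) w(2) c(2) by (rule circle_map_add_const[OF v(1)])
    ultimately have "?R \<phi> \<psi>" using p(1) by blast
    then show ?thesis by (rule r_into_equivclp[of ?R])
  qed
  show ?thesis unfolding stabiliser_rel_def using fwd bwd by blast
qed

lemma orbit_homeomorphic: "subtopology circle_functions (orbit_Id (circle_fun G)) homeomorphic_space End_mod_stabiliser (circle_fun G)"
proof -
  have top: "topspace circle_End_space = circle_End"
    unfolding circle_End_def using closure_of_subset_topspace by fastforce
  show ?thesis unfolding End_mod_stabiliser_def
  proof (rule quotient_space_homeomorphic[OF orbit_quotient])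
    show "stabiliser_rel (circle_fun G) = {(x, y). x \<in> topspace circle_End_space \<and> y \<in> topspace circle_End_space \<and>
       compose (sphere 0 1) (circle_fun G) x = compose (sphere 0 1) (circle_fun G) y}"
      unfolding top by (rule stabiliser_rel_eq)
  qed
qed

text \<open>The orbit is the space of lifts modulo translation by multiples of the least period
  \<tau>. The value of the shift at 0 modulo \<tau>, rescaled to the circle, is \<alpha>; the
  constant shifts, which correspond to translates of \<open>G\<close>, give \<beta>.\<close>

lemma orbit_homotopy_equivalent: "subtopology circle_functions (orbit_Id (circle_fun G)) homotopy_equivalent_space circle"
proof -
  obtain \<tau> where \<tau>: "0 < \<tau>" "\<And>c. (\<forall>y. G (y + c) = G y) \<longleftrightarrow> (\<exists>k::int. c = of_int k * \<tau>)" using period_exists[OF G] by blast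
  let ?O = "top_of_set (orbit_map G ` mono_shift)"
  \<comment> \<open>An arbitrary choice of representatives, with no continuity claimed; continuity
    of \<alpha> and \<open>k\<close> is tested on lifts, before passing to the quotient.\<close>
  define rep where "rep h = (SOME v. v \<in> mono_shift \<and> orbit_map G v = h)" for h
  have rep: "\<exists>k::int. rep (orbit_map G v) = v + const_bcontfun (of_int k * \<tau>)" "rep (orbit_map G v) \<in> mono_shift" if v: "v \<in> mono_shift" for v
  proof -
    have "rep (orbit_map G v) \<in> mono_shift \<and> orbit_map G (rep (orbit_map G v)) = orbit_map G v"
      unfolding rep_def by (rule someI[of _ v]) (simp add: v)
    then show "rep (orbit_map G v) \<in> mono_shift" "\<exists>k::int. rep (orbit_map G v) = v + const_bcontfun (of_int k * \<tau>)"
      using orbit_map_eq_iff[OF v, of "rep (orbit_map G v)"] \<tau>(2) by auto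
  qed
  have sym: "orbit_map G (v + const_bcontfun (of_int k * \<tau>)) = orbit_map G v" if "v \<in> mono_shift" for v and k :: int
  proof -
    have "\<forall>y. G (y + of_int k * \<tau>) = G y" unfolding \<tau>(2) by blast
    then have "orbit_map G v = orbit_map G (v + const_bcontfun (of_int k * \<tau>))"
      unfolding orbit_map_eq_iff[OF that mono_shift_shift[OF that]] by blast
    then show ?thesis ..
  qed
  define \<alpha> where "\<alpha> h = cis (2 * pi * bfun (rep h) 0 / \<tau>)" for h
  have \<alpha>: "\<alpha> (orbit_map G v) = cis (2 * pi * bfun v 0 / \<tau>)" if v: "v \<in> mono_shift" for v
  proof -
    obtain k :: int where k: "rep (orbit_map G v) = v + const_bcontfun (of_int k * \<tau>)" using rep(1)[OF v] by blast
    have "2 * pi * bfun (rep (orbit_map G v)) 0 / \<tau> = 2 * pi * bfun v 0 / \<tau> + 2 * pi * of_int k"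
      unfolding k using \<tau>(1) by (simp add: bfun_const field_simps)
    then show ?thesis unfolding \<alpha>_def by (simp only: cis_shift)
  qed
  define \<beta> where "\<beta> z = orbit_map G (const_bcontfun (\<tau> * Arg z / (2 * pi)))" for z
  have \<beta>: "\<beta> (cis t) = orbit_map G (const_bcontfun (\<tau> * t / (2 * pi)))" for t
  proof -
    have "cis t = cis (Arg (cis t))" by (rule sphere_cis) simp
    then obtain k :: int where k: "Arg (cis t) = t + 2 * pi * of_int k" using cis_eq_iff by metis
    have e: "const_bcontfun (\<tau> * Arg (cis t) / (2 * pi)) = const_bcontfun (\<tau> * t / (2 * pi)) + const_bcontfun (of_int k * \<tau>)"
      by (rule bcontfun_eqI) (simp add: bfun_const k field_simps)
    show ?thesis unfolding \<beta>_def e by (rule sym[OF const_mono_shift])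
  qed
  have c\<alpha>: "continuous_map ?O circle \<alpha>"
  proof (rule continuous_compose_quotient_map[OF quotient_orbit_map])
    have ev: "continuous_on mono_shift (\<lambda>v. bfun v 0)"
      unfolding continuous_on_iff using dist_bounded by (metis le_less_trans)
    have "continuous_on mono_shift (\<lambda>v. cis (2 * pi * bfun v 0 / \<tau>))"
      using \<tau>(1) by (intro continuous_intros ev) auto
    then have "continuous_map (top_of_set mono_shift) circle (\<lambda>v. cis (2 * pi * bfun v 0 / \<tau>))"
      by (auto simp: continuous_map_in_subtopology)
    then show "continuous_map (top_of_set mono_shift) circle (\<alpha> \<circ> orbit_map G)"
      by (rule continuous_map_eq) (simp add: \<alpha>)
  qed
  have const: "continuous_on UNIV (const_bcontfun :: real \<Rightarrow> real \<Rightarrow>\<^sub>C real)"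
    unfolding continuous_on_iff
  proof (intro ballI allI impI)
    fix x e :: real assume e: "0 < e"
    have "dist (const_bcontfun y :: real \<Rightarrow>\<^sub>C real) (const_bcontfun x) \<le> dist y x" for y
      by (rule dist_bound) (simp add: bfun_const)
    then show "\<exists>d>0. \<forall>y\<in>UNIV. dist y x < d \<longrightarrow> dist (const_bcontfun y :: real \<Rightarrow>\<^sub>C real) (const_bcontfun x) < e"
      using e by (metis le_less_trans)
  qed
  have c\<beta>: "continuous_map circle ?O \<beta>"
  proof (rule continuous_compose_quotient_map[OF quotient_map_cis[of 0]])
    have "continuous_on {0..0 + 2 * pi} (\<lambda>t. orbit_map G (const_bcontfun (\<tau> * t / (2 * pi))))"
      by (intro continuous_on_compose2[OF continuous_orbit_map] continuous_on_compose2[OF const] continuous_intros) (auto simp: const_mono_shift)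
    then show "continuous_map (top_of_set {0..0 + 2 * pi}) ?O (\<beta> \<circ> cis)"
      by (simp add: comp_def \<beta> continuous_map_in_subtopology image_subset_iff const_mono_shift Pi_iff)
  qed
  have ab: "homotopic_with (\<lambda>x. True) circle circle (\<alpha> \<circ> \<beta>) id"
  proof (rule homotopic_with_equal)
    show "continuous_map circle circle (\<alpha> \<circ> \<beta>)" using c\<beta> c\<alpha> by (rule continuous_map_compose)
    fix z :: complex assume "z \<in> topspace circle"
    then have "z \<in> sphere 0 1" by simp
    then obtain t where t: "z = cis t" by (rule sphere_cisE)
    show "(\<alpha> \<circ> \<beta>) z = id z" using \<tau>(1) by (simp add: t \<beta> \<alpha>[OF const_mono_shift] bfun_const)
  qed auto
  \<comment> \<open>This contraction commutes with adding constants to \<open>v\<close>, so the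
    induced map \<open>k\<close> does not depend on the representative.\<close>
  define m where "m u v = (1 - u) *\<^sub>R v + u *\<^sub>R const_bcontfun (bfun v 0)" for u :: real and v :: "real \<Rightarrow>\<^sub>C real"
  define k where "k = (\<lambda>(u, h). orbit_map G (m u (rep h)))"
  have mm: "m u v \<in> mono_shift" if "v \<in> mono_shift" "u \<in> {0..1}" for u v
    unfolding m_def using that const_mono_shift by (intro mono_shift_convex_comb) auto
  have kk: "k (u, orbit_map G v) = orbit_map G (m u v)" if v: "v \<in> mono_shift" and u: "u \<in> {0..1}" for u v
  proof -
    obtain j :: int where j: "rep (orbit_map G v) = v + const_bcontfun (of_int j * \<tau>)" using rep(1)[OF v] by blast
    have "m u (rep (orbit_map G v)) = m u v + const_bcontfun (of_int j * \<tau>)"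
      unfolding m_def j by (rule bcontfun_eqI) (simp add: bfun_const algebra_simps)
    then show ?thesis unfolding k_def using sym[OF mm[OF v u]] by simp
  qed
  let ?I = "top_of_set {0..1::real}"
  have qq: "quotient_map (prod_topology ?I (top_of_set mono_shift)) (prod_topology ?I ?O) (\<lambda>(u, v). (u, orbit_map G v))"
  proof (rule continuous_open_imp_quotient_map[OF _ open_map_prod_right[OF open_orbit_map]])
    have "continuous_map (top_of_set mono_shift) ?O (orbit_map G)" using continuous_orbit_map by (auto simp: continuous_map_in_subtopology)
    then show "continuous_map (prod_topology ?I (top_of_set mono_shift)) (prod_topology ?I ?O) (\<lambda>(u, v). (u, orbit_map G v))"
      unfolding case_prod_beta
      by (intro continuous_map_pairedI continuous_map_fst continuous_map_compose[OF continuous_map_snd, unfolded comp_def])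
  qed auto
  have ck: "continuous_map (prod_topology ?I ?O) ?O k"
  proof (rule continuous_compose_quotient_map[OF qq])
    have ev: "continuous_on UNIV (\<lambda>v::real \<Rightarrow>\<^sub>C real. bfun v 0)"
      unfolding continuous_on_iff using dist_bounded by (metis le_less_trans)
    have "continuous_on ({0..1} \<times> mono_shift) (\<lambda>p. m (fst p) (snd p))"
      unfolding m_def
      by (intro continuous_intros continuous_on_compose2[OF const] continuous_on_compose2[OF ev]) auto
    then have "continuous_on ({0..1} \<times> mono_shift) (\<lambda>p. orbit_map G (m (fst p) (snd p)))"
      by (rule continuous_on_compose2[OF continuous_orbit_map]) (auto simp: mm)
    then have "continuous_map (top_of_set ({0..1} \<times> mono_shift)) ?O (\<lambda>p. orbit_map G (m (fst p) (snd p)))"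
      by (auto simp: continuous_map_in_subtopology mm)
    then have "continuous_map (prod_topology ?I (top_of_set mono_shift)) ?O (\<lambda>p. orbit_map G (m (fst p) (snd p)))"
      by (simp add: prod_topology_subtopology_eu)
    then show "continuous_map (prod_topology ?I (top_of_set mono_shift)) ?O (k \<circ> (\<lambda>(u, v). (u, orbit_map G v)))"
      by (rule continuous_map_eq) (auto simp: kk)
  qed
  have ba: "homotopic_with (\<lambda>x. True) ?O ?O id (\<beta> \<circ> \<alpha>)"
  proof (subst homotopic_with, simp, intro exI[of _ k] conjI ballI)
    show "continuous_map (prod_topology ?I ?O) ?O k" by (rule ck)
    fix h assume "h \<in> topspace ?O"
    then obtain v where v: "v \<in> mono_shift" "h = orbit_map G v" by auto
    show "k (0, h) = id h" using kk[OF v(1), of 0] by (simp add: v(2) m_def)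
    have c: "\<tau> * (2 * pi * bfun v 0 / \<tau>) / (2 * pi) = bfun v 0" using \<tau>(1) by simp
    have "(\<beta> \<circ> \<alpha>) h = orbit_map G (const_bcontfun (bfun v 0))"
      by (simp only: comp_apply v(2) \<alpha>[OF v(1)] \<beta> c)
    moreover have "k (1, h) = orbit_map G (const_bcontfun (bfun v 0))"
      using kk[OF v(1), of 1] by (simp add: v(2) m_def)
    ultimately show "k (1, h) = (\<beta> \<circ> \<alpha>) h" by simp
  qed auto
  have "?O homotopy_equivalent_space circle"
    unfolding homotopy_equivalent_space_def
    using c\<alpha> c\<beta> ab homotopic_with_symD[OF ba] by blast
  moreover have "subtopology circle_functions (orbit_Id (circle_fun G)) homeomorphic_space ?O"
    using orbit_maps unfolding homeomorphic_space_def by blast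
  ultimately show ?thesis
    using homeomorphic_imp_homotopy_equivalent_space homotopy_eqv_trans by blast
qed

end

section \<open>The fiber is a finite disjoint union of orbits\<close>

lemma orbit_subset_cmaps:
  assumes "constant_speed E N L G" shows "orbit_Id (circle_fun G) \<subseteq> cmaps circle euclideanreal"
  unfolding orbit_eq[OF assms]
proof clarify
  fix v assume "v \<in> mono_shift"
  then have "orbit_map G v \<in> periodic" using orbit_map_periodic[OF assms] mono_shift_periodic by blast
  then show "circle_fun (bfun (orbit_map G v)) \<in> cmaps circle euclideanreal"
    using circle_fun_cmaps[of "bfun (orbit_map G v)" UNIV] by (simp add: periodic_def)
qed

lemma orbit_in_fiber:
  assumes G: "constant_speed E N L G" and v: "v \<in> mono_shift"
  shows "circle_fun (bfun (orbit_map G v)) \<in> PH_fiber K D\<^sub>0 D\<^sub>1 \<longleftrightarrow> circle_fun G \<in> PH_fiber K D\<^sub>0 D\<^sub>1"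
proof -
  have vp: "v \<in> periodic" using v by (rule mono_shift_periodic)
  have c: "circle_fun (bfun (orbit_map G v)) \<in> cmaps circle euclideanreal" "circle_fun G \<in> cmaps circle euclideanreal"
    using orbit_subset_cmaps[OF G] v circle_fun_G_cmaps[OF G] unfolding orbit_eq[OF G] by blast+
  have "circle_fun (bfun (orbit_map G v)) z = circle_fun G (circle_map v z)" if "z \<in> sphere 0 1" for z
    unfolding compose_circle_map[OF G vp, symmetric] using that by (simp add: compose_def)
  then have "has_PH K k (circle_fun (bfun (orbit_map G v))) D \<longleftrightarrow> has_PH K k (circle_fun G) D" if "k = 0 \<or> k = Suc 0" for k D
    using has_PH_reparametrise[OF mono_shift_monotone_lift[OF v] circle_map_cis[OF vp] _ that] by blast
  then show ?thesis using c by (simp add: PH_fiber_def)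
qed

text \<open>The non-trivial barcode enters here: by \<open>const_trivial\<close> it excludes
  constant functions, which have length 0 and hence no normal form of positive speed.\<close>

lemma fiber_orbit:
  assumes nt: "\<not> trivial_barcode D\<^sub>0 D\<^sub>1" and f: "f \<in> PH_fiber K D\<^sub>0 D\<^sub>1"
    and E: "E = endpoints D\<^sub>0 \<union> endpoints D\<^sub>1" and N: "N = 2 * (card E * size D\<^sub>0) + 2"
  obtains G L v where "constant_speed E N L G" "v \<in> mono_shift" "f = circle_fun (bfun (orbit_map G v))"
proof -
  have fc: "f \<in> cmaps circle euclideanreal" and PH: "has_PH K 0 f D\<^sub>0" "has_PH K (Suc 0) f D\<^sub>1"
    using f by (auto simp: PH_fiber_def)
  have cont: "continuous_on (sphere 0 1) f" using cmapsD(1)[OF fc] by simp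
  let ?H = "\<lambda>t. f (cis t)"
  have tame: "tame ?H E N" unfolding N by (rule tame_lift[OF cont PH refl E])
  have finE: "finite E" using finite_endpoints E by simp
  have nc: "\<not> (\<forall>t. ?H t = ?H 0)"
  proof
    assume c: "\<forall>t. ?H t = ?H 0"
    have "f z = f (cis 0)" if "z \<in> sphere 0 1" for z
    proof -
      obtain t where "z = cis t" using sphere_cisE[OF \<open>z \<in> sphere 0 1\<close>] by blast
      then show ?thesis using c by blast
    qed
    from const_trivial[OF PH this] show False using nt by blast
  qed
  obtain \<Phi> G L where 1: "monotone_lift \<Phi>" and G: "constant_speed E N L G" and 2: "\<And>t. f (cis t) = G (\<Phi> t)"
    by (rule normal_form[OF tame finE nc]) (rule that)
  obtain v where v: "v \<in> mono_shift" "\<And>t. \<Phi> t = t + bfun v t" using monotone_lift_mono_shift[OF 1] by blast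
  have vp: "v \<in> periodic" using v(1) by (rule mono_shift_periodic)
  have "f = circle_fun (bfun (orbit_map G v))"
  proof (rule circle_fun_eqI)
    show "f \<in> extensional (sphere 0 1)" using cmapsD(2)[OF fc] by simp
    show "bfun (orbit_map G v) (t + 2 * pi) = bfun (orbit_map G v) t" for t using orbit_map_periodic[OF G vp] by (rule periodic_apply)
    show "f (cis t) = bfun (orbit_map G v) t" for t by (simp only: 2 v(2) orbit_map_apply[OF G vp])
  qed
  then show ?thesis using that G v(1) by blast
qed

text \<open>If points of two orbits are close enough, \<open>close_reparametrisations\<close>
  produces a translation between the two functions, and the orbits share that point. The bound
  \<eta> is uniform in \<open>v\<close> and \<open>w\<close>, so it is a gap between whole
  orbits.\<close>

lemma orbits_separated:
  assumes G: "constant_speed E N L G" and G': "constant_speed E N L' G'"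
  obtains \<eta> where "0 < \<eta>" "\<And>v w. v \<in> mono_shift \<Longrightarrow> w \<in> mono_shift \<Longrightarrow> dist (orbit_map G v) (orbit_map G' w) < \<eta> \<Longrightarrow> orbit_map G' w \<in> orbit_map G ` mono_shift"
proof -
  from close_reparametrisations[OF G G' zero_less_one]
  obtain \<eta> where \<eta>: "0 < \<eta>" "\<forall>\<Phi> \<Phi>'. monotone_lift \<Phi> \<longrightarrow> monotone_lift \<Phi>' \<longrightarrow> (\<forall>t. \<bar>G (\<Phi> t) - G' (\<Phi>' t)\<bar> \<le> \<eta>) \<longrightarrow>
       (\<exists>s. (\<forall>y. G' (y + s) = G y) \<and> (\<forall>t. \<bar>\<Phi> t + s - \<Phi>' t\<bar> \<le> 1))"
    by (elim exE conjE) (rule that)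
  have "orbit_map G' w \<in> orbit_map G ` mono_shift" if v: "v \<in> mono_shift" and w: "w \<in> mono_shift" and d: "dist (orbit_map G v) (orbit_map G' w) < \<eta>" for v w
  proof -
    have vp: "v \<in> periodic" "w \<in> periodic" using v w mono_shift_periodic by blast+
    have cl: "\<bar>G (t + bfun v t) - G' (t + bfun w t)\<bar> \<le> \<eta>" for t
    proof -
      have "\<bar>G (t + bfun v t) - G' (t + bfun w t)\<bar> = dist (bfun (orbit_map G v) t) (bfun (orbit_map G' w) t)"
        by (simp only: orbit_map_apply[OF G vp(1)] orbit_map_apply[OF G' vp(2)] dist_real_def)
      also have "\<dots> \<le> dist (orbit_map G v) (orbit_map G' w)" by (rule dist_bounded)
      finally show ?thesis using d by simp
    qed
    from \<eta>(2)[THEN spec, THEN spec, THEN mp, OF mono_shift_monotone_lift[OF v], THEN mp, OF mono_shift_monotone_lift[OF w], THEN mp, OF allI[OF cl]]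
    obtain s where s: "\<And>y. G' (y + s) = G y" by blast
    let ?w = "w + const_bcontfun (- s)"
    have wm: "?w \<in> mono_shift" by (rule mono_shift_shift[OF w])
    have "orbit_map G' w = orbit_map G ?w"
    proof (rule bcontfun_eqI)
      fix t
      have "t + bfun ?w t + s = t + bfun w t" by (simp add: bfun_const)
      then show "bfun (orbit_map G' w) t = bfun (orbit_map G ?w) t"
        using s[of "t + bfun ?w t"] by (simp only: orbit_map_apply[OF G mono_shift_periodic[OF wm]] orbit_map_apply[OF G' vp(2)])
    qed
    then show ?thesis using wm by blast
  qed
  then show ?thesis using that \<eta>(1) by blast
qed

theorem proposition5p1:
  fixes K :: "'k::field itself"
    and D\<^sub>0 D\<^sub>1 :: "(real \<times> ereal) multiset"
  assumes "barcode D\<^sub>0" and "barcode D\<^sub>1"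
    and "\<not> trivial_barcode D\<^sub>0 D\<^sub>1"
  shows "finite (path_components_of (subtopology circle_functions (PH_fiber K D\<^sub>0 D\<^sub>1))) \<and>
    (\<forall>\<Omega> \<in> path_components_of (subtopology circle_functions (PH_fiber K D\<^sub>0 D\<^sub>1)).
       \<exists>f \<in> topspace circle_functions.
         \<Omega> = orbit_Id f \<and>
         subtopology circle_functions \<Omega> homeomorphic_space End_mod_stabiliser f \<and>
         subtopology circle_functions \<Omega> homotopy_equivalent_space circle)"
proof -
  define F where "F = PH_fiber K D\<^sub>0 D\<^sub>1"
  let ?Z = "subtopology circle_functions F"
  define E where "E = endpoints D\<^sub>0 \<union> endpoints D\<^sub>1"
  define N where "N = 2 * (card E * size D\<^sub>0) + 2"
  \<comment> \<open>The candidates are finite in number by \<open>finite_constant_speed\<close>.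
    Several translates of one function may occur, so an orbit can be listed more than once.\<close>
  define \<G> where "\<G> = {G. (\<exists>L. constant_speed E N L G) \<and> circle_fun G \<in> F}"
  have finE: "finite E" using finite_endpoints by (simp add: E_def)
  have fin: "finite \<G>" unfolding \<G>_def by (rule finite_subset[OF _ finite_constant_speed[OF finE]]) blast
  have FT: "F \<subseteq> topspace circle_functions" by (auto simp: F_def PH_fiber_def)
  have cover: "\<exists>G\<in>\<G>. f \<in> orbit_Id (circle_fun G)" if f: "f \<in> F" for f
  proof -
    obtain G L v where G: "constant_speed E N L G" and v: "v \<in> mono_shift" "f = circle_fun (bfun (orbit_map G v))"
      using fiber_orbit[OF assms(3) f[unfolded F_def] E_def N_def] by blast
    have "circle_fun G \<in> F" using f orbit_in_fiber[OF G v(1)] unfolding F_def v(2) by blast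
    then have "G \<in> \<G>" unfolding \<G>_def using G by blast
    moreover have "f \<in> orbit_Id (circle_fun G)" unfolding orbit_eq[OF G] using v by blast
    ultimately show ?thesis by blast
  qed
  have sub: "orbit_Id (circle_fun G) \<subseteq> F" if G: "G \<in> \<G>" for G
  proof -
    obtain L where u: "constant_speed E N L G" using G unfolding \<G>_def by blast
    have "circle_fun G \<in> F" using G unfolding \<G>_def by blast
    then show ?thesis unfolding orbit_eq[OF u] F_def using orbit_in_fiber[OF u] by blast
  qed
  \<comment> \<open>Orbits are path connected, so a path component contains each orbit in
    \<open>F\<close> that it meets. Conversely, the part of the component inside that orbit is open
    and closed by the uniform gap, hence the whole component.\<close>
  have main: "\<Omega> = orbit_Id (circle_fun G)" if \<Omega>: "\<Omega> \<in> path_components_of ?Z" and G: "G \<in> \<G>" and meet: "\<Omega> \<inter> orbit_Id (circle_fun G) \<noteq> {}" for \<Omega> G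
  proof
    obtain L where u: "constant_speed E N L G" using G unfolding \<G>_def by blast
    have "path_connectedin ?Z (orbit_Id (circle_fun G))"
      using orbit_path_connected[OF u] sub[OF G] by (simp add: path_connectedin_subtopology)
    then show "orbit_Id (circle_fun G) \<subseteq> \<Omega>"
      by (rule path_components_of_maximal[OF \<Omega>]) (use meet in \<open>auto simp: disjnt_def\<close>)
    have hm: "homeomorphic_maps circle_functions (top_of_set periodic) lift (\<lambda>u. circle_fun (bfun u))" by (rule homeomorphic_maps_lift)
    have lcf: "lift (circle_fun (bfun h)) = h" if "h \<in> periodic" for h using hm that by (simp add: homeomorphic_maps_def)
    have "path_connectedin ?Z \<Omega>" using \<Omega> by (rule path_connectedin_path_components_of)
    then have pc: "path_connectedin circle_functions \<Omega>" and \<Omega>F: "\<Omega> \<subseteq> F" by (simp_all add: path_connectedin_subtopology)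
    have "path_connectedin (top_of_set periodic) (lift ` \<Omega>)"
      by (rule path_connectedin_continuous_map_image[OF _ pc]) (use hm in \<open>simp add: homeomorphic_maps_def\<close>)
    then have arc_connected: "connected (lift ` \<Omega>)"
      by (auto simp: path_connectedin_subtopology intro: path_connected_imp_connected)
    have lorb: "lift ` orbit_Id (circle_fun G') = orbit_map G' ` mono_shift" if "constant_speed E N L' G'" for G' L'
      unfolding orbit_eq[OF that] image_image using lcf orbit_map_periodic[OF that] mono_shift_periodic by (intro image_cong) auto
    have "\<forall>G'\<in>\<G>. \<exists>\<eta>>0. \<forall>v w. v \<in> mono_shift \<longrightarrow> w \<in> mono_shift \<longrightarrow> dist (orbit_map G v) (orbit_map G' w) < \<eta> \<longrightarrow> orbit_map G' w \<in> orbit_map G ` mono_shift"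
    proof
      fix G' assume "G' \<in> \<G>"
      then obtain L' where "constant_speed E N L' G'" unfolding \<G>_def by blast
      from orbits_separated[OF u this]
      show "\<exists>\<eta>>0. \<forall>v w. v \<in> mono_shift \<longrightarrow> w \<in> mono_shift \<longrightarrow> dist (orbit_map G v) (orbit_map G' w) < \<eta> \<longrightarrow> orbit_map G' w \<in> orbit_map G ` mono_shift"
        by metis
    qed
    from bchoice[OF this] obtain \<eta> where \<eta>: "\<forall>G'\<in>\<G>. 0 < \<eta> G' \<and> (\<forall>v w. v \<in> mono_shift \<longrightarrow> w \<in> mono_shift \<longrightarrow> dist (orbit_map G v) (orbit_map G' w) < \<eta> G' \<longrightarrow> orbit_map G' w \<in> orbit_map G ` mono_shift)" ..
    \<comment> \<open>Finiteness of \<open>\<G>\<close> turns the individual gaps into one positive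
      gap.\<close>
    define e where "e = Min (\<eta> ` \<G>)"
    have e0: "0 < e" unfolding e_def using fin G \<eta> by (subst Min_gr_iff) auto
    have ele: "e \<le> \<eta> G'" if "G' \<in> \<G>" for G' unfolding e_def using fin that by simp
    have near: "h' \<in> orbit_map G ` mono_shift" if h: "h \<in> orbit_map G ` mono_shift" and h': "h' \<in> lift ` \<Omega>" and d: "dist h h' < e" for h h'
    proof -
      obtain f where f: "f \<in> \<Omega>" "h' = lift f" using h' by blast
      then obtain G' where G': "G' \<in> \<G>" "f \<in> orbit_Id (circle_fun G')" using cover \<Omega>F by blast
      then obtain L' where u': "constant_speed E N L' G'" unfolding \<G>_def by blast
      have "h' \<in> orbit_map G' ` mono_shift" using f(2) G'(2) lorb[OF u'] by blast
      then obtain w where w: "w \<in> mono_shift" "h' = orbit_map G' w" by blast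
      obtain v where v: "v \<in> mono_shift" "h = orbit_map G v" using h by blast
      have "dist (orbit_map G v) (orbit_map G' w) < \<eta> G'" using d ele[OF G'(1)] v(2) w(2) by simp
      then show ?thesis using \<eta> G'(1) v(1) w by blast
    qed
    let ?A = "lift ` \<Omega> \<inter> orbit_map G ` mono_shift"
    have "openin (top_of_set (lift ` \<Omega>)) ?A"
      unfolding openin_euclidean_subtopology_iff using near e0 by (metis Int_iff dist_commute inf_le1)
    moreover have "openin (top_of_set (lift ` \<Omega>)) (lift ` \<Omega> - ?A)"
      unfolding openin_euclidean_subtopology_iff
    proof (intro conjI ballI)
      fix h assume h: "h \<in> lift ` \<Omega> - ?A"
      have "h' \<in> lift ` \<Omega> - ?A" if "h' \<in> lift ` \<Omega>" "dist h' h < e" for h'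
        using near[of h' h] that h by blast
      then show "\<exists>e>0. \<forall>x'\<in>lift ` \<Omega>. dist x' h < e \<longrightarrow> x' \<in> lift ` \<Omega> - ?A" using e0 by blast
    qed blast
    then have "closedin (top_of_set (lift ` \<Omega>)) ?A" unfolding closedin_def by auto
    ultimately have "?A = {} \<or> ?A = lift ` \<Omega>" using arc_connected unfolding connected_clopen by blast
    moreover have "?A \<noteq> {}"
    proof -
      obtain f where "f \<in> \<Omega>" "f \<in> orbit_Id (circle_fun G)" using meet by blast
      then have "lift f \<in> ?A" using lorb[OF u] by blast
      then show ?thesis by blast
    qed
    ultimately have all: "lift ` \<Omega> \<subseteq> orbit_map G ` mono_shift" by blast
    show "\<Omega> \<subseteq> orbit_Id (circle_fun G)"
    proof
      fix f assume f: "f \<in> \<Omega>"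
      then have "f \<in> topspace circle_functions" using \<Omega>F FT by blast
      then have "f = circle_fun (bfun (lift f))" using hm by (simp add: homeomorphic_maps_def)
      moreover have "lift f \<in> orbit_map G ` mono_shift" using all f by blast
      ultimately show "f \<in> orbit_Id (circle_fun G)" unfolding orbit_eq[OF u] by blast
    qed
  qed
  have each: "\<exists>G\<in>\<G>. \<Omega> = orbit_Id (circle_fun G)" if \<Omega>: "\<Omega> \<in> path_components_of ?Z" for \<Omega>
  proof -
    have ne: "\<Omega> \<noteq> {}" using \<Omega> nonempty_path_components_of by blast
    have "\<Omega> \<subseteq> topspace ?Z" using \<Omega> by (rule path_components_of_subset)
    then have "\<Omega> \<subseteq> F" by auto
    then obtain f where "f \<in> \<Omega>" "f \<in> F" using ne by blast
    then obtain G where "G \<in> \<G>" "f \<in> orbit_Id (circle_fun G)" using cover by blast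
    then show ?thesis using main[OF \<Omega>] \<open>f \<in> \<Omega>\<close> by blast
  qed
  have "path_components_of ?Z \<subseteq> (\<lambda>G. orbit_Id (circle_fun G)) ` \<G>" using each by blast
  then have "finite (path_components_of ?Z)" using fin finite_surj by blast
  moreover have "\<exists>f\<in>topspace circle_functions. \<Omega> = orbit_Id f \<and>
         subtopology circle_functions \<Omega> homeomorphic_space End_mod_stabiliser f \<and>
         subtopology circle_functions \<Omega> homotopy_equivalent_space circle" if \<Omega>: "\<Omega> \<in> path_components_of ?Z" for \<Omega>
  proof -
    obtain G where G: "G \<in> \<G>" "\<Omega> = orbit_Id (circle_fun G)" using each[OF \<Omega>] by blast
    then obtain L where u: "constant_speed E N L G" unfolding \<G>_def by blast
    show ?thesis
      using circle_fun_G_cmaps[OF u] orbit_homeomorphic[OF u] orbit_homotopy_equivalent[OF u] G(2)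
      by (intro bexI[of _ "circle_fun G"]) auto
  qed
  ultimately show ?thesis unfolding F_def by blast
qed

end
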